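(* Let $\nu$ be Lebesgue measure on $\Theta=[a,b]$ with $0\le a<b<R$, and let $\lambda:=\gamma+\sqrt{\gamma^2+1}$ with $\gamma=(2+a+b)/(b-a)$. Then the following hold. (a) Let $\alpha$ and $C$ be positive numbers, $r$ a nonnegative integer and $(m_n)$ a nondecreasing divergent integer sequence. If there exists a number $\lambda_1>\lambda$ such that $$\frac1n\,\lambda_1^{2m_n}\max_{0\le k<m_n}\frac{b^k}{a_k}\to0\quad\text{as }n\to\infty,$$ then $$\sup_{f\in\mathcal{C}(\mathbf{u}^\alpha,C,r)\cap\mathbb{H}_1}\mathbb{E}_f\|\widehat f_{m_n,n}-f\|_{\mathbb{H}}^2\le C^2m_n^{-2\alpha}(1+o(1)).$$ (b) Let $\alpha>1$, $C$ a positive number, $r$ a positive integer and $(m'_n)$ a nondecreasing divergent integer sequence. Put $w_n:=n\sum_{k\ge m'_n}\int_a^b\pi_\theta(k)\,d\theta$ for any positive integer $n$. If $(w_n)$ tends to zero, then $$\inf_{\hat f\in\mathcal{S}_n}\sup_{f\in\mathcal{C}(\mathbf{u}^\alpha,C,r)\cap\mathbb{H}_1}\mathbb{E}_f\|\hat f-f\|_{\mathbb{H}}^2\ge C^2{m'_n}^{-2\alpha}(1+o(1)).$$ (c) Let $\alpha\ge1$ and $C>1/\sqrt{b-a}$. If there exist nondecreasing divergent integer sequences $(m_n)$ and $(m'_n)$ such that $\frac1n\lambda_1^{2m_n}\max_{0\le k<m_n}b^k/a_k\to0$ for some $\lambda_1>\lambda$, $n\sum_{k\ge m'_n}\int_a^b\pi_\theta(k)\,d\theta\to0$,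 and $\liminf_{n\to\infty}m_n/m'_n>0$, then the minimax MISE rate over $\widetilde{\mathcal{C}}(\alpha,C)\cap\mathbb{H}_1$ is $m_n^{-2\alpha}$ and it is achieved by the projection estimator $\widehat f_{m_n,n}$.
   Context: Power series mixands: $(a_k)_{k\ge0}$ is a sequence of positive numbers with $a_0=1$, $R\in(0,\infty]$ is the radius of convergence of $Z(t)=\sum_{k\ge0}a_kt^k$, and for $\theta\in[0,R)$, $\pi_\theta(k)=a_k\theta^k/Z(\theta)$, $k\in\mathcal{X}=\mathbb{Z}_+=\{0,1,\dots\}$. $\mathbb{H}=L^2[a,b]$ (real, Lebesgue measure) with scalar product $(\cdot,\cdot)_{\mathbb{H}}$; $\mathbb{H}_1$ is the set of nonnegative $f\in\mathbb{H}$ with $\int_a^bf=1$. For $f\in\mathbb{H}_1$, $\pi_f(k)=\int_a^b\pi_\theta(k)f(\theta)\,d\theta$, and $\mathbb{E}_f$ is expectation when $X_1,\dots,X_n$ are i.i.d. from $\pi_f$. $\mathcal{S}_n$ is the set of measurable functions from $\mathcal{X}^n$ to $\mathbb{H}$ (estimators). $\Pi\mathbf{1}_k$ is the function $\theta\mapsto\pi_\theta(k)$ on $[a,b]$; $V_0=\{0\}$, $V_m=\mathrm{Span}(\Pi\mathbf{1}_k,0\le k<m)$. Projection estimator: $\widehat f_{m,n}$ is the unique element of $V_m$ with $(\widehat f_{m,n},\Pi\mathbf{1}_k)_{\mathbb{H}}=P_n\mathbf{1}_k:=\frac1n\#\{i\le n:X_i=k\}$ for $0\le k<m$. For a positive decreasing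 sequence $u=(u_m)_{m\ge0}$, $\mathcal{C}(u,C,r)=\{f\in\mathbb{H}:\|f-\mathrm{Proj}_{V_m}f\|_{\mathbb{H}}\le Cu_m\ \forall m\ge r\}$, where $\mathrm{Proj}$ is orthogonal projection; $\mathbf{u}^\alpha=((1+m)^{-\alpha})_{m\ge0}$. $\widetilde{\mathcal{C}}(\alpha,C)=\{f\in\mathbb{H}:\|f\|_{\mathbb{H}}\le C,\ \omega^\phi_{[\alpha]+1}(f,t)_2\le Ct^\alpha\ \forall t>0\}$, where $[\cdot]$ is integer part, $\phi(x)=\sqrt{(x-a)(b-x)}$, $\omega_s^\phi(f,t)_2=\sup_{0<h\le t}\|\Delta^s_{h\phi(\cdot)}(f,\cdot)\|_{L^2[a,b]}$, and $\Delta_h^s(f,x)=\sum_{i=0}^s\binom si(-1)^if(x+(i-s/2)h)$, set to $0$ if $x+(i-s/2)h\notin[a,b]$ for $i=0$ or $i=s$. Rates: MISE means $\mathbb{E}_f\|\hat f-f\|_{\mathbb{H}}^2$. "The minimax MISE rate over $\mathcal{C}$ is $v_n$" means $0<\liminf_n v_n^{-1}\inf_{\hat f\in\mathcal{S}_n}\sup_{f\in\mathcal{C}}\mathbb{E}_f\|\hat f-f\|_{\mathbb{H}}^2$ and $\limsup_n v_n^{-1}\inf_{\hat f\in\mathcal{S}_n}\sup_{f\in\mathcal{C}}\mathbb{E}_f\|\hat f-f\|_{\mathbb{H}}^2<\infty$; it is achieved by $\hat f_n$ if $\limsup_nv_n^{-1}\sup_{f\in\mathcal{C}}\mathbb{E}_f\|\hat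 f_n-f\|^2_{\mathbb{H}}<\infty$. *)

theory Defs
  imports "HOL-Analysis.Analysis"
begin

definition ps_sum :: "(nat \<Rightarrow> real) \<Rightarrow> real \<Rightarrow> real" where
  "ps_sum c t = (\<Sum>k. c k * t ^ k)"

definition mixand :: "(nat \<Rightarrow> real) \<Rightarrow> real \<Rightarrow> nat \<Rightarrow> real" where
  "mixand c \<theta> k = c k * \<theta> ^ k / ps_sum c \<theta>"


text \<open>Elements of the Hilbert space of square integrable functions on \<open>[a,b]\<close> are represented
  by functions, with no quotient by almost everywhere equality; every notion below depends only
  on the almost everywhere class of its arguments. Values outside \<open>[a,b]\<close> are irrelevant.\<close>

definition L2 :: "real \<Rightarrow> real \<Rightarrow> (real \<Rightarrow> real) set" where
  "L2 a b = {f. f \<in> borel_measurable (lebesgue_on {a..b}) \<and>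
                integrable (lebesgue_on {a..b}) (\<lambda>x. (f x)\<^sup>2)}"

definition L2_inner :: "real \<Rightarrow> real \<Rightarrow> (real \<Rightarrow> real) \<Rightarrow> (real \<Rightarrow> real) \<Rightarrow> real" where
  "L2_inner a b f g = (LINT x|lebesgue_on {a..b}. f x * g x)"

definition L2_norm :: "real \<Rightarrow> real \<Rightarrow> (real \<Rightarrow> real) \<Rightarrow> real" where
  "L2_norm a b f = sqrt (L2_inner a b f f)"

text \<open>The Borel sigma-algebra of the norm topology.\<close>

definition L2_borel :: "real \<Rightarrow> real \<Rightarrow> (real \<Rightarrow> real) measure" where
  "L2_borel a b = sigma (L2 a b)
     {U. U \<subseteq> L2 a b \<and>
         (\<forall>f\<in>U. \<exists>e>0. \<forall>g\<in>L2 a b. L2_norm a b (\<lambda>x. g x - f x) < e \<longrightarrow> g \<in> U)}"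

definition L2_densities :: "real \<Rightarrow> real \<Rightarrow> (real \<Rightarrow> real) set" where
  "L2_densities a b = {f \<in> L2 a b. (AE x in lebesgue_on {a..b}. 0 \<le> f x) \<and>
                                   (LINT x|lebesgue_on {a..b}. f x) = 1}"


definition mixture_pmf ::
    "(nat \<Rightarrow> real) \<Rightarrow> real \<Rightarrow> real \<Rightarrow> (real \<Rightarrow> real) \<Rightarrow> nat \<Rightarrow> real" where
  "mixture_pmf c a b f k = (LINT \<theta>|lebesgue_on {a..b}. mixand c \<theta> k * f \<theta>)"

definition mixture :: "(nat \<Rightarrow> real) \<Rightarrow> real \<Rightarrow> real \<Rightarrow> (real \<Rightarrow> real) \<Rightarrow> nat measure" where
  "mixture c a b f = density (count_space UNIV) (\<lambda>k. ennreal (mixture_pmf c a b f k))"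

text \<open>A sample of size \<open>n\<close> is indexed by \<open>{..<n}\<close>.\<close>

definition estimators :: "real \<Rightarrow> real \<Rightarrow> nat \<Rightarrow> ((nat \<Rightarrow> nat) \<Rightarrow> real \<Rightarrow> real) set" where
  "estimators a b n =
     measurable (PiM {..<n} (\<lambda>_. count_space (UNIV :: nat set))) (L2_borel a b)"

text \<open>The risk is a nonnegative Lebesgue integral, so that it is infinite, rather than \<open>0\<close>, for an
  estimator whose squared error is not integrable.\<close>

definition MISE :: "(nat \<Rightarrow> real) \<Rightarrow> real \<Rightarrow> real \<Rightarrow> nat \<Rightarrow>
    ((nat \<Rightarrow> nat) \<Rightarrow> real \<Rightarrow> real) \<Rightarrow> (real \<Rightarrow> real) \<Rightarrow> ennreal" where
  "MISE c a b n est f =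
     (\<integral>\<^sup>+ x. ennreal ((L2_norm a b (\<lambda>\<theta>. est x \<theta> - f \<theta>))\<^sup>2) \<partial>PiM {..<n} (\<lambda>_. mixture c a b f))"

definition max_MISE :: "(nat \<Rightarrow> real) \<Rightarrow> real \<Rightarrow> real \<Rightarrow> nat \<Rightarrow>
    ((nat \<Rightarrow> nat) \<Rightarrow> real \<Rightarrow> real) \<Rightarrow> (real \<Rightarrow> real) set \<Rightarrow> ennreal" where
  "max_MISE c a b n est F = (SUP f\<in>F. MISE c a b n est f)"

definition minimax_MISE ::
    "(nat \<Rightarrow> real) \<Rightarrow> real \<Rightarrow> real \<Rightarrow> nat \<Rightarrow> (real \<Rightarrow> real) set \<Rightarrow> ennreal" where
  "minimax_MISE c a b n F = (INF est\<in>estimators a b n. max_MISE c a b n est F)"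

definition minimax_MISE_rate ::
    "(nat \<Rightarrow> real) \<Rightarrow> real \<Rightarrow> real \<Rightarrow> (real \<Rightarrow> real) set \<Rightarrow> (nat \<Rightarrow> real) \<Rightarrow> bool" where
  "minimax_MISE_rate c a b F v \<longleftrightarrow>
     0 < liminf (\<lambda>n. inverse (ennreal (v n)) * minimax_MISE c a b n F) \<and>
     limsup (\<lambda>n. inverse (ennreal (v n)) * minimax_MISE c a b n F) < \<infinity>"

definition achieves_MISE_rate :: "(nat \<Rightarrow> real) \<Rightarrow> real \<Rightarrow> real \<Rightarrow> (real \<Rightarrow> real) set \<Rightarrow>
    (nat \<Rightarrow> real) \<Rightarrow> (nat \<Rightarrow> (nat \<Rightarrow> nat) \<Rightarrow> real \<Rightarrow> real) \<Rightarrow> bool" where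
  "achieves_MISE_rate c a b F v est \<longleftrightarrow>
     limsup (\<lambda>n. inverse (ennreal (v n)) * max_MISE c a b n (est n) F) < \<infinity>"


definition mixand_span :: "(nat \<Rightarrow> real) \<Rightarrow> nat \<Rightarrow> (real \<Rightarrow> real) set" where
  "mixand_span c m = {g. \<exists>q. g = (\<lambda>\<theta>. \<Sum>k<m. q k * mixand c \<theta> k)}"

text \<open>In the next two definitions the description is proper when \<open>c\<close> is positive and
  \<open>0 \<le> a < b < conv_radius c\<close>: the functions \<open>\<lambda>\<theta>. mixand c \<theta> k\<close> are then linearly independent
  almost everywhere on \<open>[a,b]\<close>, so each class meets \<open>mixand_span c m\<close> in at most one function.\<close>

definition mixand_proj ::
    "(nat \<Rightarrow> real) \<Rightarrow> real \<Rightarrow> real \<Rightarrow> nat \<Rightarrow> (real \<Rightarrow> real) \<Rightarrow> real \<Rightarrow> real" where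
  "mixand_proj c a b m f =
     (THE g. g \<in> mixand_span c m \<and>
             (\<forall>v\<in>mixand_span c m. L2_inner a b (\<lambda>\<theta>. f \<theta> - g \<theta>) v = 0))"

definition proj_estimator ::
    "(nat \<Rightarrow> real) \<Rightarrow> real \<Rightarrow> real \<Rightarrow> nat \<Rightarrow> nat \<Rightarrow> (nat \<Rightarrow> nat) \<Rightarrow> real \<Rightarrow> real" where
  "proj_estimator c a b m n x =
     (THE g. g \<in> mixand_span c m \<and>
             (\<forall>k<m. L2_inner a b g (\<lambda>\<theta>. mixand c \<theta> k) = real (card {i. i < n \<and> x i = k}) / real n))"

definition approx_class :: "(nat \<Rightarrow> real) \<Rightarrow> real \<Rightarrow> real \<Rightarrow> (nat \<Rightarrow> real) \<Rightarrow> real \<Rightarrow> nat \<Rightarrow>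
    (real \<Rightarrow> real) set" where
  "approx_class c a b u C r =
     {f \<in> L2 a b. \<forall>m\<ge>r. L2_norm a b (\<lambda>\<theta>. f \<theta> - mixand_proj c a b m f \<theta>) \<le> C * u m}"

definition poly_decay :: "real \<Rightarrow> nat \<Rightarrow> real" where
  "poly_decay \<alpha> m = (1 + real m) powr (- \<alpha>)"


definition sym_diff ::
    "real \<Rightarrow> real \<Rightarrow> nat \<Rightarrow> real \<Rightarrow> (real \<Rightarrow> real) \<Rightarrow> real \<Rightarrow> real" where
  "sym_diff a b s h f x =
     (if x + (0 - real s / 2) * h \<in> {a..b} \<and> x + (real s - real s / 2) * h \<in> {a..b}
      then \<Sum>i\<le>s. real (s choose i) * (-1) ^ i * f (x + (real i - real s / 2) * h)
      else 0)"

definition step_weight :: "real \<Rightarrow> real \<Rightarrow> real \<Rightarrow> real" where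
  "step_weight a b x = sqrt ((x - a) * (b - x))"

text \<open>For \<open>f \<in> L2 a b\<close> and \<open>h > 0\<close> the weighted difference is again in \<open>L2 a b\<close>: where it is not set
  to \<open>0\<close>, each map \<open>\<lambda>x. x + (real i - real s / 2) * h * step_weight a b x\<close> has derivative at
  least \<open>1/2\<close>. Hence \<open>L2_norm\<close> below is a genuine norm.\<close>

definition weighted_modulus ::
    "real \<Rightarrow> real \<Rightarrow> nat \<Rightarrow> (real \<Rightarrow> real) \<Rightarrow> real \<Rightarrow> ennreal" where
  "weighted_modulus a b s f t =
     (SUP h\<in>{0<..t}. ennreal (L2_norm a b (\<lambda>x. sym_diff a b s (h * step_weight a b x) f x)))"

definition smooth_class :: "real \<Rightarrow> real \<Rightarrow> real \<Rightarrow> real \<Rightarrow> (real \<Rightarrow> real) set" where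
  "smooth_class a b \<alpha> C =
     {f \<in> L2 a b. L2_norm a b f \<le> C \<and>
        (\<forall>t>0. weighted_modulus a b (nat \<lfloor>\<alpha>\<rfloor> + 1) f t \<le> ennreal (C * t powr \<alpha>))}"

end

theory Submission
  imports Defs "HOL-Probability.Probability" "HOL-Computational_Algebra.Polynomial"
begin

text \<open>
  In an orthonormal basis of \<open>V\<^sub>m\<close> the projection estimator has empirical means as coordinates.
  The basis functions are \<open>Q\<^sub>j / Z\<close> with polynomials \<open>Q\<^sub>j\<close> whose coefficients are at most
  \<open>K * m * lam ^ m\<close>, by expansion in Chebyshev polynomials; hence the variance is of lower order.
  For the lower bounds, densities \<open>f\<^sub>0 + g\<close> and \<open>f\<^sub>0 - g\<close> with \<open>g\<close> orthogonal to the first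
  \<open>m'\<close> mixands are indistinguishable as long as the sample stays below \<open>m'\<close>. In (b), \<open>g\<close> is a
  combination of the first \<open>m' + 2\<close> mixands; in (c) it is a sum of bumps at scale \<open>1 / m'\<close>, at least
  half of them of full height. The upper bound in (c) is a Jackson inequality: Whitney approximations
  on the patches of a grid that is roughly equally spaced in the arcsine metric are blended into a
  spline, and a Legendre expansion, integrated by parts, approximates the spline.
\<close>

section \<open>Coefficients and suprema of polynomials\<close>

text \<open>The number \<open>lam\<close> is the growth rate of the coefficients of Chebyshev
  polynomials of the second kind in (2 x - a - b) / (b - a): this affine polynomial has coefficients
  of absolute sum \<open>\<gamma>\<close>, and the three-term recurrence leads to lam^2 = 2 \<gamma>
  lam + 1. The gap between \<open>lam1\<close> and \<open>lam\<close> pays for all powers of m. The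
  sharp constant in (b) forces a perturbation of norm almost C m'^(-\<alpha>) inside a span; its
  supremum may be m' times larger and stays below a fixed positive density only for \<alpha> > 1. In
  (c) the constant is free, so bumps with controlled supremum reach \<alpha> = 1; their height is
  limited by the room between C and 1 / sqrt (b - a), the norm of the uniform density. The Jackson
  inequality has two obstacles. At the end points the weight vanishes and the differences are cut
  off, so a patch touching an end point has no Whitney estimate of its own. And functions are given
  up to null sets only, while the modulus is a supremum over all steps; it is therefore used through
  its integral over the step.\<close>

definition coeff_norm :: "real poly \<Rightarrow> real" where
  "coeff_norm p = (\<Sum>i\<le>degree p. \<bar>coeff p i\<bar>)"

lemma coeff_norm_eq:
  assumes "\<And>i. i \<ge> n \<Longrightarrow> coeff p i = 0"
  shows "coeff_norm p = (\<Sum>i<n. \<bar>coeff p i\<bar>)"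
proof -
  have "coeff_norm p = (\<Sum>i\<in>{i. coeff p i \<noteq> 0}. \<bar>coeff p i\<bar>)"
    unfolding coeff_norm_def
    by (intro sum.mono_neutral_right) (auto intro: le_degree)
  also have "\<dots> = (\<Sum>i<n. \<bar>coeff p i\<bar>)"
    by (intro sum.mono_neutral_left) (use assms not_less in \<open>auto intro: ccontr\<close>)
  finally show ?thesis .
qed

lemma coeff_norm_eq_degree:
  assumes "degree p < n" shows "coeff_norm p = (\<Sum>i<n. \<bar>coeff p i\<bar>)"
  using assms by (intro coeff_norm_eq) (auto intro: coeff_eq_0)

lemma coeff_norm_nonneg: "0 \<le> coeff_norm p"
  by (simp add: coeff_norm_def sum_nonneg)

lemma coeff_norm_0 [simp]: "coeff_norm 0 = 0"
  by (simp add: coeff_norm_def)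

lemma coeff_norm_add: "coeff_norm (p + q) \<le> coeff_norm p + coeff_norm q"
proof -
  define n where "n = Suc (max (degree p) (degree q))"
  have "degree (p + q) < n" using degree_add_le_max[of p q] by (simp add: n_def)
  then have "coeff_norm (p + q) = (\<Sum>i<n. \<bar>coeff p i + coeff q i\<bar>)"
    by (simp add: coeff_norm_eq_degree)
  also have "\<dots> \<le> (\<Sum>i<n. \<bar>coeff p i\<bar> + \<bar>coeff q i\<bar>)"
    by (intro sum_mono) simp
  also have "\<dots> = coeff_norm p + coeff_norm q"
    using coeff_norm_eq_degree[of p n] coeff_norm_eq_degree[of q n]
    by (simp add: sum.distrib n_def del: sum.lessThan_Suc)
  finally show ?thesis .
qed

lemma coeff_norm_sum: "coeff_norm (\<Sum>i\<in>A. f i) \<le> (\<Sum>i\<in>A. coeff_norm (f i))"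
proof (induction A rule: infinite_finite_induct)
  case (insert x F)
  then show ?case using coeff_norm_add[of "f x" "sum f F"] by auto
qed auto

lemma coeff_norm_smult: "coeff_norm (smult c p) = \<bar>c\<bar> * coeff_norm p"
  using coeff_norm_eq_degree[of "smult c p" "Suc (degree p)"]
    coeff_norm_eq_degree[of p "Suc (degree p)"] degree_smult_le[of c p]
  by (simp add: abs_mult sum_distrib_left del: sum.lessThan_Suc)

lemma coeff_norm_pCons: "coeff_norm (pCons a p) = \<bar>a\<bar> + coeff_norm p"
proof -
  have "coeff_norm (pCons a p) = (\<Sum>i<Suc (Suc (degree p)). \<bar>coeff (pCons a p) i\<bar>)"
    using degree_pCons_le[of a p] by (intro coeff_norm_eq_degree) auto
  also have "\<dots> = \<bar>a\<bar> + (\<Sum>i<Suc (degree p). \<bar>coeff p i\<bar>)"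
    by (subst sum.lessThan_Suc_shift) simp
  finally show ?thesis using coeff_norm_eq_degree[of p "Suc (degree p)"]
    by (simp del: sum.lessThan_Suc)
qed

lemma coeff_norm_mult_linear:
  "coeff_norm ([:\<alpha>, \<beta>:] * p) \<le> (\<bar>\<alpha>\<bar> + \<bar>\<beta>\<bar>) * coeff_norm p"
proof -
  have "coeff_norm ([:\<alpha>, \<beta>:] * p) \<le> coeff_norm (smult \<alpha> p) + coeff_norm (pCons 0 (smult \<beta> p))"
    using coeff_norm_add[of "smult \<alpha> p" "pCons 0 (smult \<beta> p)"] by simp
  then show ?thesis by (simp add: coeff_norm_smult coeff_norm_pCons algebra_simps)
qed

lemma abs_coeff_le_coeff_norm: "\<bar>coeff p i\<bar> \<le> coeff_norm p"
proof (cases "i \<le> degree p")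
  case True
  then show ?thesis unfolding coeff_norm_def
    by (intro member_le_sum) auto
qed (auto simp: coeff_eq_0 coeff_norm_nonneg)

section \<open>Chebyshev polynomials of the second kind in an affine variable\<close>

fun chebU :: "real poly \<Rightarrow> nat \<Rightarrow> real poly" where
  "chebU y 0 = 1"
| "chebU y (Suc 0) = smult 2 y"
| "chebU y (Suc (Suc n)) = smult 2 (y * chebU y (Suc n)) - chebU y n"

text \<open>The addition formula shows that both sides satisfy the same three-term recurrence. The
  factor sin t is kept so that points where it vanishes are not exceptional.\<close>

lemma chebU_sin:
  assumes "poly y x = cos t"
  shows "poly (chebU y n) x * sin t = sin (real (Suc n) * t)"
proof (induction n rule: induct_nat_012)
  case (ge2 n)
  have "sin (real (Suc (Suc (Suc n))) * t) + sin (real (Suc n) * t)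
      = 2 * (cos t * sin (real (Suc (Suc n)) * t))"
  proof -
    have e1: "real (Suc (Suc (Suc n))) * t = real (Suc (Suc n)) * t + t" 
      and e2: "real (Suc n) * t = real (Suc (Suc n)) * t - t" by (simp_all add: algebra_simps)
    show ?thesis unfolding e1 e2 by (simp add: sin_add sin_diff)
  qed
  moreover have "poly (chebU y (Suc (Suc n))) x * sin t
     = 2 * cos t * (poly (chebU y (Suc n)) x * sin t) - poly (chebU y n) x * sin t"
    using assms by (simp add: algebra_simps)
  ultimately show ?case unfolding ge2 by simp
qed (use assms sin_double[of t] in \<open>auto simp: algebra_simps\<close>)

text \<open>Division by sin t fails at the end points, so the first-order recurrence
  \<open>rec\<close> is used instead: each index multiplies the earlier value by a cosine and adds
  another one, which raises the absolute value by at most 1.\<close>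

lemma abs_chebU_le:
  assumes "\<bar>poly y x\<bar> \<le> 1"
  shows "\<bar>poly (chebU y n) x\<bar> \<le> real (Suc n)"
proof -
  define t where "t = arccos (poly y x)"
  have t: "poly y x = cos t" using assms by (simp add: t_def cos_arccos_abs)
  have rec: "poly (chebU y (Suc n)) x = cos t * poly (chebU y n) x + cos (real (Suc n) * t)" for n
  proof (induction n)
    case (Suc n)
    have e: "cos (real (Suc (Suc n)) * t) = cos (t + real (Suc n) * t)"
      by (simp add: algebra_simps)
    have s: "sin t * sin (real (Suc n) * t) = (1 - (cos t)\<^sup>2) * poly (chebU y n) x"
      unfolding chebU_sin[OF t, symmetric] sin_squared_eq[symmetric]
      by (simp add: power2_eq_square)
    have "poly (chebU y (Suc (Suc n))) x = 2 * cos t * poly (chebU y (Suc n)) x - poly (chebU y n) x"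
      by (simp add: t)
    also have "\<dots> = cos t * poly (chebU y (Suc n)) x +
        (cos t * poly (chebU y (Suc n)) x - poly (chebU y n) x)" by simp
    also have "cos t * poly (chebU y (Suc n)) x - poly (chebU y n) x = cos (real (Suc (Suc n)) * t)"
      unfolding Suc e cos_add s by (simp add: algebra_simps power2_eq_square)
    finally show ?case .
  qed (simp add: t)
  show ?thesis
  proof (induction n)
    case (Suc n)
    have "\<bar>poly (chebU y (Suc n)) x\<bar> \<le> \<bar>cos t * poly (chebU y n) x\<bar> + \<bar>cos (real (Suc n) * t)\<bar>"
      unfolding rec by linarith
    also have "\<dots> \<le> \<bar>poly (chebU y n) x\<bar> + 1"
      by (intro add_mono) (auto simp: abs_mult intro: mult_left_le_one_le)
    finally show ?case using Suc by simp
  qed simp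
qed

text \<open>The three-term recurrence passes to coefficient norms with a plus sign, and
  \<open>lam\<close> is the positive root of the resulting characteristic equation. This is where
  the number \<open>lam\<close> of the theorem comes from.\<close>

lemma coeff_norm_chebU_le:
  assumes "y = [:\<alpha>, \<beta>:]" "0 < lam" "lam\<^sup>2 = 2 * (\<bar>\<alpha>\<bar> + \<bar>\<beta>\<bar>) * lam + 1"
  shows "coeff_norm (chebU y n) \<le> lam ^ n"
proof (induction n rule: induct_nat_012)
  case 0
  show ?case by (simp add: coeff_norm_def)
next
  case 1
  have "2 * (\<bar>\<alpha>\<bar> + \<bar>\<beta>\<bar>) * lam \<le> lam * lam" using assms by (simp add: power2_eq_square)
  then have "2 * (\<bar>\<alpha>\<bar> + \<bar>\<beta>\<bar>) \<le> lam" using assms(2) mult_le_cancel_right_pos by blast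
  then show ?case by (simp add: assms(1) coeff_norm_pCons abs_mult)
next
  case (ge2 n)
  have "coeff_norm (chebU y (Suc (Suc n))) 
      \<le> coeff_norm (smult 2 (y * chebU y (Suc n))) + coeff_norm (smult (-1) (chebU y n))"
    using coeff_norm_add[of "smult 2 (y * chebU y (Suc n))" "smult (-1) (chebU y n)"] by simp
  also have "\<dots> = 2 * coeff_norm (y * chebU y (Suc n)) + coeff_norm (chebU y n)"
    by (simp only: coeff_norm_smult)
  also have "\<dots> \<le> 2 * ((\<bar>\<alpha>\<bar> + \<bar>\<beta>\<bar>) * lam ^ Suc n) + lam ^ n"
    using ge2 coeff_norm_mult_linear[of \<alpha> \<beta> "chebU y (Suc n)"] 
      mult_left_mono[OF ge2(2), of "\<bar>\<alpha>\<bar> + \<bar>\<beta>\<bar>"] by (auto simp: assms(1))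
  also have "\<dots> = lam ^ n * (2 * (\<bar>\<alpha>\<bar> + \<bar>\<beta>\<bar>) * lam + 1)" by (simp add: algebra_simps)
  also have "\<dots> = lam ^ Suc (Suc n)" unfolding assms(3)[symmetric] by (simp add: power2_eq_square)
  finally show ?case .
qed

lemma chebU_coeffs:
  assumes "y = [:\<alpha>, \<beta>:]"
  shows "(\<forall>i>n. coeff (chebU y n) i = 0) \<and> coeff (chebU y n) n = (2 * \<beta>) ^ n"
proof (induction n rule: induct_nat_012)
  case 0
  show ?case by (auto simp: coeff_1)
next
  case 1
  show ?case by (auto simp: assms coeff_pCons split: nat.splits)
next
  case (ge2 n)
  have "coeff (y * p) (Suc i) = \<alpha> * coeff p (Suc i) + \<beta> * coeff p i" for p i
    by (simp add: assms)
  moreover have "i > Suc (Suc n) \<Longrightarrow> \<exists>j. i = Suc j \<and> j > Suc n" for i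
    by (cases i) auto
  ultimately have "coeff (y * chebU y (Suc n)) i = 0" if "i > Suc (Suc n)" for i
    using ge2 that by (metis Suc_lessD add.right_neutral mult_zero_right)
  moreover have "coeff (y * chebU y (Suc n)) (Suc (Suc n)) = \<beta> * (2 * \<beta>) ^ Suc n"
    using ge2 by (simp add: assms)
  ultimately show ?case using ge2 by auto
qed

text \<open>Subtracting a multiple of the top basis polynomial lowers the degree bound. It is stated
  for any triangular system because it serves the Chebyshev, the Legendre and the orthonormalised
  mixand systems.\<close>

lemma poly_triangular_expansion:
  fixes U :: "nat \<Rightarrow> 'a :: field poly"
  assumes U: "\<And>n i. i > n \<Longrightarrow> coeff (U n) i = 0" "\<And>n. coeff (U n) n \<noteq> 0"
    and q: "\<And>i. i \<ge> D \<Longrightarrow> coeff q i = 0"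
  shows "\<exists>s. q = (\<Sum>j<D. smult (s j) (U j))"
  using q
proof (induction D arbitrary: q)
  case 0
  then show ?case by (auto intro!: poly_eqI)
next
  case (Suc D)
  define \<kappa> where "\<kappa> = coeff q D / coeff (U D) D"
  have "coeff (q - smult \<kappa> (U D)) i = 0" if "i \<ge> D" for i
  proof (cases "i = D")
    case True
    then show ?thesis using U by (simp add: \<kappa>_def)
  next
    case False
    then show ?thesis using that U(1)[of D i] Suc.prems[of i] by simp
  qed
  from Suc.IH[OF this] obtain s where s: "q - smult \<kappa> (U D) = (\<Sum>j<D. smult (s j) (U j))"
    by blast
  have "q = (\<Sum>j<Suc D. smult ((s(D := \<kappa>)) j) (U j))"
    using s by (simp add: algebra_simps)
  then show ?case by blast
qed

lemma chebU_expansion: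
  assumes "y = [:\<alpha>, \<beta>:]" "\<beta> \<noteq> 0" "\<And>i. i \<ge> D \<Longrightarrow> coeff q i = 0"
  shows "\<exists>s. q = (\<Sum>j<D. smult (s j) (chebU y j))"
  using poly_triangular_expansion[of "chebU y"] chebU_coeffs[OF assms(1)] assms(2,3) by simp

lemma cos_multiple_has_integral:
  assumes "k \<noteq> (0::int)"
  shows "((\<lambda>t. cos (of_int k * t)) has_integral 0) {0..pi}"
proof -
  have "((\<lambda>t. cos (of_int k * t)) has_integral
      sin (of_int k * pi) / of_int k - sin (of_int k * 0) / of_int k) {0..pi}"
    using assms
    by (intro fundamental_theorem_of_calculus)
      (auto intro!: derivative_eq_intros simp flip: has_real_derivative_iff_has_vector_derivative)
  moreover have "sin (of_int k * pi) = 0" by (metis mult.commute sin_int_times_real sin_npi_int)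
  ultimately show ?thesis by simp
qed

lemma sin_sin_has_integral:
  "((\<lambda>t. sin (real (Suc j) * t) * sin (real (Suc k) * t)) has_integral
     (if j = k then pi / 2 else 0)) {0..pi}"
proof -
  have e: "sin (real (Suc j) * t) * sin (real (Suc k) * t)
     = (cos (of_int (int j - int k) * t) - cos (of_int (int j + int k + 2) * t)) / 2" for t
    by (simp add: sin_times_sin algebra_simps)
  have 2: "((\<lambda>t. cos (of_int (int j + int k + 2) * t)) has_integral 0) {0..pi}"
    by (rule cos_multiple_has_integral) simp
  have 1: "((\<lambda>t. cos (of_int (int j - int k) * t)) has_integral (if j = k then pi else 0)) {0..pi}"
  proof (cases "j = k")
    case True
    then show ?thesis using has_integral_const_real[of "1::real" 0 pi] by simp
  next
    case False
    then show ?thesis using cos_multiple_has_integral[of "int j - int k"] by simp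
  qed
  show ?thesis unfolding e using has_integral_divide[OF has_integral_diff[OF 1 2], of 2]
    by (cases "j = k") auto
qed

text \<open>With x = (a + b) / 2 + (b - a) / 2 cos t, orthogonality of sines isolates s k in the
  integral of q sin t sin ((k + 1) t). Bounding the last sine by 1 leaves sin t dt, which is dx up
  to a constant: the second kind is chosen because its weight turns into the plain L1 norm of
  q.\<close>

lemma chebU_coefficient_bound:
  fixes a b :: real
  assumes ab: "a < b" and y: "y = [:- (a + b) / (b - a), 2 / (b - a):]"
    and q: "q = (\<Sum>j<D. smult (s j) (chebU y j))" and k: "k < D"
  shows "\<bar>s k\<bar> \<le> 2 / (b - a) * integral {a..b} (\<lambda>x. \<bar>poly q x\<bar>)"
proof -
  define x where "x t = (a + b) / 2 + (b - a) / 2 * cos t" for t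
  have yx: "poly y (x t) = cos t" for t
  proof -
    have "x t * 2 = (a + b) + (b - a) * cos t" by (simp add: x_def field_simps)
    then have "- (a + b) + x t * 2 = (b - a) * cos t" by simp
    moreover have "poly y (x t) = (- (a + b) + x t * 2) / (b - a)" 
      unfolding add_divide_distrib by (simp add: y)
    ultimately show ?thesis using ab by simp
  qed
  have qx: "poly q (x t) * sin t * sin (real (Suc k) * t)
      = (\<Sum>j<D. s j * (sin (real (Suc j) * t) * sin (real (Suc k) * t)))" for t
    by (simp add: q poly_sum sum_distrib_right chebU_sin[OF yx, symmetric] mult.assoc del: of_nat_Suc)
  have "((\<lambda>t. poly q (x t) * sin t * sin (real (Suc k) * t)) has_integral
      (\<Sum>j<D. s j * (if j = k then pi / 2 else 0))) {0..pi}"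
    unfolding qx by (intro has_integral_sum has_integral_mult_right sin_sin_has_integral) auto
  also have "(\<Sum>j<D. s j * (if j = k then pi / 2 else 0)) = s k * (pi / 2)"
    using k by (simp add: if_distrib cong: if_cong)
  finally have 1: "((\<lambda>t. poly q (x t) * sin t * sin (real (Suc k) * t)) has_integral s k * (pi / 2)) {0..pi}" .
  have xr: "x ` {0..pi} \<subseteq> {a..b}"
  proof (clarsimp, intro conjI)
    fix t :: real
    have c: "-1 \<le> cos t" "cos t \<le> 1" by simp_all
    show "a \<le> x t" using mult_left_mono[OF c(1), of "(b-a)/2"] ab by (simp add: x_def field_simps)
    show "x t \<le> b" using mult_left_mono[OF c(2), of "(b-a)/2"] ab by (simp add: x_def field_simps)
  qed
  have dx: "(x has_field_derivative (- (b - a) / 2 * sin t)) (at t within S)" for t S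
  proof -
    have "(x has_field_derivative (0 + (b - a) / 2 * (- sin t))) (at t within S)"
      unfolding x_def[abs_def]
      by (intro DERIV_add DERIV_const DERIV_cmult has_field_derivative_at_within[OF DERIV_cos])
    moreover have "0 + (b - a) / 2 * (- sin t) = - (b - a) / 2 * sin t" by argo
    ultimately show ?thesis by (simp only:)
  qed
  \<comment> \<open>\<open>x\<close> runs from b down to a, so the first of the two oriented
    integrals is over an empty interval and the second carries the minus sign.\<close>
  have "((\<lambda>t. (- (b - a) / 2 * sin t) *\<^sub>R \<bar>poly q (x t)\<bar>) has_integral
     (integral {x 0..x pi} (\<lambda>x. \<bar>poly q x\<bar>) - integral {x pi..x 0} (\<lambda>x. \<bar>poly q x\<bar>))) {0..pi}"
    by (rule has_integral_substitution_general[where s = "{}" and c = a and d = b])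
      (use xr dx in \<open>auto intro!: continuous_intros DERIV_continuous_on[of _ x]\<close>)
  moreover have "x 0 = b" "x pi = a" by (auto simp: x_def field_simps)
  ultimately have "((\<lambda>t. (- (b - a) / 2 * sin t) *\<^sub>R \<bar>poly q (x t)\<bar>) has_integral
     (- integral {a..b} (\<lambda>x. \<bar>poly q x\<bar>))) {0..pi}"
    using ab by simp
  note int2 = has_integral_mult_right[OF this, of "- 2 / (b - a)"]
  have 2: "((\<lambda>t. \<bar>poly q (x t)\<bar> * sin t) has_integral
     (2 / (b - a) * integral {a..b} (\<lambda>x. \<bar>poly q x\<bar>))) {0..pi}"
  proof -
    have "- 2 / d * ((- d / 2 * u) *\<^sub>R v) = v * u" if "d \<noteq> 0" for d u v :: real
      using that by simp
    from this[of "b - a"] show ?thesis using ab int2 by simp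
  qed
  have "norm (integral {0..pi} (\<lambda>t. poly q (x t) * sin t * sin (real (Suc k) * t)))
     \<le> integral {0..pi} (\<lambda>t. \<bar>poly q (x t)\<bar> * sin t)"
  proof (rule integral_norm_bound_integral)
    fix t :: real assume "t \<in> {0..pi}"
    then have "0 \<le> sin t" by (simp add: sin_ge_zero)
    moreover have "\<bar>poly q (x t)\<bar> * sin t * \<bar>sin (real (Suc k) * t)\<bar> \<le> \<bar>poly q (x t)\<bar> * sin t"
      using \<open>0 \<le> sin t\<close> by (intro mult_right_le_one_le) auto
    ultimately show "norm (poly q (x t) * sin t * sin (real (Suc k) * t)) \<le> \<bar>poly q (x t)\<bar> * sin t"
      by (simp add: abs_mult)
  qed (use 1 2 in \<open>auto simp: has_integral_iff\<close>)
  then have 3: "\<bar>s k\<bar> * (pi / 2) \<le> 2 / (b - a) * integral {a..b} (\<lambda>x. \<bar>poly q x\<bar>)"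
    unfolding integral_unique[OF 1] integral_unique[OF 2] by (simp add: abs_mult)
  have "\<bar>s k\<bar> * 1 \<le> \<bar>s k\<bar> * (pi / 2)"
    using pi_ge_two by (intro mult_left_mono) auto
  with 3 show ?thesis by simp
qed

text \<open>Cauchy-Schwarz against the constant 1, read off from the variance of the absolute value
  of q about its mean \<open>\<mu>\<close>.\<close>

lemma integral_abs_poly_square_le:
  fixes a b :: real
  assumes "a < b"
  shows "(integral {a..b} (\<lambda>x. \<bar>poly q x\<bar>))\<^sup>2 \<le> (b - a) * integral {a..b} (\<lambda>x. (poly q x)\<^sup>2)"
proof -
  define I where "I = integral {a..b} (\<lambda>x. \<bar>poly q x\<bar>)"
  define \<mu> where "\<mu> = I / (b - a)"
  have i: "(\<lambda>x. \<bar>poly q x\<bar>) integrable_on {a..b}" "(\<lambda>x. (poly q x)\<^sup>2) integrable_on {a..b}"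
    by (intro integrable_continuous_interval continuous_intros)+
  have "0 \<le> integral {a..b} (\<lambda>x. (\<bar>poly q x\<bar> - \<mu>)\<^sup>2)"
    by (intro integral_nonneg integrable_continuous_interval continuous_intros) auto
  also have "(\<lambda>x. (\<bar>poly q x\<bar> - \<mu>)\<^sup>2) = (\<lambda>x. (poly q x)\<^sup>2 - 2 * \<mu> * \<bar>poly q x\<bar> + \<mu>\<^sup>2)"
    by (auto simp: power2_eq_square algebra_simps)
  also have "integral {a..b} \<dots> = integral {a..b} (\<lambda>x. (poly q x)\<^sup>2) - 2 * \<mu> * I + \<mu>\<^sup>2 * (b - a)"
    unfolding I_def
    by (subst integral_add integral_diff integral_mult_right; 
        (intro integrable_diff integrable_on_mult_right i integrable_const_ivl)?)+
      (use assms in auto)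
  also have "\<dots> = integral {a..b} (\<lambda>x. (poly q x)\<^sup>2) - I\<^sup>2 / (b - a)"
  proof -
    have "\<mu>\<^sup>2 * (b - a) = \<mu> * I" using assms by (simp add: \<mu>_def power2_eq_square)
    then show ?thesis by (simp add: \<mu>_def power2_eq_square)
  qed
  finally show ?thesis using assms unfolding I_def by (simp add: field_simps)
qed

text \<open>The Chebyshev coefficients are bounded by the L1 norm, hence by the L2 norm, and the
  coefficient norm of each of the D basis polynomials by lam ^ D; squaring a sum of D such terms
  produces the factor D^2.\<close>

lemma coeff_norm_le_L2:
  fixes a b lam :: real
  assumes ab: "0 \<le> a" "a < b" and lam: "lam = \<gamma> + sqrt (\<gamma>\<^sup>2 + 1)" "\<gamma> = (2 + a + b) / (b - a)"
    and q: "\<And>i. i \<ge> D \<Longrightarrow> coeff q i = 0"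
  shows "(coeff_norm q)\<^sup>2 \<le> 4 / (b - a) * (real D)\<^sup>2 * lam ^ (2 * D) * integral {a..b} (\<lambda>x. (poly q x)\<^sup>2)"
proof -
  define y where "y = [:- (a + b) / (b - a), 2 / (b - a):]"
  \<comment> \<open>Since a and b are non-negative, the coefficients of \<open>y\<close> have
    absolute sum exactly \<open>\<gamma>\<close>.\<close>
  have g: "\<bar>- (a + b) / (b - a)\<bar> + \<bar>2 / (b - a)\<bar> = \<gamma>"
    using ab by (simp add: lam(2) add_divide_distrib[symmetric])
  have g1: "1 \<le> \<gamma>" using ab by (simp add: lam(2) field_simps)
  have l1: "1 \<le> lam" using g1 by (simp add: lam(1) add_increasing2)
  have l2: "lam\<^sup>2 = 2 * \<gamma> * lam + 1" 
  proof -
    have "(sqrt (\<gamma>\<^sup>2 + 1))\<^sup>2 = \<gamma>\<^sup>2 + 1" by (simp add: add_nonneg_nonneg)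
    then show ?thesis unfolding lam(1) power2_sum by (simp add: power2_eq_square algebra_simps)
  qed
  define I where "I = integral {a..b} (\<lambda>x. \<bar>poly q x\<bar>)"
  have I0: "0 \<le> I" unfolding I_def
    by (intro integral_nonneg integrable_continuous_interval continuous_intros) auto
  obtain s where s: "q = (\<Sum>j<D. smult (s j) (chebU y j))"
    using chebU_expansion[OF y_def _ q] ab by auto
  have "coeff_norm q \<le> (\<Sum>j<D. coeff_norm (smult (s j) (chebU y j)))"
    unfolding s by (rule coeff_norm_sum)
  also have "\<dots> \<le> (\<Sum>j<D. 2 / (b - a) * I * lam ^ D)"
  proof (rule sum_mono)
    fix j assume j: "j \<in> {..<D}"
    have "coeff_norm (chebU y j) \<le> lam ^ j"
      using coeff_norm_chebU_le[OF y_def, of lam] l1 l2 unfolding g by simp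
    also have "\<dots> \<le> lam ^ D" using j l1 by (intro power_increasing) auto
    finally have "coeff_norm (chebU y j) \<le> lam ^ D" .
    moreover have "\<bar>s j\<bar> \<le> 2 / (b - a) * I"
      using chebU_coefficient_bound[OF ab(2) y_def s] j unfolding I_def by simp
    ultimately show "coeff_norm (smult (s j) (chebU y j)) \<le> 2 / (b - a) * I * lam ^ D"
      unfolding coeff_norm_smult using I0 ab by (intro mult_mono coeff_norm_nonneg) auto
  qed
  finally have "coeff_norm q \<le> real D * (2 / (b - a) * I * lam ^ D)" by simp
  then have "(coeff_norm q)\<^sup>2 \<le> (real D * (2 / (b - a) * I * lam ^ D))\<^sup>2"
    by (intro power_mono coeff_norm_nonneg)
  also have "\<dots> = (real D)\<^sup>2 * 4 / (b - a)\<^sup>2 * I\<^sup>2 * lam ^ (2 * D)"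
    by (simp add: power_mult_distrib power_divide power_mult[symmetric] mult.commute)
  also have "\<dots> \<le> (real D)\<^sup>2 * 4 / (b - a)\<^sup>2 * ((b - a) * integral {a..b} (\<lambda>x. (poly q x)\<^sup>2)) * lam ^ (2 * D)"
    using integral_abs_poly_square_le[OF ab(2), of q] l1 unfolding I_def
    by (intro mult_right_mono mult_left_mono) auto
  also have "\<dots> = 4 / (b - a) * (real D)\<^sup>2 * lam ^ (2 * D) * integral {a..b} (\<lambda>x. (poly q x)\<^sup>2)"
  proof -
    have "X * 4 / d\<^sup>2 * (d * Y) * Z = 4 / d * X * Z * Y" if "d \<noteq> 0" for X d Y Z :: real
      using that by (simp add: power2_eq_square)
    from this[of "b - a"] show ?thesis using ab by simp
  qed
  finally show ?thesis .
qed

text \<open>The expansion is applied to the square of \<open>q\<close>: this gives the sharp order \<open>D\<close>, where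
  bounding the coefficients of \<open>q\<close> itself would lose a factor \<open>sqrt D\<close>.\<close>

lemma poly_sup_le_L2:
  fixes a b :: real
  assumes ab: "a < b" and q: "\<And>i. i \<ge> D \<Longrightarrow> coeff q i = 0" and x: "x \<in> {a..b}"
  shows "(poly q x)\<^sup>2 \<le> 8 / (b - a) * (real D)\<^sup>2 * integral {a..b} (\<lambda>x. (poly q x)\<^sup>2)"
proof (cases "D = 0")
  case True
  then have "q = 0" using q by (intro poly_eqI) auto
  then show ?thesis by simp
next
  case False
  define y where "y = [:- (a + b) / (b - a), 2 / (b - a):]"
  have "degree q \<le> D - 1" using q False by (intro degree_le) auto
  then have deg: "degree (q * q) < 2 * D" using degree_mult_le[of q q] False by linarith
  obtain s where s: "q * q = (\<Sum>j<2*D. smult (s j) (chebU y j))"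
    using chebU_expansion[OF y_def _, of "2 * D" "q * q"] ab deg by (auto simp: coeff_eq_0)
  define I where "I = integral {a..b} (\<lambda>x. (poly q x)\<^sup>2)"
  have I: "I = integral {a..b} (\<lambda>x. \<bar>poly (q * q) x\<bar>)" by (simp add: I_def power2_eq_square)
  have I0: "0 \<le> I" unfolding I_def
    by (intro integral_nonneg integrable_continuous_interval continuous_intros) auto
  have y1: "\<bar>poly y x\<bar> \<le> 1" 
  proof -
    have "poly y x = (2 * x - a - b) / (b - a)" 
      using ab by (simp add: y_def divide_simps)
    then show ?thesis using x ab by (simp add: abs_le_iff divide_le_eq le_divide_eq)
  qed
  have "(poly q x)\<^sup>2 = (\<Sum>j<2*D. s j * poly (chebU y j) x)"
    using arg_cong[OF s, of "\<lambda>p. poly p x"] by (simp add: poly_sum power2_eq_square)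
  also have "\<dots> \<le> (\<Sum>j<2*D. (2 / (b - a) * I) * real (2 * D))"
  proof (rule sum_mono)
    fix j assume j: "j \<in> {..<2*D}"
    have "s j * poly (chebU y j) x \<le> \<bar>s j\<bar> * \<bar>poly (chebU y j) x\<bar>" by (metis abs_ge_self abs_mult)
    also have "\<dots> \<le> (2 / (b - a) * I) * real (2 * D)"
    proof (intro mult_mono)
      show "\<bar>s j\<bar> \<le> 2 / (b - a) * I"
        using chebU_coefficient_bound[OF ab(1) y_def s] j unfolding I by simp
      show "\<bar>poly (chebU y j) x\<bar> \<le> real (2 * D)"
        using abs_chebU_le[OF y1, of j] j by simp
    qed (use I0 ab in auto)
    finally show "s j * poly (chebU y j) x \<le> (2 / (b - a) * I) * real (2 * D)" .
  qed
  also have "\<dots> = 8 / (b - a) * (real D)\<^sup>2 * I" by (simp add: power2_eq_square)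
  finally show ?thesis unfolding I_def .
qed

section \<open>Polynomial approximation of splines\<close>

definition poly_integral :: "real \<Rightarrow> real \<Rightarrow> real poly \<Rightarrow> real" where
  "poly_integral x y p = integral {x..y} (poly p)"

lemma poly_integrable: "poly p integrable_on {x..y::real}"
  by (intro integrable_continuous_interval continuous_intros)

lemma poly_integral_add: "poly_integral x y (p + q) = poly_integral x y p + poly_integral x y q"
  unfolding poly_integral_def poly_add by (intro integral_add poly_integrable)

lemma poly_integral_smult: "poly_integral x y (smult c p) = c * poly_integral x y p"
  unfolding poly_integral_def poly_smult by (rule integral_mult_right)

lemma poly_integral_0 [simp]: "poly_integral x y 0 = 0"
  using poly_integral_smult[of x y 0 0] by simp

lemma poly_integral_minus: "poly_integral x y (- p) = - poly_integral x y p"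
  unfolding poly_integral_def poly_minus by (rule integral_neg)

lemma poly_integral_diff: "poly_integral x y (p - q) = poly_integral x y p - poly_integral x y q"
  using poly_integral_add[of x y p "- q"] by (simp add: poly_integral_minus)

lemma poly_integral_sum: "poly_integral x y (\<Sum>i\<in>A. f i) = (\<Sum>i\<in>A. poly_integral x y (f i))"
  by (induction A rule: infinite_finite_induct) (auto simp: poly_integral_add)

lemma poly_integral_nonneg:
  assumes "\<And>t. x \<le> t \<Longrightarrow> t \<le> y \<Longrightarrow> 0 \<le> poly p t"
  shows "0 \<le> poly_integral x y p"
  unfolding poly_integral_def by (intro integral_nonneg poly_integrable) (use assms in auto)

lemma poly_integral_pderiv: "x \<le> y \<Longrightarrow> poly_integral x y (pderiv p) = poly p y - poly p x"
  unfolding poly_integral_def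
  by (intro integral_unique fundamental_theorem_of_calculus)
    (auto intro: has_field_derivative_at_within simp flip: has_real_derivative_iff_has_vector_derivative)

lemma poly_integral_combine:
  assumes "\<And>j. j < N \<Longrightarrow> x j \<le> x (Suc j)"
  shows "(\<Sum>j<N. poly_integral (x j) (x (Suc j)) p) = poly_integral (x 0) (x N) p"
proof -
  have "x 0 \<le> x n \<and> (\<Sum>j<n. poly_integral (x j) (x (Suc j)) p) = poly_integral (x 0) (x n) p"
    if "n \<le> N" for n
    using that
  proof (induction n)
    case (Suc n)
    then have "x n \<le> x (Suc n)" "x 0 \<le> x n" using assms[of n] by auto
    then show ?case using Suc Henstock_Kurzweil_Integration.integral_combine[OF \<open>x 0 \<le> x n\<close> \<open>x n \<le> x (Suc n)\<close> poly_integrable, of p]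
      by (auto simp: poly_integral_def)
  qed (simp add: poly_integral_def)
  then show ?thesis by auto
qed

text \<open>The contribution of the point z to s successive integrations by parts of G against the
  s-th derivative of E.\<close>

definition boundary_terms :: "nat \<Rightarrow> real poly \<Rightarrow> real poly \<Rightarrow> real \<Rightarrow> real" where
  "boundary_terms s G E z =
     (\<Sum>i<s. (-1) ^ i * poly ((pderiv ^^ i) G) z * poly ((pderiv ^^ (s - 1 - i)) E) z)"

lemma poly_integral_by_parts:
  assumes "x \<le> y"
  shows "poly_integral x y (G * (pderiv ^^ s) E) = boundary_terms s G E y - boundary_terms s G E x
     + (-1) ^ s * poly_integral x y ((pderiv ^^ s) G * E)"
proof (induction s arbitrary: E)
  case 0
  show ?case by (simp add: boundary_terms_def)
next
  case (Suc s)
  have b: "boundary_terms (Suc s) G E z = boundary_terms s G (pderiv E) z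
      + (-1) ^ s * (poly ((pderiv ^^ s) G) z * poly E z)" for z
  proof -
    have "(pderiv ^^ (s - i)) E = (pderiv ^^ (s - 1 - i)) (pderiv E)" if "i < s" for i
    proof -
      from that have "s - i = Suc (s - 1 - i)" by simp
      then show ?thesis by (simp only: funpow_Suc_right o_apply)
    qed
    then show ?thesis by (simp add: boundary_terms_def)
  qed
  have p: "(pderiv ^^ s) G * pderiv E = pderiv ((pderiv ^^ s) G * E) - (pderiv ^^ Suc s) G * E"
    by (simp add: pderiv_mult algebra_simps)
  show ?case
    unfolding funpow_Suc_right o_apply[of "pderiv ^^ s"] Suc p poly_integral_diff b
      poly_integral_pderiv[OF assms]
    by (simp add: algebra_simps funpow_swap1)
qed

lemma power_dvd_pderiv:
  fixes p :: "real poly"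
  assumes "p ^ Suc j dvd q" shows "p ^ j dvd pderiv q"
proof -
  from assms obtain r where "q = p ^ Suc j * r" by (auto elim: dvdE)
  then have "pderiv q = p ^ Suc j * pderiv r + r * (smult (of_nat (Suc j)) (p ^ j) * pderiv p)"
    by (simp only: pderiv_mult pderiv_power_Suc)
  also have "\<dots> = p ^ j * (p * pderiv r + smult (of_nat (Suc j)) (r * pderiv p))"
    by (simp add: algebra_simps)
  finally show ?thesis by simp
qed

lemma power_dvd_higher_pderiv:
  fixes p :: "real poly"
  assumes "i \<le> n" shows "p ^ (n - i) dvd (pderiv ^^ i) (p ^ n)"
  using assms
proof (induction i)
  case (Suc i)
  then have "p ^ Suc (n - Suc i) dvd (pderiv ^^ i) (p ^ n)" by (simp add: Suc_diff_Suc)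
  then show ?case using power_dvd_pderiv by auto
qed simp

lemma poly_higher_pderiv_eq_0:
  fixes p :: "real poly"
  assumes "i < n" "poly p z = 0" shows "poly ((pderiv ^^ i) (p ^ n)) z = 0"
proof -
  have "p dvd p ^ (n - i)" using assms(1) by (intro dvd_power) auto
  then have "p dvd (pderiv ^^ i) (p ^ n)" using power_dvd_higher_pderiv[of i n p] assms(1)
    by (meson dvd_trans less_imp_le)
  then show ?thesis using assms(2) by (auto elim: dvdE)
qed

lemma higher_pderiv_const:
  assumes "\<And>i. i > k \<Longrightarrow> coeff (q::real poly) i = 0"
  shows "(pderiv ^^ k) q = [:fact k * coeff q k:]"
proof (rule poly_eqI)
  fix i show "coeff ((pderiv ^^ k) q) i = coeff [:fact k * coeff q k:] i"
    using assms by (cases i) (auto simp: coeff_higher_pderiv pochhammer_fact)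
qed

lemma higher_pderiv_eq_0:
  assumes "\<And>i. i \<ge> k \<Longrightarrow> coeff (q::real poly) i = 0"
  shows "(pderiv ^^ k) q = 0"
  by (rule poly_eqI) (use assms in \<open>auto simp: coeff_higher_pderiv\<close>)

text \<open>Turns the ratio of factorials by which the squared norms of \<open>ker n\<close> and
  \<open>rho n\<close> differ into the power 2 s of the degree.\<close>

lemma fact_ge_power: "fact k * (real k + 1) ^ l \<le> fact (k + l)"
proof (induction l)
  case (Suc l)
  have "fact k * (real k + 1) ^ Suc l \<le> fact (k + l) * (real k + 1)"
    using mult_right_mono[OF Suc, of "real k + 1"] by (simp add: mult_ac)
  also have "\<dots> \<le> fact (k + l) * (real (k + l) + 1)" by (intro mult_left_mono) auto
  also have "\<dots> = fact (k + Suc l)" by (simp add: algebra_simps)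
  finally show ?case .
qed simp

section \<open>Legendre expansion of a spline\<close>

locale spline =
  fixes a b :: real and x :: "nat \<Rightarrow> real" and N s :: nat and G :: "nat \<Rightarrow> real poly"
    and g :: "real \<Rightarrow> real"
  assumes ab: "a < b" and x0: "x 0 = a" and xN: "x N = b"
    and knots: "\<And>j. j < N \<Longrightarrow> x j < x (Suc j)"
    and matching: "\<And>i j. Suc j < N \<Longrightarrow> i < s \<Longrightarrow>
      poly ((pderiv ^^ i) (G j)) (x (Suc j)) = poly ((pderiv ^^ i) (G (Suc j))) (x (Suc j))"
    and cont: "continuous_on {a..b} g"
    and pieces: "\<And>j t. j < N \<Longrightarrow> t \<in> {x j..x (Suc j)} \<Longrightarrow> g t = poly (G j) t"
begin

definition W :: "real poly" where "W = [:- a, 1:] * [:b, -1:]"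

text \<open>Rodrigues' formula: the Legendre polynomial of degree n on [a,b], without
  normalisation.\<close>

definition rho :: "nat \<Rightarrow> real poly" where "rho n = (pderiv ^^ n) (W ^ n)"

text \<open>Up to scaling a Gegenbauer polynomial, of degree n - s and orthogonal for the weight
  \<open>W ^ s\<close>. For s \<le> n the division is exact, because \<open>W ^ s\<close> divides
  the derivative.\<close>

definition ker :: "nat \<Rightarrow> real poly" where "ker n = (pderiv ^^ (n - s)) (W ^ n) div W ^ s"

text \<open>The integral of the s-th derivative of g against p, taken piece by piece because that
  derivative may jump at the knots.\<close>

definition pairing :: "real poly \<Rightarrow> real" where
  "pairing p = (\<Sum>j<N. poly_integral (x j) (x (Suc j)) ((pderiv ^^ s) (G j) * p))"

text \<open>The squared norm of the s-th derivative of g for the weight \<open>W ^ s\<close>, which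
  is the power 2 s of the step weight.\<close>

definition energy :: real where
  "energy = (\<Sum>j<N. poly_integral (x j) (x (Suc j)) (((pderiv ^^ s) (G j))\<^sup>2 * W ^ s))"

lemma poly_W: "poly W t = (t - a) * (b - t)" by (simp add: W_def algebra_simps)

lemma W_nonneg: "a \<le> t \<Longrightarrow> t \<le> b \<Longrightarrow> 0 \<le> poly W t" by (simp add: poly_W)

lemma W_neq_0: "W \<noteq> 0" by (simp add: W_def)

lemma degree_W_power: "degree (W ^ n) = 2 * n"

proof -
  have "degree W = 2" by (simp add: W_def)
  then show ?thesis by (simp add: degree_power_eq[OF W_neq_0])
qed

lemma lead_coeff_W_power: "coeff (W ^ n) (2 * n) = (-1) ^ n"
  using lead_coeff_power[of W n] lead_coeff_mult[of "[:- a, 1:]" "[:b, -1:]"]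
  unfolding degree_W_power by (simp add: W_def)

text \<open>\<open>W ^ n\<close> has zeros of order n at both ends, so its derivatives of order
  below n vanish there and no boundary term survives.\<close>

lemma parts_at_ends:
  assumes "k \<le> n"
  shows "poly_integral a b (q * (pderiv ^^ n) (W ^ n))
    = (-1) ^ k * poly_integral a b ((pderiv ^^ k) q * (pderiv ^^ (n - k)) (W ^ n))"
    and "j \<le> n \<Longrightarrow> boundary_terms j q ((pderiv ^^ (n - j)) (W ^ n)) a = 0"
    and "j \<le> n \<Longrightarrow> boundary_terms j q ((pderiv ^^ (n - j)) (W ^ n)) b = 0"
proof -
  have z: "poly ((pderiv ^^ (j - 1 - i)) ((pderiv ^^ (n - j)) (W ^ n))) t = 0"
    if "i < j" "j \<le> n" "t = a \<or> t = b" for i j t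
  proof -
    have "(pderiv ^^ (j - 1 - i)) ((pderiv ^^ (n - j)) (W ^ n)) = (pderiv ^^ (n - 1 - i)) (W ^ n)"
      using that by (simp add: funpow_add[symmetric, THEN fun_cong, unfolded o_apply])
    then show ?thesis using poly_higher_pderiv_eq_0[of "n - 1 - i" n W t] that by (auto simp: poly_W)
  qed
  show B: "j \<le> n \<Longrightarrow> boundary_terms j q ((pderiv ^^ (n - j)) (W ^ n)) a = 0"
    "j \<le> n \<Longrightarrow> boundary_terms j q ((pderiv ^^ (n - j)) (W ^ n)) b = 0" for j
    using z by (auto simp: boundary_terms_def)
  have "(pderiv ^^ n) (W ^ n) = (pderiv ^^ k) ((pderiv ^^ (n - k)) (W ^ n))"
    using assms by (simp add: funpow_add[symmetric, THEN fun_cong, unfolded o_apply])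
  then show "poly_integral a b (q * (pderiv ^^ n) (W ^ n))
    = (-1) ^ k * poly_integral a b ((pderiv ^^ k) q * (pderiv ^^ (n - k)) (W ^ n))"
    using poly_integral_by_parts[of a b q k] ab B[OF assms] by simp
qed

lemma parts_ker:
  assumes "s \<le> n"
  shows "poly_integral a b (q * (pderiv ^^ (n - s)) (W ^ n))
    = (-1) ^ (n - s) * poly_integral a b ((pderiv ^^ (n - s)) q * W ^ n)"
proof -
  have z: "poly ((pderiv ^^ (n - s - 1 - i)) (W ^ n)) t = 0" if "i < n - s" "t = a \<or> t = b" for i t
    using that poly_higher_pderiv_eq_0[of "n - s - 1 - i" n W t] by (auto simp: poly_W)
  then have "boundary_terms (n - s) q (W ^ n) a = 0" "boundary_terms (n - s) q (W ^ n) b = 0"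
    by (auto simp: boundary_terms_def)
  then show ?thesis using poly_integral_by_parts[of a b q "n - s" "W ^ n"] ab by simp
qed

definition w :: "nat \<Rightarrow> real" where "w n = poly_integral a b (W ^ n)"

lemma w_pos: "0 < w n"
proof -
  have "0 \<le> w n" unfolding w_def by (intro poly_integral_nonneg) (simp add: W_nonneg)
  moreover have "w n \<noteq> 0"
  proof
    assume "w n = 0"
    then have "(poly (W ^ n) has_integral 0) (cbox a b)"
      by (metis box_real(2) integrable_integral poly_integrable poly_integral_def w_def)
    then have "poly (W ^ n) ((a + b) / 2) = 0"
      by (rule has_integral_0_cbox_imp_0[rotated 2])
        (use ab in \<open>auto simp: W_nonneg box_real intro!: continuous_intros zero_le_power\<close>)
    then show False using ab by (auto simp: poly_W)
  qed
  ultimately show ?thesis by simp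
qed

lemma coeff_rho: "i > n \<Longrightarrow> coeff (rho n) i = 0" "coeff (rho n) n \<noteq> 0"
proof -
  show "i > n \<Longrightarrow> coeff (rho n) i = 0"
    using degree_W_power[of n] by (simp add: rho_def coeff_higher_pderiv coeff_eq_0)
  have "coeff (W ^ n) (n + n) \<noteq> 0" using lead_coeff_W_power[of n] by (simp add: mult_2)
  moreover have "pochhammer (real (Suc n)) n > 0" by (intro pochhammer_pos) simp
  ultimately show "coeff (rho n) n \<noteq> 0"
    by (simp add: rho_def coeff_higher_pderiv)
qed

lemma rho_orth: "(\<And>i. i \<ge> n \<Longrightarrow> coeff q i = 0) \<Longrightarrow> poly_integral a b (q * rho n) = 0"
  unfolding rho_def using parts_at_ends(1)[of n n q] higher_pderiv_eq_0[of n q] by simp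

lemma rho_orth': "l \<noteq> n \<Longrightarrow> poly_integral a b (rho l * rho n) = 0"
proof -
  have *: "l < n \<Longrightarrow> poly_integral a b (rho l * rho n) = 0" for l n
    by (intro rho_orth coeff_rho) auto
  show "l \<noteq> n \<Longrightarrow> poly_integral a b (rho l * rho n) = 0"
    using *[of l n] *[of n l] by (metis linorder_neqE_nat mult.commute)
qed

text \<open>The n integrations by parts leave the derivative of order 2 n of \<open>W ^ n\<close>, a
  constant whose sign cancels that of the integrations.\<close>

lemma rho_norm: "poly_integral a b (rho n * rho n) = fact (2 * n) * w n"
proof -
  have "(pderiv ^^ n) (rho n) = (pderiv ^^ (2 * n)) (W ^ n)"
    by (simp add: rho_def funpow_add[symmetric, THEN fun_cong, unfolded o_apply] mult_2)
  also have "\<dots> = [:fact (2 * n) * (-1) ^ n:]"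
    using higher_pderiv_const[of "2 * n" "W ^ n"] degree_W_power[of n]
    by (simp add: coeff_eq_0 lead_coeff_W_power)
  finally have "(pderiv ^^ n) (rho n) = [:fact (2 * n) * (-1) ^ n:]" .
  then show ?thesis using parts_at_ends(1)[of n n "rho n"]
    by (simp add: poly_integral_smult w_def flip: rho_def power_mult_distrib)
qed

lemma ker_mult: "s \<le> n \<Longrightarrow> W ^ s * ker n = (pderiv ^^ (n - s)) (W ^ n)"
  unfolding ker_def using power_dvd_higher_pderiv[of "n - s" n W] by simp

text \<open>Both are read off from the factorisation of the derivative of order n - s: the product
  has degree n + s, the factor \<open>W ^ s\<close> degree 2 s.\<close>

lemma degree_ker: "s \<le> n \<Longrightarrow> degree (ker n) = n - s"
  and lead_coeff_ker: "s \<le> n \<Longrightarrow> fact (n + s) * coeff (ker n) (n - s) = (-1) ^ (n - s) * fact (2 * n)"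
proof -
  assume sn: "s \<le> n"
  have d: "degree ((pderiv ^^ (n - s)) (W ^ n)) = n + s"
    using sn by (simp add: degree_higher_pderiv degree_W_power)
  have nz: "ker n \<noteq> 0"
  proof
    assume "ker n = 0"
    then have "(pderiv ^^ (n - s)) (W ^ n) = 0" using ker_mult[OF sn] by simp
    then have e: "n + s = 0" using d by simp
    then show False using ker_mult[OF sn] \<open>ker n = 0\<close> by simp
  qed
  show dk: "degree (ker n) = n - s"
    using ker_mult[OF sn] d degree_mult_eq[of "W ^ s" "ker n"] nz W_neq_0 degree_W_power[of s] by simp
  have "coeff ((pderiv ^^ (n - s)) (W ^ n)) (n + s) = (-1) ^ s * coeff (ker n) (n - s)"
    using lead_coeff_mult[of "W ^ s" "ker n"] unfolding ker_mult[OF sn] d dk degree_W_power lead_coeff_W_power .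
  then have "pochhammer (real (Suc (n + s))) (n - s) * coeff (W ^ n) (n + s + (n - s))
     = (-1) ^ s * coeff (ker n) (n - s)"
    by (simp add: coeff_higher_pderiv)
  moreover have "n + s + (n - s) = 2 * n" using sn by simp
  ultimately have c: "pochhammer (real (Suc (n + s))) (n - s) * (-1) ^ n = (-1) ^ s * coeff (ker n) (n - s)"
    by (simp only: lead_coeff_W_power)
  have "fact (n + s) * pochhammer (real (Suc (n + s))) (n - s) = (fact (n + s + (n - s)) :: real)"
    unfolding pochhammer_fact pochhammer_product'[of 1 "n + s" "n - s"] by (simp add: add.commute)
  then have f: "fact (n + s) * pochhammer (real (Suc (n + s))) (n - s) = (fact (2 * n) :: real)"
    using sn by (simp add: mult_2)
  have sg: "(-1) ^ s * (-1) ^ s = (1 :: real)" "(-1) ^ s * (-1) ^ n = ((-1) ^ (n - s) :: real)"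
    using sn by (simp_all flip: power_add power_mult_distrib add: minus_one_power_iff)
  have "coeff (ker n) (n - s) = (-1) ^ s * ((-1) ^ s * coeff (ker n) (n - s))"
    using sg(1) by (simp flip: mult.assoc)
  also have "\<dots> = pochhammer (real (Suc (n + s))) (n - s) * (-1) ^ (n - s)"
    unfolding c[symmetric] sg(2)[symmetric] by simp
  finally show "fact (n + s) * coeff (ker n) (n - s) = (-1) ^ (n - s) * fact (2 * n)"
    unfolding f[symmetric] by simp
qed

lemma ker_orth:
  assumes "s \<le> l" "s \<le> n" "l \<noteq> n"
  shows "poly_integral a b (ker l * (W ^ s * ker n)) = 0"
proof -
  have *: "poly_integral a b (ker l * (W ^ s * ker n)) = 0" if "s \<le> l" "l < n" for l n
  proof -
    have "(pderiv ^^ (n - s)) (ker l) = 0"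
      using that degree_ker[of l] by (intro higher_pderiv_eq_0) (auto intro!: coeff_eq_0)
    then show ?thesis using that ker_mult[of n] parts_ker[of n "ker l"] by simp
  qed
  have "ker l * (W ^ s * ker n) = ker n * (W ^ s * ker l)" by (simp add: mult_ac)
  then show ?thesis using *[of l n] *[of n l] assms by (metis linorder_neqE_nat)
qed

text \<open>Here only n - s derivatives are moved. The result is smaller than the squared norm of
  \<open>rho n\<close> by the factor (n - s)! / (n + s)!, and this gap is the whole gain of the
  Jackson estimate.\<close>

lemma ker_norm:
  assumes "s \<le> n"
  shows "poly_integral a b (ker n * (W ^ s * ker n)) = fact (n - s) * fact (2 * n) / fact (n + s) * w n"
proof -
  have "(pderiv ^^ (n - s)) (ker n) = [:fact (n - s) * coeff (ker n) (n - s):]"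
    using degree_ker[OF assms] by (intro higher_pderiv_const) (auto intro: coeff_eq_0)
  then have "poly_integral a b (ker n * (W ^ s * ker n))
     = (-1) ^ (n - s) * (fact (n - s) * coeff (ker n) (n - s)) * w n"
    using ker_mult[OF assms] parts_ker[OF assms, of "ker n"] by (simp add: poly_integral_smult w_def)
  also have "coeff (ker n) (n - s) = (-1) ^ (n - s) * fact (2 * n) / fact (n + s)"
    using lead_coeff_ker[OF assms] by (simp add: field_simps)
  also have "(-1) ^ (n - s) * (fact (n - s) * ((-1) ^ (n - s) * fact (2 * n) / fact (n + s))) * w n
     = ((-1) ^ (n - s) * (-1) ^ (n - s)) * (fact (n - s) * fact (2 * n) / fact (n + s) * w n)" by simp
  also have "(-1) ^ (n - s) * (-1) ^ (n - s) = (1 :: real)" by (simp flip: power_mult_distrib)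
  finally show ?thesis by simp
qed

lemma integral_pieces:
  "integral {a..b} (\<lambda>t. g t * poly p t) = (\<Sum>j<N. poly_integral (x j) (x (Suc j)) (G j * p))"
proof -
  have mono: "x i \<le> x j" if "i \<le> j" "j \<le> N" for i j
    using that
  proof (induction rule: dec_induct)
    case (step n)
    then show ?case using knots[of n] by simp
  qed simp
  have int: "(\<lambda>t. g t * poly p t) integrable_on {a..x n}" if "n \<le> N" for n
    by (intro integrable_continuous_interval continuous_intros continuous_on_subset[OF cont])
      (use mono[OF that] xN in auto)
  have "integral {a..x n} (\<lambda>t. g t * poly p t) = (\<Sum>j<n. poly_integral (x j) (x (Suc j)) (G j * p))"
    if "n \<le> N" for n
    using that
  proof (induction n)
    case (Suc n)
    have "integral {x n..x (Suc n)} (\<lambda>t. g t * poly p t) = poly_integral (x n) (x (Suc n)) (G n * p)"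
      unfolding poly_integral_def by (intro integral_cong) (use Suc.prems pieces in auto)
    moreover have "integral {a..x n} (\<lambda>t. g t * poly p t) + integral {x n..x (Suc n)} (\<lambda>t. g t * poly p t)
       = integral {a..x (Suc n)} (\<lambda>t. g t * poly p t)"
      using Suc.prems mono[of 0 n] knots[of n] x0 by (intro Henstock_Kurzweil_Integration.integral_combine int) auto
    ultimately show ?case using Suc by simp
  qed (simp add: x0)
  from this[of N] show ?thesis by (simp add: xN)
qed

text \<open>Boundary terms at interior knots cancel in pairs because derivatives of order below s
  match there; those at a and b vanish together with the derivatives of E.\<close>

lemma telescope:
  assumes E: "\<And>i. i < s \<Longrightarrow> poly ((pderiv ^^ i) E) a = 0" "\<And>i. i < s \<Longrightarrow> poly ((pderiv ^^ i) E) b = 0"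
  shows "(\<Sum>j<N. poly_integral (x j) (x (Suc j)) (G j * (pderiv ^^ s) E)) = (-1) ^ s * pairing E"
proof -
  define B where "B j z = boundary_terms s (G j) E z" for j z
  have BB: "B j (x (Suc j)) = B (Suc j) (x (Suc j))" if "Suc j < N" for j
    using matching[OF that] by (auto simp: B_def boundary_terms_def)
  have B0: "B j a = 0" "B j b = 0" for j using E by (auto simp: B_def boundary_terms_def)
  have tel: "n < N \<Longrightarrow> (\<Sum>j<Suc n. B j (x (Suc j)) - B j (x j)) = B n (x (Suc n)) - B 0 (x 0)" for n
    by (induction n) (use BB in auto)
  have "(\<Sum>j<N. B j (x (Suc j)) - B j (x j)) = 0"
  proof (cases N)
    case (Suc n)
    then show ?thesis using tel[of n] B0 x0 xN by simp
  qed simp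
  moreover have "(\<Sum>j<N. poly_integral (x j) (x (Suc j)) (G j * (pderiv ^^ s) E))
     = (\<Sum>j<N. (B j (x (Suc j)) - B j (x j)) 
       + (-1) ^ s * poly_integral (x j) (x (Suc j)) ((pderiv ^^ s) (G j) * E))"
    using knots by (intro sum.cong refl) (simp add: B_def poly_integral_by_parts less_imp_le)
  ultimately show ?thesis by (simp add: sum.distrib pairing_def sum_distrib_left)
qed

text \<open>Moving s derivatives from \<open>rho n\<close> to the spline shows that its Legendre
  coefficients are, up to sign and normalisation, the coefficients of its s-th derivative in the
  system \<open>ker\<close> with weight \<open>W ^ s\<close>.\<close>

lemma integral_rho:
  assumes "s \<le> n"
  shows "integral {a..b} (\<lambda>t. g t * poly (rho n) t) = (-1) ^ s * pairing (W ^ s * ker n)"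
proof -
  define E where "E = (pderiv ^^ (n - s)) (W ^ n)"
  have "rho n = (pderiv ^^ s) E" unfolding rho_def E_def
    using assms by (simp add: funpow_add[symmetric, THEN fun_cong, unfolded o_apply])
  moreover have "poly ((pderiv ^^ i) E) t = 0" if "i < s" "t = a \<or> t = b" for i t
  proof -
    have "(pderiv ^^ i) E = (pderiv ^^ (i + (n - s))) (W ^ n)"
      by (simp add: E_def funpow_add)
    then show ?thesis using poly_higher_pderiv_eq_0[of "i + (n - s)" n W t] that assms 
      by (auto simp: poly_W)
  qed
  ultimately show ?thesis using telescope[of E] integral_pieces[of "rho n"] ker_mult[OF assms]
    by (simp add: E_def)
qed

lemma pairing_sum: "pairing (\<Sum>i\<in>A. smult (c i) (p i)) = (\<Sum>i\<in>A. c i * pairing (p i))"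
proof -
  have "pairing (p + q) = pairing p + pairing q" for p q
    by (simp add: pairing_def distrib_left poly_integral_add sum.distrib)
  moreover have "pairing (smult c p) = c * pairing p" for c p
    by (simp add: pairing_def poly_integral_smult sum_distrib_left)
  moreover have "pairing 0 = 0" by (simp add: pairing_def)
  ultimately show ?thesis by (induction A rule: infinite_finite_induct) auto
qed

text \<open>The usual argument, applied to the s-th derivative of the spline: its squared weighted
  distance from the expansion \<open>Q\<close> is non-negative. Sums over pieces appear because that
  derivative is not a single polynomial.\<close>

lemma bessel:
  assumes "\<And>n. n \<in> A \<Longrightarrow> s \<le> n" "finite A"
  defines "K \<equiv> \<lambda>n. fact (n - s) * fact (2 * n) / fact (n + s) * w n"
  shows "(\<Sum>n\<in>A. (pairing (W ^ s * ker n))\<^sup>2 / K n) \<le> energy"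
proof -
  define c where "c n = pairing (W ^ s * ker n) / K n" for n
  have K: "K n > 0" for n by (simp add: K_def w_pos)
  define Q where "Q = (\<Sum>n\<in>A. smult (c n) (ker n))"
  have QQ: "poly_integral a b (Q * (W ^ s * Q)) = (\<Sum>n\<in>A. (c n)\<^sup>2 * K n)"
  proof -
    have "Q * (W ^ s * Q) = (\<Sum>l\<in>A. \<Sum>n\<in>A. smult (c l * c n) (ker l * (W ^ s * ker n)))"
    proof -
      have "Q * (W ^ s * Q) = (\<Sum>l\<in>A. smult (c l) (ker l)) * (\<Sum>n\<in>A. W ^ s * smult (c n) (ker n))"
        by (simp only: Q_def sum_distrib_left)
      then show ?thesis unfolding sum_product by (simp add: mult.commute[of "c _" "c _"])
    qed
    then have "poly_integral a b (Q * (W ^ s * Q))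
       = (\<Sum>l\<in>A. \<Sum>n\<in>A. c l * c n * poly_integral a b (ker l * (W ^ s * ker n)))"
      by (simp add: poly_integral_sum poly_integral_smult)
    also have "\<dots> = (\<Sum>l\<in>A. \<Sum>n\<in>A. if n = l then (c l)\<^sup>2 * K l else 0)"
      using assms(1) by (intro sum.cong refl) (auto simp: ker_orth ker_norm K_def power2_eq_square)
    finally show ?thesis using assms(2) by simp
  qed
  have PQ: "pairing (W ^ s * Q) = (\<Sum>n\<in>A. (c n)\<^sup>2 * K n)"
  proof -
    have "W ^ s * Q = (\<Sum>n\<in>A. smult (c n) (W ^ s * ker n))" by (simp add: Q_def sum_distrib_left)
    then have "pairing (W ^ s * Q) = (\<Sum>n\<in>A. c n * pairing (W ^ s * ker n))"
      by (simp add: pairing_sum)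
    also have "\<dots> = (\<Sum>n\<in>A. (c n)\<^sup>2 * K n)"
      using K by (intro sum.cong refl) (simp add: c_def power2_eq_square less_imp_neq[symmetric])
    finally show ?thesis .
  qed
  have "0 \<le> (\<Sum>j<N. poly_integral (x j) (x (Suc j)) (((pderiv ^^ s) (G j) - Q)\<^sup>2 * W ^ s))"
  proof (intro sum_nonneg poly_integral_nonneg)
    fix j t assume j: "j \<in> {..<N}" and t: "x j \<le> t" "t \<le> x (Suc j)"
    have mono: "x i \<le> x j" if "i \<le> j" "j \<le> N" for i j
      using that
    proof (induction rule: dec_induct)
      case (step n)
      then show ?case using knots[of n] by simp
    qed simp
    have "a \<le> t" "t \<le> b" using mono[of 0 j] mono[of "Suc j" N] j t x0 xN by auto
    then show "0 \<le> poly (((pderiv ^^ s) (G j) - Q)\<^sup>2 * W ^ s) t"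
      by (simp add: W_nonneg)
  qed
  also have "\<dots> = (\<Sum>j<N. poly_integral (x j) (x (Suc j)) (((pderiv ^^ s) (G j))\<^sup>2 * W ^ s)
      - 2 * poly_integral (x j) (x (Suc j)) ((pderiv ^^ s) (G j) * (W ^ s * Q))
      + poly_integral (x j) (x (Suc j)) (Q * (W ^ s * Q)))"
  proof (intro sum.cong refl)
    fix j
    have "((pderiv ^^ s) (G j) - Q)\<^sup>2 * W ^ s = ((pderiv ^^ s) (G j))\<^sup>2 * W ^ s
       - smult 2 ((pderiv ^^ s) (G j) * (W ^ s * Q)) + Q * (W ^ s * Q)"
      by (rule poly_eq_poly_eq_iff[THEN iffD1], rule ext) (simp add: power2_eq_square algebra_simps)
    then show "poly_integral (x j) (x (Suc j)) (((pderiv ^^ s) (G j) - Q)\<^sup>2 * W ^ s)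
      = poly_integral (x j) (x (Suc j)) (((pderiv ^^ s) (G j))\<^sup>2 * W ^ s)
      - 2 * poly_integral (x j) (x (Suc j)) ((pderiv ^^ s) (G j) * (W ^ s * Q))
      + poly_integral (x j) (x (Suc j)) (Q * (W ^ s * Q))"
      by (simp only: poly_integral_add poly_integral_diff poly_integral_smult)
  qed
  also have "\<dots> = energy - 2 * pairing (W ^ s * Q) + poly_integral a b (Q * (W ^ s * Q))"
    using poly_integral_combine[of N x "Q * (W ^ s * Q)"] knots
    by (simp add: energy_def pairing_def sum.distrib sum_subtractf sum_distrib_left x0 xN less_imp_le)
  also have "\<dots> = energy - (\<Sum>n\<in>A. (c n)\<^sup>2 * K n)" unfolding PQ QQ by simp
  also have "(\<Sum>n\<in>A. (c n)\<^sup>2 * K n) = (\<Sum>n\<in>A. (pairing (W ^ s * ker n))\<^sup>2 / K n)"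
    using K by (intro sum.cong refl) (simp add: c_def power2_eq_square less_imp_neq[symmetric])
  finally show ?thesis by simp
qed

definition proj :: "nat \<Rightarrow> real poly" where
  "proj m = (\<Sum>n<m. smult (integral {a..b} (\<lambda>t. g t * poly (rho n) t) / (fact (2 * n) * w n)) (rho n))"

lemma coeff_proj: "i \<ge> m \<Longrightarrow> coeff (proj m) i = 0"
  by (auto simp: proj_def coeff_sum coeff_rho)

lemma g_integrable:
  "(\<lambda>t. g t * poly p t) integrable_on {a..b}" "(\<lambda>t. (g t - poly p t)\<^sup>2) integrable_on {a..b}"
  "(\<lambda>t. (poly p t)\<^sup>2) integrable_on {a..b}" "(\<lambda>t. (g t)\<^sup>2) integrable_on {a..b}"
  by (intro integrable_continuous_interval continuous_intros cont)+

text \<open>Completing the square in the coefficients: the distance is smallest when \<beta> equals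
  c, which makes truncated Legendre expansions best approximations.\<close>

lemma square_dist:
  fixes A :: "nat set"
  assumes "finite A" and p: "p = (\<Sum>n\<in>A. smult (\<beta> n) (rho n))"
  defines "R \<equiv> \<lambda>n. fact (2 * n) * w n"
  defines "c \<equiv> \<lambda>n. integral {a..b} (\<lambda>t. g t * poly (rho n) t) / R n"
  shows "integral {a..b} (\<lambda>t. (g t - poly p t)\<^sup>2)
    = integral {a..b} (\<lambda>t. (g t)\<^sup>2) - (\<Sum>n\<in>A. (c n)\<^sup>2 * R n) + (\<Sum>n\<in>A. (\<beta> n - c n)\<^sup>2 * R n)"
proof -
  have R: "R n > 0" for n by (simp add: R_def w_pos)
  have gp: "integral {a..b} (\<lambda>t. g t * poly p t) = (\<Sum>n\<in>A. \<beta> n * (c n * R n))"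
  proof -
    have "(\<lambda>t. g t * poly p t) = (\<lambda>t. \<Sum>n\<in>A. \<beta> n * (g t * poly (rho n) t))"
      by (auto simp: p poly_sum sum_distrib_left mult_ac)
    then have "integral {a..b} (\<lambda>t. g t * poly p t) = (\<Sum>n\<in>A. integral {a..b} (\<lambda>t. \<beta> n * (g t * poly (rho n) t)))"
      using assms(1) by (simp add: integral_sum g_integrable integrable_on_mult_right)
    also have "\<dots> = (\<Sum>n\<in>A. \<beta> n * (c n * R n))"
      using R by (intro sum.cong refl) (simp add: c_def less_imp_neq[symmetric])
    finally show ?thesis .
  qed
  have pp: "integral {a..b} (\<lambda>t. (poly p t)\<^sup>2) = (\<Sum>n\<in>A. (\<beta> n)\<^sup>2 * R n)"
  proof -
    have "p * p = (\<Sum>l\<in>A. \<Sum>n\<in>A. smult (\<beta> l * \<beta> n) (rho l * rho n))"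
      unfolding p sum_product by (simp add: mult.commute[of "\<beta> _" "\<beta> _"])
    then have "poly_integral a b (p * p)
       = (\<Sum>l\<in>A. \<Sum>n\<in>A. \<beta> l * \<beta> n * poly_integral a b (rho l * rho n))"
      by (simp add: poly_integral_sum poly_integral_smult)
    also have "\<dots> = (\<Sum>l\<in>A. \<Sum>n\<in>A. if n = l then (\<beta> l)\<^sup>2 * R l else 0)"
      by (intro sum.cong refl) (auto simp: rho_orth' rho_norm R_def power2_eq_square)
    also have "\<dots> = (\<Sum>n\<in>A. (\<beta> n)\<^sup>2 * R n)" using assms(1) by simp
    also have "poly_integral a b (p * p) = integral {a..b} (\<lambda>t. (poly p t)\<^sup>2)"
      unfolding poly_integral_def by (simp add: poly_mult[abs_def] power2_eq_square)
    finally show ?thesis .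
  qed
  have "(\<lambda>t. (g t - poly p t)\<^sup>2) = (\<lambda>t. (g t)\<^sup>2 - 2 * (g t * poly p t) + (poly p t)\<^sup>2)"
    by (auto simp: power2_eq_square algebra_simps)
  then have "integral {a..b} (\<lambda>t. (g t - poly p t)\<^sup>2) = integral {a..b} (\<lambda>t. (g t)\<^sup>2)
     - 2 * integral {a..b} (\<lambda>t. g t * poly p t) + integral {a..b} (\<lambda>t. (poly p t)\<^sup>2)"
    by (simp add: integral_add integral_diff integrable_diff integrable_on_mult_right g_integrable)
  also have "\<dots> = integral {a..b} (\<lambda>t. (g t)\<^sup>2) + (\<Sum>n\<in>A. (\<beta> n - c n)\<^sup>2 * R n - (c n)\<^sup>2 * R n)"
  proof -
    have "(\<beta> n - c n)\<^sup>2 * R n - (c n)\<^sup>2 * R n = (\<beta> n)\<^sup>2 * R n - 2 * (\<beta> n * (c n * R n))" for n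
      by (simp add: power2_eq_square algebra_simps)
    then show ?thesis by (simp add: gp pp sum_subtractf sum_distrib_left)
  qed
  finally show ?thesis by (simp add: sum_subtractf)
qed

text \<open>The error is the tail of the Legendre expansion. Its coefficients come from the s-th
  derivative, so Bessel's inequality bounds the tail by the energy times the largest ratio (n - s)!
  / (n + s)!. Completeness of the Legendre system is supplied by the Weierstrass theorem, at the
  cost of an arbitrary e.\<close>

theorem jackson:
  assumes "s \<le> m"
  shows "integral {a..b} (\<lambda>t. (g t - poly (proj m) t)\<^sup>2) \<le> energy / real (m - s + 1) ^ (2 * s)"
proof (rule field_le_epsilon)
  fix e :: real assume e: "0 < e"
  define R where "R n = fact (2 * n) * w n" for n
  define K where "K n = fact (n - s) * fact (2 * n) / fact (n + s) * w n" for n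
  define c where "c n = integral {a..b} (\<lambda>t. g t * poly (rho n) t) / R n" for n
  have R: "R n > 0" and K: "K n > 0" for n by (simp_all add: R_def K_def w_pos)
  have d: "integral {a..b} (\<lambda>t. (g t - poly (proj M) t)\<^sup>2)
     = integral {a..b} (\<lambda>t. (g t)\<^sup>2) - (\<Sum>n<M. (c n)\<^sup>2 * R n)" for M
    using square_dist[of "{..<M}" "proj M" c] by (simp add: proj_def c_def R_def)
  define \<delta> where "\<delta> = sqrt (e / (b - a))"
  have \<delta>: "0 < \<delta>" "\<delta>\<^sup>2 * (b - a) = e" using e ab by (simp_all add: \<delta>_def)
  obtain h where h: "real_polynomial_function h" "\<And>t. t \<in> {a..b} \<Longrightarrow> \<bar>g t - h t\<bar> < \<delta>"
    using Stone_Weierstrass_real_polynomial_function[OF compact_Icc cont \<delta>(1)] by auto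
  obtain co d0 where "h = (\<lambda>t. \<Sum>i\<le>d0. co i * t ^ i)"
    using h(1) unfolding real_polynomial_function_iff_sum by blast
  then have hq: "h t = poly (\<Sum>i\<le>d0. monom (co i) i) t" for t by (simp add: poly_sum poly_monom)
  define q where "q = (\<Sum>i\<le>d0. monom (co i) i)"
  \<comment> \<open>Large enough for the Weierstrass polynomial to lie in the span of the first M
    Legendre polynomials, so that the projection of level M is at least as good.\<close>
  define M where "M = max m (Suc (degree q))"
  have "\<exists>\<beta>. q = (\<Sum>n<M. smult (\<beta> n) (rho n))"
    by (rule poly_triangular_expansion) (auto simp: coeff_rho M_def coeff_eq_0)
  then obtain \<beta> where \<beta>: "q = (\<Sum>n<M. smult (\<beta> n) (rho n))" by blast
  have "integral {a..b} (\<lambda>t. (g t - poly (proj M) t)\<^sup>2) \<le> integral {a..b} (\<lambda>t. (g t - poly q t)\<^sup>2)"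
    unfolding d square_dist[OF finite_lessThan \<beta>] c_def R_def
    using sum_nonneg[of "{..<M}" "\<lambda>n. (\<beta> n - c n)\<^sup>2 * R n"] R
    by (auto simp: c_def R_def less_imp_le)
  also have "\<dots> \<le> integral {a..b} (\<lambda>t. \<delta>\<^sup>2)"
  proof (intro integral_le g_integrable integrable_const_ivl)
    fix t assume "t \<in> {a..b}"
    then have "\<bar>g t - poly q t\<bar> \<le> \<bar>\<delta>\<bar>" using h(2)[of t] \<delta>(1) by (simp add: hq q_def)
    then show "(g t - poly q t)\<^sup>2 \<le> \<delta>\<^sup>2" by (simp only: abs_le_square_iff)
  qed
  also have "\<dots> = e" using \<delta> ab by (simp add: mult.commute)
  finally have 1: "integral {a..b} (\<lambda>t. (g t - poly (proj M) t)\<^sup>2) \<le> e" .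
  have "(\<Sum>n\<in>{m..<M}. (c n)\<^sup>2 * R n) \<le> (\<Sum>n\<in>{m..<M}. (pairing (W ^ s * ker n))\<^sup>2 / K n / real (m - s + 1) ^ (2 * s))"
  proof (rule sum_mono)
    fix n assume n: "n \<in> {m..<M}"
    have sn: "s \<le> n" using n assms by simp
    have KR: "K n = fact (n - s) / fact (n + s) * R n" by (simp add: K_def R_def)
    have "real (m - s + 1) ^ (2 * s) \<le> (real (n - s) + 1) ^ (2 * s)"
      using n by (intro power_mono) auto
    moreover have "fact (n - s) * (real (n - s) + 1) ^ (2 * s) \<le> fact (n + s)"
      using fact_ge_power[of "n - s" "2 * s"] sn by (simp add: add.commute)
    ultimately have "fact (n - s) * real (m - s + 1) ^ (2 * s) \<le> fact (n + s)"
      by (meson fact_ge_zero mult_left_mono order.trans)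
    then have KR': "K n * real (m - s + 1) ^ (2 * s) \<le> R n"
      unfolding KR using R[of n] by (simp add: field_simps)
    have "(c n)\<^sup>2 * R n = (pairing (W ^ s * ker n))\<^sup>2 / R n"
    proof -
      have "(y / z)\<^sup>2 * z = y\<^sup>2 / z" if "z \<noteq> 0" for y z :: real
        using that by (simp add: power2_eq_square)
      moreover have "((-1) ^ s * y)\<^sup>2 = y\<^sup>2" for y :: real
        by (simp add: power_mult_distrib flip: power_mult)
      ultimately show ?thesis using R[of n] by (simp add: c_def integral_rho[OF sn])
    qed
    also have "\<dots> \<le> (pairing (W ^ s * ker n))\<^sup>2 / (K n * real (m - s + 1) ^ (2 * s))"
      using KR' K[of n] R[of n] by (intro divide_left_mono) auto
    finally show "(c n)\<^sup>2 * R n \<le> (pairing (W ^ s * ker n))\<^sup>2 / K n / real (m - s + 1) ^ (2 * s)"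
      by simp
  qed
  also have "\<dots> = (\<Sum>n\<in>{m..<M}. (pairing (W ^ s * ker n))\<^sup>2 / K n) / real (m - s + 1) ^ (2 * s)"
    by (simp add: sum_divide_distrib)
  also have "\<dots> \<le> energy / real (m - s + 1) ^ (2 * s)"
    using bessel[of "{m..<M}"] assms unfolding K_def by (intro divide_right_mono) auto
  finally have 2: "(\<Sum>n\<in>{m..<M}. (c n)\<^sup>2 * R n) \<le> energy / real (m - s + 1) ^ (2 * s)" .
  have "{..<M} = {..<m} \<union> {m..<M}" by (auto simp: M_def)
  then have "(\<Sum>n<M. (c n)\<^sup>2 * R n) = (\<Sum>n<m. (c n)\<^sup>2 * R n) + (\<Sum>n\<in>{m..<M}. (c n)\<^sup>2 * R n)"
    by (simp add: sum.union_disjoint ivl_disj_int)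
  then show "integral {a..b} (\<lambda>t. (g t - poly (proj m) t)\<^sup>2) \<le> energy / real (m - s + 1) ^ (2 * s) + e"
    using 1 2 unfolding d by simp
qed

end

abbreviation sq_int :: "real set \<Rightarrow> (real \<Rightarrow> real) \<Rightarrow> ennreal" where
  "sq_int A f \<equiv> \<integral>\<^sup>+x\<in>A. ennreal ((f x)\<^sup>2) \<partial>lborel"

section \<open>Whitney's inequality\<close>

text \<open>The usual forward difference up to the sign (-1) ^ s, chosen so that f x itself has
  coefficient 1 and can be isolated.\<close>

definition fdiff :: "nat \<Rightarrow> real \<Rightarrow> (real \<Rightarrow> real) \<Rightarrow> real \<Rightarrow> real" where
  "fdiff s v f x = (\<Sum>l\<le>s. real (s choose l) * (-1) ^ l * f (x + real l * v))"

lemma fdiff_0 [simp]: "fdiff 0 v f x = f x"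
  by (simp add: fdiff_def)

lemma fdiff_Suc: "fdiff (Suc s) v f x = fdiff s v f x - fdiff s v f (x + v)"
proof -
  have "fdiff (Suc s) v f x = f x + (\<Sum>l\<le>s. real (Suc s choose Suc l) * (-1) ^ Suc l * f (x + real (Suc l) * v))"
    unfolding fdiff_def by (subst sum.atMost_Suc_shift) simp
  also have "(\<Sum>l\<le>s. real (Suc s choose Suc l) * (-1) ^ Suc l * f (x + real (Suc l) * v))
     = (\<Sum>l\<le>s. real (s choose Suc l) * (-1) ^ Suc l * f (x + real (Suc l) * v)) 
       - (\<Sum>l\<le>s. real (s choose l) * (-1) ^ l * f (x + v + real l * v))"
    by (subst sum_subtractf[symmetric], intro sum.cong refl) (simp add: algebra_simps)
  also have "f x + ((\<Sum>l\<le>s. real (s choose Suc l) * (-1) ^ Suc l * f (x + real (Suc l) * v)) 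
       - (\<Sum>l\<le>s. real (s choose l) * (-1) ^ l * f (x + v + real l * v)))
     = (\<Sum>l\<le>Suc s. real (s choose l) * (-1) ^ l * f (x + real l * v)) - fdiff s v f (x + v)"
    unfolding fdiff_def by (subst sum.atMost_Suc_shift) simp
  finally show ?thesis by (simp add: fdiff_def binomial_eq_0)
qed

lemma fdiff_Suc': "fdiff (Suc s) v f x = fdiff s v (\<lambda>y. f y - f (y + v)) x"
  unfolding fdiff_Suc
  by (simp add: fdiff_def sum_subtractf[symmetric] algebra_simps)

text \<open>Compact intervals only, because a difference, read as a function of its step, contains
  the constant f x and is in general not integrable over the line.\<close>

definition loc_int :: "(real \<Rightarrow> real) \<Rightarrow> bool" where
  "loc_int f \<longleftrightarrow> (\<forall>x y. f integrable_on {x..y})"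

lemma loc_intD: "loc_int f \<Longrightarrow> f integrable_on {x..y}"
  by (simp add: loc_int_def)

lemma loc_int_integrable: "integrable lborel f \<Longrightarrow> loc_int f"
  unfolding loc_int_def
  by (meson integrable_on_lborel integrable_on_subinterval subset_UNIV)

lemma loc_int_sum: "(\<And>i. i \<in> A \<Longrightarrow> loc_int (f i)) \<Longrightarrow> loc_int (\<lambda>x. \<Sum>i\<in>A. f i x)"
  unfolding loc_int_def by (cases "finite A") (auto intro: integrable_sum)

lemma loc_int_cmult: "loc_int f \<Longrightarrow> loc_int (\<lambda>x. c * f x)"
  unfolding loc_int_def by (auto intro: integrable_on_mult_right)

lemma loc_int_diff: "loc_int f \<Longrightarrow> loc_int g \<Longrightarrow> loc_int (\<lambda>x. f x - g x)"
  unfolding loc_int_def by (auto intro: integrable_diff)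

lemma affine_has_integral:
  fixes f :: "real \<Rightarrow> real"
  assumes f: "f integrable_on {c + m * x..c + m * y}" and m: "0 < m"
  shows "((\<lambda>u. f (c + m * u)) has_integral integral {c + m * x..c + m * y} f / m) {x..y}"
proof -
  have "((\<lambda>u. f (m *\<^sub>R u + c)) has_integral (1 / \<bar>m\<bar> ^ DIM(real)) *\<^sub>R integral (cbox (c + m * x) (c + m * y)) f)
     ((\<lambda>x. (1 / m) *\<^sub>R x + - ((1 / m) *\<^sub>R c)) ` cbox (c + m * x) (c + m * y))"
    using f m by (intro has_integral_affinity) (auto simp: integrable_integral)
  moreover have "((\<lambda>x. (1 / m) *\<^sub>R x + - ((1 / m) *\<^sub>R c)) ` cbox (c + m * x) (c + m * y)) = {x..y}"
  proof -
    have "((\<lambda>x. (1 / m) *\<^sub>R x + - ((1 / m) *\<^sub>R c)) ` cbox (c + m * x) (c + m * y)) 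
      = (\<lambda>t. (1 / m) * t + - (1 / m) * c) ` {c + m * x..c + m * y}" by auto
    also have "\<dots> = {x..y}" using m by (subst image_affinity_atLeastAtMost) (auto simp: field_simps)
    finally show ?thesis .
  qed
  ultimately show ?thesis using m by (simp add: add.commute)
qed

lemma loc_int_affine: "loc_int f \<Longrightarrow> 0 < m \<Longrightarrow> loc_int (\<lambda>u. f (c + m * u))"
  using affine_has_integral unfolding loc_int_def by (meson has_integral_integrable)

lemma loc_int_shift: "loc_int f \<Longrightarrow> loc_int (\<lambda>u. f (u + c))"
  using loc_int_affine[of f 1 c] by (simp add: add.commute)

lemma integral_shift_real:
  "loc_int f \<Longrightarrow> integral {x..y} (\<lambda>u. f (u + c)) = integral {x + c..y + c} (f :: real \<Rightarrow> real)"
  using affine_has_integral[of f c 1 x y] by (simp add: loc_intD add.commute has_integral_iff)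

section \<open>Steklov averages and iterated primitives\<close>

definition avg :: "real \<Rightarrow> (real \<Rightarrow> real) \<Rightarrow> real \<Rightarrow> real" where
  "avg h f x = integral {x..x + h} f / h"

definition prim :: "real \<Rightarrow> (real \<Rightarrow> real) \<Rightarrow> real \<Rightarrow> real" where
  "prim p f x = integral {p..x} f"

lemma prim_eq: "prim p f = (\<lambda>x. integral {p..x} f)"
  by (rule ext) (rule prim_def)

lemma avg_eq_prim:
  assumes "loc_int f" "0 \<le> h" "p \<le> x"
  shows "avg h f x = (prim p f (x + h) - prim p f x) / h"
  using Henstock_Kurzweil_Integration.integral_combine[of p x "x + h" f] assms
  by (simp add: avg_def prim_def loc_intD diff_divide_distrib[symmetric])

lemma continuous_prim: "loc_int f \<Longrightarrow> continuous_on {p..q} (prim p f)"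
  unfolding prim_def[abs_def] by (rule indefinite_integral_continuous_1) (rule loc_intD)

lemma continuous_avg:
  assumes f: "loc_int f" and h: "0 < h"
  shows "continuous_on {p..q} (avg h f)"
proof -
  have "continuous_on {p..q} (\<lambda>x. (prim p f (x + h) - prim p f x) / h)"
    using h by (intro continuous_intros continuous_prim[OF f]
      continuous_on_compose2[OF continuous_prim[OF f, of p "q + h"], of _ "\<lambda>x. x + h"]) auto
  then show ?thesis by (rule continuous_on_eq) (use h f avg_eq_prim[of f h p] in auto)
qed

lemma loc_int_avg: "loc_int f \<Longrightarrow> 0 < h \<Longrightarrow> loc_int (avg h f)"
  using continuous_avg unfolding loc_int_def by (meson integrable_continuous_interval)

lemma loc_int_avg_power: "loc_int f \<Longrightarrow> 0 < h \<Longrightarrow> loc_int ((avg h ^^ k) f)"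
  by (induction k) (auto intro: loc_int_avg)

lemma avg_cmult: "avg h (\<lambda>x. c * f x) = (\<lambda>x. c * avg h f x)"
  by (auto simp: avg_def)

lemma avg_sum:
  assumes "finite A" "\<And>i. i \<in> A \<Longrightarrow> loc_int (f i)"
  shows "avg h (\<lambda>x. \<Sum>i\<in>A. f i x) = (\<lambda>x. \<Sum>i\<in>A. avg h (f i) x)"
  using assms by (auto simp: avg_def integral_sum loc_intD sum_divide_distrib)

lemma avg_power_sum:
  assumes "finite A" "\<And>i. i \<in> A \<Longrightarrow> loc_int (f i)" "0 < h"
  shows "(avg h ^^ k) (\<lambda>x. \<Sum>i\<in>A. c i * f i x) = (\<lambda>x. \<Sum>i\<in>A. c i * (avg h ^^ k) (f i) x)"
proof (induction k)
  case (Suc k)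
  have "loc_int (\<lambda>x. c i * (avg h ^^ k) (f i) x)" if "i \<in> A" for i
    using assms that by (intro loc_int_cmult loc_int_avg_power)
  then show ?case using Suc assms by (simp add: avg_sum avg_cmult)
qed simp

lemma avg_affine:
  assumes "loc_int f" "0 < m" "0 < h"
  shows "avg h (\<lambda>u. f (c + m * u)) x = avg (m * h) f (c + m * x)"
  using affine_has_integral[OF loc_intD[OF assms(1)] assms(2), of c x "x + h"] assms
  by (simp add: avg_def has_integral_iff algebra_simps)

lemma avg_power_affine:
  assumes "loc_int f" "0 < m" "0 < h"
  shows "(avg h ^^ k) (\<lambda>u. f (c + m * u)) = (\<lambda>x. (avg (m * h) ^^ k) f (c + m * x))"
proof (induction k)
  case (Suc k)
  have "loc_int ((avg (m * h) ^^ k) f)" using assms by (intro loc_int_avg_power) auto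
  then show ?case using Suc assms by (auto simp: avg_affine)
qed simp

lemma avg_power_diff:
  assumes "loc_int f" "0 < h"
  shows "(avg h ^^ k) (\<lambda>y. f y - f (y + c)) = (\<lambda>y. (avg h ^^ k) f y - (avg h ^^ k) f (y + c))"
proof -
  \<comment> \<open>The difference is written as a sum over two indices so that linearity, proved
    for finite sums, applies.\<close>
  have "(avg h ^^ k) (\<lambda>y. \<Sum>i\<in>{True, False}. (if i then 1 else -1) * (if i then f y else f (c + 1 * y)))
    = (\<lambda>y. \<Sum>i\<in>{True, False}. (if i then 1 else -1) * (avg h ^^ k) (\<lambda>y. if i then f y else f (c + 1 * y)) y)"
  proof (intro avg_power_sum)
    fix i show "loc_int (\<lambda>y. if i then f y else f (c + 1 * y))"
      using assms loc_int_shift[of f c] by (cases i) (auto simp: add.commute)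
  qed (use assms in auto)
  then show ?thesis using avg_power_affine[of f 1 h k c] assms by (simp add: add.commute)
qed

lemma prim_poly:
  assumes "\<And>i. i \<ge> k \<Longrightarrow> coeff r i = 0"
  shows "\<exists>R. (\<forall>i\<ge>Suc k. coeff R i = 0) \<and> (\<forall>x\<ge>p. prim p (poly r) x = poly R x)"
proof -
  define Q where "Q = (\<Sum>i<k. monom (coeff r i / real (Suc i)) (Suc i))"
  have d: "pderiv Q = r"
  proof (rule poly_eqI)
    fix n show "coeff (pderiv Q) n = coeff r n"
      using assms[of n] by (cases "n < k") (simp_all add: Q_def coeff_pderiv coeff_sum coeff_monom if_distrib
        cong: if_cong)
  qed
  show ?thesis
  proof (intro exI conjI allI impI)
    fix i assume "Suc k \<le> i"
    then show "coeff (Q - [:poly Q p:]) i = 0"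
      by (cases i) (auto simp: Q_def coeff_sum)
  next
    fix x assume "p \<le> x"
    then show "prim p (poly r) x = poly (Q - [:poly Q p:]) x"
      using poly_integral_pderiv[of p x Q] by (simp add: d poly_integral_def prim_def)
  qed
qed

lemma prim_cong: "(\<And>y. p \<le> y \<Longrightarrow> y \<le> x \<Longrightarrow> f y = g y) \<Longrightarrow> prim p f x = prim p g x"
  unfolding prim_def by (intro integral_cong) auto

lemma prim_power_integrable:
  assumes "loc_int f" shows "(prim p ^^ k) f integrable_on {p..q}"
proof (induction k arbitrary: q)
  case (Suc k)
  have "continuous_on {p..q} (prim p ((prim p ^^ k) f))"
    unfolding prim_eq[of p "(prim p ^^ k) f"] by (rule indefinite_integral_continuous_1) (rule Suc)
  then show ?case by (simp add: integrable_continuous_interval)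
qed (simp add: loc_intD assms)

text \<open>An average is -1 / h times the primitive of a first difference, up to a constant.
  Averages commute with differences, so iteration turns the k-fold average into the k-fold primitive
  of the k-th difference; every further primitive raises the degree of the accumulated polynomial by
  one. Hence iterated averages are close to polynomials where the differences are small.\<close>

lemma avg_power_eq_prim_power:
  assumes "loc_int f" "0 < h"
  shows "\<exists>r. (\<forall>i\<ge>k. coeff r i = 0) \<and>
    (\<forall>x\<ge>p. (avg h ^^ k) f x = (-1 / h) ^ k * (prim p ^^ k) (fdiff k h f) x + poly r x)"
  using assms(1)
proof (induction k arbitrary: f)
  case 0
  show ?case by (intro exI[of _ 0]) simp
next
  case (Suc k)
  define f1 where "f1 y = f y - f (y + h)" for y
  have l1: "loc_int f1" unfolding f1_def[abs_def] by (intro loc_int_diff loc_int_shift Suc.prems)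
  obtain r where r: "\<forall>i\<ge>k. coeff r i = 0"
    "\<forall>x\<ge>p. (avg h ^^ k) f1 x = (-1 / h) ^ k * (prim p ^^ k) (fdiff k h f1) x + poly r x"
    using Suc.IH[OF l1] by blast
  obtain R where R: "\<forall>i\<ge>Suc k. coeff R i = 0" "\<forall>x\<ge>p. prim p (poly r) x = poly R x"
    using prim_poly[of k r p] r(1) by blast
  define F where "F = (avg h ^^ k) f"
  have lF: "loc_int F" unfolding F_def by (intro loc_int_avg_power Suc.prems assms)
  have F1: "(avg h ^^ k) f1 = (\<lambda>y. F y - F (y + h))"
    unfolding f1_def[abs_def] F_def by (rule avg_power_diff[OF Suc.prems assms(2)])
  have fd: "fdiff k h f1 = fdiff (Suc k) h f" by (rule ext) (simp only: fdiff_Suc' f1_def[abs_def])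
  have ld: "loc_int (fdiff (Suc k) h f)"
    unfolding fdiff_def[abs_def] by (intro loc_int_sum loc_int_cmult loc_int_shift Suc.prems)
  have "(avg h ^^ Suc k) f x = (-1 / h) ^ Suc k * (prim p ^^ Suc k) (fdiff (Suc k) h f) x
      + poly (smult (-1 / h) R + [:prim p F (p + h) / h:]) x" if x: "p \<le> x" for x
  proof -
    have "prim p ((avg h ^^ k) f1) x = prim p F x - (prim p F (x + h) - prim p F (p + h))"
    proof -
      have "integral {p..x} (\<lambda>y. F y - F (y + h)) = integral {p..x} F - integral {p + h..x + h} F"
        using integral_shift_real[OF lF, of p x h] 
        by (simp add: integral_diff loc_intD[OF lF] loc_intD[OF loc_int_shift[OF lF]])
      moreover have "integral {p..p + h} F + integral {p + h..x + h} F = integral {p..x + h} F"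
        using x assms(2) 
        by (intro Henstock_Kurzweil_Integration.integral_combine loc_intD[OF lF]) auto
      ultimately show ?thesis by (simp add: F1 prim_def)
    qed
    moreover have "avg h F x = (prim p F (x + h) - prim p F x) / h"
      using x assms(2) by (intro avg_eq_prim lF) auto
    ultimately have 1: "avg h F x = (-1 / h) * prim p ((avg h ^^ k) f1) x + prim p F (p + h) / h"
      using assms(2) by (simp add: field_simps)
    have "prim p ((avg h ^^ k) f1) x
       = prim p (\<lambda>y. (-1 / h) ^ k * (prim p ^^ k) (fdiff (Suc k) h f) y + poly r y) x"
      by (rule prim_cong) (use r(2) fd in simp)
    also have "\<dots> = (-1 / h) ^ k * prim p ((prim p ^^ k) (fdiff (Suc k) h f)) x + prim p (poly r) x"
      unfolding prim_def[of p _ x]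
      by (subst integral_add) 
        (auto intro!: integrable_on_mult_right prim_power_integrable[OF ld] poly_integrable)
    finally have 2: "prim p ((avg h ^^ k) f1) x 
      = (-1 / h) ^ k * (prim p ^^ Suc k) (fdiff (Suc k) h f) x + poly R x" using R(2) x by simp
    show ?thesis using 1 unfolding 2 by (simp add: F_def algebra_simps)
  qed
  moreover have "\<forall>i\<ge>Suc k. coeff (smult (-1 / h) R + [:prim p F (p + h) / h:]) i = 0"
    using R(1) by (auto simp: coeff_pCons split: nat.splits)
  ultimately show ?case by blast
qed

lemma integral_abs_le_const:
  fixes F :: "real \<Rightarrow> real"
  assumes "F integrable_on {x..y}" "x \<le> y" "\<And>t. t \<in> {x..y} \<Longrightarrow> \<bar>F t\<bar> \<le> B"
  shows "\<bar>integral {x..y} F\<bar> \<le> B * (y - x)"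
proof -
  have "norm (integral {x..y} F) \<le> integral {x..y} (\<lambda>_. B)"
    by (rule integral_norm_bound_integral) (use assms in auto)
  then show ?thesis using assms(2) by (simp add: mult.commute)
qed

lemma avg_power_bound:
  assumes "loc_int F" "0 < h" "\<And>t. t \<in> {v..v + real k * h} \<Longrightarrow> \<bar>F t\<bar> \<le> B"
  shows "\<bar>(avg h ^^ k) F v\<bar> \<le> B"
  using assms(3)
proof (induction k arbitrary: v)
  case (Suc k)
  have "\<bar>integral {v..v + h} ((avg h ^^ k) F)\<bar> \<le> B * ((v + h) - v)"
  proof (rule integral_abs_le_const)
    show "(avg h ^^ k) F integrable_on {v..v + h}" by (intro loc_intD loc_int_avg_power assms)
    fix t assume t: "t \<in> {v..v + h}"
    show "\<bar>(avg h ^^ k) F t\<bar> \<le> B"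
      by (rule Suc.IH, rule Suc.prems) (use t in \<open>auto simp: algebra_simps\<close>)
  qed (use assms in simp)
  then have "\<bar>avg h ((avg h ^^ k) F) v\<bar> \<le> B"
    using assms(2) unfolding avg_def[of h "(avg h ^^ k) F"] by (simp add: abs_divide field_simps)
  then show ?case by simp
qed simp

text \<open>The innermost average turns the L1 norm into a supremum bound, which the outer k
  averages preserve.\<close>

lemma avg_power_bound_L1:
  assumes F: "loc_int F" "loc_int (\<lambda>t. \<bar>F t\<bar>)" and h: "0 < h"
  shows "\<bar>(avg h ^^ Suc k) F 0\<bar> \<le> integral {0..real (Suc k) * h} (\<lambda>t. \<bar>F t\<bar>) / h"
proof -
  have "\<bar>(avg h ^^ k) (avg h F) 0\<bar> \<le> integral {0..real (Suc k) * h} (\<lambda>t. \<bar>F t\<bar>) / h"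
  proof (rule avg_power_bound[OF loc_int_avg[OF F(1) h] h])
    fix t assume t: "t \<in> {0..0 + real k * h}"
    have "\<bar>integral {t..t + h} F\<bar> \<le> integral {t..t + h} (\<lambda>t. \<bar>F t\<bar>)"
      using integral_norm_bound_integral[of F "{t..t+h}" "\<lambda>t. \<bar>F t\<bar>"] F by (simp add: loc_intD)
    also have "\<dots> \<le> integral {0..real (Suc k) * h} (\<lambda>t. \<bar>F t\<bar>)"
      using t h by (intro integral_subset_le loc_intD[OF F(2)]) (auto simp: algebra_simps)
    finally show "\<bar>avg h F t\<bar> \<le> integral {0..real (Suc k) * h} (\<lambda>t. \<bar>F t\<bar>) / h"
      using h by (simp add: avg_def divide_right_mono)
  qed
  then show ?thesis by (simp add: funpow_swap1)
qed

text \<open>The first primitive turns the L1 norm into a supremum bound; each of the other k costs a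
  factor l.\<close>

lemma prim_power_bound:
  assumes u: "loc_int u" "loc_int (\<lambda>t. \<bar>u t\<bar>)" and l: "0 < l" and x: "x \<in> {p..p + l}"
  shows "\<bar>(prim p ^^ Suc k) u x\<bar> \<le> l ^ k * integral {p..p + l} (\<lambda>t. \<bar>u t\<bar>)"
  using x
proof (induction k arbitrary: x)
  case 0
  have "\<bar>integral {p..x} u\<bar> \<le> integral {p..x} (\<lambda>t. \<bar>u t\<bar>)"
    using integral_norm_bound_integral[of u "{p..x}" "\<lambda>t. \<bar>u t\<bar>"] u by (simp add: loc_intD)
  also have "\<dots> \<le> integral {p..p + l} (\<lambda>t. \<bar>u t\<bar>)"
    using 0 by (intro integral_subset_le loc_intD[OF u(2)]) auto
  finally show ?case by (simp add: prim_def)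
next
  case (Suc k)
  define I where "I = integral {p..p + l} (\<lambda>t. \<bar>u t\<bar>)"
  have I: "0 \<le> I" unfolding I_def by (intro integral_nonneg loc_intD[OF u(2)]) auto
  have "\<bar>integral {p..x} ((prim p ^^ Suc k) u)\<bar> \<le> (l ^ k * I) * (x - p)"
  proof (rule integral_abs_le_const)
    show "(prim p ^^ Suc k) u integrable_on {p..x}" by (rule prim_power_integrable[OF u(1)])
  qed (use Suc in \<open>auto simp: I_def\<close>)
  also have "\<dots> \<le> (l ^ k * I) * l" using Suc.prems l I by (intro mult_left_mono) auto
  finally have "\<bar>prim p ((prim p ^^ Suc k) u) x\<bar> \<le> l ^ Suc k * I"
    unfolding prim_eq[of p "(prim p ^^ Suc k) u"] by (simp add: mult_ac)
  then show ?case by (simp add: I_def)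
qed

text \<open>Cauchy-Schwarz, and at the same time the passage from gauge integrals, used for
  primitives, to non-negative Lebesgue integrals, used for norms and for Tonelli's theorem.\<close>

lemma integral_abs_square_le_nn_integral:
  assumes u: "integrable lborel u" and pq: "p \<le> q"
  shows "ennreal ((integral {p..q} (\<lambda>x. \<bar>u x\<bar>))\<^sup>2)
     \<le> ennreal (q - p) * sq_int {p..q} u"
proof -
  have [measurable]: "u \<in> borel_measurable borel" using borel_measurable_integrable[OF u] by simp
  have si: "set_integrable lborel {p..q} (\<lambda>x. \<bar>u x\<bar>)"
    using integrable_abs[OF u] unfolding set_integrable_def by (intro integrable_mult_indicator) auto
  have I0: "0 \<le> integral {p..q} (\<lambda>x. \<bar>u x\<bar>)"
    by (intro integral_nonneg loc_intD[OF loc_int_integrable] integrable_abs u) auto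
  have "ennreal (integral {p..q} (\<lambda>x. \<bar>u x\<bar>)) = (\<integral>\<^sup>+x. ennreal \<bar>u x\<bar> * indicator {p..q} x \<partial>lborel)"
  proof -
    have "(\<integral>\<^sup>+x. ennreal \<bar>u x\<bar> * indicator {p..q} x \<partial>lborel) = (\<integral>\<^sup>+x. ennreal (indicator {p..q} x *\<^sub>R \<bar>u x\<bar>) \<partial>lborel)"
      by (intro nn_integral_cong) (auto simp: indicator_def)
    also have "\<dots> = ennreal (LINT x:{p..q}|lborel. \<bar>u x\<bar>)"
      using si unfolding set_integrable_def set_lebesgue_integral_def
      by (intro nn_integral_eq_integral) auto
    also have "(LINT x:{p..q}|lborel. \<bar>u x\<bar>) = integral {p..q} (\<lambda>x. \<bar>u x\<bar>)"
      using si by (rule set_borel_integral_eq_integral(2))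
    finally show ?thesis by simp
  qed
  then have "ennreal ((integral {p..q} (\<lambda>x. \<bar>u x\<bar>))\<^sup>2) 
    = (\<integral>\<^sup>+x. ennreal \<bar>u x\<bar> * indicator {p..q} x \<partial>lborel)\<^sup>2"
    using ennreal_power[OF I0, of 2] by (simp only:)
  also have "\<dots> = (\<integral>\<^sup>+x. (ennreal \<bar>u x\<bar> * indicator {p..q} x) * indicator {p..q} x \<partial>lborel)\<^sup>2"
    by (intro arg_cong[of _ _ "\<lambda>y. y\<^sup>2"] nn_integral_cong) (auto simp: indicator_def)
  also have "\<dots> \<le> (\<integral>\<^sup>+x. (ennreal \<bar>u x\<bar> * indicator {p..q} x)\<^sup>2 \<partial>lborel) * (\<integral>\<^sup>+x. (indicator {p..q} x)\<^sup>2 \<partial>lborel)"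
    by (rule Cauchy_Schwarz_nn_integral) auto
  also have "(\<integral>\<^sup>+x. (indicator {p..q} x)\<^sup>2 \<partial>lborel) = (ennreal (q - p))"
  proof -
    have "(\<integral>\<^sup>+x. (indicator {p..q} x)\<^sup>2 \<partial>lborel) = (\<integral>\<^sup>+x. indicator {p..q} x \<partial>lborel)"
      by (intro nn_integral_cong) (auto simp: indicator_def)
    then show ?thesis using pq by simp
  qed
  also have "(\<integral>\<^sup>+x. (ennreal \<bar>u x\<bar> * indicator {p..q} x)\<^sup>2 \<partial>lborel) = sq_int {p..q} u"
    by (intro nn_integral_cong) (auto simp: indicator_def ennreal_power)
  finally show ?thesis by (simp add: mult.commute)
qed

lemma square_sum_le:
  fixes f :: "'a \<Rightarrow> real"
  shows "(\<Sum>i\<in>A. f i)\<^sup>2 \<le> real (card A) * (\<Sum>i\<in>A. (f i)\<^sup>2)"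
  using Cauchy_Schwarz_ineq_sum[of f "\<lambda>_. 1" A] by (simp add: mult.commute)

lemma measurable_fdiff [measurable]:
  assumes [measurable]: "f \<in> borel_measurable borel"
  shows "(\<lambda>z. fdiff s (fst z) f (snd z)) \<in> borel_measurable (borel \<Otimes>\<^sub>M borel)"
    "(\<lambda>z. fdiff s (snd z) f (fst z)) \<in> borel_measurable (borel \<Otimes>\<^sub>M borel)"
    "fdiff s v f \<in> borel_measurable borel" "(\<lambda>v. fdiff s v f x) \<in> borel_measurable borel"
  unfolding fdiff_def[abs_def] by measurable

lemma integrable_fdiff: "integrable lborel f \<Longrightarrow> integrable lborel (fdiff s v f)"
  unfolding fdiff_def[abs_def]
  using lborel_integrable_real_affine[of f 1 "real _ * v"]
  by (intro Bochner_Integration.integrable_sum integrable_mult_right) (auto simp: add.commute)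

lemma integrable_fdiff_step_loc_int:
  assumes "integrable lborel f"
  shows "loc_int (\<lambda>v. fdiff s v f x)" "loc_int (\<lambda>v. \<bar>fdiff s v f x\<bar>)"
    "integrable lborel (\<lambda>v. indicator {p..q} v * fdiff s v f x)"
proof -
  have i: "set_integrable lborel {p..q} (\<lambda>v. f (x + real l * v))" for l p q
  proof (cases "l = 0")
    case False
    then have "integrable lborel (\<lambda>v. f (x + real l * v))"
      using lborel_integrable_real_affine[of f "real l" x] assms by simp
    then show ?thesis unfolding set_integrable_def by (intro integrable_mult_indicator) auto
  qed (simp add: set_integrable_def integrable_indicator_iff emeasure_lborel_Icc_eq)
  have si: "set_integrable lborel {p..q} (\<lambda>v. fdiff s v f x)" for p q
  proof -
    have "integrable lborel (\<lambda>v. \<Sum>l\<le>s. (real (s choose l) * (-1) ^ l) * (indicator {p..q} v *\<^sub>R f (x + real l * v)))"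
      using i unfolding set_integrable_def
      by (intro Bochner_Integration.integrable_sum integrable_mult_right) auto
    then show ?thesis by (simp add: set_integrable_def fdiff_def sum_distrib_left mult_ac)
  qed
  then show "loc_int (\<lambda>v. fdiff s v f x)" unfolding loc_int_def
    using set_borel_integral_eq_integral(1) by blast
  show "loc_int (\<lambda>v. \<bar>fdiff s v f x\<bar>)" unfolding loc_int_def
    using set_borel_integral_eq_integral(1)[OF set_integrable_abs[OF si]] by blast
  show "integrable lborel (\<lambda>v. indicator {p..q} v * fdiff s v f x)"
    using si[of p q] by (simp add: set_integrable_def)
qed

text \<open>Averaged s times in the step, the summand f (x + l v) becomes the s-fold average of f
  with step l h, while the summand l = 0 remains f x. So f is an averaged difference plus a
  combination of its own Steklov averages.\<close>

lemma fdiff_average: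
  assumes f: "integrable lborel f" and h: "0 < h"
  shows "(avg h ^^ s) (\<lambda>v. fdiff s v f x) 0
    = f x + (\<Sum>l\<in>{1..s}. real (s choose l) * (-1) ^ l * (avg (real l * h) ^^ s) f x)"
proof -
  have lf: "loc_int f" using f by (rule loc_int_integrable)
  have ll: "loc_int (\<lambda>v. f (x + real l * v))" for l
    using loc_int_affine[OF lf, of "real l" x] by (cases "l = 0") (auto simp: loc_int_def)
  have c: "(avg h ^^ k) (\<lambda>v. y) = (\<lambda>v. y)" for k y
    using h by (induction k) (auto simp: avg_def)
  have "(avg h ^^ s) (\<lambda>v. fdiff s v f x) 0
    = (\<Sum>l\<le>s. real (s choose l) * (-1) ^ l * (avg h ^^ s) (\<lambda>v. f (x + real l * v)) 0)"
    unfolding fdiff_def using avg_power_sum[of "{..s}" "\<lambda>l v. f (x + real l * v)" h s "\<lambda>l. real (s choose l) * (-1) ^ l"] ll h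
    by simp
  also have "{..s} = insert 0 {1..s}" by auto
  also have "(\<Sum>l\<in>insert 0 {1..s}. real (s choose l) * (-1) ^ l * (avg h ^^ s) (\<lambda>v. f (x + real l * v)) 0)
    = f x + (\<Sum>l\<in>{1..s}. real (s choose l) * (-1) ^ l * (avg h ^^ s) (\<lambda>v. f (x + real l * v)) 0)"
    by (subst sum.insert) (auto simp: c)
  also have "(\<Sum>l\<in>{1..s}. real (s choose l) * (-1) ^ l * (avg h ^^ s) (\<lambda>v. f (x + real l * v)) 0)
    = (\<Sum>l\<in>{1..s}. real (s choose l) * (-1) ^ l * (avg (real l * h) ^^ s) f x)"
    by (intro sum.cong refl) (use h in \<open>auto simp: avg_power_affine[OF lf]\<close>)
  finally show ?thesis .
qed

lemma fdiff_average_bound: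
  assumes f: "integrable lborel f" and h: "0 < h" and s: "0 < s"
  shows "ennreal (((avg h ^^ s) (\<lambda>v. fdiff s v f x) 0)\<^sup>2)
    \<le> ennreal (real s / h) * sq_int {0..real s * h} (\<lambda>v. fdiff s v f x)"
proof -
  define \<Psi> where "\<Psi> v = fdiff s v f x" for v
  define H where "H = real s * h"
  define u where "u v = indicator {0..H} v * \<Psi> v" for v
  have H: "0 < H" using h s by (simp add: H_def)
  have ui: "integrable lborel u"
    unfolding u_def \<Psi>_def by (rule integrable_fdiff_step_loc_int(3)[OF f])
  have "\<bar>(avg h ^^ s) \<Psi> 0\<bar> \<le> integral {0..H} (\<lambda>t. \<bar>\<Psi> t\<bar>) / h"
    using avg_power_bound_L1[of \<Psi> h "s - 1"] integrable_fdiff_step_loc_int(1,2)[OF f, of s x] h s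
    by (simp add: \<Psi>_def[abs_def] H_def)
  also have "integral {0..H} (\<lambda>t. \<bar>\<Psi> t\<bar>) = integral {0..H} (\<lambda>t. \<bar>u t\<bar>)"
    by (intro integral_cong) (simp add: u_def)
  finally have "\<bar>(avg h ^^ s) \<Psi> 0\<bar>\<^sup>2 \<le> (integral {0..H} (\<lambda>t. \<bar>u t\<bar>) / h)\<^sup>2"
    by (intro power_mono) auto
  then have "((avg h ^^ s) \<Psi> 0)\<^sup>2 \<le> 1 / h\<^sup>2 * (integral {0..H} (\<lambda>t. \<bar>u t\<bar>))\<^sup>2"
    by (simp add: power_divide)
  then have "ennreal (((avg h ^^ s) \<Psi> 0)\<^sup>2) \<le> ennreal (1 / h\<^sup>2) * ennreal ((integral {0..H} (\<lambda>t. \<bar>u t\<bar>))\<^sup>2)"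
    by (subst ennreal_mult[symmetric]) (auto intro!: ennreal_leI)
  also have "\<dots> \<le> ennreal (1 / h\<^sup>2) * (ennreal H * (sq_int {0..H} u))"
    using integral_abs_square_le_nn_integral[OF ui, of 0 H] H by (intro mult_left_mono) auto
  also have "\<dots> = ennreal (real s / h) * sq_int {0..H} u"
  proof -
    have "ennreal (1 / h\<^sup>2) * ennreal H = ennreal (real s / h)"
      using h by (subst ennreal_mult[symmetric]) (auto simp: H_def power2_eq_square)
    then show ?thesis by (simp flip: mult.assoc)
  qed
  also have "sq_int {0..H} u = sq_int {0..H} \<Psi>"
    by (intro nn_integral_cong) (auto simp: u_def indicator_def)
  finally show ?thesis by (simp add: \<Psi>_def[abs_def] H_def)
qed

lemma prim_power_fdiff_bound:
  assumes f: "integrable lborel f" and l: "0 < l" and s: "0 < s" and x: "x \<in> {p..p + l}"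
  shows "ennreal (((prim p ^^ s) (fdiff s v f) x)\<^sup>2)
    \<le> ennreal (l ^ (2 * s - 1)) * sq_int {p..p + l} (fdiff s v f)"
proof -
  define u where "u = fdiff s v f"
  have ui: "integrable lborel u" unfolding u_def by (rule integrable_fdiff[OF f])
  have "\<bar>(prim p ^^ s) u x\<bar> \<le> l ^ (s - 1) * integral {p..p + l} (\<lambda>t. \<bar>u t\<bar>)"
    using prim_power_bound[of u l x p "s - 1"] loc_int_integrable[OF ui]
      loc_int_integrable[OF integrable_abs[OF ui]] l x s by simp
  then have "\<bar>(prim p ^^ s) u x\<bar>\<^sup>2 \<le> (l ^ (s - 1) * integral {p..p + l} (\<lambda>t. \<bar>u t\<bar>))\<^sup>2"
    by (intro power_mono) auto
  then have "((prim p ^^ s) u x)\<^sup>2 \<le> (l ^ (s - 1))\<^sup>2 * (integral {p..p + l} (\<lambda>t. \<bar>u t\<bar>))\<^sup>2"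
    by (simp add: power_mult_distrib)
  then have "ennreal (((prim p ^^ s) u x)\<^sup>2) \<le> ennreal ((l ^ (s - 1))\<^sup>2) * ennreal ((integral {p..p + l} (\<lambda>t. \<bar>u t\<bar>))\<^sup>2)"
    by (subst ennreal_mult[symmetric]) (auto intro!: ennreal_leI)
  also have "\<dots> \<le> ennreal ((l ^ (s - 1))\<^sup>2) * (ennreal l * (sq_int {p..p + l} u))"
    using integral_abs_square_le_nn_integral[OF ui, of p "p + l"] l by (intro mult_left_mono) auto
  also have "\<dots> = ennreal (l ^ (2 * s - 1)) * sq_int {p..p + l} u"
  proof -
    have "2 * s - 1 = Suc (2 * (s - 1))" using s by simp
    then have "(l ^ (s - 1))\<^sup>2 * l = l ^ (2 * s - 1)" by (simp add: power_mult[symmetric] mult.commute)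
    then have "ennreal ((l ^ (s - 1))\<^sup>2) * ennreal l = ennreal (l ^ (2 * s - 1))"
      using l by (subst ennreal_mult[symmetric]) auto
    then show ?thesis by (simp flip: mult.assoc)
  qed
  finally show ?thesis unfolding u_def .
qed

lemma ennreal_square_sum_le:
  assumes "finite A"
  shows "ennreal ((\<Sum>i\<in>A. f i)\<^sup>2) \<le> ennreal (real (card A)) * (\<Sum>i\<in>A. ennreal ((f i)\<^sup>2))"
proof -
  have "ennreal ((\<Sum>i\<in>A. f i)\<^sup>2) \<le> ennreal (real (card A) * (\<Sum>i\<in>A. (f i)\<^sup>2))"
    by (intro ennreal_leI square_sum_le)
  also have "\<dots> = ennreal (real (card A)) * (\<Sum>i\<in>A. ennreal ((f i)\<^sup>2))"
    by (subst ennreal_mult) (auto intro: sum_nonneg)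
  finally show ?thesis .
qed

text \<open>Otherwise the sum is at least the bound on a whole interval of steps of length H / (2
  s), and integration gives at least 2 s \<tau>. Substituting v = l h keeps the arguments in {0..H},
  so each of the s integrals is at most \<tau>. The lower end H / (2 s) keeps h comparable to H,
  since powers of 1 / h occur later.\<close>

lemma good_step:
  fixes D :: "real \<Rightarrow> ennreal"
  assumes D [measurable]: "D \<in> borel_measurable borel"
    and s: "0 < s" and H: "0 < H" and \<tau>: "0 < \<tau>"
    and T: "(\<integral>\<^sup>+v\<in>{0..H}. D v \<partial>lborel) \<le> ennreal \<tau>"
  shows "\<exists>h\<in>{H / (2 * real s)..H / real s}. (\<Sum>l\<in>{1..s}. D (real l * h)) \<le> ennreal (4 * (real s)\<^sup>2 * \<tau> / H)"
proof (rule ccontr)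
  assume neg: "\<not> ?thesis"
  define S where "S = {H / (2 * real s)..H / real s}"
  define B where "B = 4 * (real s)\<^sup>2 * \<tau> / H"
  have c: "ennreal B \<le> (\<Sum>l\<in>{1..s}. D (real l * h))" if "h \<in> S" for h
    using neg that unfolding S_def B_def by (meson less_imp_le not_le)
  have B: "0 < B" using s H \<tau> by (simp add: B_def)
  have "ennreal (B * (H / (2 * real s))) = (\<integral>\<^sup>+h\<in>S. ennreal B \<partial>lborel)"
  proof -
    have "H / real s - H / (2 * real s) = H / (2 * real s)" using s by (simp add: field_simps)
    moreover have "H / (2 * real s) \<le> H / real s" using s H by (simp add: frac_le)
    ultimately show ?thesis
      unfolding S_def using B H s
      by (simp add: nn_integral_cmult_indicator ennreal_mult[symmetric])
  qed
  also have "\<dots> \<le> (\<integral>\<^sup>+h\<in>S. (\<Sum>l\<in>{1..s}. D (real l * h)) \<partial>lborel)"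
    using c by (intro nn_integral_mono) (auto simp: indicator_def)
  also have "\<dots> = (\<Sum>l\<in>{1..s}. \<integral>\<^sup>+h\<in>S. D (real l * h) \<partial>lborel)"
    unfolding sum_distrib_right S_def by (rule nn_integral_sum) measurable
  also have "\<dots> \<le> (\<Sum>l\<in>{1..s}. ennreal \<tau>)"
  proof (rule sum_mono)
    fix l assume l: "l \<in> {1..s}"
    have "(\<integral>\<^sup>+h\<in>S. D (real l * h) \<partial>lborel) \<le> (\<integral>\<^sup>+h. D (0 + real l * h) * indicator {0..H} (0 + real l * h) \<partial>lborel)"
    proof (rule nn_integral_mono)
      fix h
      have "real l * h \<in> {0..H}" if "h \<in> S"
      proof -
        have "0 \<le> h" using that s H unfolding S_def by (auto intro: order_trans[rotated])
        moreover have "real l * h \<le> real s * (H / real s)"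
          using that l H s \<open>0 \<le> h\<close> by (intro mult_mono) (auto simp: S_def)
        ultimately show ?thesis using s by simp
      qed
      then show "D (real l * h) * indicator S h \<le> D (0 + real l * h) * indicator {0..H} (0 + real l * h)"
        by (auto simp: indicator_def)
    qed
    also have "\<dots> \<le> ennreal \<bar>real l\<bar> * (\<integral>\<^sup>+h. D (0 + real l * h) * indicator {0..H} (0 + real l * h) \<partial>lborel)"
    proof -
      have "1 \<le> ennreal \<bar>real l\<bar>" using l by (simp flip: ennreal_1)
      from mult_right_mono[OF this] show ?thesis by fastforce
    qed
    also have "\<dots> = (\<integral>\<^sup>+v\<in>{0..H}. D v \<partial>lborel)"
      using l by (intro nn_integral_real_affine[symmetric]) auto
    finally show "(\<integral>\<^sup>+h\<in>S. D (real l * h) \<partial>lborel) \<le> ennreal \<tau>" using T by (rule order_trans)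
  qed
  also have "\<dots> = ennreal (real s * \<tau>)" using \<tau> by (simp add: ennreal_mult ennreal_of_nat_eq_real_of_nat)
  finally have "B * (H / (2 * real s)) \<le> real s * \<tau>" using s \<tau> by (simp add: ennreal_le_iff)
  moreover have "B * (H / (2 * real s)) = 2 * (real s * \<tau>)"
    using s H by (simp add: B_def field_simps power2_eq_square)
  ultimately show False using s \<tau> by simp
qed

text \<open>The factor s + 1 is the number of terms in the decomposition of the error; the first
  summand comes from the averaged difference, the second from the iterated primitives.\<close>

definition whitney_const :: "nat \<Rightarrow> real" where
  "whitney_const s = real (Suc s) * (2 * real s ^ 3 + 4 * real s ^ 3 * (2 ^ s) ^ 2 * (2 * (real s)\<^sup>2) ^ (2 * s))"

text \<open>Averaging the difference in its step expresses f through Steklov averages, and each of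
  these is a polynomial plus an iterated primitive of a difference. So f minus a polynomial is a sum
  of s + 1 terms controlled by differences. One term involves an integral over steps, the others
  only the steps k h, and h is chosen so that the differences with these steps are small
  together.\<close>

lemma whitney:
  assumes f: "integrable lborel f" and s: "0 < s" and l: "0 < l" and \<tau>: "0 < \<tau>"
    and T: "(\<integral>\<^sup>+v\<in>{0..l / real s}. (sq_int {p..p + l} (fdiff s v f)) \<partial>lborel) \<le> ennreal \<tau>"
  shows "\<exists>r. (\<forall>i\<ge>s. coeff r i = 0) \<and>
     (sq_int {p..p + l} (\<lambda>x. f x - poly r x)) \<le> ennreal (whitney_const s * \<tau> / l)"
proof -
  have [measurable]: "f \<in> borel_measurable borel" using borel_measurable_integrable[OF f] by simp
  have lf: "loc_int f" using f by (rule loc_int_integrable)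
  define H where "H = l / real s"
  have H: "0 < H" using l s by (simp add: H_def)
  define D where "D v = sq_int {p..p + l} (fdiff s v f)" for v
  have D [measurable]: "D \<in> borel_measurable borel"
    unfolding D_def fdiff_def by measurable
  have T': "(\<integral>\<^sup>+v\<in>{0..H}. D v \<partial>lborel) \<le> ennreal \<tau>" using T by (simp add: D_def[abs_def] H_def)
  obtain h where h: "h \<in> {H / (2 * real s)..H / real s}"
    and Dh: "(\<Sum>l\<in>{1..s}. D (real l * h)) \<le> ennreal (4 * (real s)\<^sup>2 * \<tau> / H)"
    using good_step[OF D s H \<tau> T'] by blast
  have h0: "0 < h" using h s H by (auto intro: less_le_trans[rotated])
  have hs: "real s * h \<le> H" using h s by (simp add: field_simps)
  have hl: "l / h \<le> 2 * (real s)\<^sup>2"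
  proof -
    have "H \<le> h * (2 * real s)" using h s by (simp add: field_simps)
    then have "l \<le> h * (2 * real s) * real s" using s by (simp add: H_def field_simps)
    then show ?thesis using h0 by (simp add: field_simps power2_eq_square)
  qed
  define e where "e k = real (s choose k) * (-1) ^ k" for k
  have "\<exists>r. (\<forall>i\<ge>s. coeff r i = 0) \<and> (\<forall>x\<ge>p. (avg (real k * h) ^^ s) f x
      = (-1 / (real k * h)) ^ s * (prim p ^^ s) (fdiff s (real k * h) f) x + poly r x)" if "k \<in> {1..s}" for k
    using that h0 by (intro avg_power_eq_prim_power lf) auto
  then obtain r where r: "\<And>k i. k \<in> {1..s} \<Longrightarrow> i \<ge> s \<Longrightarrow> coeff (r k) i = 0"
    "\<And>k x. k \<in> {1..s} \<Longrightarrow> p \<le> x \<Longrightarrow> (avg (real k * h) ^^ s) f x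
      = (-1 / (real k * h)) ^ s * (prim p ^^ s) (fdiff s (real k * h) f) x + poly (r k) x"
    by metis
  define q where "q = - (\<Sum>k\<in>{1..s}. smult (e k) (r k))"
  \<comment> \<open>The error terms: index 0 carries the averaged difference, index k the iterated
    primitive of the difference with step k h.\<close>
  define w where "w k x = (if k = 0 then (avg h ^^ s) (\<lambda>v. fdiff s v f x) 0
     else - e k * (-1 / (real k * h)) ^ s * (prim p ^^ s) (fdiff s (real k * h) f) x)" for k x
  have eq: "f x - poly q x = (\<Sum>k\<le>s. w k x)" if "p \<le> x" for x
  proof -
    have "f x = w 0 x - (\<Sum>k\<in>{1..s}. e k * (avg (real k * h) ^^ s) f x)"
      using fdiff_average[OF f h0, of s x] by (simp add: w_def e_def)
    also have "(\<Sum>k\<in>{1..s}. e k * (avg (real k * h) ^^ s) f x) = (\<Sum>k\<in>{1..s}. - w k x + e k * poly (r k) x)"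
      by (intro sum.cong refl) (use r(2) that in \<open>simp add: w_def algebra_simps\<close>)
    finally have "f x - poly q x = w 0 x + (\<Sum>k\<in>{1..s}. w k x)"
      by (simp only: q_def poly_sum sum.distrib sum_negf poly_minus poly_smult)
    also have "\<dots> = (\<Sum>k\<le>s. w k x)"
    proof -
      have "{..s} = insert 0 {1..s}" by auto
      then show ?thesis by simp
    qed
    finally show ?thesis .
  qed
  have w0: "ennreal ((w 0 x)\<^sup>2) \<le> ennreal (real s / h) * sq_int {0..H} (\<lambda>v. fdiff s v f x)" for x
  proof -
    have "sq_int {0..real s * h} (\<lambda>v. fdiff s v f x) \<le> sq_int {0..H} (\<lambda>v. fdiff s v f x)"
      using hs by (intro nn_integral_mono) (auto simp: indicator_def)
    then have "ennreal (real s / h) * sq_int {0..real s * h} (\<lambda>v. fdiff s v f x)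
      \<le> ennreal (real s / h) * sq_int {0..H} (\<lambda>v. fdiff s v f x)"
      by (intro mult_left_mono) auto
    with fdiff_average_bound[OF f h0 s, of x] show ?thesis
      unfolding w_def by (simp only: if_True refl)
  qed
  define C where "C = (2 ^ s) ^ 2 * (2 * (real s)\<^sup>2) ^ (2 * s) / l"
  have C0: "0 \<le> C" using l by (simp add: C_def)
  have wk: "ennreal ((w k x)\<^sup>2) \<le> ennreal C * D (real k * h)" if k: "k \<in> {1..s}" and x: "x \<in> {p..p + l}" for k x
  proof -
    define P where "P = (prim p ^^ s) (fdiff s (real k * h) f) x"
    have kh: "h \<le> real k * h" using k h0 by simp
    have "(w k x)\<^sup>2 = (real (s choose k))\<^sup>2 * (1 / (real k * h)) ^ (2 * s) * P\<^sup>2"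
      using k by (simp add: w_def e_def P_def power_mult_distrib power_divide flip: power_mult)
        (simp add: mult.commute)
    also have "\<dots> \<le> (2 ^ s)\<^sup>2 * (1 / h) ^ (2 * s) * P\<^sup>2"
      using h0 k kh binomial_le_pow2[of s k]
      by (intro mult_right_mono mult_mono power_mono frac_le) (auto simp flip: of_nat_power_eq_of_nat_cancel_iff)
    finally have "ennreal ((w k x)\<^sup>2) \<le> ennreal ((2 ^ s)\<^sup>2 * (1 / h) ^ (2 * s)) * ennreal (P\<^sup>2)"
      using h0 by (subst ennreal_mult[symmetric]) (auto intro!: ennreal_leI)
    also have "\<dots> \<le> ennreal ((2 ^ s)\<^sup>2 * (1 / h) ^ (2 * s)) * (ennreal (l ^ (2 * s - 1)) * D (real k * h))"
      using prim_power_fdiff_bound[OF f l s x, of "real k * h"] unfolding P_def D_def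
      by (intro mult_left_mono) auto
    also have "\<dots> = ennreal ((2 ^ s)\<^sup>2 * (1 / h) ^ (2 * s) * l ^ (2 * s - 1)) * D (real k * h)"
      using h0 l by (simp add: ennreal_mult mult.assoc)
    also have "\<dots> \<le> ennreal C * D (real k * h)"
    proof (intro mult_right_mono ennreal_leI)
      have "l ^ (2 * s - 1) = l ^ (2 * s) / l"
        using l s by (simp add: power_diff)
      then have "(2 ^ s)\<^sup>2 * (1 / h) ^ (2 * s) * l ^ (2 * s - 1) = (2 ^ s)\<^sup>2 * (l / h) ^ (2 * s) / l"
        by (simp add: power_divide)
      also have "\<dots> \<le> C"
        unfolding C_def using hl h0 l by (intro divide_right_mono mult_left_mono power_mono) auto
      finally show "(2 ^ s)\<^sup>2 * (1 / h) ^ (2 * s) * l ^ (2 * s - 1) \<le> C" .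
    qed auto
    finally show ?thesis .
  qed
  have "sq_int {p..p + l} (\<lambda>x. f x - poly q x)
     \<le> (\<integral>\<^sup>+x\<in>{p..p + l}. (ennreal (real (Suc s)) * (ennreal (real s / h) * sq_int {0..H} (\<lambda>v. fdiff s v f x)
         + (\<Sum>k\<in>{1..s}. ennreal C * D (real k * h)))) \<partial>lborel)"
  proof (intro nn_integral_mono)
    fix x
    have "ennreal ((f x - poly q x)\<^sup>2) \<le> ennreal (real (Suc s)) * (ennreal (real s / h) * sq_int {0..H} (\<lambda>v. fdiff s v f x)
         + (\<Sum>k\<in>{1..s}. ennreal C * D (real k * h)))" if x: "x \<in> {p..p + l}"
    proof -
      have "ennreal ((f x - poly q x)\<^sup>2) \<le> ennreal (real (Suc s)) * (\<Sum>k\<le>s. ennreal ((w k x)\<^sup>2))"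
        using eq[of x] x ennreal_square_sum_le[of "{..s}" "\<lambda>k. w k x"] by simp
      also have "(\<Sum>k\<le>s. ennreal ((w k x)\<^sup>2)) = ennreal ((w 0 x)\<^sup>2) + (\<Sum>k\<in>{1..s}. ennreal ((w k x)\<^sup>2))"
      proof -
        have "{..s} = insert 0 {1..s}" by auto
        then show ?thesis by (simp del: sum_ennreal)
      qed
      finally show ?thesis
        using w0[of x] wk[OF _ x]
        by (elim order_trans) (intro mult_left_mono add_mono sum_mono, auto)
    qed
    then show "ennreal ((f x - poly q x)\<^sup>2) * indicator {p..p + l} x
      \<le> ennreal (real (Suc s)) * (ennreal (real s / h) * sq_int {0..H} (\<lambda>v. fdiff s v f x)
         + (\<Sum>k\<in>{1..s}. ennreal C * D (real k * h))) * indicator {p..p + l} x"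
      by (auto simp: indicator_def)
  qed
  also have "\<dots> = ennreal (real (Suc s)) * (\<integral>\<^sup>+x. (ennreal (real s / h) * sq_int {0..H} (\<lambda>v. fdiff s v f x)
         + (\<Sum>k\<in>{1..s}. ennreal C * D (real k * h))) * indicator {p..p + l} x \<partial>lborel)"
    by (subst nn_integral_cmult[symmetric]) (auto simp: mult.assoc fdiff_def)
  also have "(\<integral>\<^sup>+x. (ennreal (real s / h) * sq_int {0..H} (\<lambda>v. fdiff s v f x)
         + (\<Sum>k\<in>{1..s}. ennreal C * D (real k * h))) * indicator {p..p + l} x \<partial>lborel)
    = ennreal (real s / h) * (\<integral>\<^sup>+x. (sq_int {0..H} (\<lambda>v. fdiff s v f x)) * indicator {p..p + l} x \<partial>lborel)
      + (\<Sum>k\<in>{1..s}. ennreal C * D (real k * h)) * ennreal l"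
    using l unfolding distrib_right
    by (subst nn_integral_add) (auto simp: mult.assoc fdiff_def nn_integral_cmult nn_integral_cmult_indicator)
  also have "(\<integral>\<^sup>+x. (sq_int {0..H} (\<lambda>v. fdiff s v f x)) * indicator {p..p + l} x \<partial>lborel)
     = (\<integral>\<^sup>+v\<in>{0..H}. D v \<partial>lborel)"
  proof -
    have "(\<integral>\<^sup>+x. (sq_int {0..H} (\<lambda>v. fdiff s v f x)) * indicator {p..p + l} x \<partial>lborel)
      = (\<integral>\<^sup>+x. \<integral>\<^sup>+v. ennreal ((fdiff s v f x)\<^sup>2) * indicator {0..H} v * indicator {p..p + l} x \<partial>lborel \<partial>lborel)"
      by (intro nn_integral_cong nn_integral_multc[symmetric]) (simp add: fdiff_def)
    also have "\<dots> = (\<integral>\<^sup>+v. \<integral>\<^sup>+x. ennreal ((fdiff s v f x)\<^sup>2) * indicator {0..H} v * indicator {p..p + l} x \<partial>lborel \<partial>lborel)"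
      unfolding fdiff_def by (rule lborel_pair.Fubini') measurable
    also have "\<dots> = (\<integral>\<^sup>+v\<in>{0..H}. D v \<partial>lborel)"
      unfolding D_def by (subst nn_integral_multc[symmetric]) (auto simp: fdiff_def mult_ac)
    finally show ?thesis .
  qed
  also have "ennreal (real (Suc s)) * (ennreal (real s / h) * (\<integral>\<^sup>+v\<in>{0..H}. D v \<partial>lborel)
      + (\<Sum>k\<in>{1..s}. ennreal C * D (real k * h)) * ennreal l)
    \<le> ennreal (real (Suc s)) * (ennreal (real s / h) * ennreal \<tau> + ennreal C * ennreal (4 * (real s)\<^sup>2 * \<tau> / H) * ennreal l)"
    unfolding sum_distrib_left[symmetric] using Dh T' by (intro mult_mono add_mono) auto
  also have "\<dots> = ennreal (real (Suc s) * (real s / h * \<tau> + C * (4 * (real s)\<^sup>2 * \<tau> / H) * l))"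
    using h0 H l \<tau> C0 by (simp add: ennreal_mult[symmetric] ennreal_plus[symmetric] del: ennreal_plus of_nat_Suc)
  also have "\<dots> \<le> ennreal (whitney_const s * \<tau> / l)"
  proof (rule ennreal_leI)
    have "real s / h * \<tau> \<le> (2 * real s ^ 3) * \<tau> / l"
    proof -
      have "1 / h \<le> 2 * (real s)\<^sup>2 / l" using hl h0 l by (simp add: field_simps)
      then have "real s * (1 / h) * \<tau> \<le> real s * (2 * (real s)\<^sup>2 / l) * \<tau>"
        using \<tau> s by (intro mult_right_mono mult_left_mono) auto
      then show ?thesis by (simp add: power2_eq_square power3_eq_cube mult_ac)
    qed
    moreover have "C * (4 * (real s)\<^sup>2 * \<tau> / H) * l = 4 * real s ^ 3 * (2 ^ s) ^ 2 * (2 * (real s)\<^sup>2) ^ (2 * s) * \<tau> / l"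
      using l s by (simp add: C_def H_def power2_eq_square power3_eq_cube)
    ultimately have "real s / h * \<tau> + C * (4 * (real s)\<^sup>2 * \<tau> / H) * l 
       \<le> (2 * real s ^ 3 + 4 * real s ^ 3 * (2 ^ s) ^ 2 * (2 * (real s)\<^sup>2) ^ (2 * s)) * \<tau> / l"
      by (simp add: add_divide_distrib algebra_simps)
    then have "real (Suc s) * (real s / h * \<tau> + C * (4 * (real s)\<^sup>2 * \<tau> / H) * l)
       \<le> real (Suc s) * ((2 * real s ^ 3 + 4 * real s ^ 3 * (2 ^ s) ^ 2 * (2 * (real s)\<^sup>2) ^ (2 * s)) * \<tau> / l)"
      by (intro mult_left_mono) auto
    then show "real (Suc s) * (real s / h * \<tau> + C * (4 * (real s)\<^sup>2 * \<tau> / H) * l) \<le> whitney_const s * \<tau> / l"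
      by (simp add: whitney_const_def mult.assoc)
  qed
  finally have "sq_int {p..p + l} (\<lambda>x. f x - poly q x) \<le> ennreal (whitney_const s * \<tau> / l)" .
  moreover have "\<forall>i\<ge>s. coeff q i = 0" using r(1) by (simp add: q_def coeff_sum)
  ultimately show ?thesis by blast
qed

section \<open>Weighted symmetric differences\<close>

lemma sym_diff_eq_fdiff:
  "sym_diff a b s v f y = (if y - real s / 2 * v \<in> {a..b} \<and> y + real s / 2 * v \<in> {a..b}
     then fdiff s v f (y - real s / 2 * v) else 0)"
  by (simp add: sym_diff_def fdiff_def algebra_simps)

lemma step_weight_pos: "a < x \<Longrightarrow> x < b \<Longrightarrow> 0 < step_weight a b x"
  by (simp add: step_weight_def)

lemma measurable_step_weight [measurable]: "step_weight a b \<in> borel_measurable borel"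
  unfolding step_weight_def[abs_def] by measurable

lemma measurable_sym_diff [measurable]:
  assumes [measurable]: "f \<in> borel_measurable borel" "u \<in> borel_measurable M" "v \<in> borel_measurable M"
  shows "(\<lambda>z. sym_diff a b s (u z) f (v z)) \<in> borel_measurable M"
  unfolding sym_diff_def atLeastAtMost_iff by measurable

definition mean_square_diff :: "real \<Rightarrow> real \<Rightarrow> nat \<Rightarrow> (real \<Rightarrow> real) \<Rightarrow> real set \<Rightarrow> real \<Rightarrow> ennreal" where
  "mean_square_diff a b s f J h = sq_int J (\<lambda>x. sym_diff a b s (h * step_weight a b x) f x)"

text \<open>For a fixed point the substitution of h times the weight for v turns plain steps into
  weighted ones; as the weight lies between \<phi>1 and \<phi>2 on the patch, this costs a factor
  \<phi>2 and enlarges the range of h to l / (s \<phi>1). A forward difference at x is a symmetric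
  one centred at x + s v / 2, with nodes reaching up to p + 2 l: hence the hypothesis on a patch of
  twice the length.\<close>

lemma weighted_whitney:
  assumes f: "integrable lborel f" and s: "0 < s" and l: "0 < l" and \<tau>: "0 < \<tau>"
    and J: "a < p" "p + 2 * l < b"
    and \<phi>: "0 < \<phi>1" "\<And>x. x \<in> {p..p + 2 * l} \<Longrightarrow> \<phi>1 \<le> step_weight a b x \<and> step_weight a b x \<le> \<phi>2"
    and T: "(\<integral>\<^sup>+h\<in>{0..l / (real s * \<phi>1)}. mean_square_diff a b s f {p..p + 2 * l} h \<partial>lborel) \<le> ennreal \<tau>"
  shows "\<exists>r. (\<forall>i\<ge>s. coeff r i = 0) \<and>
     (sq_int {p..p + l} (\<lambda>x. f x - poly r x)) \<le> ennreal (whitney_const s * (\<phi>2 * \<tau>) / l)"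
proof -
  have [measurable]: "f \<in> borel_measurable borel" using borel_measurable_integrable[OF f] by simp
  have \<phi>2: "0 < \<phi>2" using \<phi>(1) \<phi>(2)[of p] l by auto
  then have \<phi>\<tau>: "0 < \<phi>2 * \<tau>" using \<tau> by simp
  define H where "H = l / real s"
  define J where "J = {p..p + 2 * l}"
  have sH: "real s * H = l" using s by (simp add: H_def)
  have J' [measurable]: "J \<in> sets borel" by (simp add: J_def)
  have "(\<integral>\<^sup>+v\<in>{0..H}. (sq_int {p..p + l} (fdiff s v f)) \<partial>lborel)
    \<le> (\<integral>\<^sup>+v\<in>{0..H}. (sq_int J (sym_diff a b s v f)) \<partial>lborel)"
  proof (intro nn_integral_mono)
    fix v
    have "sq_int {p..p + l} (fdiff s v f) \<le> sq_int J (sym_diff a b s v f)"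
      if v: "v \<in> {0..H}"
    proof -
      define d where "d = real s * v / 2"
      have d: "0 \<le> d" "2 * d \<le> l"
      proof -
        have "real s * v \<le> real s * H" using v by (intro mult_left_mono) auto
        then show "2 * d \<le> l" unfolding sH by (simp add: d_def)
        show "0 \<le> d" using v by (simp add: d_def)
      qed
      have "sq_int {p..p + l} (fdiff s v f)
        = ennreal \<bar>1\<bar> * (\<integral>\<^sup>+y. ennreal ((fdiff s v f (- d + 1 * y))\<^sup>2) * indicator {p..p + l} (- d + 1 * y) \<partial>lborel)"
        by (intro nn_integral_real_affine) (auto simp: fdiff_def)
      also have "\<dots> \<le> sq_int J (sym_diff a b s v f)"
      proof (simp, intro nn_integral_mono)
        fix y
        have "y \<in> J \<and> sym_diff a b s v f y = fdiff s v f (y - d)" if "y - d \<in> {p..p + l}"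
          using that d J(1,2) assms(5,6) by (auto simp: sym_diff_eq_fdiff J_def d_def[symmetric])
        then show "ennreal ((fdiff s v f (y - d))\<^sup>2) * indicator {p..p + l} (y - d)
           \<le> ennreal ((sym_diff a b s v f y)\<^sup>2) * indicator J y"
          by (auto simp: indicator_def)
      qed
      finally show ?thesis .
    qed
    then show "sq_int {p..p + l} (fdiff s v f) * indicator {0..H} v
      \<le> sq_int J (sym_diff a b s v f) * indicator {0..H} v"
      by (auto simp: indicator_def)
  qed
  also have "\<dots> = (\<integral>\<^sup>+v. \<integral>\<^sup>+y. ennreal ((sym_diff a b s v f y)\<^sup>2) * indicator J y * indicator {0..H} v \<partial>lborel \<partial>lborel)"
    by (intro nn_integral_cong nn_integral_multc[symmetric]) auto
  also have "\<dots> = (\<integral>\<^sup>+y. \<integral>\<^sup>+v. ennreal ((sym_diff a b s v f y)\<^sup>2) * indicator J y * indicator {0..H} v \<partial>lborel \<partial>lborel)"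
    by (rule lborel_pair.Fubini') measurable
  also have "\<dots> \<le> (\<integral>\<^sup>+y. \<integral>\<^sup>+h. ennreal \<phi>2 * (ennreal ((sym_diff a b s (h * step_weight a b y) f y)\<^sup>2)
      * indicator J y * indicator {0..H / \<phi>1} h) \<partial>lborel \<partial>lborel)"
  proof (rule nn_integral_mono)
    fix y
    show "(\<integral>\<^sup>+v. ennreal ((sym_diff a b s v f y)\<^sup>2) * indicator J y * indicator {0..H} v \<partial>lborel)
      \<le> (\<integral>\<^sup>+h. ennreal \<phi>2 * (ennreal ((sym_diff a b s (h * step_weight a b y) f y)\<^sup>2)
      * indicator J y * indicator {0..H / \<phi>1} h) \<partial>lborel)"
    proof (cases "y \<in> J")
      case True
      define c where "c = step_weight a b y"
      have c: "\<phi>1 \<le> c" "c \<le> \<phi>2" "0 < c" using \<phi>(2)[of y] \<phi>(1) True by (auto simp: J_def c_def)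
      have "(\<integral>\<^sup>+v. ennreal ((sym_diff a b s v f y)\<^sup>2) * indicator J y * indicator {0..H} v \<partial>lborel)
        = ennreal \<bar>c\<bar> * (\<integral>\<^sup>+h. ennreal ((sym_diff a b s (0 + c * h) f y)\<^sup>2) * indicator J y * indicator {0..H} (0 + c * h) \<partial>lborel)"
        using c by (intro nn_integral_real_affine) auto
      also have "\<dots> \<le> ennreal \<phi>2 * (\<integral>\<^sup>+h. ennreal ((sym_diff a b s (h * c) f y)\<^sup>2) * indicator J y * indicator {0..H / \<phi>1} h \<partial>lborel)"
      proof (rule mult_mono, use c in simp, rule nn_integral_mono)
        fix h
        have "h \<in> {0..H / \<phi>1}" if "c * h \<in> {0..H}"
        proof -
          have "0 \<le> h" using that c by (auto simp: zero_le_mult_iff)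
          moreover have "\<phi>1 * h \<le> H" using that mult_right_mono[OF c(1) \<open>0 \<le> h\<close>] by auto
          ultimately show ?thesis using \<phi>(1) by (auto simp: field_simps)
        qed
        then show "ennreal ((sym_diff a b s (0 + c * h) f y)\<^sup>2) * indicator J y * indicator {0..H} (0 + c * h)
          \<le> ennreal ((sym_diff a b s (h * c) f y)\<^sup>2) * indicator J y * indicator {0..H / \<phi>1} h"
          by (auto simp: indicator_def mult.commute)
      qed (use c in auto)
      finally show ?thesis unfolding c_def by (subst nn_integral_cmult) auto
    qed simp
  qed
  also have "\<dots> = (\<integral>\<^sup>+h. \<integral>\<^sup>+y. ennreal \<phi>2 * (ennreal ((sym_diff a b s (h * step_weight a b y) f y)\<^sup>2)
      * indicator J y * indicator {0..H / \<phi>1} h) \<partial>lborel \<partial>lborel)"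
    by (rule lborel_pair.Fubini') measurable
  also have "\<dots> = ennreal \<phi>2 * (\<integral>\<^sup>+h\<in>{0..H / \<phi>1}. mean_square_diff a b s f J h \<partial>lborel)"
    unfolding mean_square_diff_def
    by (subst nn_integral_cmult[symmetric])
      (auto simp: nn_integral_cmult nn_integral_multc intro!: nn_integral_cong)
  also have "\<dots> \<le> ennreal \<phi>2 * ennreal \<tau>"
    using T unfolding H_def J_def by (intro mult_left_mono) auto
  also have "\<dots> = ennreal (\<phi>2 * \<tau>)" using \<phi>2 \<tau> by (simp add: ennreal_mult)
  finally have "(\<integral>\<^sup>+v\<in>{0..l / real s}. (sq_int {p..p + l} (fdiff s v f)) \<partial>lborel) \<le> ennreal (\<phi>2 * \<tau>)"
    by (simp only: H_def)
  from whitney[OF f s l \<phi>\<tau> this] show ?thesis .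
qed

section \<open>Jackson's inequality for the weighted modulus\<close>

definition sqn :: "real \<Rightarrow> real \<Rightarrow> (real \<Rightarrow> real) \<Rightarrow> ennreal" where
  "sqn p q u = sq_int {p..q} u"

lemma sqn_mono_interval: "p' \<le> p \<Longrightarrow> q \<le> q' \<Longrightarrow> sqn p q u \<le> sqn p' q' u"
  unfolding sqn_def by (intro nn_integral_mono) (auto simp: indicator_def)

lemma sqn_mono: "(\<And>x. x \<in> {p..q} \<Longrightarrow> \<bar>u x\<bar> \<le> \<bar>v x\<bar>) \<Longrightarrow> sqn p q u \<le> sqn p q v"
  unfolding sqn_def by (intro nn_integral_mono) (auto simp: indicator_def abs_le_square_iff intro!: ennreal_leI)

lemma sqn_cong: "(\<And>x. x \<in> {p..q} \<Longrightarrow> u x = v x) \<Longrightarrow> sqn p q u = sqn p q v"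
  unfolding sqn_def by (intro nn_integral_cong) (auto simp: indicator_def)

lemma square_add_le: "((x::real) + y)\<^sup>2 \<le> 2 * x\<^sup>2 + 2 * y\<^sup>2"
  using zero_le_power2[of "x - y"] by (simp add: power2_eq_square algebra_simps)

lemma sqn_add:
  assumes [measurable]: "u \<in> borel_measurable borel" "v \<in> borel_measurable borel"
  shows "sqn p q (\<lambda>x. u x + v x) \<le> 2 * sqn p q u + 2 * sqn p q v"
proof -
  have "sqn p q (\<lambda>x. u x + v x) \<le> (\<integral>\<^sup>+x. (2 * (ennreal ((u x)\<^sup>2) * indicator {p..q} x) + 2 * (ennreal ((v x)\<^sup>2) * indicator {p..q} x)) \<partial>lborel)"
    unfolding sqn_def
  proof (intro nn_integral_mono)
    fix x
    have "ennreal ((u x + v x)\<^sup>2) \<le> ennreal (2 * (u x)\<^sup>2 + 2 * (v x)\<^sup>2)"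
      by (intro ennreal_leI square_add_le)
    also have "\<dots> = 2 * ennreal ((u x)\<^sup>2) + 2 * ennreal ((v x)\<^sup>2)"
      by (simp add: ennreal_plus ennreal_mult)
    finally show "ennreal ((u x + v x)\<^sup>2) * indicator {p..q} x
      \<le> 2 * (ennreal ((u x)\<^sup>2) * indicator {p..q} x) + 2 * (ennreal ((v x)\<^sup>2) * indicator {p..q} x)"
      by (auto simp: indicator_def)
  qed
  also have "\<dots> = 2 * sqn p q u + 2 * sqn p q v"
    unfolding sqn_def by (subst nn_integral_add) (auto simp: nn_integral_cmult)
  finally show ?thesis .
qed

lemma measurable_poly [measurable]: "poly (r :: real poly) \<in> borel_measurable borel"
  by (intro borel_measurable_continuous_onI continuous_intros)

lemma sqn_diff_poly:
  assumes [measurable]: "f \<in> borel_measurable borel"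
  shows "sqn p q (poly (r - r')) \<le> 2 * sqn p q (\<lambda>x. f x - poly r x) + 2 * sqn p q (\<lambda>x. f x - poly r' x)"
proof -
  have "sqn p q (poly (r - r')) = sqn p q (\<lambda>x. (f x - poly r' x) + - (f x - poly r x))"
    by (intro sqn_cong) simp
  also have "\<dots> \<le> 2 * sqn p q (\<lambda>x. f x - poly r' x) + 2 * sqn p q (\<lambda>x. - (f x - poly r x))"
    by (rule sqn_add) auto
  also have "sqn p q (\<lambda>x. - (f x - poly r x)) = sqn p q (\<lambda>x. f x - poly r x)"
    unfolding sqn_def by (simp add: power2_commute)
  finally show ?thesis by (simp only: add.commute)
qed

lemma sqn_continuous:
  assumes "continuous_on {p..q} u"
  shows "sqn p q u = ennreal (integral {p..q} (\<lambda>x. (u x)\<^sup>2))"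
proof -
  have c: "continuous_on {p..q} (\<lambda>x. (u x)\<^sup>2)" using assms by (intro continuous_intros)
  have si: "set_integrable lborel {p..q} (\<lambda>x. (u x)\<^sup>2)"
    by (rule borel_integrable_atLeastAtMost') (rule c)
  have "sqn p q u = (\<integral>\<^sup>+x. ennreal (indicator {p..q} x *\<^sub>R (u x)\<^sup>2) \<partial>lborel)"
    unfolding sqn_def by (intro nn_integral_cong) (auto simp: indicator_def)
  also have "\<dots> = ennreal (LINT x:{p..q}|lborel. (u x)\<^sup>2)"
    using si unfolding set_integrable_def set_lebesgue_integral_def
    by (intro nn_integral_eq_integral) auto
  also have "(LINT x:{p..q}|lborel. (u x)\<^sup>2) = integral {p..q} (\<lambda>x. (u x)\<^sup>2)"
    using si by (rule set_borel_integral_eq_integral(2))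
  finally show ?thesis .
qed

lemma sqn_poly: "sqn p q (poly r) = ennreal (integral {p..q} (\<lambda>x. (poly r x)\<^sup>2))"
  by (intro sqn_continuous continuous_intros)

text \<open>The constant of \<open>coeff_norm_le_L2\<close> on the unit interval, where \<gamma> = 3
  and lam = 3 + sqrt 10.\<close>

definition poly_const :: "nat \<Rightarrow> real" where
  "poly_const d = 4 * (real d)\<^sup>2 * (3 + sqrt 10) ^ (2 * d)"

lemma poly_const_nonneg: "0 \<le> poly_const d"
  by (simp add: poly_const_def)

lemma coeff_pcompose_linear_eq_0:
  fixes r :: "real poly"
  assumes "\<And>i. i \<ge> d \<Longrightarrow> coeff r i = 0" "i \<ge> d"
  shows "coeff (pcompose r [:c, l:]) i = 0"
proof (cases "r = 0")
  case False
  then have "degree r < d" using assms(1) by (meson leading_coeff_0_iff not_less)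
  moreover have "degree (pcompose r [:c, l:]) \<le> degree r * 1"
    by (rule order_trans[OF degree_pcompose_le]) (intro mult_left_mono, auto)
  ultimately show ?thesis using assms(2) by (intro coeff_eq_0) simp
qed simp

lemma coeff_norm_rescaled:
  assumes r: "\<And>i. i \<ge> d \<Longrightarrow> coeff r i = 0" and l: "0 < l"
  shows "(coeff_norm (pcompose r [:p, l:]))\<^sup>2 \<le> poly_const d / l * integral {p..p + l} (\<lambda>x. (poly r x)\<^sup>2)"
proof -
  define q where "q = pcompose r [:p, l:]"
  have "(coeff_norm q)\<^sup>2 \<le> 4 / (1 - 0) * (real d)\<^sup>2 * (3 + sqrt 10) ^ (2 * d) * integral {0..1} (\<lambda>x. (poly q x)\<^sup>2)"
    by (rule coeff_norm_le_L2[where \<gamma> = 3])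
      (use coeff_pcompose_linear_eq_0[OF r] in \<open>auto simp: q_def\<close>)
  moreover have "integral {0..1} (\<lambda>x. (poly q x)\<^sup>2) = integral {p..p + l} (\<lambda>x. (poly r x)\<^sup>2) / l"
  proof -
    have "((\<lambda>u. (poly r (p + l * u))\<^sup>2) has_integral integral {p + l * 0..p + l * 1} (\<lambda>x. (poly r x)\<^sup>2) / l) {0..1}"
      using l by (intro affine_has_integral integrable_continuous_interval continuous_intros)
    then show ?thesis by (simp add: q_def poly_pcompose has_integral_iff mult.commute)
  qed
  ultimately show ?thesis by (simp add: q_def poly_const_def)
qed

lemma abs_poly_le_coeff_norm:
  assumes r: "\<And>i. i \<ge> d \<Longrightarrow> coeff r i = 0" and y: "\<bar>y\<bar> \<le> M" "1 \<le> M"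
  shows "\<bar>poly r y\<bar> \<le> M ^ d * coeff_norm r"
proof -
  have "poly r y = (\<Sum>i<d. coeff r i * y ^ i)"
  proof (cases "r = 0")
    case False
    then have "degree r < d" using r by (meson leading_coeff_0_iff not_less)
    then show ?thesis unfolding poly_altdef
      by (intro sum.mono_neutral_left) (auto simp: coeff_eq_0)
  qed simp
  also have "\<bar>\<dots>\<bar> \<le> (\<Sum>i<d. \<bar>coeff r i * y ^ i\<bar>)" by (rule sum_abs)
  also have "\<dots> \<le> (\<Sum>i<d. \<bar>coeff r i\<bar> * M ^ d)"
  proof (intro sum_mono)
    fix i assume i: "i \<in> {..<d}"
    have "\<bar>y\<bar> ^ i \<le> M ^ i" using y by (intro power_mono) auto
    also have "\<dots> \<le> M ^ d" using i y by (intro power_increasing) auto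
    finally show "\<bar>coeff r i * y ^ i\<bar> \<le> \<bar>coeff r i\<bar> * M ^ d"
      by (auto simp: abs_mult power_abs intro: mult_left_mono)
  qed
  also have "\<dots> = M ^ d * coeff_norm r"
    using coeff_norm_eq[OF r] by (simp add: sum_distrib_left mult.commute)
  finally show ?thesis .
qed

text \<open>After rescaling to the unit interval the point has modulus at most 4, and 16 ^ d is the
  square of 4 ^ d. The range is wide enough to carry a bound from one dyadic interval down to the
  end point.\<close>

lemma poly_extend:
  assumes r: "\<And>i. i \<ge> d \<Longrightarrow> coeff r i = 0" and l: "0 < l" and x: "\<bar>x - p\<bar> \<le> 4 * l"
  shows "(poly r x)\<^sup>2 \<le> 16 ^ d * poly_const d / l * integral {p..p + l} (\<lambda>x. (poly r x)\<^sup>2)"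
proof -
  define q where "q = pcompose r [:p, l:]"
  have "poly r x = poly q ((x - p) / l)" using l by (simp add: q_def poly_pcompose)
  moreover have "\<bar>poly q ((x - p) / l)\<bar> \<le> 4 ^ d * coeff_norm q"
    using x l coeff_pcompose_linear_eq_0[OF r]
    by (intro abs_poly_le_coeff_norm) (auto simp: q_def abs_divide field_simps)
  ultimately have "\<bar>poly r x\<bar>\<^sup>2 \<le> (4 ^ d * coeff_norm q)\<^sup>2" by (intro power_mono) auto
  also have "\<dots> = 16 ^ d * (coeff_norm q)\<^sup>2"
  proof -
    have "((4::real) ^ d)\<^sup>2 = (4 * 4) ^ d" unfolding power2_eq_square power_mult_distrib ..
    then show ?thesis by (simp add: power_mult_distrib)
  qed
  also have "\<dots> \<le> 16 ^ d * (poly_const d / l * integral {p..p + l} (\<lambda>x. (poly r x)\<^sup>2))"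
    unfolding q_def by (intro mult_left_mono coeff_norm_rescaled r l) auto
  finally show ?thesis by simp
qed

lemma coeff_norm_pderiv:
  assumes "\<And>i. i \<ge> d \<Longrightarrow> coeff r i = 0"
  shows "coeff_norm (pderiv r) \<le> real d * coeff_norm r"
proof -
  have "coeff_norm (pderiv r) = (\<Sum>i<d. real (Suc i) * \<bar>coeff r (Suc i)\<bar>)"
    using assms by (subst coeff_norm_eq[of d]) (auto simp: coeff_pderiv abs_mult)
  also have "\<dots> \<le> (\<Sum>i<d. real d * \<bar>coeff r (Suc i)\<bar>)"
  proof (intro sum_mono)
    fix i assume "i \<in> {..<d}"
    then show "real (Suc i) * \<bar>coeff r (Suc i)\<bar> \<le> real d * \<bar>coeff r (Suc i)\<bar>"
      by (intro mult_right_mono) auto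
  qed
  also have "\<dots> = real d * (\<Sum>i<d. \<bar>coeff r (Suc i)\<bar>)" by (simp add: sum_distrib_left)
  also have "(\<Sum>i<d. \<bar>coeff r (Suc i)\<bar>) \<le> (\<Sum>i<Suc d. \<bar>coeff r i\<bar>)"
    by (subst sum.lessThan_Suc_shift) simp
  also have "\<dots> = coeff_norm r" using assms by (intro coeff_norm_eq[symmetric]) auto
  finally show ?thesis by (simp add: mult_left_mono)
qed

lemma coeff_norm_higher_pderiv:
  assumes "\<And>i. i \<ge> d \<Longrightarrow> coeff r i = 0"
  shows "coeff_norm ((pderiv ^^ s) r) \<le> real d ^ s * coeff_norm r"
proof (induction s)
  case (Suc s)
  have "coeff_norm ((pderiv ^^ Suc s) r) \<le> real d * coeff_norm ((pderiv ^^ s) r)"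
    using assms by (simp, intro coeff_norm_pderiv) (simp add: coeff_higher_pderiv)
  also have "\<dots> \<le> real d * (real d ^ s * coeff_norm r)" using Suc by (intro mult_left_mono) auto
  finally show ?case by simp
qed simp

lemma higher_pderiv_pcompose_linear:
  "(pderiv ^^ i) (pcompose r [:c, l:]) = smult (l ^ i) (pcompose ((pderiv ^^ i) r) [:c, l::real:])"
proof (induction i)
  case (Suc i)
  then show ?case by (simp add: pderiv_smult pderiv_pcompose pderiv_pCons mult.commute)
qed simp

text \<open>A crude Markov inequality: after rescaling to the unit interval, every derivative
  multiplies the coefficient norm by at most d.\<close>

lemma poly_higher_pderiv_bound:
  assumes r: "\<And>i. i \<ge> d \<Longrightarrow> coeff r i = 0" and l: "0 < l" and x: "x \<in> {p..p + l}"
  shows "(poly ((pderiv ^^ s) r) x)\<^sup>2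
    \<le> real d ^ (2 * s) * poly_const d / l ^ (2 * s + 1) * integral {p..p + l} (\<lambda>x. (poly r x)\<^sup>2)"
proof -
  define q where "q = pcompose r [:p, l:]"
  have q0: "\<And>i. i \<ge> d \<Longrightarrow> coeff q i = 0"
    using coeff_pcompose_linear_eq_0[OF r] by (simp add: q_def)
  have "poly ((pderiv ^^ s) q) ((x - p) / l) = l ^ s * poly ((pderiv ^^ s) r) x"
    using l by (simp add: q_def higher_pderiv_pcompose_linear poly_pcompose)
  moreover have "\<bar>poly ((pderiv ^^ s) q) ((x - p) / l)\<bar> \<le> 1 ^ d * coeff_norm ((pderiv ^^ s) q)"
    using x l q0 by (intro abs_poly_le_coeff_norm) (auto simp: coeff_higher_pderiv abs_divide field_simps)
  ultimately have "\<bar>l ^ s * poly ((pderiv ^^ s) r) x\<bar> \<le> real d ^ s * coeff_norm q"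
    using coeff_norm_higher_pderiv[of d q s] q0 by simp
  then have "\<bar>l ^ s * poly ((pderiv ^^ s) r) x\<bar>\<^sup>2 \<le> (real d ^ s * coeff_norm q)\<^sup>2"
    by (intro power_mono) auto
  then have "l ^ (2 * s) * (poly ((pderiv ^^ s) r) x)\<^sup>2 \<le> real d ^ (2 * s) * (coeff_norm q)\<^sup>2"
    by (simp add: power_mult_distrib power_mult[symmetric] mult.commute)
  also have "\<dots> \<le> real d ^ (2 * s) * (poly_const d / l * integral {p..p + l} (\<lambda>x. (poly r x)\<^sup>2))"
    unfolding q_def by (intro mult_left_mono coeff_norm_rescaled r l) auto
  finally show ?thesis using l by (simp add: field_simps)
qed

text \<open>The modulus enters through its integral over the step: this is all that Whitney's
  inequality uses, and in this form it survives a change of f on a null set. Integrating a bound C h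
  powr (2 \<alpha>) on the squared modulus gives the exponent 2 \<alpha> + 1, so C is the square of
  the constant of the class. The function lives on the whole line to free shifts from domain
  conditions.\<close>

locale smooth_function =
  fixes a b :: real and s :: nat and f :: "real \<Rightarrow> real" and \<alpha> C :: real
  assumes ab: "a < b" and f: "integrable lborel f" and s: "0 < s" and \<alpha>: "1 \<le> \<alpha>" and C: "0 < C"
    and modulus: "\<And>t. 0 < t \<Longrightarrow>
      (\<integral>\<^sup>+h\<in>{0..t}. mean_square_diff a b s f {a..b} h \<partial>lborel) \<le> ennreal (C * t powr (2 * \<alpha> + 1))"
begin

lemma f_measurable [measurable]: "f \<in> borel_measurable borel"
  using borel_measurable_integrable[OF f] by simp

lemma mean_square_diff_mono:
  "J \<subseteq> J' \<Longrightarrow> mean_square_diff a b s f J h \<le> mean_square_diff a b s f J' h"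
  unfolding mean_square_diff_def by (intro nn_integral_mono) (auto simp: indicator_def)

definition edge_const :: real where
  "edge_const = whitney_const s * C * sqrt (7 * (b - a)) * (3 * sqrt (2 / (b - a))) powr (2 * \<alpha> + 1)"

lemma edge_const_nonneg: "0 \<le> edge_const"
  using C ab by (simp add: edge_const_def whitney_const_def)

text \<open>Whitney's inequality at distance t from the end, on a patch whose double is
  [a + t, a + 7 t]. There the weight is of order sqrt t, so the relevant steps are of order sqrt t
  and the error \<phi>2 \<tau> / t is of order t powr \<alpha>. The condition 14 t \<le> b - a keeps
  the double in the left half.\<close>

lemma edge_local:
  assumes t: "0 < t" "14 * t \<le> b - a"
  shows "\<exists>r. (\<forall>i\<ge>s. coeff r i = 0) \<and>
    sqn (a + t) (a + 4 * t) (\<lambda>x. f x - poly r x) \<le> ennreal (edge_const * t powr \<alpha>)"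
proof -
  define L where "L = b - a"
  have L: "0 < L" using ab by (simp add: L_def)
  define \<phi>1 where "\<phi>1 = sqrt (t * (L / 2))"
  define \<phi>2 where "\<phi>2 = sqrt (7 * t * L)"
  have \<phi>1: "0 < \<phi>1" using t L by (simp add: \<phi>1_def)
  define T where "T = 3 * t / (real s * \<phi>1)"
  have T: "0 < T" using t s \<phi>1 by (simp add: T_def)
  define \<tau> where "\<tau> = C * T powr (2 * \<alpha> + 1)"
  have \<tau>: "0 < \<tau>" using C T by (simp add: \<tau>_def)
  have wt: "\<phi>1 \<le> step_weight a b x \<and> step_weight a b x \<le> \<phi>2" if "x \<in> {a + t..a + t + 2 * (3 * t)}" for x
  proof -
    have "t * (L / 2) \<le> (x - a) * (b - x)"
      using that t L by (intro mult_mono) (auto simp: L_def)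
    moreover have "(x - a) * (b - x) \<le> (7 * t) * L"
      using that t L by (intro mult_mono) (auto simp: L_def)
    ultimately show ?thesis by (simp add: \<phi>1_def \<phi>2_def step_weight_def real_sqrt_le_iff)
  qed
  have "(\<integral>\<^sup>+h\<in>{0..T}. mean_square_diff a b s f {a + t..a + t + 2 * (3 * t)} h \<partial>lborel)
    \<le> (\<integral>\<^sup>+h\<in>{0..T}. mean_square_diff a b s f {a..b} h \<partial>lborel)"
    using t by (intro nn_integral_mono mult_right_mono mean_square_diff_mono) auto
  also have "\<dots> \<le> ennreal \<tau>" unfolding \<tau>_def by (rule modulus[OF T])
  finally have "(\<integral>\<^sup>+h\<in>{0..3 * t / (real s * \<phi>1)}. mean_square_diff a b s f {a + t..a + t + 2 * (3 * t)} h \<partial>lborel) \<le> ennreal \<tau>"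
    by (simp only: T_def)
  from weighted_whitney[OF f s _ \<tau> _ _ \<phi>1 wt this]
  obtain r where r: "\<forall>i\<ge>s. coeff r i = 0"
    "sq_int {a + t..a + t + 3 * t} (\<lambda>x. f x - poly r x) \<le> ennreal (whitney_const s * (\<phi>2 * \<tau>) / (3 * t))"
    using t by auto
  have "T \<le> 3 * sqrt (2 / L) * sqrt t"
  proof -
    have "T \<le> 3 * t / \<phi>1" using s t \<phi>1 unfolding T_def by (intro divide_left_mono) auto
    also have "\<dots> = 3 * sqrt (2 / L) * sqrt t"
    proof -
      have "\<phi>1 = sqrt t * sqrt (L / 2)" unfolding \<phi>1_def by (rule real_sqrt_mult)
      moreover have "sqrt (2 / L) * sqrt (L / 2) = 1" using L by (simp flip: real_sqrt_mult)
      moreover have "sqrt t * sqrt t = t" using t by simp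
      ultimately have "3 * sqrt (2 / L) * sqrt t * \<phi>1 = 3 * t"
        by (metis (no_types, opaque_lifting) mult.assoc mult.commute mult.right_neutral)
      then show ?thesis using \<phi>1 by (metis less_irrefl nonzero_mult_div_cancel_right)
    qed
    finally show ?thesis .
  qed
  then have "T powr (2 * \<alpha> + 1) \<le> (3 * sqrt (2 / L) * sqrt t) powr (2 * \<alpha> + 1)"
    using T \<alpha> by (intro powr_mono2) auto
  also have "\<dots> = (3 * sqrt (2 / L)) powr (2 * \<alpha> + 1) * (t powr \<alpha> * sqrt t)"
  proof -
    have "sqrt t powr (2 * \<alpha> + 1) = t powr ((1 / 2) * (2 * \<alpha> + 1))"
      using t by (simp add: powr_half_sqrt[symmetric] powr_powr)
    also have "(1 / 2) * (2 * \<alpha> + 1) = \<alpha> + 1 / 2" by (simp add: field_simps)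
    also have "t powr (\<alpha> + 1 / 2) = t powr \<alpha> * sqrt t" using t by (simp add: powr_add powr_half_sqrt)
    finally show ?thesis using L t by (simp add: powr_mult)
  qed
  finally have Tp: "T powr (2 * \<alpha> + 1) \<le> (3 * sqrt (2 / L)) powr (2 * \<alpha> + 1) * (t powr \<alpha> * sqrt t)" .
  have W: "0 \<le> whitney_const s" by (simp add: whitney_const_def)
  have \<phi>2_eq: "\<phi>2 = sqrt (7 * L) * sqrt t" by (simp add: \<phi>2_def real_sqrt_mult)
  have "whitney_const s * (\<phi>2 * \<tau>) / (3 * t)
    \<le> whitney_const s * (\<phi>2 * (C * ((3 * sqrt (2 / L)) powr (2 * \<alpha> + 1) * (t powr \<alpha> * sqrt t)))) / (3 * t)"
    unfolding \<tau>_def using W C t Tp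
    by (intro divide_right_mono mult_left_mono) (auto simp: \<phi>2_def L less_imp_le)
  also note \<phi>2_eq
  also have "whitney_const s * (sqrt (7 * L) * sqrt t * (C * ((3 * sqrt (2 / L)) powr (2 * \<alpha> + 1) * (t powr \<alpha> * sqrt t)))) / (3 * t)
    = edge_const * t powr \<alpha> * ((sqrt t * sqrt t) / (3 * t))"
    by (simp add: edge_const_def L_def)
  also have "(sqrt t * sqrt t) / (3 * t) = 1 / 3" using t by simp
  also have "edge_const * t powr \<alpha> * (1 / 3) \<le> edge_const * t powr \<alpha>" 
    using edge_const_nonneg by simp
  finally have "whitney_const s * (\<phi>2 * \<tau>) / (3 * t) \<le> edge_const * t powr \<alpha>"
    unfolding \<phi>2_eq .
  then have "ennreal (whitney_const s * (\<phi>2 * \<tau>) / (3 * t)) \<le> ennreal (edge_const * t powr \<alpha>)"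
    by (rule ennreal_leI)
  then show ?thesis using r by (intro exI[of _ r]) (auto simp: sqn_def add.assoc intro: order_trans)
qed

text \<open>Makes (1 + k^2) / 2^k at most 4 (3/4)^k, so that the squared drift after k dyadic steps
  is summable against the lengths.\<close>

lemma square_le_geometric: "1 + (real k)\<^sup>2 \<le> 4 * (3 / 2) ^ k"
proof (induction k)
  case (Suc k)
  show ?case
  proof (cases "k \<le> 4")
    case True
    then have "k = 0 \<or> k = 1 \<or> k = 2 \<or> k = 3 \<or> k = 4" by auto
    then show ?thesis by (auto simp: power2_eq_square numeral_eq_Suc)
  next
    case False
    then have k: "5 \<le> real k" by simp
    then have "5 * real k \<le> real k * real k" by (intro mult_right_mono) auto
    moreover have "(real (Suc k))\<^sup>2 = real k * real k + 2 * real k + 1"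
      by (simp add: power2_eq_square algebra_simps)
    moreover have "(real k)\<^sup>2 = real k * real k" by (rule power2_eq_square)
    ultimately have "1 + (real (Suc k))\<^sup>2 \<le> 3 / 2 * (1 + (real k)\<^sup>2)"
      using k unfolding distrib_left by linarith
    also have "\<dots> \<le> 3 / 2 * (4 * (3 / 2) ^ k)" using Suc by (intro mult_left_mono) auto
    finally show ?thesis by simp
  qed
qed simp

text \<open>The factor 16 is 4 times the sum of the geometric series with ratio 3/4.\<close>

definition edge_const' :: real where
  "edge_const' = 16 * (edge_const * (2 + 24 * (16 ^ s * poly_const s)))"

lemma edge_const'_nonneg: "0 \<le> edge_const'"
  using edge_const_nonneg poly_const_nonneg[of s] by (simp add: edge_const'_def)

text \<open>Chaining along the dyadic intervals \<open>[a + t/2^k, a + 4t/2^k]\<close>; the local polynomials drift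
  from one another by at most a constant per step, which the shrinking lengths absorb.\<close>

lemma edge_global:
  assumes t: "0 < t" "14 * t \<le> b - a"
  shows "\<exists>r. (\<forall>i\<ge>s. coeff r i = 0) \<and>
    sqn a (a + 4 * t) (\<lambda>x. f x - poly r x) \<le> ennreal (edge_const' * t powr \<alpha>)"
proof -
  define A where "A = edge_const"
  have A: "0 \<le> A" using edge_const_nonneg by (simp add: A_def)
  define K where "K = 16 ^ s * poly_const s"
  have K: "0 \<le> K" using poly_const_nonneg by (simp add: K_def)
  define t' where "t' k = t / 2 ^ k" for k :: nat
  have t': "0 < t' k" "t' k \<le> t" "14 * t' k \<le> b - a" "t' (Suc k) = t' k / 2" "t' k \<le> t / 1" for k
  proof -
    show "0 < t' k" using t by (simp add: t'_def)
    show le: "t' k \<le> t" using t by (simp add: t'_def divide_le_eq mult_le_cancel_left1)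
    then show "t' k \<le> t / 1" by simp
    show "14 * t' k \<le> b - a" using le t by simp
    show "t' (Suc k) = t' k / 2" by (simp add: t'_def)
  qed
  have "\<forall>k. \<exists>r. (\<forall>i\<ge>s. coeff r i = 0) \<and>
    sqn (a + t' k) (a + 4 * t' k) (\<lambda>x. f x - poly r x) \<le> ennreal (A * t' k powr \<alpha>)"
    unfolding A_def using edge_local t' by blast
  then obtain q where q: "\<And>k i. i \<ge> s \<Longrightarrow> coeff (q k) i = 0"
    "\<And>k. sqn (a + t' k) (a + 4 * t' k) (\<lambda>x. f x - poly (q k) x) \<le> ennreal (A * t' k powr \<alpha>)"
    by metis
  \<comment> \<open>Bounds the squared difference of consecutive polynomials. They are compared on
    the part [a + t' k, a + 2 t' k] common to their intervals, and the comparison is extended to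
    [a, a + 4 t' k]; since \<alpha> \<ge> 1, the bound does not grow with k.\<close>
  define M where "M = 4 * A * K * t powr (\<alpha> - 1)"
  have M: "0 \<le> M" using A K by (simp add: M_def)
  have step: "(poly (q (Suc k) - q k) x)\<^sup>2 \<le> M" if x: "x \<in> {a..a + 4 * t' k}" for k x
  proof -
    have "ennreal (integral {a + t' k..a + t' k + t' k} (\<lambda>x. (poly (q (Suc k) - q k) x)\<^sup>2))
      = sqn (a + t' k) (a + t' k + t' k) (poly (q (Suc k) - q k))" by (simp add: sqn_poly)
    also have "\<dots> \<le> 2 * sqn (a + t' k) (a + t' k + t' k) (\<lambda>x. f x - poly (q (Suc k)) x)
      + 2 * sqn (a + t' k) (a + t' k + t' k) (\<lambda>x. f x - poly (q k) x)"
      by (rule sqn_diff_poly) simp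
    also have "\<dots> \<le> 2 * sqn (a + t' (Suc k)) (a + 4 * t' (Suc k)) (\<lambda>x. f x - poly (q (Suc k)) x)
      + 2 * sqn (a + t' k) (a + 4 * t' k) (\<lambda>x. f x - poly (q k) x)"
      using t'(1)[of k]
      by (intro add_mono[OF mult_left_mono[OF sqn_mono_interval] mult_left_mono[OF sqn_mono_interval]])
        (auto simp: t'(4))
    also have "\<dots> \<le> 2 * ennreal (A * t' k powr \<alpha>) + 2 * ennreal (A * t' k powr \<alpha>)"
    proof (intro add_mono mult_left_mono q order_trans[OF q(2)] ennreal_leI)
      show "t' (Suc k) powr \<alpha> \<le> t' k powr \<alpha>"
        using t'(1)[of k] \<alpha> by (intro powr_mono2) (auto simp: t'(4))
    qed (use A in auto)
    also have "\<dots> = ennreal (4 * (A * t' k powr \<alpha>))"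
      using A by (simp add: ennreal_mult[symmetric] ennreal_plus[symmetric] flip: ennreal_numeral del: ennreal_plus)
    finally have I: "integral {a + t' k..a + t' k + t' k} (\<lambda>x. (poly (q (Suc k) - q k) x)\<^sup>2) \<le> 4 * (A * t' k powr \<alpha>)"
      using A by (subst (asm) ennreal_le_iff) auto
    have "(poly (q (Suc k) - q k) x)\<^sup>2 \<le> K / t' k * integral {a + t' k..a + t' k + t' k} (\<lambda>x. (poly (q (Suc k) - q k) x)\<^sup>2)"
      unfolding K_def using q(1) t'(1)[of k] x by (intro poly_extend) (auto simp: abs_le_iff)
    also have "\<dots> \<le> K / t' k * (4 * (A * t' k powr \<alpha>))"
      using I K t'(1)[of k] by (intro mult_left_mono) auto
    also have "\<dots> = 4 * A * K * t' k powr (\<alpha> - 1)"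
      using t'(1)[of k] by (simp add: powr_diff)
    also have "\<dots> \<le> M" unfolding M_def
      using t' A K \<alpha> by (intro mult_left_mono powr_mono2) (auto simp: less_imp_le)
    finally show ?thesis .
  qed
  have drift: "\<bar>poly (q k - q 0) x\<bar> \<le> real k * sqrt M" if "x \<in> {a..a + 4 * t' k}" for k x
    using that
  proof (induction k)
    case (Suc k)
    then have x: "x \<in> {a..a + 4 * t' k}" using t'(1)[of k] by (auto simp: t'(4))
    have "\<bar>poly (q (Suc k) - q k) x\<bar> \<le> sqrt M" using step[OF x] by (simp add: real_le_rsqrt)
    moreover have "\<bar>poly (q k - q 0) x\<bar> \<le> real k * sqrt M" using Suc.IH x by simp
    ultimately show ?case by (simp add: algebra_simps)
  qed simp
  define B where "B = A * (2 + 24 * K) * t powr \<alpha>"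
  have B: "0 \<le> B" using A K by (simp add: B_def)
  have piece: "sqn (a + t' k) (a + 4 * t' k) (\<lambda>x. f x - poly (q 0) x) \<le> ennreal (4 * B * (3 / 4) ^ k)" for k
  proof -
    have "sqn (a + t' k) (a + 4 * t' k) (\<lambda>x. f x - poly (q 0) x)
      = sqn (a + t' k) (a + 4 * t' k) (\<lambda>x. (f x - poly (q k) x) + poly (q k - q 0) x)"
      by (intro sqn_cong) simp
    also have "\<dots> \<le> 2 * sqn (a + t' k) (a + 4 * t' k) (\<lambda>x. f x - poly (q k) x)
        + 2 * sqn (a + t' k) (a + 4 * t' k) (poly (q k - q 0))"
      by (rule sqn_add) auto
    also have "sqn (a + t' k) (a + 4 * t' k) (poly (q k - q 0)) \<le> sqn (a + t' k) (a + 4 * t' k) (\<lambda>_. real k * sqrt M)"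
      using drift t'(1)[of k] M by (intro sqn_mono) auto
    also have "sqn (a + t' k) (a + 4 * t' k) (\<lambda>_. real k * sqrt M) = ennreal ((real k)\<^sup>2 * M * (3 * t' k))"
      using t'(1)[of k] M unfolding sqn_def
      by (simp add: nn_integral_cmult_indicator power_mult_distrib ennreal_mult)
    also have "2 * sqn (a + t' k) (a + 4 * t' k) (\<lambda>x. f x - poly (q k) x) + 2 * ennreal ((real k)\<^sup>2 * M * (3 * t' k))
      \<le> 2 * ennreal (A * t' k powr \<alpha>) + 2 * ennreal ((real k)\<^sup>2 * M * (3 * t' k))"
      by (intro add_mono mult_left_mono q) auto
    also have "\<dots> = ennreal (2 * (A * t' k powr \<alpha>) + 2 * ((real k)\<^sup>2 * M * (3 * t' k)))"
      using A M t'(1)[of k] by (simp add: ennreal_mult[symmetric] ennreal_plus[symmetric] flip: ennreal_numeral del: ennreal_plus)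
    also have "\<dots> \<le> ennreal (4 * B * (3 / 4) ^ k)"
    proof (rule ennreal_leI)
      have tk: "t' k powr \<alpha> \<le> t powr \<alpha> / 2 ^ k"
      proof -
        have "t' k powr \<alpha> = t' k * t' k powr (\<alpha> - 1)" using t'(1)[of k] by (simp add: powr_diff)
        also have "\<dots> \<le> t' k * t powr (\<alpha> - 1)"
          using t'(1)[of k] t'(2)[of k] \<alpha> by (intro mult_left_mono powr_mono2) auto
        also have "\<dots> = t powr \<alpha> / 2 ^ k" using t by (simp add: t'_def powr_diff)
        finally show ?thesis .
      qed
      have "M * t' k = 4 * A * K * t powr \<alpha> / 2 ^ k" using t by (simp add: M_def t'_def powr_diff)
      note Mt = this have "2 * (A * t' k powr \<alpha>) + 2 * ((real k)\<^sup>2 * M * (3 * t' k))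
         = 2 * (A * t' k powr \<alpha>) + 24 * (real k)\<^sup>2 * (A * K * t powr \<alpha> / 2 ^ k)"
      proof -

        have "2 * ((real k)\<^sup>2 * M * (3 * t' k)) = 6 * (real k)\<^sup>2 * (M * t' k)" by simp
        then show ?thesis unfolding Mt by simp
      qed
      also have "\<dots> \<le> 2 * (A * (t powr \<alpha> / 2 ^ k)) + 24 * (real k)\<^sup>2 * (A * K * t powr \<alpha> / 2 ^ k)"
        using tk A by (intro add_mono mult_left_mono) auto
      also have "\<dots> \<le> 2 * (1 + (real k)\<^sup>2) * (A * (t powr \<alpha> / 2 ^ k)) + 24 * (1 + (real k)\<^sup>2) * (A * K * t powr \<alpha> / 2 ^ k)"
      proof -
        have "2 * (A * (t powr \<alpha> / 2 ^ k)) \<le> 2 * (1 + (real k)\<^sup>2) * (A * (t powr \<alpha> / 2 ^ k))"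
          using A by (simp add: mult_right_mono algebra_simps)
        moreover have "24 * (real k)\<^sup>2 * (A * K * t powr \<alpha> / 2 ^ k) \<le> 24 * (1 + (real k)\<^sup>2) * (A * K * t powr \<alpha> / 2 ^ k)"
          using A K by (intro mult_right_mono) auto
        ultimately show ?thesis by simp
      qed
      also have "\<dots> = B * ((1 + (real k)\<^sup>2) / 2 ^ k)" by (simp add: B_def algebra_simps add_divide_distrib)
      also have "\<dots> \<le> B * ((4 * (3 / 2) ^ k) / 2 ^ k)"
        using B square_le_geometric[of k] by (intro mult_left_mono divide_right_mono) auto
      also have "\<dots> = 4 * B * (3 / 4) ^ k" by (simp add: power_divide power_mult_distrib[symmetric] mult_ac)
      finally show "2 * (A * t' k powr \<alpha>) + 2 * ((real k)\<^sup>2 * M * (3 * t' k)) \<le> 4 * B * (3 / 4) ^ k" .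
    qed
    finally show ?thesis by (simp add: mult_left_mono)
  qed
  have cover: "\<exists>k. x \<in> {a + t' k..a + 4 * t' k}" if x: "a < x" "x \<le> a + 4 * t" for x
  proof -
    have "\<exists>k. t' k \<le> x - a"
    proof -
      obtain k where "(1 / 2) ^ k < (x - a) / t" using real_arch_pow_inv[of "(x - a) / t" "1 / 2"] x t by auto
      then show ?thesis using t by (intro exI[of _ k]) (simp add: t'_def field_simps power_divide less_imp_le)
    qed
    define k where "k = (LEAST k. t' k \<le> x - a)"
    have k: "t' k \<le> x - a" unfolding k_def by (rule LeastI_ex) fact
    show ?thesis
    proof (cases k)
      case 0
      then show ?thesis using k x by (intro exI[of _ 0]) (auto simp: t'_def)
    next
      case (Suc j)
      have "\<not> t' j \<le> x - a" using not_less_Least[of j "\<lambda>k. t' k \<le> x - a"] Suc by (simp add: k_def)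
      then show ?thesis using k Suc t'(4)[of j] t'(1)[of j] by (intro exI[of _ k]) auto
    qed
  qed
  have "sqn a (a + 4 * t) (\<lambda>x. f x - poly (q 0) x)
    \<le> (\<integral>\<^sup>+x. (\<Sum>k. ennreal ((f x - poly (q 0) x)\<^sup>2) * indicator {a + t' k..a + 4 * t' k} x) \<partial>lborel)"
    unfolding sqn_def
  \<comment> \<open>The dyadic intervals miss only the point a.\<close>
  proof (rule nn_integral_mono_AE, rule AE_mp[OF AE_lborel_singleton[of a]], rule AE_I2, rule impI)
    fix x assume "x \<noteq> a"
    show "ennreal ((f x - poly (q 0) x)\<^sup>2) * indicator {a..a + 4 * t} x
      \<le> (\<Sum>k. ennreal ((f x - poly (q 0) x)\<^sup>2) * indicator {a + t' k..a + 4 * t' k} x)"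
    proof (cases "x \<in> {a..a + 4 * t}")
      case True
      then obtain k where k: "x \<in> {a + t' k..a + 4 * t' k}" using cover[of x] \<open>x \<noteq> a\<close> by auto
      have "ennreal ((f x - poly (q 0) x)\<^sup>2) = (\<Sum>j\<in>{k}. ennreal ((f x - poly (q 0) x)\<^sup>2) * indicator {a + t' j..a + 4 * t' j} x)"
        using k by simp
      also have "\<dots> \<le> (\<Sum>k. ennreal ((f x - poly (q 0) x)\<^sup>2) * indicator {a + t' k..a + 4 * t' k} x)"
        by (intro sum_le_suminf) auto
      finally show ?thesis using True by simp
    qed simp
  qed
  also have "\<dots> = (\<Sum>k. sqn (a + t' k) (a + 4 * t' k) (\<lambda>x. f x - poly (q 0) x))"
    unfolding sqn_def by (rule nn_integral_suminf) measurable
  also have "\<dots> \<le> (\<Sum>k. ennreal (4 * B * (3 / 4) ^ k))"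
    by (intro suminf_le piece) auto
  also have "\<dots> = ennreal (\<Sum>k. 4 * B * (3 / 4) ^ k)"
    using B by (intro suminf_ennreal2 summable_mult summable_geometric) auto
  also have "(\<Sum>k. 4 * B * (3 / 4) ^ k) = edge_const' * t powr \<alpha>"
    using suminf_geometric[of "3 / 4 :: real"]
    by (subst suminf_mult) (auto simp: B_def edge_const'_def A_def K_def summable_geometric)
  finally show ?thesis using q(1) by blast
qed

end

section \<open>A grid crowding quadratically at both end points\<close>

definition cubic :: "real \<Rightarrow> real" where "cubic u = 3 * u\<^sup>2 - 2 * u ^ 3"

lemma cubic_diff: "cubic v - cubic u = (v - u) * (u * (3 - 2 * u) + v * (3 - 2 * v) - 2 * u * v)"
  by (simp add: cubic_def power2_eq_square power3_eq_cube algebra_simps)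

lemma cubic_reflect: "cubic (1 - u) = 1 - cubic u"
  by (simp add: cubic_def power2_eq_square power3_eq_cube algebra_simps)

lemma cubic_less:
  assumes "0 \<le> u" "u < v" "v \<le> 1" shows "cubic u < cubic v"
proof -
  have "u * 1 \<le> u * (3 - 2 * u)" "v * 1 \<le> v * (3 - 2 * v)" using assms by (intro mult_left_mono; simp)+
  moreover have "0 \<le> u * (1 - v)" "0 < v * (1 - u)" using assms by auto
  ultimately have "0 < u * (3 - 2 * u) + v * (3 - 2 * v) - 2 * u * v" by (simp add: algebra_simps)
  then have "0 < cubic v - cubic u" unfolding cubic_diff using assms by (intro mult_pos_pos) auto
  then show ?thesis by simp
qed

lemma cubic_bounds:
  assumes "0 \<le> u" "u \<le> 1"
  shows "u\<^sup>2 \<le> cubic u" "cubic u \<le> 3 * u\<^sup>2" "1 - cubic u \<le> 3 * (1 - u)\<^sup>2"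
proof -
  have c: "cubic u = u\<^sup>2 * (3 - 2 * u)" for u
    by (simp add: cubic_def power2_eq_square power3_eq_cube algebra_simps)
  have "u\<^sup>2 * 1 \<le> u\<^sup>2 * (3 - 2 * u)" using assms by (intro mult_left_mono) auto
  then show "u\<^sup>2 \<le> cubic u" by (simp add: c)
  have *: "cubic u \<le> 3 * u\<^sup>2" if "0 \<le> u" for u
    using mult_left_mono[of "3 - 2 * u" 3 "u\<^sup>2"] that by (simp add: c mult.commute)
  show "cubic u \<le> 3 * u\<^sup>2" by (rule *) fact
  show "1 - cubic u \<le> 3 * (1 - u)\<^sup>2" unfolding cubic_reflect[symmetric] by (rule *) (use assms in simp)
qed

lemma cubic_step2:
  assumes "0 < \<delta>" "\<delta> \<le> u" "u \<le> 1 / 2 - \<delta>"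
  shows "6 * u * \<delta> \<le> cubic (u + 2 * \<delta>) - cubic u" "cubic (u + 2 * \<delta>) - cubic u \<le> 24 * u * \<delta>"
proof -
  have e: "cubic (u + 2 * \<delta>) - cubic u = 2 * \<delta> * (6 * (u * (1 - u)) + 6 * (\<delta> * (1 - 2 * u)) - 8 * (\<delta> * \<delta>))"
    by (simp add: cubic_def power2_eq_square power3_eq_cube algebra_simps)
  have 1: "u * (1 / 2) \<le> u * (1 - u)" "\<delta> * (2 * \<delta>) \<le> \<delta> * (1 - 2 * u)"
    using assms by (intro mult_left_mono; simp)+
  have 2: "u * (1 - u) \<le> u * 1" "\<delta> * (1 - 2 * u) \<le> \<delta> * 1" "0 \<le> \<delta> * \<delta>"
    using assms by (intro mult_left_mono; simp)+ simp
  have "3 * u \<le> 6 * (u * (1 - u)) + 6 * (\<delta> * (1 - 2 * u)) - 8 * (\<delta> * \<delta>)" using 1 2 by linarith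
  then have "2 * \<delta> * (3 * u) \<le> cubic (u + 2 * \<delta>) - cubic u"
    unfolding e using assms by (intro mult_left_mono) auto
  then show "6 * u * \<delta> \<le> cubic (u + 2 * \<delta>) - cubic u" by (simp add: mult_ac)
  have "6 * (u * (1 - u)) + 6 * (\<delta> * (1 - 2 * u)) - 8 * (\<delta> * \<delta>) \<le> 12 * u" using 1 2 assms by linarith
  then have "cubic (u + 2 * \<delta>) - cubic u \<le> 2 * \<delta> * (12 * u)"
    unfolding e using assms by (intro mult_left_mono) auto
  then show "cubic (u + 2 * \<delta>) - cubic u \<le> 24 * u * \<delta>" by (simp add: mult_ac)
qed

text \<open>48 is twice the constant 24 in the upper bound for a patch of two grid steps: such a
  patch, extended to twice its length, stays within forty grid steps. The quadratic terms in
  \<delta> are harmless below 1/2000, which is why N is at least 2000 later on.\<close>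

lemma cubic_step40:
  assumes "0 < \<delta>" "\<delta> \<le> u" "u \<le> 1 / 2 - \<delta>" "\<delta> \<le> 1 / 2000"
  shows "cubic u + 48 * u * \<delta> \<le> cubic (u + 40 * \<delta>)"
proof -
  have e: "cubic (u + 40 * \<delta>) - cubic u = 40 * \<delta> * (6 * (u * (1 - u)) + 120 * (\<delta> * (1 - 2 * u)) - 3200 * (\<delta> * \<delta>))"
    by (simp add: cubic_def power2_eq_square power3_eq_cube algebra_simps)
  have 1: "u * (1 / 2) \<le> u * (1 - u)" "0 \<le> \<delta> * (1 - 2 * u)"
    using assms by (auto intro: mult_left_mono)
  have "\<delta> * \<delta> \<le> u * (1 / 2000)" using assms by (intro mult_mono) auto
  then have "6 / 5 * u \<le> 6 * (u * (1 - u)) + 120 * (\<delta> * (1 - 2 * u)) - 3200 * (\<delta> * \<delta>)" using 1 assms by linarith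
  then have "40 * \<delta> * (6 / 5 * u) \<le> cubic (u + 40 * \<delta>) - cubic u"
    unfolding e using assms by (intro mult_left_mono) auto
  then show ?thesis by (simp add: mult_ac)
qed

lemma cubic_step1:
  assumes "0 < \<delta>" "\<delta> \<le> u" "2 * \<delta> \<le> 1 - u"
  shows "3 * \<delta> * (u * (1 - u)) \<le> cubic (u + \<delta>) - cubic u"
proof -
  have e: "cubic (u + \<delta>) - cubic u = \<delta> * (6 * (u * (1 - u)) + 3 * (\<delta> * (1 - u) - \<delta> * u) - 2 * (\<delta> * \<delta>))"
    by (simp add: cubic_def power2_eq_square power3_eq_cube algebra_simps)
  have 1: "u * \<delta> \<le> u * ((1 - u) / 2)" "0 \<le> \<delta> * (1 - u)" "\<delta> * \<delta> \<le> u * ((1 - u) / 2)"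
  proof -
    show "u * \<delta> \<le> u * ((1 - u) / 2)" using assms by (intro mult_left_mono) auto
    show "0 \<le> \<delta> * (1 - u)" using assms by simp
    show "\<delta> * \<delta> \<le> u * ((1 - u) / 2)" using assms by (intro mult_mono) auto
  qed
  have "3 * (u * (1 - u)) \<le> 6 * (u * (1 - u)) + 3 * (\<delta> * (1 - u) - \<delta> * u) - 2 * (\<delta> * \<delta>)"
  proof -
    have lin: "3 * y \<le> 6 * y + 3 * (v - x) - 2 * w"
      if "h = y / 2" "0 \<le> y" "x \<le> h" "0 \<le> v" "w \<le> h" for y h x v w :: real
    proof -
      have "3 * x \<le> 3 * h" "2 * w \<le> 2 * h" using that by simp_all
      then have "3 * x + 2 * w \<le> 5 * h" by simp
      then show ?thesis using that by simp
    qed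
    show ?thesis unfolding mult.commute[of \<delta> u]
      by (rule lin[OF _ _ 1[unfolded mult.commute[of \<delta> u]]]) (use assms in auto)
  qed
  then have "\<delta> * (3 * (u * (1 - u))) \<le> cubic (u + \<delta>) - cubic u"
    unfolding e using assms by (intro mult_left_mono) auto
  then show ?thesis by (simp add: mult_ac)
qed

text \<open>A polynomial substitute for the Chebyshev knots: like (1 - cos (pi u)) / 2,
  \<open>cubic\<close> leaves both end values quadratically, so that away from the outermost
  intervals the spacing is comparable to the weight divided by N.\<close>

definition knot :: "real \<Rightarrow> real \<Rightarrow> nat \<Rightarrow> nat \<Rightarrow> real" where
  "knot a b N j = a + (b - a) * cubic (real j / real N)"

text \<open>Two grid steps, so that consecutive patches share one grid interval, on which their
  polynomials are compared and blended.\<close>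

abbreviation sqn_patch :: "real \<Rightarrow> real \<Rightarrow> nat \<Rightarrow> nat \<Rightarrow> (real \<Rightarrow> real) \<Rightarrow> ennreal" where
  "sqn_patch a b N j \<equiv> sqn (knot a b N j) (knot a b N (j + 2))"

lemma knot_ends: "0 < N \<Longrightarrow> knot a b N 0 = a" "0 < N \<Longrightarrow> knot a b N N = b"
  by (auto simp: knot_def cubic_def)

lemma knot_less:
  assumes "a < b" "j < k" "k \<le> N" shows "knot a b N j < knot a b N k"
proof -
  have "cubic (real j / real N) < cubic (real k / real N)"
    using assms by (intro cubic_less) (auto simp: divide_strict_right_mono)
  then show ?thesis using assms by (simp add: knot_def)
qed

lemma knot_le: "a < b \<Longrightarrow> j \<le> k \<Longrightarrow> k \<le> N \<Longrightarrow> knot a b N j \<le> knot a b N k"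
  using knot_less[of a b j k N] by (cases "j = k") auto

lemma knot_reflect: "0 < N \<Longrightarrow> j \<le> N \<Longrightarrow> knot a b N (N - j) = a + b - knot a b N j"

proof -
  assume N: "0 < N" "j \<le> N"
  then have "real (N - j) / real N = 1 - real j / real N" by (simp add: of_nat_diff diff_divide_distrib)
  then have "knot a b N (N - j) = a + (b - a) * (1 - cubic (real j / real N))"
    by (simp only: knot_def cubic_reflect)
  then show ?thesis by (simp add: knot_def algebra_simps)
qed

lemma card_overlap:
  fixes k :: "nat \<Rightarrow> 'a :: linorder"
  assumes mono: "\<And>i j. i < j \<Longrightarrow> j \<le> N \<Longrightarrow> k i < k j" and A: "\<And>j. j \<in> A \<Longrightarrow> j + M \<le> N"
  shows "card {j \<in> A. k j \<le> x \<and> x \<le> k (j + M)} \<le> Suc M"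
proof (cases "{j \<in> A. k j \<le> x \<and> x \<le> k (j + M)} = {}")
  case True
  show ?thesis unfolding True by simp
next
  case False
  define B where "B = {j \<in> A. k j \<le> x \<and> x \<le> k (j + M)}"
  define i where "i = (LEAST j. j \<in> B)"
  have i: "i \<in> B" unfolding i_def by (rule LeastI_ex) (use False B_def in auto)
  have "B \<subseteq> {i..i + M}"
  proof
    fix j assume j: "j \<in> B"
    have "i \<le> j" unfolding i_def by (rule Least_le) (rule j)
    moreover have "j \<le> i + M"
    proof (rule ccontr)
      assume "\<not> j \<le> i + M"
      then have "k (i + M) < k j" using mono[of "i + M" j] A[of j] j by (auto simp: B_def)
      then show False using i j by (auto simp: B_def)
    qed
    ultimately show "j \<in> {i..i + M}" by simp
  qed
  then have "card B \<le> card {i..i + M}" by (intro card_mono) auto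
  then show ?thesis by (simp add: B_def)
qed

text \<open>Bounded overlap of the windows at every point; it lets local moduli be added up to a
  multiple of the modulus on the whole interval.\<close>

lemma nn_integral_overlap:
  fixes k :: "nat \<Rightarrow> real" and N M :: nat
  assumes mono: "\<And>i j. i < j \<Longrightarrow> j \<le> N \<Longrightarrow> k i < k j" and A: "\<And>j. j \<in> A \<Longrightarrow> j + M \<le> N"
    and fin: "finite A" and sub: "\<And>j. j \<in> A \<Longrightarrow> {k j..k (j + M)} \<subseteq> J"
    and [measurable]: "F \<in> borel_measurable borel" "J \<in> sets borel"
  shows "(\<Sum>j\<in>A. \<integral>\<^sup>+x\<in>{k j..k (j + M)}. F x \<partial>lborel) \<le> of_nat (Suc M) * (\<integral>\<^sup>+x\<in>J. F x \<partial>lborel)"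
proof -
  have "(\<Sum>j\<in>A. \<integral>\<^sup>+x\<in>{k j..k (j + M)}. F x \<partial>lborel) = (\<integral>\<^sup>+x. (\<Sum>j\<in>A. F x * indicator {k j..k (j + M)} x) \<partial>lborel)"
    by (rule nn_integral_sum[symmetric]) measurable
  also have "\<dots> \<le> (\<integral>\<^sup>+x. of_nat (Suc M) * (F x * indicator J x) \<partial>lborel)"
  proof (rule nn_integral_mono)
    fix x
    have "(\<Sum>j\<in>A. F x * indicator {k j..k (j + M)} x) = (\<Sum>j\<in>{j\<in>A. k j \<le> x \<and> x \<le> k (j + M)}. F x * indicator J x)"
    proof (rule sum.mono_neutral_cong_right)
      fix j assume "j \<in> {j\<in>A. k j \<le> x \<and> x \<le> k (j + M)}"
      then have "x \<in> {k j..k (j + M)}" "x \<in> J" using sub[of j] by auto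
      then show "F x * indicator {k j..k (j + M)} x = F x * indicator J x" by simp
    qed (use fin in auto)
    also have "\<dots> = of_nat (card {j\<in>A. k j \<le> x \<and> x \<le> k (j + M)}) * (F x * indicator J x)" by simp
    also have "\<dots> \<le> of_nat (Suc M) * (F x * indicator J x)"
      using card_overlap[of N k A M x, OF mono A] by (intro mult_right_mono) (auto simp del: of_nat_Suc)
    finally show "(\<Sum>j\<in>A. F x * indicator {k j..k (j + M)} x) \<le> of_nat (Suc M) * (F x * indicator J x)" .
  qed
  also have "\<dots> = of_nat (Suc M) * (\<integral>\<^sup>+x\<in>J. F x \<partial>lborel)"
    by (rule nn_integral_cmult) measurable
  finally show ?thesis .
qed

text \<open>Reversing the order of the nodes leaves the binomial coefficients unchanged. Reflection
  reduces the right half of the interval to the left half.\<close>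

lemma sym_diff_reflect:
  "sym_diff a b s v (\<lambda>x. f (a + b - x)) x = (-1) ^ s * sym_diff a b s v f (a + b - x)"
proof -
  have e: "(\<Sum>i\<le>s. real (s choose i) * (-1) ^ i * f (a + b - (x + (real i - real s / 2) * v)))
    = (-1) ^ s * (\<Sum>i\<le>s. real (s choose i) * (-1) ^ i * f (a + b - x + (real i - real s / 2) * v))"
    unfolding sum_distrib_left
  proof (rule sum.reindex_bij_witness[of _ "\<lambda>i. s - i" "\<lambda>i. s - i"])
    fix i assume i: "i \<in> {..s}"
    have 1: "real (s - i) - real s / 2 = - (real i - real s / 2)" using i by (simp add: of_nat_diff)
    have 2: "s choose (s - i) = s choose i" using i by (simp add: binomial_symmetric[symmetric])
    have "(-1) ^ s * (-1) ^ (s - i) = ((-1) ^ i :: real)"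
      using i by (simp flip: power_add add: minus_one_power_iff)
    note sg = this
    show "(-1) ^ s * (real (s choose (s - i)) * (-1) ^ (s - i) * f (a + b - x + (real (s - i) - real s / 2) * v))
      = real (s choose i) * (-1) ^ i * f (a + b - (x + (real i - real s / 2) * v))"
    proof -
      have "(-1) ^ s * (c * (-1) ^ (s - i) * y) = c * ((-1) ^ s * (-1) ^ (s - i)) * y" for c y :: real
        by simp
      then have *: "(-1) ^ s * (c * (-1) ^ (s - i) * y) = c * (-1) ^ i * y" for c y :: real
        unfolding sg .
      have y: "a + b - x + - (real i - real s / 2) * v = a + b - (x + (real i - real s / 2) * v)"
        by (simp add: algebra_simps)
      show ?thesis unfolding 1 2 y by (rule *)
    qed
  qed auto
  have c: "(x + (0 - real s / 2) * v \<in> {a..b} \<and> x + (real s - real s / 2) * v \<in> {a..b}) \<longleftrightarrow>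
    (a + b - x + (0 - real s / 2) * v \<in> {a..b} \<and> a + b - x + (real s - real s / 2) * v \<in> {a..b})"
    by (auto simp: algebra_simps)
  show ?thesis unfolding sym_diff_def c e by simp
qed

lemma step_weight_reflect: "step_weight a b (a + b - x) = step_weight a b x"
  by (simp add: step_weight_def mult.commute)

lemma sqn_reflect:
  assumes [measurable]: "u \<in> borel_measurable borel"
  shows "sqn p q (\<lambda>x. u (c - x)) = sqn (c - q) (c - p) u"
proof -
  have "sqn (c - q) (c - p) u = ennreal \<bar>-1\<bar> * (\<integral>\<^sup>+x. ennreal ((u (c + (-1) * x))\<^sup>2) * indicator {c - q..c - p} (c + (-1) * x) \<partial>lborel)"
    unfolding sqn_def by (intro nn_integral_real_affine) auto
  also have "\<dots> = sqn p q (\<lambda>x. u (c - x))"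
    unfolding sqn_def by (auto intro!: nn_integral_cong simp: indicator_def)
  finally show ?thesis by simp
qed

section \<open>Local approximation on the patches of the grid\<close>

context smooth_function
begin

lemma reflect: "smooth_function a b s (\<lambda>x. f (a + b - x)) \<alpha> C"
proof
  show "integrable lborel (\<lambda>x. f (a + b - x))"
    using lborel_integrable_real_affine[OF f, of "-1" "a + b"] by simp
  fix t :: real assume "0 < t"
  have "mean_square_diff a b s (\<lambda>x. f (a + b - x)) {a..b} h = mean_square_diff a b s f {a..b} h" for h
  proof -
    have "mean_square_diff a b s (\<lambda>x. f (a + b - x)) {a..b} h
      = sqn a b (\<lambda>x. sym_diff a b s (h * step_weight a b (a + b - x)) f (a + b - x))"
      unfolding mean_square_diff_def sqn_def sym_diff_reflect step_weight_reflect
      by (simp add: power_mult_distrib flip: power_mult)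
    also have "\<dots> = sqn (a + b - b) (a + b - a) (\<lambda>x. sym_diff a b s (h * step_weight a b x) f x)"
      by (rule sqn_reflect) measurable
    finally show ?thesis by (simp add: mean_square_diff_def sqn_def)
  qed
  then show "(\<integral>\<^sup>+h\<in>{0..t}. mean_square_diff a b s (\<lambda>x. f (a + b - x)) {a..b} h \<partial>lborel) \<le> ennreal (C * t powr (2 * \<alpha> + 1))"
    using modulus[OF \<open>0 < t\<close>] by simp
qed (use ab s \<alpha> C in auto)

text \<open>41 bounds the overlap of windows of forty grid steps, 60 / N is the largest step used on
  an inner patch, and the summand 1 pays for the slack that keeps the local bounds positive.\<close>

definition inner_const :: real where
  "inner_const = 2 * whitney_const s * (41 * C * 60 powr (2 * \<alpha> + 1) + 1)"

definition half_const :: real where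
  "half_const = edge_const' * (3 * (b - a)) powr \<alpha> + inner_const"

lemma whitney_const_nonneg: "0 \<le> whitney_const s"
  by (simp add: whitney_const_def)

lemma half_const_nonneg: "0 \<le> half_const"
  using edge_const'_nonneg C whitney_const_nonneg by (simp add: half_const_def inner_const_def)

lemma edge_patch:
  assumes N: "2000 \<le> N"
  shows "\<exists>r. (\<forall>i\<ge>s. coeff r i = 0) \<and>
    sqn (knot a b N 0) (knot a b N 2) (\<lambda>x. f x - poly r x) \<le> ennreal (edge_const' * (3 * (b - a)) powr \<alpha> * real N powr (- 2 * \<alpha>))"
proof -
  \<comment> \<open>Chosen so that the first patch is exactly [a, a + 4 t]; it is of order 1 / N^2,
    which turns t powr \<alpha> into N powr (- 2 \<alpha>).\<close>
  define t where "t = (b - a) * cubic (2 / real N) / 4"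
  have c: "cubic (2 / real N) \<le> 3 * (2 / real N)\<^sup>2" "(2 / real N)\<^sup>2 \<le> cubic (2 / real N)"
    using N by (intro cubic_bounds; simp)+
  have N0: "0 < real N" using N by simp
  have cp: "0 < cubic (2 / real N)" using c(2) N0 by (intro less_le_trans[OF _ c(2)]) auto
  then have t0: "0 < t" using ab by (simp add: t_def)
  have tl: "t \<le> 3 * (b - a) / (real N)\<^sup>2"
    using mult_left_mono[OF c(1), of "b - a"] ab by (simp add: t_def power_divide algebra_simps)
  have "14 * t \<le> b - a"
  proof -
    have "cubic (2 / real N) \<le> 3 * (2 / 2000)\<^sup>2" using c(1) N
      by (elim order_trans) (intro mult_left_mono power_mono divide_left_mono, auto)
    then have "(b - a) * cubic (2 / real N) \<le> (b - a) * (1 / 4)" using ab by (intro mult_left_mono) (auto simp: power2_eq_square)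
    note cN = this
    have lin: "14 * (X / 4) \<le> d" if "X \<le> d * (1 / 4)" "0 < d" for X d :: real using that by linarith
    have "0 < b - a" using ab by simp
    from lin[OF cN this] show ?thesis unfolding t_def .
  qed
  from edge_global[OF t0 this] obtain r where r: "\<forall>i\<ge>s. coeff r i = 0"
    "sqn a (a + 4 * t) (\<lambda>x. f x - poly r x) \<le> ennreal (edge_const' * t powr \<alpha>)" by blast
  have "t powr \<alpha> \<le> (3 * (b - a) / (real N)\<^sup>2) powr \<alpha>" using t0 tl \<alpha> by (intro powr_mono2) auto
  also have "\<dots> = (3 * (b - a)) powr \<alpha> * real N powr (- 2 * \<alpha>)"
  proof -
    have "(3 * (b - a) / (real N)\<^sup>2) = 3 * (b - a) * real N powr (-2)"
      using N0 by (simp add: powr_minus divide_inverse)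
    then show ?thesis using ab N0 by (simp add: powr_mult powr_powr)
  qed
  finally have "edge_const' * t powr \<alpha> \<le> edge_const' * ((3 * (b - a)) powr \<alpha> * real N powr (- 2 * \<alpha>))"
    using edge_const'_nonneg by (intro mult_left_mono)
  then have "ennreal (edge_const' * t powr \<alpha>) \<le> ennreal (edge_const' * (3 * (b - a)) powr \<alpha> * real N powr (- 2 * \<alpha>))"
    by (intro ennreal_leI) (simp add: mult_ac)
  moreover have "knot a b N 0 = a" "knot a b N 2 = a + 4 * t" using N 
    using knot_ends(1)[of N a b] by (simp_all add: knot_def t_def)
  ultimately show ?thesis using r by (intro exI[of _ r]) auto
qed

text \<open>With u = j / N, the patch doubled in length satisfies L u^2 \<le> x - a \<le> 51 L u^2
  and b - x \<ge> L / 5, so the weight lies between 2/5 L u and 8 L u; the length lies between 6 L u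
  / N and 24 L u / N. Hence l / \<phi>1 \<le> 60 / N and \<phi>2 / l \<le> 2 N, uniformly in
  j.\<close>

lemma inner_patch:
  assumes N: "2000 \<le> N" and j: "1 \<le> j" "2 * j + 2 \<le> N" and \<tau>: "0 < \<tau>"
    and T: "(\<integral>\<^sup>+h\<in>{0..60 / real N}. mean_square_diff a b s f {knot a b N j..knot a b N (j + 40)} h \<partial>lborel) \<le> ennreal \<tau>"
  shows "\<exists>r. (\<forall>i\<ge>s. coeff r i = 0) \<and>
    sqn_patch a b N j (\<lambda>x. f x - poly r x) \<le> ennreal (2 * real N * whitney_const s * \<tau>)"
proof -
  define \<delta> where "\<delta> = 1 / real N"
  define u where "u = real j * \<delta>"
  define L where "L = b - a"
  have L: "0 < L" using ab by (simp add: L_def)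
  have N0: "0 < real N" using N by simp
  have \<delta>: "0 < \<delta>" "\<delta> \<le> 1 / 2000" using N by (auto simp: \<delta>_def frac_le)
  have u: "\<delta> \<le> u" using j(1) \<delta> by (simp add: u_def)
  have u': "u \<le> 1 / 2 - \<delta>" 
  proof -
    have "real (2 * j + 2) \<le> real N" using j(2) of_nat_le_iff by blast
    then show ?thesis using N0 by (simp add: u_def \<delta>_def field_simps)
  qed
  have u0: "0 < u" "u \<le> 1 / 2" using u u' \<delta> by auto
  have kn: "knot a b N (j + i) = a + L * cubic (u + real i * \<delta>)" for i
    by (simp add: knot_def L_def u_def \<delta>_def add_divide_distrib)
  define p where "p = knot a b N j"
  define l where "l = knot a b N (j + 2) - p"
  have p: "p = a + L * cubic u" using kn[of 0] by (simp add: p_def)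
  have l_eq: "l = L * (cubic (u + 2 * \<delta>) - cubic u)" using kn[of 2] by (simp add: l_def p algebra_simps)
  have l: "L * (6 * u * \<delta>) \<le> l" "l \<le> L * (24 * u * \<delta>)"
    unfolding l_eq using cubic_step2[OF \<delta>(1) u u'] L by (auto intro: mult_left_mono)
  have l0: "0 < l" using l(1) L u0 \<delta> by (auto intro: less_le_trans[rotated])
  have end40: "p + 2 * l \<le> knot a b N (j + 40)"
  proof -
    have "L * (cubic u + 48 * u * \<delta>) \<le> L * cubic (u + 40 * \<delta>)"
      using cubic_step40[OF \<delta>(1) u u' \<delta>(2)] L by (intro mult_left_mono) auto
    then show ?thesis using l(2) kn[of 40] by (simp add: p algebra_simps)
  qed
  have S1: "u\<^sup>2 \<le> cubic u" and S3: "cubic u \<le> 3 * u\<^sup>2" using cubic_bounds[of u] u0 by auto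
  have pa: "a + L * u\<^sup>2 \<le> p" using S1 L by (simp add: p)
  have ud: "u * \<delta> \<le> u\<^sup>2" using u u0 by (simp add: power2_eq_square)
  have pe: "p + 2 * l \<le> a + L * (51 * u\<^sup>2)"
  proof -
    have "L * cubic u + 2 * (L * (24 * u * \<delta>)) \<le> L * (3 * u\<^sup>2) + 2 * (L * (24 * u\<^sup>2))"
      using S3 ud L by (intro add_mono mult_left_mono) auto
    then show ?thesis using l(2) by (simp add: p algebra_simps)
  qed
  have pe': "p + 2 * l \<le> b - L / 5"
  proof -
    have "u\<^sup>2 \<le> (1 / 2)\<^sup>2" using u0 by (intro power_mono) auto
    moreover have "u * \<delta> \<le> (1 / 2) * (1 / 2000)" using u0 \<delta> by (intro mult_mono) auto
    ultimately have "cubic u + 2 * (24 * u * \<delta>) \<le> 4 / 5" using S3 by (simp add: power2_eq_square)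
    then have "L * (cubic u + 2 * (24 * u * \<delta>)) \<le> L * (4 / 5)" using L by (intro mult_left_mono) auto
    moreover have "b = a + L" by (simp add: L_def)
    ultimately show ?thesis using l(2) by (simp add: p algebra_simps)
  qed
  define \<phi>1 where "\<phi>1 = L * u * (2 / 5)"
  define \<phi>2 where "\<phi>2 = 8 * L * u"
  have \<phi>1: "0 < \<phi>1" using L u0 by (simp add: \<phi>1_def)
  have wt: "\<phi>1 \<le> step_weight a b x \<and> step_weight a b x \<le> \<phi>2" if x: "x \<in> {p..p + 2 * l}" for x
  proof -
    have "\<phi>1\<^sup>2 \<le> (L * u\<^sup>2) * (L / 5)"
      using L by (simp add: \<phi>1_def power_mult_distrib power2_eq_square mult_ac)
    also have "\<dots> \<le> (x - a) * (b - x)"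
    proof (rule mult_mono)
      have "0 \<le> L * u\<^sup>2" using L by simp
      then show "L * u\<^sup>2 \<le> x - a" "0 \<le> x - a" using x pa by auto
    qed (use x pe' L in auto)
    finally have 1: "\<phi>1\<^sup>2 \<le> (x - a) * (b - x)" .
    have xa: "a + L * u\<^sup>2 \<le> x" using x pa by auto
    have a0: "0 \<le> L * u\<^sup>2" using L by simp
    have "(x - a) * (b - x) \<le> (L * (51 * u\<^sup>2)) * L" 
    proof (rule mult_mono)
      show "x - a \<le> L * (51 * u\<^sup>2)" using x pe by simp
      show "b - x \<le> L" using xa a0 by (simp add: L_def)
      show "0 \<le> b - x" using x pe' L by simp
    qed (use L in auto)
    also have "\<dots> \<le> \<phi>2\<^sup>2" using L by (simp add: \<phi>2_def power_mult_distrib power2_eq_square mult_ac)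
    finally have 2: "(x - a) * (b - x) \<le> \<phi>2\<^sup>2" .
    have "sqrt (\<phi>1\<^sup>2) \<le> step_weight a b x" "step_weight a b x \<le> sqrt (\<phi>2\<^sup>2)"
      using 1 2 by (simp_all only: step_weight_def real_sqrt_le_iff)
    then show ?thesis using \<phi>1 L u0 by (simp add: \<phi>2_def)
  qed
  have Tle: "l / (real s * \<phi>1) \<le> 60 / real N" 
  proof -
    have "l / (real s * \<phi>1) \<le> l / \<phi>1" using s \<phi>1 l0 by (intro divide_left_mono) auto
    also have "\<dots> \<le> L * (24 * u * \<delta>) / \<phi>1" using l(2) \<phi>1 by (intro divide_right_mono) auto
    also have "\<dots> = 60 / real N" using L u0 N0 by (simp add: \<phi>1_def \<delta>_def field_simps)
    finally show ?thesis .
  qed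
  have J: "a < p" "p + 2 * l < b"
  proof -
    have "0 < L * u\<^sup>2" using L u0 by simp
    then show "a < p" using pa by simp
    show "p + 2 * l < b" using pe' L by simp
  qed
  have "(\<integral>\<^sup>+h\<in>{0..l / (real s * \<phi>1)}. mean_square_diff a b s f {p..p + 2 * l} h \<partial>lborel)
    \<le> (\<integral>\<^sup>+h\<in>{0..60 / real N}. mean_square_diff a b s f {knot a b N j..knot a b N (j + 40)} h \<partial>lborel)"
    using Tle end40 by (intro nn_integral_mono mult_mono mean_square_diff_mono) (auto simp: p_def indicator_def)
  also note T
  finally have T': "(\<integral>\<^sup>+h\<in>{0..l / (real s * \<phi>1)}. mean_square_diff a b s f {p..p + 2 * l} h \<partial>lborel) \<le> ennreal \<tau>" .
  from weighted_whitney[OF f s l0 \<tau> J \<phi>1 wt T'] obtain r where r: "\<forall>i\<ge>s. coeff r i = 0"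
    "sq_int {p..p + l} (\<lambda>x. f x - poly r x) \<le> ennreal (whitney_const s * (\<phi>2 * \<tau>) / l)"
    by blast
  have "\<phi>2 / l \<le> \<phi>2 / (L * (6 * u * \<delta>))"
    using l(1) L u0 \<delta> l0 by (intro divide_left_mono) (auto simp: \<phi>2_def)
  also have "\<dots> \<le> 2 * real N" using L u0 N0 by (simp add: \<phi>2_def \<delta>_def)
  finally have "whitney_const s * \<tau> * (\<phi>2 / l) \<le> whitney_const s * \<tau> * (2 * real N)"
    using whitney_const_nonneg \<tau> by (intro mult_left_mono) auto
  then have "ennreal (whitney_const s * (\<phi>2 * \<tau>) / l) \<le> ennreal (2 * real N * whitney_const s * \<tau>)"
    by (intro ennreal_leI) (simp add: mult_ac)
  then show ?thesis using r by (intro exI[of _ r]) (auto simp: sqn_def p_def l_def)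
qed

text \<open>The windows of forty grid steps have bounded overlap, so the local moduli integrated up
  to 60 / N add up to a multiple of the global one, of order N powr (- 2 \<alpha> - 1); the factor N
  in the inner estimate restores the exponent - 2 \<alpha>. The condition 2 j + 2 \<le> N selects
  the patches in the left half.\<close>

lemma half_patches:
  assumes N: "2000 \<le> N"
  shows "\<exists>ps. (\<forall>j. \<forall>i\<ge>s. coeff (ps j) i = 0) \<and>
    (\<Sum>j\<in>{j. 2 * j + 2 \<le> N}. sqn_patch a b N j (\<lambda>x. f x - poly (ps j) x))
      \<le> ennreal (half_const * real N powr (- 2 * \<alpha>))"
proof -
  have N0: "0 < real N" using N by simp
  define A where "A = {j. 1 \<le> j \<and> 2 * j + 2 \<le> N}"
  have A: "finite A" "\<And>j. j \<in> A \<Longrightarrow> j + 40 \<le> N" "card A \<le> N"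
  proof -
    have "A \<subseteq> {..<N}" by (auto simp: A_def)
    then show "finite A" "card A \<le> N" using finite_subset card_mono[of "{..<N}" A] by auto
    show "\<And>j. j \<in> A \<Longrightarrow> j + 40 \<le> N" using N by (auto simp: A_def)
  qed
  define F where "F j = (\<integral>\<^sup>+h\<in>{0..60 / real N}. mean_square_diff a b s f {knot a b N j..knot a b N (j + 40)} h \<partial>lborel)" for j
  define B where "B = 41 * (C * (60 / real N) powr (2 * \<alpha> + 1))"
  have B0: "0 \<le> B" using C by (simp add: B_def)
  have sumF: "(\<Sum>j\<in>A. F j) \<le> ennreal B"
  proof -
    have sub: "{knot a b N j..knot a b N (j + 40)} \<subseteq> {a..b}" if "j \<in> A" for j
      using knot_le[OF ab, of 0 j N] knot_le[OF ab, of "j + 40" N N] A(2)[OF that] knot_ends[of N a b] N by auto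
    have "(\<Sum>j\<in>A. F j) = (\<integral>\<^sup>+h. (\<Sum>j\<in>A. mean_square_diff a b s f {knot a b N j..knot a b N (j + 40)} h * indicator {0..60 / real N} h) \<partial>lborel)"
      unfolding F_def mean_square_diff_def by (rule nn_integral_sum[symmetric]) measurable
    also have "\<dots> \<le> (\<integral>\<^sup>+h. 41 * (mean_square_diff a b s f {a..b} h * indicator {0..60 / real N} h) \<partial>lborel)"
    proof (rule nn_integral_mono)
      fix h
      have "(\<Sum>j\<in>A. mean_square_diff a b s f {knot a b N j..knot a b N (j + 40)} h) \<le> of_nat (Suc 40) * mean_square_diff a b s f {a..b} h"
        unfolding mean_square_diff_def
        by (rule nn_integral_overlap[of N "knot a b N" A]) (use knot_less[OF ab] A sub in auto)
      from mult_right_mono[OF this, of "indicator {0..60 / real N} h"]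
      show "(\<Sum>j\<in>A. mean_square_diff a b s f {knot a b N j..knot a b N (j + 40)} h * indicator {0..60 / real N} h)
        \<le> 41 * (mean_square_diff a b s f {a..b} h * indicator {0..60 / real N} h)"
        by (simp add: sum_distrib_right mult.assoc)
    qed
    also have "\<dots> = 41 * (\<integral>\<^sup>+h\<in>{0..60 / real N}. mean_square_diff a b s f {a..b} h \<partial>lborel)"
      unfolding mean_square_diff_def by (rule nn_integral_cmult) measurable
    also have "\<dots> \<le> 41 * ennreal (C * (60 / real N) powr (2 * \<alpha> + 1))"
      using modulus[of "60 / real N"] N0 by (intro mult_left_mono) auto
    also have "\<dots> = ennreal B" using C by (simp add: B_def ennreal_mult flip: ennreal_numeral)
    finally show ?thesis .
  qed
  have Ffin: "F j < \<top>" if "j \<in> A" for j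
  proof -
    have "F j \<le> (\<Sum>j\<in>A. F j)" using that A(1) by (intro member_le_sum) auto
    then show ?thesis using sumF by (meson ennreal_less_top order_le_less_trans)
  qed
  \<comment> \<open>A local modulus may vanish, while Whitney's inequality asks for a positive
    bound; this slack, summed over the patches and multiplied by N, stays of the order of the target
    rate.\<close>
  define \<epsilon> where "\<epsilon> = real N powr (- 2 * \<alpha> - 2)"
  have \<epsilon>: "0 < \<epsilon>" using N0 by (simp add: \<epsilon>_def)
  define \<tau> where "\<tau> j = enn2real (F j) + \<epsilon>" for j
  have \<tau>: "0 < \<tau> j" for j using \<epsilon> by (simp add: \<tau>_def add_nonneg_pos)
  have F\<tau>: "F j \<le> ennreal (\<tau> j)" if "j \<in> A" for j
    using Ffin[OF that] \<epsilon> by (cases "F j") (auto simp: \<tau>_def intro!: ennreal_leI)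
  have sum\<tau>: "(\<Sum>j\<in>A. \<tau> j) \<le> B + real N * \<epsilon>"
  proof -
    have "ennreal (\<Sum>j\<in>A. enn2real (F j)) = (\<Sum>j\<in>A. F j)"
      using Ffin by (subst sum_ennreal[symmetric]) auto
    then have "(\<Sum>j\<in>A. enn2real (F j)) \<le> B" using sumF B0 by (metis ennreal_le_iff)
    moreover have "real (card A) * \<epsilon> \<le> real N * \<epsilon>" using A(3) \<epsilon> by (intro mult_right_mono) auto
    ultimately show ?thesis by (simp add: \<tau>_def sum.distrib)
  qed
  have "\<forall>j\<in>A. \<exists>r. (\<forall>i\<ge>s. coeff r i = 0) \<and>
    sqn_patch a b N j (\<lambda>x. f x - poly r x) \<le> ennreal (2 * real N * whitney_const s * \<tau> j)"
    using inner_patch[OF N _ _ \<tau>] F\<tau> unfolding A_def F_def by blast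
  then obtain q where q: "\<And>j i. j \<in> A \<Longrightarrow> i \<ge> s \<Longrightarrow> coeff (q j) i = 0"
    "\<And>j. j \<in> A \<Longrightarrow> sqn_patch a b N j (\<lambda>x. f x - poly (q j) x) \<le> ennreal (2 * real N * whitney_const s * \<tau> j)"
    by metis
  obtain q0 where q0: "\<And>i. i \<ge> s \<Longrightarrow> coeff q0 i = 0"
    "sqn (knot a b N 0) (knot a b N 2) (\<lambda>x. f x - poly q0 x) \<le> ennreal (edge_const' * (3 * (b - a)) powr \<alpha> * real N powr (- 2 * \<alpha>))"
    using edge_patch[OF N] by blast
  define ps where "ps j = (if j = 0 then q0 else if j \<in> A then q j else 0)" for j
  have "{j. 2 * j + 2 \<le> N} = insert 0 A" using N by (auto simp: A_def)
  moreover have "0 \<notin> A" by (simp add: A_def)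
  ultimately have "(\<Sum>j\<in>{j. 2 * j + 2 \<le> N}. sqn_patch a b N j (\<lambda>x. f x - poly (ps j) x))
    = sqn (knot a b N 0) (knot a b N 2) (\<lambda>x. f x - poly q0 x)
      + (\<Sum>j\<in>A. sqn_patch a b N j (\<lambda>x. f x - poly (q j) x))"
    using A(1) by (auto simp: ps_def numeral_2_eq_2 intro!: sum.cong)
  also have "\<dots> \<le> ennreal (edge_const' * (3 * (b - a)) powr \<alpha> * real N powr (- 2 * \<alpha>))
      + (\<Sum>j\<in>A. ennreal (2 * real N * whitney_const s * \<tau> j))"
    by (intro add_mono sum_mono q0 q)
  also have "(\<Sum>j\<in>A. ennreal (2 * real N * whitney_const s * \<tau> j)) = ennreal (2 * real N * whitney_const s * (\<Sum>j\<in>A. \<tau> j))"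
    using \<tau> whitney_const_nonneg by (simp add: sum_distrib_left less_imp_le)
  also have "\<dots> \<le> ennreal (inner_const * real N powr (- 2 * \<alpha>))"
  proof (rule ennreal_leI)
    have "2 * real N * whitney_const s * (\<Sum>j\<in>A. \<tau> j) \<le> 2 * real N * whitney_const s * (B + real N * \<epsilon>)"
      using sum\<tau> whitney_const_nonneg by (intro mult_left_mono) auto
    also have "\<dots> = 2 * whitney_const s * (41 * C * (real N * (60 / real N) powr (2 * \<alpha> + 1)) + real N * real N * \<epsilon>)"
      by (simp add: B_def algebra_simps)
    also have "real N * real N * \<epsilon> = real N powr (- 2 * \<alpha>)"
      using N0 by (simp add: \<epsilon>_def powr_diff power2_eq_square)
    also have "real N * (60 / real N) powr (2 * \<alpha> + 1) = 60 powr (2 * \<alpha> + 1) * real N powr (- 2 * \<alpha>)"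
    proof -
      have "60 / real N = 60 * real N powr (-1)" using N0 by (simp add: powr_minus divide_inverse)
      note e60 = this
      have "(60 / real N) powr (2 * \<alpha> + 1) = 60 powr (2 * \<alpha> + 1) * real N powr (- 2 * \<alpha> - 1)"
      proof -
        have "(60 * y) powr z = 60 powr z * y powr z" if "0 \<le> y" for y z :: real
          using that by (simp add: powr_mult)
        moreover have "(real N powr (-1)) powr (2 * \<alpha> + 1) = real N powr (- 2 * \<alpha> - 1)"
        proof -
          have "(-1) * (2 * \<alpha> + 1) = - 2 * \<alpha> - 1" by simp
          then show ?thesis by (simp only: powr_powr)
        qed
        ultimately show ?thesis unfolding e60 by (simp only: powr_ge_zero)
      qed
      also have "real N powr (- 2 * \<alpha> - 1) = real N powr (- 2 * \<alpha>) / real N"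
        using N0 by (simp add: powr_diff)
      finally show ?thesis using N0 by simp
    qed
    also have "2 * whitney_const s * (41 * C * (60 powr (2 * \<alpha> + 1) * real N powr (- 2 * \<alpha>)) + real N powr (- 2 * \<alpha>))
      = inner_const * real N powr (- 2 * \<alpha>)" by (simp add: inner_const_def algebra_simps)
    finally show "2 * real N * whitney_const s * (\<Sum>j\<in>A. \<tau> j) \<le> inner_const * real N powr (- 2 * \<alpha>)" .
  qed
  also have "ennreal (edge_const' * (3 * (b - a)) powr \<alpha> * real N powr (- 2 * \<alpha>)) + ennreal (inner_const * real N powr (- 2 * \<alpha>))
    = ennreal (half_const * real N powr (- 2 * \<alpha>))"
    using edge_const'_nonneg C whitney_const_nonneg
    by (subst ennreal_plus[symmetric]) (auto simp: half_const_def inner_const_def algebra_simps)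
  finally have "(\<Sum>j\<in>{j. 2 * j + 2 \<le> N}. sqn_patch a b N j (\<lambda>x. f x - poly (ps j) x))
      \<le> ennreal (half_const * real N powr (- 2 * \<alpha>))"
    by (simp add: add_left_mono)
  moreover have "\<forall>j. \<forall>i\<ge>s. coeff (ps j) i = 0" using q q0 by (simp add: ps_def)
  ultimately show ?thesis by blast
qed

end

context smooth_function
begin

lemma patches:
  assumes N: "2000 \<le> N"
  shows "\<exists>ps. (\<forall>j. \<forall>i\<ge>s. coeff (ps j) i = 0) \<and>
    (\<Sum>j<N - 1. sqn_patch a b N j (\<lambda>x. f x - poly (ps j) x))
      \<le> ennreal (2 * half_const * real N powr (- 2 * \<alpha>))"
proof -
  define K where "K = half_const * real N powr (- 2 * \<alpha>)"
  have K: "0 \<le> K" using half_const_nonneg by (simp add: K_def)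
  define A where "A = {j. 2 * j + 2 \<le> N}"
  define e where "e j r = sqn_patch a b N j (\<lambda>x. f x - poly r x)" for j r
  obtain p1 where p1: "\<And>j i. i \<ge> s \<Longrightarrow> coeff (p1 j) i = 0" "(\<Sum>j\<in>A. e j (p1 j)) \<le> ennreal K"
    using half_patches[OF N] unfolding e_def A_def K_def by blast
  interpret r: smooth_function a b s "\<lambda>x. f (a + b - x)" \<alpha> C by (rule reflect)
  obtain p2 where p2: "\<And>j i. i \<ge> s \<Longrightarrow> coeff (p2 j) i = 0"
    "(\<Sum>j\<in>A. sqn_patch a b N j (\<lambda>x. f (a + b - x) - poly (p2 j) x)) \<le> ennreal K"
    using r.half_patches[OF N] unfolding A_def K_def by blast
  \<comment> \<open>A patch outside the left half is the mirror image of patch N - 2 - j, which lies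
    in it.\<close>
  define p3 where "p3 j = pcompose (p2 (N - 2 - j)) [:a + b, -1:]" for j
  have e3: "e j (p3 j) = sqn (knot a b N (N - 2 - j)) (knot a b N (N - 2 - j + 2)) (\<lambda>x. f (a + b - x) - poly (p2 (N - 2 - j)) x)"
    if "j < N - 1" for j
  proof -
    define h where "h x = f x - poly (p2 (N - 2 - j)) (a + b - x)" for x
    have [measurable]: "h \<in> borel_measurable borel" unfolding h_def[abs_def] by measurable
    have "N - 2 - j = N - (j + 2)" "N - 2 - j + 2 = N - j" using that by auto
    then have "sqn (knot a b N (N - 2 - j)) (knot a b N (N - 2 - j + 2)) (\<lambda>x. f (a + b - x) - poly (p2 (N - 2 - j)) x)
      = sqn (a + b - knot a b N (j + 2)) (a + b - knot a b N j) (\<lambda>x. h (a + b - x))"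
      using that by (simp add: knot_reflect h_def)
    also have "\<dots> = sqn_patch a b N j h"
      by (subst sqn_reflect) auto
    also have "\<dots> = e j (p3 j)" by (simp add: e_def h_def[abs_def] p3_def poly_pcompose)
    finally show ?thesis ..
  qed
  define ps where "ps j = (if j \<in> A then p1 j else p3 j)" for j
  have fA: "finite A" by (rule finite_subset[of _ "{..N}"]) (auto simp: A_def)
  have "(\<Sum>j<N - 1. e j (ps j)) = (\<Sum>j\<in>A. e j (p1 j)) + (\<Sum>j\<in>{..<N - 1} - A. e j (p3 j))"
  proof -
    have "A \<subseteq> {..<N - 1}" by (auto simp: A_def)
    then have "(\<Sum>j<N - 1. e j (ps j)) = (\<Sum>j\<in>{..<N - 1} - A. e j (ps j)) + (\<Sum>j\<in>A. e j (ps j))"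
      by (intro sum.subset_diff) auto
    then show ?thesis by (simp add: ps_def add.commute)
  qed
  also have "(\<Sum>j\<in>{..<N - 1} - A. e j (p3 j)) 
    = (\<Sum>j\<in>(\<lambda>j. N - 2 - j) ` ({..<N - 1} - A). sqn_patch a b N j (\<lambda>x. f (a + b - x) - poly (p2 j) x))"
  proof (subst sum.reindex)
    show "inj_on (\<lambda>j. N - 2 - j) ({..<N - 1} - A)" by (auto simp: inj_on_def)
    show "(\<Sum>j\<in>{..<N - 1} - A. e j (p3 j)) = sum ((\<lambda>j. sqn_patch a b N j
        (\<lambda>x. f (a + b - x) - poly (p2 j) x)) \<circ> (\<lambda>j. N - 2 - j)) ({..<N - 1} - A)"
      unfolding o_def by (rule sum.cong[OF refl], rule e3) simp
  qed
  also have "\<dots> \<le> (\<Sum>j\<in>A. sqn_patch a b N j (\<lambda>x. f (a + b - x) - poly (p2 j) x))"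
    by (intro sum_mono2 fA) (auto simp: A_def)
  also note p2(2)
  finally have "(\<Sum>j<N - 1. e j (ps j)) \<le> (\<Sum>j\<in>A. e j (p1 j)) + ennreal K"
    by (simp add: add_left_mono)
  also have "\<dots> \<le> ennreal K + ennreal K" by (intro add_mono p1 order_refl)
  also have "\<dots> = ennreal (2 * half_const * real N powr (- 2 * \<alpha>))"
    using K by (simp flip: ennreal_plus add: K_def)
  finally have "(\<Sum>j<N - 1. e j (ps j)) \<le> ennreal (2 * half_const * real N powr (- 2 * \<alpha>))" .
  moreover have "\<forall>j. \<forall>i\<ge>s. coeff (ps j) i = 0"
    using p1(1) coeff_pcompose_linear_eq_0[OF p2(1)] by (auto simp: ps_def p3_def)
  ultimately show ?thesis unfolding e_def by blast
qed

end

section \<open>Blending the local polynomials into a spline\<close>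

definition vanishes :: "nat \<Rightarrow> real \<Rightarrow> real poly \<Rightarrow> bool" where
  "vanishes s z p \<longleftrightarrow> (\<forall>i<s. poly ((pderiv ^^ i) p) z = 0)"

lemma vanishes_Suc: "vanishes (Suc s) z p \<longleftrightarrow> poly p z = 0 \<and> vanishes s z (pderiv p)"
  unfolding vanishes_def less_Suc_eq_0_disj by (auto simp: funpow_swap1)

lemma vanishes_mono: "vanishes s z p \<Longrightarrow> r \<le> s \<Longrightarrow> vanishes r z p"
  by (auto simp: vanishes_def)

lemma vanishes_add: "vanishes s z p \<Longrightarrow> vanishes s z q \<Longrightarrow> vanishes s z (p + q)"
  by (auto simp: vanishes_def higher_pderiv_add)

lemma vanishes_mult: "vanishes s z q \<Longrightarrow> vanishes s z (p * q)"
proof (induction s arbitrary: p q)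
  case (Suc s)
  then have q: "poly q z = 0" "vanishes s z (pderiv q)" "vanishes s z q"
    using vanishes_mono[of "Suc s" z q s] by (auto simp: vanishes_Suc)
  have "vanishes s z (p * pderiv q + pderiv p * q)" by (intro vanishes_add Suc.IH q)
  then show ?case using q(1) by (simp add: vanishes_Suc pderiv_mult mult.commute)
qed (simp add: vanishes_def)

lemma vanishes_pcompose:
  assumes "vanishes s w p" "c + l * z = w" shows "vanishes s z (pcompose p [:c, l:])"
  using assms by (auto simp: vanishes_def higher_pderiv_pcompose_linear poly_pcompose mult.commute)

text \<open>H is the primitive of (y (1 - y)) ^ s that starts at 0, normalised to reach 1; its
  derivative is non-negative on the unit interval and has zeros of order s at both ends.\<close>

lemma smoothstep:
  "\<exists>H :: real poly. (\<forall>i\<ge>2 * s + 2. coeff H i = 0) \<and> vanishes s 0 H \<and> vanishes s 1 (1 - H) \<and>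
    poly H 0 = 0 \<and> poly H 1 = 1 \<and> (\<forall>y\<in>{0..1}. 0 \<le> poly H y \<and> poly H y \<le> 1)"
proof -
  define Q where "Q = ([:0, 1:] * [:1, -1:] :: real poly) ^ s"
  have Qp: "poly Q y = (y * (1 - y)) ^ s" for y by (simp add: Q_def algebra_simps)
  have "degree ([:0, 1:] * [:1, -1:] :: real poly) \<le> 2" by (simp add: numeral_2_eq_2)
  then have "degree Q \<le> 2 * s" unfolding Q_def
    by (metis (no_types, lifting) degree_power_le mult.commute mult_le_mono2 order.trans)
  then have Qc: "coeff Q i = 0" if "i \<ge> 2 * s + 1" for i using that by (intro coeff_eq_0) simp
  define R where "R = (\<Sum>i<2 * s + 1. monom (coeff Q i / real (Suc i)) (Suc i))"
  have dR: "pderiv R = Q"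
  proof (rule poly_eqI)
    fix n show "coeff (pderiv R) n = coeff Q n"
      using Qc[of n] by (cases "n < 2 * s + 1") (simp_all add: R_def coeff_pderiv coeff_sum coeff_monom if_distrib
        del: sum.lessThan_Suc cong: if_cong)
  qed
  have R0: "poly R 0 = 0" by (simp add: R_def poly_sum poly_monom)
  have Rc: "coeff R i = 0" if "i \<ge> 2 * s + 2" for i using that by (cases i) (auto simp: R_def coeff_sum)
  have inc: "poly R y \<le> poly R z" if yz: "0 \<le> y" "y \<le> z" "z \<le> 1" for y z
  proof -
    have "0 \<le> poly_integral y z Q"
      using yz by (intro poly_integral_nonneg) (auto simp: Qp intro!: zero_le_power)
    then show ?thesis using poly_integral_pderiv[of y z R] yz by (simp add: dR)
  qed
  define c where "c = poly R 1"
  have c: "0 < c"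
  proof -
    obtain \<xi> where "0 < \<xi>" "\<xi> < 1" "poly R 1 - poly R 0 = (1 - 0) * poly (pderiv R) \<xi>"
      using poly_MVT[of 0 1 R] by auto
    then show ?thesis by (simp add: c_def R0 dR Qp)
  qed
  define H where "H = smult (1 / c) R"
  have H01: "poly H 0 = 0" "poly H 1 = 1" using c by (simp_all add: H_def R0 c_def)
  have vQ: "vanishes s 0 (smult y Q)" "vanishes s 1 (smult y Q)" for y
    unfolding vanishes_def Q_def higher_pderiv_smult
    by (auto intro!: poly_higher_pderiv_eq_0 simp del: mult_pCons_left mult_pCons_right)
  have dH: "pderiv H = smult (1 / c) Q" "pderiv (1 - H) = smult (- 1 / c) Q"
    using smult_minus_left[of "1 / c" Q] by (simp_all add: H_def pderiv_smult dR pderiv_diff)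
  have "vanishes (Suc s) 0 H" "vanishes (Suc s) 1 (1 - H)"
    unfolding vanishes_Suc dH using vQ[of "1 / c"] vQ[of "- 1 / c"] H01 by simp_all
  then have "vanishes s 0 H" "vanishes s 1 (1 - H)" using vanishes_mono[of "Suc s" _ _ s] by auto
  moreover have "0 \<le> poly H y \<and> poly H y \<le> 1" if "y \<in> {0..1}" for y
    using inc[of 0 y] inc[of y 1] that c by (auto simp: H_def R0 c_def divide_le_eq)
  moreover have "\<forall>i\<ge>2 * s + 2. coeff H i = 0" using Rc by (simp add: H_def)
  ultimately show ?thesis using H01 by blast
qed

lemma coeff_mult_eq_0:
  fixes p q :: "real poly"
  assumes "\<And>i. i \<ge> m \<Longrightarrow> coeff p i = 0" "\<And>i. i \<ge> n \<Longrightarrow> coeff q i = 0" "i \<ge> m + n"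
  shows "coeff (p * q) i = 0"
proof -
  have "coeff p j * coeff q (i - j) = 0" if "j \<le> i" for j
    using assms(1)[of j] assms(2)[of "i - j"] assms(3) that by (cases "m \<le> j") auto
  then show ?thesis unfolding coeff_mult by (intro sum.neutral) auto
qed

text \<open>With u = j / N, both the squared weight and N^2 times the squared spacing are of order
  (u (1 - u))^2. This lets the weight in the energy absorb the negative powers of the spacing in the
  derivative bound.\<close>

lemma knot_weight:
  assumes ab: "a < b" and N: "3 \<le> N" and j: "1 \<le> j" "j + 2 \<le> N"
    and t: "t \<in> {knot a b N j..knot a b N (Suc j)}"
  shows "(t - a) * (b - t) \<le> 4 * (real N)\<^sup>2 * (knot a b N (Suc j) - knot a b N j)\<^sup>2"
proof -
  define \<delta> where "\<delta> = 1 / real N"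
  define u where "u = real j * \<delta>"
  define L where "L = b - a"
  have L: "0 < L" using ab by (simp add: L_def)
  have N0: "0 < real N" using N by simp
  have \<delta>: "0 < \<delta>" using N by (auto simp: \<delta>_def)
  have u: "\<delta> \<le> u" using j(1) \<delta> by (simp add: u_def)
  have u': "2 * \<delta> \<le> 1 - u" 
  proof -
    have "real (j + 2) \<le> real N" using j(2) of_nat_le_iff by blast
    then show ?thesis using N0 by (simp add: u_def \<delta>_def field_simps)
  qed
  have kn: "knot a b N (j + i) = a + L * cubic (u + real i * \<delta>)" for i
    by (simp add: knot_def L_def u_def \<delta>_def add_divide_distrib)
  have len: "3 * L * \<delta> * (u * (1 - u)) \<le> knot a b N (Suc j) - knot a b N j"
  proof -
    have "L * (3 * \<delta> * (u * (1 - u))) \<le> L * (cubic (u + \<delta>) - cubic u)"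
      using L by (intro mult_left_mono cubic_step1[OF \<delta> u u']) auto
    then show ?thesis using kn[of 0] kn[of 1] by (simp add: algebra_simps)
  qed
  have ta: "t - a \<le> L * (12 * u\<^sup>2)"
  proof -
    have "cubic (u + \<delta>) \<le> 3 * (u + \<delta>)\<^sup>2" using u u' \<delta> by (intro cubic_bounds) auto
    also have "\<dots> \<le> 3 * (2 * u)\<^sup>2" using u \<delta> by (intro mult_left_mono power_mono) auto
    finally have "L * cubic (u + \<delta>) \<le> L * (3 * (2 * u)\<^sup>2)" using L by (intro mult_left_mono) auto
    then show ?thesis using t kn[of 1] by (simp add: power_mult_distrib)
  qed
  have bt: "b - t \<le> L * (3 * (1 - u)\<^sup>2)"
  proof -
    have "1 - cubic u \<le> 3 * (1 - u)\<^sup>2" using u u' \<delta> by (intro cubic_bounds) auto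
    then have "L * (1 - cubic u) \<le> L * (3 * (1 - u)\<^sup>2)" using L by (intro mult_left_mono) auto
    moreover have "b = a + L" by (simp add: L_def)
    ultimately show ?thesis using t kn[of 0] by (simp add: algebra_simps)
  qed
  have "b - t \<ge> 0" using t knot_le[OF ab, of "Suc j" N N] j knot_ends[of N a b] N by auto
  then have "(t - a) * (b - t) \<le> (L * (12 * u\<^sup>2)) * (L * (3 * (1 - u)\<^sup>2))"
    using ta bt L by (intro mult_mono) auto
  also have "\<dots> = 4 * (real N)\<^sup>2 * (3 * L * \<delta> * (u * (1 - u)))\<^sup>2"
    using N0 by (simp add: \<delta>_def power_mult_distrib power_divide power2_eq_square)
  also have "\<dots> \<le> 4 * (real N)\<^sup>2 * (knot a b N (Suc j) - knot a b N j)\<^sup>2"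
    using len L \<delta> u u' by (intro mult_left_mono power_mono) auto
  finally show ?thesis .
qed

lemma sqn_pieces:
  assumes mono: "\<And>j. j < N \<Longrightarrow> x j \<le> x (Suc j)" and [measurable]: "u \<in> borel_measurable borel"
    and "0 < N"
  shows "sqn (x 0) (x N) u \<le> (\<Sum>j<N. sqn (x j) (x (Suc j)) u)"
proof -
  have ex: "\<exists>j<n. t \<in> {x j..x (Suc j)}" if "t \<in> {x 0..x n}" "0 < n" "n \<le> N" for t n
    using that
  proof (induction n)
    case (Suc n)
    show ?case
    proof (cases "t \<le> x n \<and> 0 < n")
      case True
      then show ?thesis using Suc by (auto intro: less_SucI)
    next
      case False
      then have "t \<in> {x n..x (Suc n)}" using Suc.prems by auto
      then show ?thesis by blast
    qed
  qed simp
  have "sqn (x 0) (x N) u \<le> (\<integral>\<^sup>+t. (\<Sum>j<N. ennreal ((u t)\<^sup>2) * indicator {x j..x (Suc j)} t) \<partial>lborel)"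
    unfolding sqn_def
  proof (rule nn_integral_mono)
    fix t
    show "ennreal ((u t)\<^sup>2) * indicator {x 0..x N} t \<le> (\<Sum>j<N. ennreal ((u t)\<^sup>2) * indicator {x j..x (Suc j)} t)"
    proof (cases "t \<in> {x 0..x N}")
      case True
      then obtain j where j: "j < N" "t \<in> {x j..x (Suc j)}" using ex[of t N] \<open>0 < N\<close> by auto
      have "ennreal ((u t)\<^sup>2) * indicator {x j..x (Suc j)} t \<le> (\<Sum>j<N. ennreal ((u t)\<^sup>2) * indicator {x j..x (Suc j)} t)"
        using j(1) by (intro member_le_sum) auto
      then show ?thesis using j True by simp
    qed simp
  qed
  also have "\<dots> = (\<Sum>j<N. sqn (x j) (x (Suc j)) u)"
    unfolding sqn_def by (rule nn_integral_sum) measurable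
  finally show ?thesis .
qed

context smooth_function
begin

definition jackson_const :: real where
  "jackson_const = (3 + 2 * (16 ^ s * (real (3 * s + 2) ^ (2 * s) * poly_const (3 * s + 2)))) * (8 * half_const)"

lemma jackson_const_nonneg: "0 \<le> jackson_const"
  using half_const_nonneg poly_const_nonneg by (simp add: jackson_const_def)

text \<open>Local polynomials have degree below s, so only the transitions contribute to the
  derivative of order s of the spline, and its weighted energy is at most a constant times N ^ (2 s)
  times the squared differences of neighbours, which the Whitney errors control. The Jackson
  estimate divides the energy by a multiple of N ^ (2 s), leaving an error of the size of the local
  ones.\<close>

theorem polynomial_approximation:
  assumes N: "2000 \<le> N" "2 * s \<le> N"
  shows "\<exists>q. (\<forall>i\<ge>N. coeff q i = 0) \<and>
    sqn a b (\<lambda>x. f x - poly q x) \<le> ennreal (jackson_const * real N powr (- 2 * \<alpha>))"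
proof -
  define E where "E = 2 * half_const * real N powr (- 2 * \<alpha>)"
  have E: "0 \<le> E" using half_const_nonneg by (simp add: E_def)
  define x where "x = knot a b N"
  have x_less: "x j < x k" if "j < k" "k \<le> N" for j k using knot_less[OF ab that] by (simp add: x_def)
  have x_le: "x j \<le> x k" if "j \<le> k" "k \<le> N" for j k using knot_le[OF ab that] by (simp add: x_def)
  have x_ends: "x 0 = a" "x N = b" using knot_ends[of N a b] N by (auto simp: x_def)
  obtain ps where ps: "\<And>j i. i \<ge> s \<Longrightarrow> coeff (ps j) i = 0"
    "(\<Sum>j<N - 1. sqn (x j) (x (j + 2)) (\<lambda>t. f t - poly (ps j) t)) \<le> ennreal E"
    using patches[OF N(1)] unfolding E_def x_def by blast
  define e where "e j = sqn (x j) (x (j + 2)) (\<lambda>t. f t - poly (ps j) t)" for j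
  have esum: "(\<Sum>j<N - 1. e j) \<le> ennreal E" using ps(2) by (simp add: e_def)
  obtain H where H: "\<And>i. i \<ge> 2 * s + 2 \<Longrightarrow> coeff H i = 0" "vanishes s 0 H" "vanishes s 1 (1 - H)"
    "poly H 0 = 0" "poly H 1 = 1" "\<And>y. y \<in> {0..1} \<Longrightarrow> 0 \<le> poly H y \<and> poly H y \<le> 1"
    using smoothstep[of s] by metis
  define l where "l j = x (Suc j) - x j" for j
  have l: "0 < l j" if "j < N" for j using x_less[of j "Suc j"] that by (simp add: l_def)
  define Hc where "Hc j = pcompose H [:- x j / l j, 1 / l j:]" for j
  have Hc: "poly (Hc j) t = poly H ((t - x j) / l j)" for j t
    by (simp add: Hc_def poly_pcompose diff_divide_distrib)
  have inside: "(t - x j) / l j \<in> {0..1}" if "j < N" "t \<in> {x j..x (Suc j)}" for j t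
    using that l[OF that(1)] by (auto simp: l_def divide_le_eq)
  have Hc01: "0 \<le> poly (Hc j) t \<and> poly (Hc j) t \<le> 1" if "j < N" "t \<in> {x j..x (Suc j)}" for j t
    unfolding Hc by (intro H(6) inside that)
  have vHc: "vanishes s (x j) (Hc j)" "vanishes s (x (Suc j)) (1 - Hc j)" if "j < N" for j
  proof -
    show "vanishes s (x j) (Hc j)" unfolding Hc_def by (rule vanishes_pcompose[OF H(2)]) simp
    have "1 - Hc j = pcompose (1 - H) [:- x j / l j, 1 / l j:]" by (simp add: Hc_def pcompose_diff pcompose_1)
    moreover have "- x j / l j + 1 / l j * x (Suc j) = 1"
      using l[OF that] by (simp add: l_def diff_divide_distrib[symmetric] algebra_simps)
    ultimately show "vanishes s (x (Suc j)) (1 - Hc j)"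
      by (simp only:) (rule vanishes_pcompose[OF H(3)])
  qed
  define R where "R j = (ps j - ps (j - 1)) * Hc j" for j
  \<comment> \<open>Interval j lies in patches j - 1 and j; the first and the last interval lie in
    one patch only, so no transition takes place there.\<close>
  define G where "G j = (if j = 0 then ps 0 else if j = N - 1 then ps (N - 2) else ps (j - 1) + R j)" for j
  have matching: "poly ((pderiv ^^ i) (G j)) (x (Suc j)) = poly ((pderiv ^^ i) (G (Suc j))) (x (Suc j))"
    if j: "Suc j < N" and i: "i < s" for i j
  proof -
    have 1: "vanishes s (x (Suc j)) (ps j - G j)"
    proof (cases "j = 0")
      case False
      have "ps j - G j = (ps j - ps (j - 1)) * (1 - Hc j)"
        using False j by (simp add: G_def R_def algebra_simps)
      then show ?thesis using vHc(2)[of j] j by (simp add: vanishes_mult)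
    qed (simp add: G_def vanishes_def)
    have 2: "vanishes s (x (Suc j)) (G (Suc j) - ps j)"
    proof (cases "Suc j = N - 1")
      case True
      then have "N - 2 = j" by simp
      then show ?thesis using True N by (simp add: G_def vanishes_def)
    next
      case False
      then show ?thesis using vHc(1)[of "Suc j"] j by (simp add: G_def R_def vanishes_mult)
    qed
    have "vanishes s (x (Suc j)) (G (Suc j) - G j)"
      using vanishes_add[OF 1 2] by simp
    then have "poly ((pderiv ^^ i) (G j + (G (Suc j) - G j))) (x (Suc j)) = poly ((pderiv ^^ i) (G j)) (x (Suc j))"
      unfolding higher_pderiv_add using i by (simp add: vanishes_def)
    then show ?thesis by simp
  qed
  \<comment> \<open>A single formula for all pieces: clamping the argument of H makes the factor of
    each increment 0 before its interval and 1 after it, so continuity is immediate.\<close>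
  define g where "g t = poly (ps 0) t
    + (\<Sum>k\<in>{1..N - 2}. poly (ps k - ps (k - 1)) t * poly H (max 0 (min 1 ((t - x k) / l k))))" for t
  have g_cont: "continuous_on UNIV g"
    unfolding g_def[abs_def] divide_inverse
    by (intro continuous_intros) 
  have pieces: "g t = poly (G j) t" if j: "j < N" and t: "t \<in> {x j..x (Suc j)}" for j t
  proof -
    define \<sigma> where "\<sigma> k = max 0 (min 1 ((t - x k) / l k))" for k
    have s1: "\<sigma> k = 1" if "k < j" for k
    proof -
      have "x (Suc k) \<le> t" using x_le[of "Suc k" j] that j t by auto
      then have "1 \<le> (t - x k) / l k" using l[of k] that j by (simp add: l_def)
      then show ?thesis by (simp add: \<sigma>_def)
    qed
    have s0: "\<sigma> k = 0" if "j < k" "k < N" for k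
    proof -
      have "t \<le> x k" using x_le[of "Suc j" k] that t by auto
      then have "(t - x k) / l k \<le> 0" using l[of k] that by (simp add: divide_le_0_iff)
      then show ?thesis by (simp add: \<sigma>_def)
    qed
    have sj: "\<sigma> j = (t - x j) / l j" using inside[OF j t] by (auto simp: \<sigma>_def)
    have tel: "poly (ps 0) t + (\<Sum>k\<in>{1..n}. poly (ps k - ps (k - 1)) t) = poly (ps n) t" for n
      by (induction n) auto
    have sub: "(\<Sum>k\<in>{1..N - 2}. poly (ps k - ps (k - 1)) t * poly H (\<sigma> k))
      = (\<Sum>k\<in>{1..min (j - 1) (N - 2)}. poly (ps k - ps (k - 1)) t) + (if 1 \<le> j \<and> j \<le> N - 2 then poly (R j) t else 0)"
    proof -
      have "(\<Sum>k\<in>{1..N - 2}. poly (ps k - ps (k - 1)) t * poly H (\<sigma> k))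
        = (\<Sum>k\<in>{1..N - 2}. (if k < j then poly (ps k - ps (k - 1)) t else 0) + (if k = j then poly (R j) t else 0))"
        using s1 s0 sj H(4,5) by (intro sum.cong refl) (auto simp: R_def Hc not_less le_less)
      also have "\<dots> = (\<Sum>k\<in>{1..N - 2}. if k < j then poly (ps k - ps (k - 1)) t else 0)
          + (if 1 \<le> j \<and> j \<le> N - 2 then poly (R j) t else 0)"
        by (simp add: sum.distrib)
      also have "(\<Sum>k\<in>{1..N - 2}. if k < j then poly (ps k - ps (k - 1)) t else 0)
         = (\<Sum>k\<in>{1..min (j - 1) (N - 2)}. poly (ps k - ps (k - 1)) t)"
        by (rule sum.mono_neutral_cong_right) (auto simp: less_eq_Suc_le)
      finally show ?thesis .
    qed
    have "g t = poly (ps (min (j - 1) (N - 2))) t + (if 1 \<le> j \<and> j \<le> N - 2 then poly (R j) t else 0)"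
      using sub tel[of "min (j - 1) (N - 2)"] by (simp add: g_def \<sigma>_def)
    also have "\<dots> = poly (G j) t"
      using j N by (auto simp: G_def min_def numeral_2_eq_2)
    finally show ?thesis .
  qed
  interpret sp: spline a b x N s G g
    by unfold_locales (use ab x_ends x_less matching pieces continuous_on_subset[OF g_cont] in auto)
  define d where "d = 3 * s + 2"
  define P where "P = real d ^ (2 * s) * poly_const d"
  have P: "0 \<le> P" using poly_const_nonneg by (simp add: P_def)
  define I where "I j = integral {x j..x (Suc j)} (\<lambda>t. (poly (ps j - ps (j - 1)) t)\<^sup>2)" for j
  have I: "0 \<le> I j" for j
    unfolding I_def by (intro integral_nonneg integrable_continuous_interval continuous_intros) auto
  have Ie: "ennreal (I j) \<le> 2 * e j + 2 * e (j - 1)" if j: "j \<in> {1..N - 2}" for j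
  proof -
    have "ennreal (I j) = sqn (x j) (x (Suc j)) (poly (ps j - ps (j - 1)))" by (simp add: I_def sqn_poly)
    also have "\<dots> \<le> 2 * sqn (x j) (x (Suc j)) (\<lambda>t. f t - poly (ps j) t) + 2 * sqn (x j) (x (Suc j)) (\<lambda>t. f t - poly (ps (j - 1)) t)"
      by (rule sqn_diff_poly) simp
    also have "\<dots> \<le> 2 * e j + 2 * e (j - 1)"
      unfolding e_def using j
      by (intro add_mono[OF mult_left_mono[OF sqn_mono_interval] mult_left_mono[OF sqn_mono_interval]])
        (auto intro!: x_le)
    finally show ?thesis .
  qed
  have sumshift: "(\<Sum>j\<in>{1..N - 2}. 2 * e j + 2 * e (j - 1)) \<le> ennreal (4 * E)"
  proof -
    have "(\<Sum>j\<in>{1..N - 2}. e j) \<le> (\<Sum>j<N - 1. e j)" using N by (intro sum_mono2) auto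
    moreover have "(\<Sum>j\<in>{1..N - 2}. e (j - 1)) \<le> (\<Sum>j<N - 1. e j)"
    proof -
      have "(\<Sum>j\<in>{1..N - 2}. e (j - 1)) = (\<Sum>j<N - 2. e j)"
        by (rule sum.reindex_bij_witness[of _ Suc "\<lambda>j. j - 1"]) auto
      also have "\<dots> \<le> (\<Sum>j<N - 1. e j)" by (intro sum_mono2) auto
      finally show ?thesis .
    qed
    ultimately have "(\<Sum>j\<in>{1..N - 2}. 2 * e j + 2 * e (j - 1)) \<le> 2 * ennreal E + 2 * ennreal E"
      using esum unfolding sum.distrib sum_distrib_left[symmetric]
      by (intro add_mono mult_left_mono) (auto intro: order_trans)
    also have "\<dots> = ennreal (4 * E)"
      using E by (simp add: ennreal_mult[symmetric] ennreal_plus[symmetric] flip: ennreal_numeral del: ennreal_plus)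
    finally show ?thesis .
  qed
  have sumI: "(\<Sum>j\<in>{1..N - 2}. I j) \<le> 4 * E"
  proof -
    have "ennreal (\<Sum>j\<in>{1..N - 2}. I j) = (\<Sum>j\<in>{1..N - 2}. ennreal (I j))" using I by simp
    also have "\<dots> \<le> (\<Sum>j\<in>{1..N - 2}. 2 * e j + 2 * e (j - 1))" by (intro sum_mono Ie)
    also note sumshift
    finally show ?thesis using E by (subst (asm) ennreal_le_iff) auto
  qed
  have energy_piece: "poly_integral (x j) (x (Suc j)) (((pderiv ^^ s) (G j))\<^sup>2 * sp.W ^ s)
     \<le> (if j \<in> {1..N - 2} then (4 * (real N)\<^sup>2) ^ s * P * I j else 0)" if j: "j < N" for j
  proof (cases "j \<in> {1..N - 2}")
    case False
    then have "(pderiv ^^ s) (G j) = 0" using ps(1) j by (intro higher_pderiv_eq_0) (auto simp: G_def)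
    then show ?thesis unfolding if_not_P[OF False] by simp
  next
    case True
    have Gj: "(pderiv ^^ s) (G j) = (pderiv ^^ s) (R j)"
      using True higher_pderiv_eq_0[of s "ps (j - 1)"] ps(1) by (auto simp: G_def higher_pderiv_add)
    have Rc: "\<And>i. i \<ge> d \<Longrightarrow> coeff (R j) i = 0"
      unfolding R_def Hc_def d_def
      by (rule coeff_mult_eq_0[of s _ "2 * s + 2"]) (auto simp: ps coeff_pcompose_linear_eq_0[OF H(1)])
    define M where "M = integral {x j..x (Suc j)} (\<lambda>t. (poly (R j) t)\<^sup>2)"
    have M0: "0 \<le> M"
      unfolding M_def by (intro integral_nonneg integrable_continuous_interval continuous_intros) auto
    have MI: "M \<le> I j" unfolding M_def I_def
    proof (intro integral_le integrable_continuous_interval continuous_intros)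
      fix t assume "t \<in> {x j..x (Suc j)}"
      then have "\<bar>poly (R j) t\<bar> \<le> \<bar>poly (ps j - ps (j - 1)) t\<bar>"
        using Hc01[OF j] by (auto simp: R_def abs_mult intro: mult_right_le_one_le)
      then show "(poly (R j) t)\<^sup>2 \<le> (poly (ps j - ps (j - 1)) t)\<^sup>2" by (simp only: abs_le_square_iff)
    qed
    have "poly (((pderiv ^^ s) (G j))\<^sup>2 * sp.W ^ s) t \<le> P / l j ^ (2 * s + 1) * M * (4 * (real N)\<^sup>2 * (l j)\<^sup>2) ^ s"
      if t: "t \<in> {x j..x (Suc j)}" for t
    proof -
      have "(poly ((pderiv ^^ s) (R j)) t)\<^sup>2 \<le> P / l j ^ (2 * s + 1) * M"
        using poly_higher_pderiv_bound[of d "R j" "l j" t "x j" s] Rc l[OF j] t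
        by (simp add: P_def M_def l_def)
      moreover have "poly (sp.W ^ s) t \<le> (4 * (real N)\<^sup>2 * (l j)\<^sup>2) ^ s"
      proof -
        have "(t - a) * (b - t) \<le> 4 * (real N)\<^sup>2 * (l j)\<^sup>2"
        proof -
          have "j + 2 \<le> N" "1 \<le> j" "3 \<le> N" using True N by auto
          from knot_weight[OF ab this(3,2,1)] show ?thesis using t by (simp add: l_def x_def)
        qed
        moreover have "0 \<le> (t - a) * (b - t)"
          using t x_le[of 0 j] x_le[of "Suc j" N] j x_ends by simp
        ultimately show ?thesis by (simp add: sp.poly_W power_mono)
      qed
      moreover have "0 \<le> poly (sp.W ^ s) t"
        using t x_le[of 0 j] x_le[of "Suc j" N] j x_ends by (simp add: sp.poly_W)
      ultimately show ?thesis unfolding Gj poly_mult poly_power[of _ 2]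
        using P M0 l[OF j] by (intro mult_mono) auto
    qed
    then have "poly_integral (x j) (x (Suc j)) (((pderiv ^^ s) (G j))\<^sup>2 * sp.W ^ s)
      \<le> integral {x j..x (Suc j)} (\<lambda>t. P / l j ^ (2 * s + 1) * M * (4 * (real N)\<^sup>2 * (l j)\<^sup>2) ^ s)"
      unfolding poly_integral_def by (intro integral_le poly_integrable integrable_const_ivl)
    also have "\<dots> = (P / l j ^ (2 * s + 1) * M * (4 * (real N)\<^sup>2 * (l j)\<^sup>2) ^ s) * l j"
      using l[OF j] by (simp add: l_def mult.commute)
    also have "\<dots> = (4 * (real N)\<^sup>2) ^ s * P * M"
    proof -
      have "A / y ^ (2 * s + 1) * B * (D * y\<^sup>2) ^ s * y = D ^ s * A * B" if "0 < y" for y A B D :: real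
      proof -
        have 1: "(D * y\<^sup>2) ^ s = D ^ s * y ^ (2 * s)" by (simp only: power_mult_distrib power_mult)
        have 2: "y ^ (2 * s + 1) = y ^ (2 * s) * y" by simp
        have "A / (Y * y) * B * (D ^ s * Y) * y = D ^ s * A * B" if "Y \<noteq> 0" for Y using that \<open>0 < y\<close> by simp
        then show ?thesis unfolding 1 2 using that by simp
      qed
      from this[OF l[OF j]] show ?thesis .
    qed
    also have "\<dots> \<le> (4 * (real N)\<^sup>2) ^ s * P * I j" using MI P by (intro mult_left_mono) auto
    finally show ?thesis using True by simp
  qed
  have energy: "sp.energy \<le> (4 * (real N)\<^sup>2) ^ s * P * (4 * E)"
  proof -
    have "sp.energy \<le> (\<Sum>j<N. if j \<in> {1..N - 2} then (4 * (real N)\<^sup>2) ^ s * P * I j else 0)"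
      unfolding sp.energy_def by (intro sum_mono energy_piece) auto
    also have "\<dots> = (\<Sum>j\<in>{1..N - 2}. (4 * (real N)\<^sup>2) ^ s * P * I j)"
      by (rule sum.mono_neutral_cong_right) (use N in auto)
    also have "\<dots> = (4 * (real N)\<^sup>2) ^ s * P * (\<Sum>j\<in>{1..N - 2}. I j)" by (simp add: sum_distrib_left)
    also have "\<dots> \<le> (4 * (real N)\<^sup>2) ^ s * P * (4 * E)" using sumI P by (intro mult_left_mono) auto
    finally show ?thesis .
  qed
  define q where "q = sp.proj N"
  have gq: "integral {a..b} (\<lambda>t. (g t - poly q t)\<^sup>2) \<le> 16 ^ s * P * (4 * E)"
  proof -
    have "integral {a..b} (\<lambda>t. (g t - poly q t)\<^sup>2) \<le> sp.energy / real (N - s + 1) ^ (2 * s)"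
      unfolding q_def using N(2) by (intro sp.jackson) simp
    also have "\<dots> \<le> ((4 * (real N)\<^sup>2) ^ s * P * (4 * E)) / (real N / 2) ^ (2 * s)"
    proof (intro frac_le energy power_mono)
      show "0 < (real N / 2) ^ (2 * s)" using N by simp
      show "0 \<le> (4 * (real N)\<^sup>2) ^ s * P * (4 * E)" using P E by simp
      have "real N \<le> real (2 * (N - s + 1))" using N(2) by (intro of_nat_mono) simp
      then show "real N / 2 \<le> real (N - s + 1)" by simp
    qed auto
    also have "\<dots> = 16 ^ s * P * (4 * E)"
    proof -
      have "(4 * (real N)\<^sup>2) ^ s = (16 * (real N / 2)\<^sup>2) ^ s" by (simp add: power_divide)
      also have "\<dots> = 16 ^ s * (real N / 2) ^ (2 * s)" by (simp only: power_mult_distrib power_mult)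
      finally have "(4 * (real N)\<^sup>2) ^ s = 16 ^ s * (real N / 2) ^ (2 * s)" .
      then show ?thesis using N by simp
    qed
    finally show ?thesis .
  qed
  have gm [measurable]: "g \<in> borel_measurable borel" by (rule borel_measurable_continuous_onI[OF g_cont])
  have fg_piece: "sqn (x j) (x (Suc j)) (\<lambda>t. f t - g t) \<le>
    (if j = 0 then e 0 else if j = N - 1 then e (N - 2) else 2 * e j + 2 * e (j - 1))" if j: "j < N" for j
  proof -
    have c: "sqn (x j) (x (Suc j)) (\<lambda>t. f t - g t) = sqn (x j) (x (Suc j)) (\<lambda>t. f t - poly (G j) t)"
      by (intro sqn_cong) (simp add: pieces[OF j])
    consider "j = 0" | "j = N - 1" "j \<noteq> 0" | "j \<in> {1..N - 2}" "j \<noteq> 0" "j \<noteq> N - 1" using j N by fastforce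
    then show ?thesis
    proof cases
      case 1
      then show ?thesis unfolding c e_def using N by (auto simp: G_def intro!: sqn_mono_interval x_le)
    next
      case 2
      have "x (Suc j) = x (N - 2 + 2)" using 2 N j by (intro arg_cong[of _ _ x]) simp
      moreover have "x (N - 2) \<le> x j" using 2 by (intro x_le) auto
      ultimately show ?thesis unfolding c e_def using 2 by (auto simp: G_def intro!: sqn_mono_interval)
    next
      case 3
      \<comment> \<open>Here the spline is a convex combination of two neighbouring polynomials, so
        its error is the same combination of theirs.\<close>
      have "sqn (x j) (x (Suc j)) (\<lambda>t. f t - poly (G j) t)
        = sqn (x j) (x (Suc j)) (\<lambda>t. poly (Hc j) t * (f t - poly (ps j) t) + (1 - poly (Hc j) t) * (f t - poly (ps (j - 1)) t))"
        using 3 by (intro sqn_cong) (simp add: G_def R_def algebra_simps)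
      also have "\<dots> \<le> 2 * sqn (x j) (x (Suc j)) (\<lambda>t. poly (Hc j) t * (f t - poly (ps j) t))
         + 2 * sqn (x j) (x (Suc j)) (\<lambda>t. (1 - poly (Hc j) t) * (f t - poly (ps (j - 1)) t))"
        by (rule sqn_add) measurable
      also have "\<dots> \<le> 2 * sqn (x j) (x (Suc j)) (\<lambda>t. f t - poly (ps j) t) + 2 * sqn (x j) (x (Suc j)) (\<lambda>t. f t - poly (ps (j - 1)) t)"
      proof (rule add_mono[OF mult_left_mono[OF sqn_mono] mult_left_mono[OF sqn_mono]])
        fix t assume t: "t \<in> {x j..x (Suc j)}"
        show "\<bar>poly (Hc j) t * (f t - poly (ps j) t)\<bar> \<le> \<bar>f t - poly (ps j) t\<bar>"
          using Hc01[OF j t] by (auto simp: abs_mult intro: mult_left_le_one_le)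
        show "\<bar>(1 - poly (Hc j) t) * (f t - poly (ps (j - 1)) t)\<bar> \<le> \<bar>f t - poly (ps (j - 1)) t\<bar>"
          using Hc01[OF j t] by (auto simp: abs_mult intro: mult_left_le_one_le)
      qed auto
      also have "\<dots> \<le> 2 * e j + 2 * e (j - 1)"
        unfolding e_def using 3
        by (intro add_mono[OF mult_left_mono[OF sqn_mono_interval] mult_left_mono[OF sqn_mono_interval]])
          (auto intro!: x_le)
      finally show ?thesis using 3 by (simp add: c)
    qed
  qed
  have fg: "sqn a b (\<lambda>t. f t - g t) \<le> ennreal (6 * E)"
  proof -
    have "sqn a b (\<lambda>t. f t - g t) \<le> (\<Sum>j<N. sqn (x j) (x (Suc j)) (\<lambda>t. f t - g t))"
      unfolding x_ends[symmetric] by (rule sqn_pieces) (use x_le N in auto)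
    also have "\<dots> \<le> (\<Sum>j<N. if j = 0 then e 0 else if j = N - 1 then e (N - 2) else 2 * e j + 2 * e (j - 1))"
      by (intro sum_mono fg_piece) simp
    also have "\<dots> = e 0 + e (N - 2) + (\<Sum>j\<in>{1..N - 2}. 2 * e j + 2 * e (j - 1))"
    proof -
      have "{..<N} = insert 0 (insert (N - 1) {1..N - 2})" using N by auto
      moreover have "N - 1 \<notin> {1..N - 2}" "0 \<notin> insert (N - 1) {1..N - 2}" using N by auto
      moreover have "(\<Sum>j\<in>{1..N - 2}. if j = 0 then e 0 else if j = N - 1 then e (N - 2) else 2 * e j + 2 * e (j - 1))
        = (\<Sum>j\<in>{1..N - 2}. 2 * e j + 2 * e (j - 1))" using N by (intro sum.cong) auto
      ultimately show ?thesis using N by (simp add: add.assoc del: One_nat_def)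
    qed
    also have "\<dots> \<le> ennreal E + ennreal E + ennreal (4 * E)"
    proof (intro add_mono sumshift)
      have "e j \<le> (\<Sum>j<N - 1. e j)" if "j < N - 1" for j using that by (intro member_le_sum) auto
      then have "e j \<le> ennreal E" if "j < N - 1" for j using esum that order_trans by blast
      then show "e 0 \<le> ennreal E" "e (N - 2) \<le> ennreal E" using N by auto
    qed
    also have "\<dots> = ennreal (6 * E)" using E by (simp flip: ennreal_plus)
    finally show ?thesis .
  qed
  have "sqn a b (\<lambda>t. f t - poly q t) = sqn a b (\<lambda>t. (f t - g t) + (g t - poly q t))" by simp
  also have "\<dots> \<le> 2 * sqn a b (\<lambda>t. f t - g t) + 2 * sqn a b (\<lambda>t. g t - poly q t)"
    by (rule sqn_add) measurable
  also have "sqn a b (\<lambda>t. g t - poly q t) = ennreal (integral {a..b} (\<lambda>t. (g t - poly q t)\<^sup>2))"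
    by (intro sqn_continuous continuous_intros continuous_on_subset[OF g_cont]) auto
  also have "2 * sqn a b (\<lambda>t. f t - g t) + 2 * ennreal (integral {a..b} (\<lambda>t. (g t - poly q t)\<^sup>2))
    \<le> 2 * ennreal (6 * E) + 2 * ennreal (16 ^ s * P * (4 * E))"
    by (intro add_mono mult_left_mono fg ennreal_leI gq) auto
  also have "\<dots> = ennreal (2 * (6 * E) + 2 * (16 ^ s * P * (4 * E)))"
    using E P by (simp add: ennreal_mult[symmetric] ennreal_plus[symmetric] flip: ennreal_numeral del: ennreal_plus)
  also have "\<dots> \<le> ennreal (jackson_const * real N powr (- 2 * \<alpha>))"
  proof (rule ennreal_leI)
    have "jackson_const * real N powr (- 2 * \<alpha>) = (3 + 2 * (16 ^ s * P)) * (4 * E)"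
      by (simp add: jackson_const_def E_def P_def d_def)
    also have "\<dots> = 12 * E + 2 * (16 ^ s * P * (4 * E))" by (simp add: algebra_simps)
    finally show "2 * (6 * E) + 2 * (16 ^ s * P * (4 * E)) \<le> jackson_const * real N powr (- 2 * \<alpha>)"
      by simp
  qed
  finally have "sqn a b (\<lambda>t. f t - poly q t) \<le> ennreal (jackson_const * real N powr (- 2 * \<alpha>))" .
  moreover have "\<forall>i\<ge>N. coeff q i = 0" by (simp add: q_def sp.coeff_proj)
  ultimately show ?thesis by blast
qed

end

section \<open>From classes modulo null sets to Borel functions\<close>

lemma L2_norm_AE_borel:
  assumes g: "g \<in> borel_measurable borel" and eq: "AE x in lborel. x \<in> {a..b} \<longrightarrow> u x = g x"
  shows "(L2_norm a b u)\<^sup>2 = enn2real (sqn a b g)"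
proof -
  note [measurable] = g
  define U where "U x = indicator {a..b} x *\<^sub>R (u x * u x)" for x
  define G where "G x = indicator {a..b} x *\<^sub>R (g x * g x)" for x
  have G: "G \<in> borel_measurable borel" unfolding G_def[abs_def] by measurable
  have eq': "AE x in lebesgue. G x = U x"
    using AE_completion[OF eq] by eventually_elim (auto simp: G_def U_def indicator_def)
  have Gl: "G \<in> borel_measurable lebesgue" using G by (intro measurable_completion) auto
  have Ul: "U \<in> borel_measurable lebesgue" by (rule borel_measurable_AE[OF Gl eq'])
  have "L2_inner a b u u = integral\<^sup>L lebesgue U"
    unfolding L2_inner_def U_def by (rule integral_restrict_space) auto
  also have "\<dots> = integral\<^sup>L lebesgue G"
    using eq' by (intro integral_cong_AE Ul Gl) auto
  also have "\<dots> = enn2real (\<integral>\<^sup>+x. ennreal (G x) \<partial>lebesgue)"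
    by (intro integral_eq_nn_integral Gl) (auto simp: G_def)
  also have "(\<integral>\<^sup>+x. ennreal (G x) \<partial>lebesgue) = sqn a b g"
    unfolding nn_integral_completion sqn_def
    by (intro nn_integral_cong) (auto simp: G_def indicator_def power2_eq_square)
  finally have "L2_inner a b u u = enn2real (sqn a b g)" .
  then show ?thesis by (simp add: L2_norm_def)
qed

text \<open>Tonelli's theorem in the step and the point needs joint measurability, which
  compositions with a Borel function have; so every class is replaced by a Borel function that
  vanishes outside the interval.\<close>

lemma L2_borel_representative:
  assumes f: "f \<in> L2 a b"
  shows "\<exists>g. g \<in> borel_measurable borel \<and> (\<forall>x. x \<notin> {a..b} \<longrightarrow> g x = 0) \<and>
    (AE x in lborel. x \<in> {a..b} \<longrightarrow> f x = g x) \<and> sqn a b g = ennreal ((L2_norm a b f)\<^sup>2)"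
proof -
  have fm: "(\<lambda>x. if x \<in> {a..b} then f x else 0) \<in> borel_measurable lebesgue"
    using f by (simp add: L2_def borel_measurable_if del: atLeastAtMost_iff)
  then obtain g0 where g0: "g0 \<in> borel_measurable lborel" "AE x in lborel. (if x \<in> {a..b} then f x else 0) = g0 x"
    using completion_ex_borel_measurable_real by blast
  define g where "g x = (if x \<in> {a..b} then g0 x else 0)" for x
  have [measurable]: "g0 \<in> borel_measurable borel" using g0(1) by simp
  have g [measurable]: "g \<in> borel_measurable borel" unfolding g_def[abs_def] by measurable
  have eq: "AE x in lborel. x \<in> {a..b} \<longrightarrow> f x = g x" using g0(2) by eventually_elim (auto simp: g_def)
  have "sqn a b g < \<top>"
  proof -
    have i: "integrable lebesgue (\<lambda>x. indicator {a..b} x *\<^sub>R (f x)\<^sup>2)"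
      using f by (simp add: L2_def integrable_restrict_space)
    have "sqn a b g = (\<integral>\<^sup>+x. ennreal (indicator {a..b} x *\<^sub>R (g x)\<^sup>2) \<partial>lebesgue)"
      unfolding nn_integral_completion sqn_def by (intro nn_integral_cong) (auto simp: indicator_def)
    also have "\<dots> = (\<integral>\<^sup>+x. ennreal (indicator {a..b} x *\<^sub>R (f x)\<^sup>2) \<partial>lebesgue)"
      using AE_completion[OF eq] by (intro nn_integral_cong_AE, eventually_elim) (auto simp: indicator_def)
    also have "\<dots> < \<top>" using i by (simp add: integrable_iff_bounded ennreal_indicator) 
    finally show ?thesis .
  qed
  then have "sqn a b g = ennreal ((L2_norm a b f)\<^sup>2)"
    using L2_norm_AE_borel[OF g eq] by (cases "sqn a b g") auto
  then show ?thesis using g eq by (intro exI[of _ g]) (auto simp: g_def)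
qed

text \<open>For fixed x in the open interval and \<tau> \<noteq> 0 the node is a non-constant affine
  function of h, so it avoids N for almost every h; Tonelli's theorem exchanges the quantifiers.
  Hence a change on a null set alters no class of weighted differences, for almost every
  step.\<close>

lemma AE_weighted_shifts:
  assumes N: "N \<in> null_sets lborel" and ab: "a < b" and F: "finite (F :: real set)"
  shows "AE h in lborel. AE x in lborel. x \<in> {a<..<b} \<longrightarrow> (\<forall>\<tau>\<in>F. x + \<tau> * (h * step_weight a b x) \<notin> N)"
proof -
  have [measurable]: "N \<in> sets borel" using N by auto
  have N0: "(\<integral>\<^sup>+x. indicator N x \<partial>lborel) = 0" using N by (auto simp: null_setsD1)
  have "AE h in lborel. AE x in lborel. x \<in> {a<..<b} \<longrightarrow> x + \<tau> * (h * step_weight a b x) \<notin> N" for \<tau>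
  proof -
    define K :: "real \<Rightarrow> real \<Rightarrow> ennreal" where
      "K h x = indicator N (x + \<tau> * (h * step_weight a b x)) * indicator {a<..<b} x" for h x
    have [measurable]: "(\<lambda>z. K (fst z) (snd z)) \<in> borel_measurable (borel \<Otimes>\<^sub>M borel)"
      "(\<lambda>z. K (snd z) (fst z)) \<in> borel_measurable (borel \<Otimes>\<^sub>M borel)"
      "K h \<in> borel_measurable borel" for h
      unfolding K_def[abs_def] by measurable
    have "(\<integral>\<^sup>+h. \<integral>\<^sup>+x. K h x \<partial>lborel \<partial>lborel) = (\<integral>\<^sup>+x. \<integral>\<^sup>+h. K h x \<partial>lborel \<partial>lborel)"
      by (rule lborel_pair.Fubini') measurable
    also have "\<dots> = (\<integral>\<^sup>+(x::real). 0 \<partial>lborel)"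
    proof (rule nn_integral_cong_AE, rule AE_mp[OF AE_not_in[OF N]], rule AE_I2, rule impI)
      fix x assume x: "x \<notin> N"
      show "(\<integral>\<^sup>+h. K h x \<partial>lborel) = 0"
      proof (cases "x \<in> {a<..<b} \<and> \<tau> \<noteq> 0")
        case True
        define c where "c = \<tau> * step_weight a b x"
        have c: "c \<noteq> 0" using True step_weight_pos[of a x b] by (auto simp: c_def)
        have "0 = ennreal \<bar>c\<bar> * (\<integral>\<^sup>+h. indicator N (x + c * h) \<partial>lborel)"
          unfolding N0[symmetric] using c by (intro nn_integral_real_affine) auto
        then have "(\<integral>\<^sup>+h. indicator N (x + c * h) \<partial>lborel) = (0 :: ennreal)" using c by simp
        moreover have "K h x = indicator N (x + c * h)" for h using True by (simp add: K_def c_def mult_ac)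
        ultimately show ?thesis by simp
      qed (use x in \<open>auto simp: K_def\<close>)
    qed
    finally have "(\<integral>\<^sup>+h. \<integral>\<^sup>+x. K h x \<partial>lborel \<partial>lborel) = 0" by simp
    then have "AE h in lborel. (\<integral>\<^sup>+x. K h x \<partial>lborel) = 0"
      by (subst (asm) nn_integral_0_iff_AE) auto
    then show ?thesis
    proof eventually_elim
      case (elim h)
      then have "AE x in lborel. K h x = 0" by (subst (asm) nn_integral_0_iff_AE) auto
      then show ?case by eventually_elim (auto simp: K_def indicator_def split: if_splits)
    qed
  qed
  then have "AE h in lborel. \<forall>\<tau>\<in>F. AE x in lborel. x \<in> {a<..<b} \<longrightarrow> x + \<tau> * (h * step_weight a b x) \<notin> N"
    using F by (simp add: AE_finite_all)
  then show ?thesis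
  proof eventually_elim
    case (elim h)
    then have "AE x in lborel. \<forall>\<tau>\<in>F. x \<in> {a<..<b} \<longrightarrow> x + \<tau> * (h * step_weight a b x) \<notin> N"
      using F by (intro AE_finite_allI) auto
    then show ?case by eventually_elim auto
  qed
qed

text \<open>Where the difference is not cut off, both x - a and b - x are at least s / 2 times h
  times the weight. As the squared weight is the product of these two distances, they are
  comparable, and neither can be small because their sum is b - a.\<close>

lemma step_domain_weight:
  assumes ab: "a < b" and s: "0 < s" and h: "0 < h0" "h0 \<le> h" and x: "x \<in> {a<..<b}"
    and dom: "a \<le> x - real s / 2 * (h * step_weight a b x)" "x + real s / 2 * (h * step_weight a b x) \<le> b"
  shows "sqrt (min 1 ((real s / 2 * h0)\<^sup>2)) * ((b - a) / 2) \<le> step_weight a b x"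
proof -
  define w where "w = step_weight a b x"
  define \<kappa> where "\<kappa> = min 1 ((real s / 2 * h0)\<^sup>2)"
  have w2: "w\<^sup>2 = (x - a) * (b - x)" using x by (simp add: w_def step_weight_def)
  have w0: "0 < w" using x step_weight_pos by (simp add: w_def)
  have \<kappa>: "0 < \<kappa>" "\<kappa> \<le> 1" using h s by (auto simp: \<kappa>_def)
  have k: "\<kappa> * y \<le> x'" if "real s / 2 * (h * w) \<le> x'" "w\<^sup>2 = x' * y" "0 < x'" "0 < y" for x' y
  proof -
    have "\<kappa> \<le> (real s / 2 * h0)\<^sup>2" by (simp add: \<kappa>_def)
    also have "\<dots> \<le> (real s / 2 * h)\<^sup>2" using h by (intro power_mono mult_left_mono) auto
    finally have "\<kappa> * w\<^sup>2 \<le> (real s / 2 * h)\<^sup>2 * w\<^sup>2" by (intro mult_right_mono) auto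
    also have "\<dots> = (real s / 2 * (h * w))\<^sup>2" by (simp only: power_mult_distrib mult.assoc)
    also have "\<dots> \<le> x'\<^sup>2" using that(1) h w0 by (intro power_mono) auto
    finally have "x' * (\<kappa> * y) \<le> x' * x'" unfolding that(2) by (simp add: power2_eq_square mult_ac)
    then show ?thesis using that(3) by simp
  qed
  have 1: "\<kappa> * (b - x) \<le> x - a" "\<kappa> * (x - a) \<le> b - x"
    using k[of "x - a" "b - x"] k[of "b - x" "x - a"] dom w2 x by (auto simp: w_def mult.commute)
  define L where "L = b - a"
  have "\<kappa> * (L / 2)\<^sup>2 \<le> (x - a) * (b - x)"
  proof (cases "x - a \<le> L / 2")
    case True
    then have "L / 2 \<le> b - x" by (simp add: L_def field_simps)
    then have "\<kappa> * (L / 2) \<le> \<kappa> * (b - x)" using \<kappa> by (intro mult_left_mono) auto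
    then have "\<kappa> * (L / 2) \<le> x - a" using 1 by simp
    then have "(\<kappa> * (L / 2)) * (L / 2) \<le> (x - a) * (b - x)"
      using \<open>L / 2 \<le> b - x\<close> x ab \<kappa> by (intro mult_mono) (auto simp: L_def)
    then show ?thesis by (simp add: power2_eq_square mult_ac)
  next
    case False
    then have "\<kappa> * (L / 2) \<le> \<kappa> * (x - a)" using \<kappa> by (intro mult_left_mono) auto
    then have "\<kappa> * (L / 2) \<le> b - x" using 1 by simp
    then have "(L / 2) * (\<kappa> * (L / 2)) \<le> (x - a) * (b - x)"
      using False x ab \<kappa> by (intro mult_mono) (auto simp: L_def)
    then show ?thesis by (simp add: power2_eq_square mult_ac)
  qed
  then have "sqrt (\<kappa> * (L / 2)\<^sup>2) \<le> w" by (simp add: w_def step_weight_def)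
  then show ?thesis using ab by (simp add: real_sqrt_mult L_def w_def \<kappa>_def)
qed

text \<open>A norm computed from a Bochner integral is 0 when the square is not integrable, so a
  bound on it is informative only once finiteness is known. Integrating over a compact range of
  positive steps and substituting in h, with slopes bounded below by
  \<open>step_domain_weight\<close>, gives finiteness for almost every step; countably many such
  ranges exhaust the positive steps.\<close>

lemma AE_mean_square_diff_finite:
  assumes [measurable]: "g \<in> borel_measurable borel" and fin: "(\<integral>\<^sup>+x. ennreal ((g x)\<^sup>2) \<partial>lborel) < \<top>"
    and ab: "a < b" and s: "0 < s"
  shows "AE h in lborel. 0 < h \<longrightarrow> mean_square_diff a b s g {a..b} h < \<top>"
proof -
  define \<Gamma> where "\<Gamma> = (\<integral>\<^sup>+x. ennreal ((g x)\<^sup>2) \<partial>lborel)"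
  have loc: "AE h in lborel. h \<in> {h0..T} \<longrightarrow> mean_square_diff a b s g {a..b} h < \<top>" if h0: "0 < h0" "h0 \<le> T" for h0 T
  proof -
    define w where "w = step_weight a b"
    have wm [measurable]: "w \<in> borel_measurable borel" by (simp add: w_def)
    define m where "m = sqrt (min 1 ((real s / 2 * h0)\<^sup>2)) * ((b - a) / 2)"
    have m: "0 < m" using h0 s ab by (simp add: m_def)
    define K where "K i h x = ennreal ((g (x + (real i - real s / 2) * (h * w x)))\<^sup>2)
      * (indicator {a..b} x * indicator {m..} (w x) * indicator {h0..T} h)" for i h x
    have Km [measurable]: "(\<lambda>z. K i (fst z) (snd z)) \<in> borel_measurable (borel \<Otimes>\<^sub>M borel)"
      "(\<lambda>z. K i (snd z) (fst z)) \<in> borel_measurable (borel \<Otimes>\<^sub>M borel)"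
      "K i h \<in> borel_measurable borel" for h i
      unfolding K_def[abs_def] by measurable
    have Kfin: "(\<integral>\<^sup>+h. \<integral>\<^sup>+x. K i h x \<partial>lborel \<partial>lborel) < \<top>" for i
    proof (cases "real i - real s / 2 = 0")
      \<comment> \<open>The middle node does not move with h, so no substitution is possible; the
        finite length of the range of steps is used instead.\<close>
      case True
      have "(\<integral>\<^sup>+h. \<integral>\<^sup>+x. K i h x \<partial>lborel \<partial>lborel) \<le> (\<integral>\<^sup>+h. \<Gamma> * indicator {h0..T} h \<partial>lborel)"
      proof (rule nn_integral_mono)
        fix h
        have "(\<integral>\<^sup>+x. K i h x \<partial>lborel) \<le> (\<integral>\<^sup>+x. ennreal ((g x)\<^sup>2) * indicator {h0..T} h \<partial>lborel)"
          unfolding K_def True by (intro nn_integral_mono) (auto simp: indicator_def)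
        also have "\<dots> = \<Gamma> * indicator {h0..T} h" unfolding \<Gamma>_def by (rule nn_integral_multc) measurable
        finally show "(\<integral>\<^sup>+x. K i h x \<partial>lborel) \<le> \<Gamma> * indicator {h0..T} h" .
      qed
      also have "\<dots> = \<Gamma> * ennreal (T - h0)" using h0 by (simp add: nn_integral_cmult_indicator)
      also have "\<dots> < \<top>" using fin by (simp add: \<Gamma>_def ennreal_mult_less_top)
      finally show ?thesis .
    next
      case False
      define \<tau> where "\<tau> = real i - real s / 2"
      have \<tau>: "\<tau> \<noteq> 0" using False by (simp add: \<tau>_def)
      have "(\<integral>\<^sup>+h. \<integral>\<^sup>+x. K i h x \<partial>lborel \<partial>lborel) = (\<integral>\<^sup>+x. \<integral>\<^sup>+h. K i h x \<partial>lborel \<partial>lborel)"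
        by (rule lborel_pair.Fubini') measurable
      also have "\<dots> \<le> (\<integral>\<^sup>+x. ennreal (1 / (\<bar>\<tau>\<bar> * m)) * \<Gamma> * indicator {a..b} x \<partial>lborel)"
      proof (rule nn_integral_mono)
        fix x
        show "(\<integral>\<^sup>+h. K i h x \<partial>lborel) \<le> ennreal (1 / (\<bar>\<tau>\<bar> * m)) * \<Gamma> * indicator {a..b} x"
        proof (cases "x \<in> {a..b} \<and> m \<le> w x")
          case True
          define c where "c = \<tau> * w x"
          have c: "\<bar>\<tau>\<bar> * m \<le> \<bar>c\<bar>" "c \<noteq> 0" using True m \<tau> by (auto simp: c_def abs_mult intro: mult_left_mono)
          have "\<Gamma> = ennreal \<bar>c\<bar> * (\<integral>\<^sup>+h. ennreal ((g (x + c * h))\<^sup>2) \<partial>lborel)"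
            unfolding \<Gamma>_def using c by (intro nn_integral_real_affine) auto
          then have "ennreal (1 / \<bar>c\<bar>) * \<Gamma> = ennreal (1 / \<bar>c\<bar>) * ennreal \<bar>c\<bar> * (\<integral>\<^sup>+h. ennreal ((g (x + c * h))\<^sup>2) \<partial>lborel)"
            by (simp add: mult.assoc)
          also have "ennreal (1 / \<bar>c\<bar>) * ennreal \<bar>c\<bar> = 1" using c by (simp flip: ennreal_mult add: ennreal_1)
          finally have e: "(\<integral>\<^sup>+h. ennreal ((g (x + c * h))\<^sup>2) \<partial>lborel) = ennreal (1 / \<bar>c\<bar>) * \<Gamma>" by simp
          have "(\<integral>\<^sup>+h. K i h x \<partial>lborel) \<le> (\<integral>\<^sup>+h. ennreal ((g (x + c * h))\<^sup>2) \<partial>lborel)"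
            unfolding K_def c_def \<tau>_def by (intro nn_integral_mono) (auto simp: indicator_def mult_ac)
          also have "\<dots> \<le> ennreal (1 / (\<bar>\<tau>\<bar> * m)) * \<Gamma>"
            unfolding e using c m \<tau> by (intro mult_right_mono ennreal_leI frac_le) auto
          finally show ?thesis using True by simp
        qed (auto simp: K_def)
      qed
      also have "\<dots> = ennreal (1 / (\<bar>\<tau>\<bar> * m)) * \<Gamma> * ennreal (b - a)" using ab by (simp add: nn_integral_cmult_indicator)
      also have "\<dots> < \<top>" using fin by (simp add: \<Gamma>_def ennreal_mult_less_top)
      finally show ?thesis .
    qed
    define Q where "Q = (\<lambda>i. (real (s choose i))\<^sup>2)"
    have bound: "mean_square_diff a b s g {a..b} h \<le> ennreal (real (Suc s)) * (\<Sum>i\<le>s. ennreal (Q i) * (\<integral>\<^sup>+x. K i h x \<partial>lborel))"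
      if h: "h \<in> {h0..T}" for h
    proof -
      have "mean_square_diff a b s g {a..b} h \<le> (\<integral>\<^sup>+x. ennreal (real (Suc s)) * (\<Sum>i\<le>s. ennreal (Q i) * K i h x) \<partial>lborel)"
        unfolding mean_square_diff_def
      proof (rule nn_integral_mono_AE, rule AE_mp[OF AE_conjI[OF AE_lborel_singleton[of a] AE_lborel_singleton[of b]]], rule AE_I2, rule impI)
        fix x assume xab: "x \<noteq> a \<and> x \<noteq> b"
        show "ennreal ((sym_diff a b s (h * step_weight a b x) g x)\<^sup>2) * indicator {a..b} x
          \<le> ennreal (real (Suc s)) * (\<Sum>i\<le>s. ennreal (Q i) * K i h x)"
        proof (cases "x \<in> {a..b} \<and> sym_diff a b s (h * step_weight a b x) g x \<noteq> 0")
          case True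
          then have "x - real s / 2 * (h * w x) \<in> {a..b}" "x + real s / 2 * (h * w x) \<in> {a..b}"
            by (auto simp: sym_diff_eq_fdiff w_def split: if_splits)
          then have mw: "m \<le> w x"
            using step_domain_weight[OF ab s h0(1), of h x] True xab h unfolding m_def w_def by auto
          have "sym_diff a b s (h * step_weight a b x) g x
            = (\<Sum>i\<le>s. real (s choose i) * (-1) ^ i * g (x + (real i - real s / 2) * (h * w x)))"
            using True unfolding sym_diff_def w_def by (metis (no_types, lifting))
          then have "ennreal ((sym_diff a b s (h * step_weight a b x) g x)\<^sup>2)
            \<le> ennreal (real (card {..s})) * (\<Sum>i\<le>s. ennreal ((real (s choose i) * (-1) ^ i * g (x + (real i - real s / 2) * (h * w x)))\<^sup>2))"
            by (simp only:) (rule ennreal_square_sum_le, simp)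
          also have "(\<Sum>i\<le>s. ennreal ((real (s choose i) * (-1) ^ i * g (x + (real i - real s / 2) * (h * w x)))\<^sup>2))
            = (\<Sum>i\<le>s. ennreal (Q i) * K i h x)"
          proof (intro sum.cong refl)
            fix i
            have "((-1) ^ i :: real)\<^sup>2 = 1" by (simp flip: power_mult)
            then show "ennreal ((real (s choose i) * (-1) ^ i * g (x + (real i - real s / 2) * (h * w x)))\<^sup>2) = ennreal (Q i) * K i h x"
              using True mw h by (simp add: K_def Q_def power_mult_distrib ennreal_mult)
          qed
          finally show ?thesis using True by simp
        qed auto
      qed
      also have "\<dots> = ennreal (real (Suc s)) * (\<Sum>i\<le>s. ennreal (Q i) * (\<integral>\<^sup>+x. K i h x \<partial>lborel))"
        by (simp add: nn_integral_cmult nn_integral_sum)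
      finally show ?thesis .
    qed
    have "AE h in lborel. \<forall>i\<in>{..s}. (\<integral>\<^sup>+x. K i h x \<partial>lborel) < \<top>"
    proof (intro AE_finite_allI)
      fix i
      have "AE h in lborel. (\<integral>\<^sup>+x. K i h x \<partial>lborel) \<noteq> \<infinity>"
        using Kfin[of i] by (intro nn_integral_PInf_AE) auto
      then show "AE h in lborel. (\<integral>\<^sup>+x. K i h x \<partial>lborel) < \<top>" by eventually_elim (auto simp: less_top)
    qed simp
    then show ?thesis
    proof eventually_elim
      case (elim h)
      show ?case
      proof
        assume "h \<in> {h0..T}"
        from bound[OF this] show "mean_square_diff a b s g {a..b} h < \<top>"
          by (rule order_le_less_trans) (use elim in \<open>auto simp: ennreal_mult_less_top\<close>)
      qed
    qed
  qed
  have "AE h in lborel. \<forall>n. h \<in> {1 / real (Suc n)..real (Suc n)} \<longrightarrow> mean_square_diff a b s g {a..b} h < \<top>"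
    unfolding AE_all_countable by (intro allI loc) (auto simp: field_simps)
  then show ?thesis
  proof eventually_elim
    case (elim h)
    show ?case
    proof
      assume h: "0 < h"
      obtain n1 where n1: "inverse (real (Suc n1)) < h" using reals_Archimedean[OF h] by auto
      obtain n2 where n2: "h < real n2" using reals_Archimedean2 by auto
      define n where "n = max n1 n2"
      have "1 / real (Suc n) \<le> 1 / real (Suc n1)" by (intro divide_left_mono) (auto simp: n_def)
      then have "h \<in> {1 / real (Suc n)..real (Suc n)}" using n1 n2 by (auto simp: n_def inverse_eq_divide)
      then show "mean_square_diff a b s g {a..b} h < \<top>" using elim by blast
    qed
  qed
qed

text \<open>The bound on the supremum over steps passes to the Borel function for almost every step,
  which suffices for the integrated form in \<open>smooth_function\<close>; squaring the norm
  squares the constant.\<close>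

lemma smooth_class_representative:
  assumes ab: "a < b" and \<alpha>: "1 \<le> \<alpha>" and C: "0 < C" and f: "f \<in> smooth_class a b \<alpha> C"
  shows "\<exists>g. smooth_function a b (nat \<lfloor>\<alpha>\<rfloor> + 1) g \<alpha> (C\<^sup>2) \<and> (AE x in lborel. x \<in> {a..b} \<longrightarrow> f x = g x)"
proof -
  define s where "s = nat \<lfloor>\<alpha>\<rfloor> + 1"
  have s: "0 < s" by (simp add: s_def)
  have fL: "f \<in> L2 a b" and fmod: "\<And>t. 0 < t \<Longrightarrow> weighted_modulus a b s f t \<le> ennreal (C * t powr \<alpha>)"
    using f by (auto simp: smooth_class_def s_def)
  obtain g where g [measurable]: "g \<in> borel_measurable borel" and g0: "\<And>x. x \<notin> {a..b} \<Longrightarrow> g x = 0"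
    and eq: "AE x in lborel. x \<in> {a..b} \<longrightarrow> f x = g x" and gn: "sqn a b g = ennreal ((L2_norm a b f)\<^sup>2)"
    using L2_borel_representative[OF fL] by blast
  have gfin: "(\<integral>\<^sup>+x. ennreal ((g x)\<^sup>2) \<partial>lborel) < \<top>"
  proof -
    have "(\<integral>\<^sup>+x. ennreal ((g x)\<^sup>2) \<partial>lborel) = sqn a b g"
      unfolding sqn_def using g0 by (intro nn_integral_cong) (auto simp: indicator_def)
    then show ?thesis by (simp add: gn)
  qed
  have gint: "integrable lborel g"
  proof (rule integrableI_bounded)
    have "(\<integral>\<^sup>+x. ennreal (norm (g x)) \<partial>lborel) \<le> (\<integral>\<^sup>+x. indicator {a..b} x + ennreal ((g x)\<^sup>2) \<partial>lborel)"
    proof (rule nn_integral_mono)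
      fix x
      have "\<bar>y\<bar> \<le> 1 + y\<^sup>2" for y :: real
        using zero_le_power2[of "\<bar>y\<bar> - 1"] by (simp add: power2_eq_square algebra_simps)
      then have "ennreal \<bar>g x\<bar> \<le> ennreal (1 + (g x)\<^sup>2)" by (rule ennreal_leI)
      also have "\<dots> = ennreal 1 + ennreal ((g x)\<^sup>2)" by (rule ennreal_plus) auto
      finally have "ennreal \<bar>g x\<bar> \<le> ennreal 1 + ennreal ((g x)\<^sup>2)" .
      then show "ennreal (norm (g x)) \<le> indicator {a..b} x + ennreal ((g x)\<^sup>2)"
        using g0[of x] by (cases "x \<in> {a..b}") auto
    qed
    also have "\<dots> = ennreal (b - a) + (\<integral>\<^sup>+x. ennreal ((g x)\<^sup>2) \<partial>lborel)"
      using ab by (subst nn_integral_add) auto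
    also have "\<dots> < \<infinity>" using gfin by simp
    finally show "(\<integral>\<^sup>+x. ennreal (norm (g x)) \<partial>lborel) < \<infinity>" .
  qed simp
  obtain N where N: "N \<in> null_sets lborel" "\<And>x. x \<notin> N \<Longrightarrow> x \<in> {a..b} \<Longrightarrow> f x = g x"
    using AE_E3[OF eq] by auto
  have good: "AE h in lborel. 0 < h \<longrightarrow> mean_square_diff a b s g {a..b} h \<le> ennreal (C\<^sup>2 * h powr (2 * \<alpha>))"
    using AE_weighted_shifts[OF N(1) ab, of "(\<lambda>i. real i - real s / 2) ` {..s}", simplified]
      AE_mean_square_diff_finite[OF g gfin ab s]
  proof eventually_elim
    case (elim h)
    show ?case
    proof
      assume h: "0 < h"
      define u where "u x = sym_diff a b s (h * step_weight a b x) f x" for x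
      define v where "v x = sym_diff a b s (h * step_weight a b x) g x" for x
      have vm: "v \<in> borel_measurable borel" unfolding v_def[abs_def] by measurable
      have "AE x in lborel. x \<in> {a..b} \<longrightarrow> u x = v x"
        using elim(1) AE_lborel_singleton[of a] AE_lborel_singleton[of b]
      proof eventually_elim
        case (elim x)
        show ?case
        proof
          assume "x \<in> {a..b}"
          then have x: "\<forall>i\<in>{..s}. x + (real i - real s / 2) * (h * step_weight a b x) \<notin> N" using elim by auto
          define w where "w = h * step_weight a b x"
          have w0: "0 \<le> w" using h \<open>x \<in> {a..b}\<close> by (simp add: w_def step_weight_def)
          have "f (x + (real i - real s / 2) * w) = g (x + (real i - real s / 2) * w)"
            if "i \<le> s" "x + (0 - real s / 2) * w \<in> {a..b}" "x + (real s - real s / 2) * w \<in> {a..b}" for i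
          proof (rule N(2))
            show "x + (real i - real s / 2) * w \<notin> N" using x that by (auto simp: w_def)
            have "(0 - real s / 2) * w \<le> (real i - real s / 2) * w" "(real i - real s / 2) * w \<le> (real s - real s / 2) * w"
              using that(1) w0 by (intro mult_right_mono; simp)+
            then show "x + (real i - real s / 2) * w \<in> {a..b}" using that(2,3) by auto
          qed
          then show "u x = v x" by (simp add: u_def v_def sym_diff_def w_def)
        qed
      qed
      then have n: "(L2_norm a b u)\<^sup>2 = enn2real (sqn a b v)" by (rule L2_norm_AE_borel[OF vm])
      have msd: "mean_square_diff a b s g {a..b} h = sqn a b v" by (simp add: mean_square_diff_def sqn_def v_def)
      then have "sqn a b v < \<top>" using elim(2) h by simp
      then have "mean_square_diff a b s g {a..b} h = ennreal ((L2_norm a b u)\<^sup>2)"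
        unfolding msd n by (cases "sqn a b v") auto
      moreover have "L2_norm a b u \<le> C * h powr \<alpha>"
      proof -
        have "ennreal (L2_norm a b u) \<le> weighted_modulus a b s f h"
          unfolding weighted_modulus_def u_def[abs_def] using h by (intro SUP_upper) auto
        also have "\<dots> \<le> ennreal (C * h powr \<alpha>)" by (rule fmod[OF h])
        finally show ?thesis using C by (subst (asm) ennreal_le_iff) auto
      qed
      moreover have "0 \<le> L2_norm a b u" by (simp add: L2_norm_def L2_inner_def)
      ultimately have "mean_square_diff a b s g {a..b} h \<le> ennreal ((C * h powr \<alpha>)\<^sup>2)"
        by (simp add: power_mono ennreal_leI)
      also have "(C * h powr \<alpha>)\<^sup>2 = C\<^sup>2 * h powr (2 * \<alpha>)"
        using h by (simp add: power_mult_distrib powr_powr[symmetric] power2_eq_square flip: powr_add)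
      finally show "mean_square_diff a b s g {a..b} h \<le> ennreal (C\<^sup>2 * h powr (2 * \<alpha>))" .
    qed
  qed
  have "smooth_function a b s g \<alpha> (C\<^sup>2)"
  proof
    fix t :: real assume t: "0 < t"
    have "(\<integral>\<^sup>+h\<in>{0..t}. mean_square_diff a b s g {a..b} h \<partial>lborel) \<le> (\<integral>\<^sup>+h. ennreal (C\<^sup>2 * t powr (2 * \<alpha>)) * indicator {0..t} h \<partial>lborel)"
    proof (rule nn_integral_mono_AE)
      show "AE h in lborel. mean_square_diff a b s g {a..b} h * indicator {0..t} h \<le> ennreal (C\<^sup>2 * t powr (2 * \<alpha>)) * indicator {0..t} h"
        using good AE_lborel_singleton[of 0]
      proof eventually_elim
        case (elim h)
        show ?case
        proof (cases "h \<in> {0..t}")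
          case True
          then have "mean_square_diff a b s g {a..b} h \<le> ennreal (C\<^sup>2 * h powr (2 * \<alpha>))" using elim by auto
          also have "\<dots> \<le> ennreal (C\<^sup>2 * t powr (2 * \<alpha>))"
            using True \<alpha> by (intro ennreal_leI mult_left_mono powr_mono2) auto
          finally show ?thesis using True by simp
        qed simp
      qed
    qed
    also have "\<dots> = ennreal (C\<^sup>2 * t powr (2 * \<alpha> + 1))"
      using t by (subst nn_integral_cmult_indicator) (auto simp: powr_add ennreal_mult[symmetric] mult.assoc)
    finally show "(\<integral>\<^sup>+h\<in>{0..t}. mean_square_diff a b s g {a..b} h \<partial>lborel) \<le> ennreal (C\<^sup>2 * t powr (2 * \<alpha> + 1))" .
  qed (use ab gint s \<alpha> C in auto)
  then show ?thesis using eq unfolding s_def by blast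
qed

theorem smooth_class_polynomial_approximation:
  assumes ab: "a < b" and \<alpha>: "1 \<le> \<alpha>" and C: "0 < C"
  shows "\<exists>K N0. 0 \<le> K \<and> (\<forall>f\<in>smooth_class a b \<alpha> C. \<forall>N\<ge>N0. \<exists>q. (\<forall>i\<ge>N. coeff q i = 0) \<and>
    (L2_norm a b (\<lambda>x. f x - poly q x))\<^sup>2 \<le> K * real N powr (- 2 * \<alpha>))"
proof -
  define s where "s = nat \<lfloor>\<alpha>\<rfloor> + 1"
  define K where "K = smooth_function.jackson_const a b s \<alpha> (C\<^sup>2)"
  \<comment> \<open>\<open>max K 0\<close> is used because non-negativity of \<open>K\<close> is
    known only inside the locale, hence only when the class has a member.\<close>
  have "\<exists>q. (\<forall>i\<ge>N. coeff q i = 0) \<and> (L2_norm a b (\<lambda>x. f x - poly q x))\<^sup>2 \<le> max K 0 * real N powr (- 2 * \<alpha>)"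
    if f: "f \<in> smooth_class a b \<alpha> C" and N: "max 2000 (2 * s) \<le> N" for f N
  proof -
    obtain g where g: "smooth_function a b s g \<alpha> (C\<^sup>2)" and eq: "AE x in lborel. x \<in> {a..b} \<longrightarrow> f x = g x"
      using smooth_class_representative[OF ab \<alpha> C f] unfolding s_def by blast
    interpret smooth_function a b s g \<alpha> "C\<^sup>2" by (rule g)
    obtain q where q: "\<forall>i\<ge>N. coeff q i = 0" "sqn a b (\<lambda>x. g x - poly q x) \<le> ennreal (jackson_const * real N powr (- 2 * \<alpha>))"
      using polynomial_approximation[of N] N by auto
    have "(L2_norm a b (\<lambda>x. f x - poly q x))\<^sup>2 = enn2real (sqn a b (\<lambda>x. g x - poly q x))"
    proof (rule L2_norm_AE_borel)
      show "(\<lambda>x. g x - poly q x) \<in> borel_measurable borel" using f_measurable by measurable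
      show "AE x in lborel. x \<in> {a..b} \<longrightarrow> f x - poly q x = g x - poly q x"
        using eq by eventually_elim auto
    qed
    also have "\<dots> \<le> enn2real (ennreal (jackson_const * real N powr (- 2 * \<alpha>)))"
      using q(2) by (intro enn2real_mono) auto
    also have "\<dots> = K * real N powr (- 2 * \<alpha>)" using jackson_const_nonneg by (simp add: K_def)
    also have "\<dots> \<le> max K 0 * real N powr (- 2 * \<alpha>)" by (intro mult_right_mono) auto
    finally show ?thesis using q(1) by blast
  qed
  then show ?thesis by (intro exI[of _ "max K 0"] exI[of _ "max 2000 (2 * s)"]) auto
qed

section \<open>Spans of mixands\<close>

lemma L2_measurable: "f \<in> L2 a b \<Longrightarrow> f \<in> borel_measurable (lebesgue_on {a..b})"
  and L2_square_integrable: "f \<in> L2 a b \<Longrightarrow> integrable (lebesgue_on {a..b}) (\<lambda>x. (f x)\<^sup>2)"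
  by (simp_all add: L2_def)

lemma L2_mult_integrable:
  assumes "f \<in> L2 a b" "g \<in> L2 a b"
  shows "integrable (lebesgue_on {a..b}) (\<lambda>x. f x * g x)"
proof (rule Bochner_Integration.integrable_bound)
  show "integrable (lebesgue_on {a..b}) (\<lambda>x. (f x)\<^sup>2 + (g x)\<^sup>2)"
    using assms by (intro Bochner_Integration.integrable_add L2_square_integrable)
  show "(\<lambda>x. f x * g x) \<in> borel_measurable (lebesgue_on {a..b})"
    using assms by (intro borel_measurable_times L2_measurable)
  have "\<bar>y * z\<bar> \<le> y\<^sup>2 + z\<^sup>2" for y z :: real
  proof -
    have "0 \<le> (\<bar>y\<bar> - \<bar>z\<bar>)\<^sup>2" by simp
    then have "2 * \<bar>y * z\<bar> \<le> y\<^sup>2 + z\<^sup>2" by (simp add: power2_eq_square algebra_simps abs_mult)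
    moreover have "0 \<le> \<bar>y * z\<bar>" by simp
    ultimately show ?thesis by linarith
  qed
  then show "AE x in lebesgue_on {a..b}. norm (f x * g x) \<le> norm ((f x)\<^sup>2 + (g x)\<^sup>2)" by auto
qed

lemma L2_cmult: "f \<in> L2 a b \<Longrightarrow> (\<lambda>x. k * f x) \<in> L2 a b"
  by (auto simp: L2_def power_mult_distrib)

lemma L2_add:
  assumes "f \<in> L2 a b" "g \<in> L2 a b" shows "(\<lambda>x. f x + g x) \<in> L2 a b"
proof -
  have "integrable (lebesgue_on {a..b}) (\<lambda>x. (f x)\<^sup>2 + (g x)\<^sup>2 + 2 * (f x * g x))"
    using assms by (intro Bochner_Integration.integrable_add integrable_mult_right L2_square_integrable L2_mult_integrable)
  moreover have "(\<lambda>x. (f x)\<^sup>2 + (g x)\<^sup>2 + 2 * (f x * g x)) = (\<lambda>x. (f x + g x)\<^sup>2)"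
    by (simp add: power2_sum mult.assoc)
  ultimately show ?thesis using assms by (auto simp: L2_def)
qed

lemma L2_diff: "f \<in> L2 a b \<Longrightarrow> g \<in> L2 a b \<Longrightarrow> (\<lambda>x. f x - g x) \<in> L2 a b"
  using L2_add[of f a b "\<lambda>x. (-1) * g x"] L2_cmult[of g a b "-1"] by simp

lemma L2_zero: "(\<lambda>x. 0) \<in> L2 a b"
  by (simp add: L2_def)

lemma L2_sum: "(\<And>i. i \<in> A \<Longrightarrow> f i \<in> L2 a b) \<Longrightarrow> (\<lambda>x. \<Sum>i\<in>A. f i x) \<in> L2 a b"
  by (induction A rule: infinite_finite_induct) (auto intro: L2_add L2_zero)

lemma L2_continuous:
  assumes "continuous_on {a..b} f" shows "f \<in> L2 a b"
  using continuous_imp_integrable_real[OF assms] 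
    continuous_imp_integrable_real[of a b "\<lambda>x. (f x)\<^sup>2"] assms
  by (auto simp: L2_def intro: continuous_on_power)

lemma L2_inner_commute: "L2_inner a b f g = L2_inner a b g f"
  by (simp add: L2_inner_def mult.commute)

lemma L2_inner_add: "f \<in> L2 a b \<Longrightarrow> g \<in> L2 a b \<Longrightarrow> h \<in> L2 a b \<Longrightarrow>
  L2_inner a b (\<lambda>x. f x + g x) h = L2_inner a b f h + L2_inner a b g h"
  by (simp add: L2_inner_def distrib_right L2_mult_integrable)

lemma L2_inner_diff: "f \<in> L2 a b \<Longrightarrow> g \<in> L2 a b \<Longrightarrow> h \<in> L2 a b \<Longrightarrow>
  L2_inner a b (\<lambda>x. f x - g x) h = L2_inner a b f h - L2_inner a b g h"
  by (simp add: L2_inner_def left_diff_distrib L2_mult_integrable)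

lemma L2_inner_cmult: "L2_inner a b (\<lambda>x. k * f x) h = k * L2_inner a b f h"
  by (simp add: L2_inner_def mult.assoc)

lemma L2_inner_sum: "(\<And>i. i \<in> A \<Longrightarrow> f i \<in> L2 a b) \<Longrightarrow> h \<in> L2 a b \<Longrightarrow>
  L2_inner a b (\<lambda>x. \<Sum>i\<in>A. k i * f i x) h = (\<Sum>i\<in>A. k i * L2_inner a b (f i) h)"
proof (induction A rule: infinite_finite_induct)
  case (insert i A)
  then have "L2_inner a b (\<lambda>x. k i * f i x + (\<Sum>i\<in>A. k i * f i x)) h
    = L2_inner a b (\<lambda>x. k i * f i x) h + L2_inner a b (\<lambda>x. \<Sum>i\<in>A. k i * f i x) h"
    by (intro L2_inner_add L2_cmult L2_sum) auto
  then show ?case using insert by (simp add: L2_inner_cmult)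
qed (auto simp: L2_inner_def)

lemma L2_inner_nonneg: "0 \<le> L2_inner a b f f"
  by (simp add: L2_inner_def)

lemma L2_norm_nonneg: "0 \<le> L2_norm a b f"
  by (simp add: L2_norm_def L2_inner_nonneg)

lemma L2_norm_square: "(L2_norm a b f)\<^sup>2 = L2_inner a b f f"
  by (simp add: L2_norm_def L2_inner_nonneg)

lemma L2_norm_cmult: "L2_norm a b (\<lambda>x. k * f x) = \<bar>k\<bar> * L2_norm a b f"
proof -
  have "L2_inner a b (\<lambda>x. k * f x) (\<lambda>x. k * f x) = k\<^sup>2 * L2_inner a b f f"
    unfolding L2_inner_cmult L2_inner_commute[of a b f "\<lambda>x. k * f x"] by (simp add: power2_eq_square)
  then show ?thesis by (simp add: L2_norm_def real_sqrt_mult)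
qed

lemma L2_norm_add_square:
  assumes "f \<in> L2 a b" "g \<in> L2 a b"
  shows "(L2_norm a b (\<lambda>x. f x + g x))\<^sup>2 = (L2_norm a b f)\<^sup>2 + 2 * L2_inner a b f g + (L2_norm a b g)\<^sup>2"
proof -
  have 1: "L2_inner a b h (\<lambda>x. f x + g x) = L2_inner a b h f + L2_inner a b h g" if "h \<in> L2 a b" for h
    using L2_inner_add[OF assms that] by (simp only: L2_inner_commute[of a b h "\<lambda>x. f x + g x"]
      L2_inner_commute[of a b h f] L2_inner_commute[of a b h g])
  have "L2_inner a b (\<lambda>x. f x + g x) (\<lambda>x. f x + g x)
    = (L2_inner a b f f + L2_inner a b f g) + (L2_inner a b g f + L2_inner a b g g)"
    using assms by (subst L2_inner_add) (auto simp: 1 L2_add)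
  then show ?thesis using L2_inner_commute[of a b g f] by (simp add: L2_norm_square)
qed

lemma L2_norm_diff_square:
  assumes "f \<in> L2 a b" "g \<in> L2 a b"
  shows "(L2_norm a b (\<lambda>x. f x - g x))\<^sup>2 = (L2_norm a b f)\<^sup>2 - 2 * L2_inner a b f g + (L2_norm a b g)\<^sup>2"
  using L2_norm_add_square[OF assms(1) L2_cmult[OF assms(2), of "-1"]] L2_norm_cmult[of a b "-1" g]
    L2_inner_cmult[of a b "-1" g f] L2_inner_commute[of a b f g]
    L2_inner_commute[of a b f "\<lambda>x. (-1) * g x"] by simp

lemma L2_Cauchy_Schwarz:
  assumes f: "f \<in> L2 a b" and g: "g \<in> L2 a b"
  shows "\<bar>L2_inner a b f g\<bar> \<le> L2_norm a b f * L2_norm a b g"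
proof -
  define I F G where "I = L2_inner a b f g" and "F = L2_inner a b f f" and "G = L2_inner a b g g"
  have q: "0 \<le> F - 2 * t * I + t\<^sup>2 * G" for t
  proof -
    have "0 \<le> (L2_norm a b (\<lambda>x. f x - t * g x))\<^sup>2" by simp
    also have "\<dots> = F - 2 * (t * I) + t\<^sup>2 * G"
      using L2_norm_diff_square[OF f L2_cmult[OF g, of t]] L2_inner_cmult[of a b t g f]
        L2_inner_commute[of a b f g] L2_inner_commute[of a b f "\<lambda>x. t * g x"]
      by (simp add: L2_norm_cmult L2_norm_square power_mult_distrib I_def F_def G_def)
    finally show ?thesis by simp
  qed
  have FG: "0 \<le> F" "0 \<le> G" by (simp_all add: F_def G_def L2_inner_nonneg)
  have "I\<^sup>2 \<le> F * G"
  proof (cases "G = 0")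
    case True
    have "I = 0"
    proof (rule ccontr)
      assume "I \<noteq> 0"
      then show False using q[of "(F + 1) / (2 * I)"] True by (simp add: field_simps)
    qed
    then show ?thesis using FG by simp
  next
    case False
    then have G: "0 < G" using FG by simp
    have "0 \<le> F - 2 * (I / G) * I + (I / G)\<^sup>2 * G" by (rule q)
    also have "\<dots> = F - I\<^sup>2 / G" using G by (simp add: power2_eq_square)
    finally show ?thesis using G by (simp add: field_simps)
  qed
  then have "sqrt (I\<^sup>2) \<le> sqrt (F * G)" by (rule real_sqrt_le_mono)
  then show ?thesis by (simp add: I_def F_def G_def L2_norm_def real_sqrt_mult)
qed

lemma L2_norm_triangle:
  assumes "f \<in> L2 a b" "g \<in> L2 a b"
  shows "L2_norm a b (\<lambda>x. f x + g x) \<le> L2_norm a b f + L2_norm a b g"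
proof (rule power2_le_imp_le)
  show "(L2_norm a b (\<lambda>x. f x + g x))\<^sup>2 \<le> (L2_norm a b f + L2_norm a b g)\<^sup>2"
    unfolding L2_norm_add_square[OF assms] power2_sum using L2_Cauchy_Schwarz[OF assms] by simp
qed (simp add: L2_norm_nonneg add_nonneg_nonneg)

lemma L2_norm_le_sup_mult:
  assumes g: "g \<in> L2 a b" and h: "h \<in> L2 a b" and M: "0 \<le> M" "\<And>x. x \<in> {a..b} \<Longrightarrow> \<bar>g x\<bar> \<le> M * \<bar>h x\<bar>"
  shows "L2_norm a b g \<le> M * L2_norm a b h"
proof (rule power2_le_imp_le)
  have "L2_inner a b g g \<le> (LINT x|lebesgue_on {a..b}. M\<^sup>2 * (h x)\<^sup>2)"
    unfolding L2_inner_def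
  proof (rule integral_mono)
    show "integrable (lebesgue_on {a..b}) (\<lambda>x. M\<^sup>2 * (h x)\<^sup>2)"
      by (intro integrable_mult_right L2_square_integrable h)
    fix x assume "x \<in> space (lebesgue_on {a..b})"
    then have "\<bar>g x\<bar>\<^sup>2 \<le> (M * \<bar>h x\<bar>)\<^sup>2" using M(2)[of x] by (intro power_mono) auto
    then have "(g x)\<^sup>2 \<le> M\<^sup>2 * (h x)\<^sup>2" by (simp add: power_mult_distrib)
    then show "g x * g x \<le> M\<^sup>2 * (h x)\<^sup>2" by (simp only: power2_eq_square)
  qed (rule L2_mult_integrable[OF g g])
  also have "\<dots> = M\<^sup>2 * L2_inner a b h h" by (simp add: L2_inner_def power2_eq_square)
  finally show "(L2_norm a b g)\<^sup>2 \<le> (M * L2_norm a b h)\<^sup>2"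
    by (simp add: power_mult_distrib L2_norm_square)
qed (simp add: M L2_norm_nonneg)

lemma L2_inner_continuous:
  assumes "continuous_on {a..b} f" "continuous_on {a..b} g"
  shows "L2_inner a b f g = integral {a..b} (\<lambda>x. f x * g x)"
  unfolding L2_inner_def
  using assms by (intro lebesgue_integral_eq_integral continuous_imp_integrable_real continuous_intros) auto

section \<open>Mixand spans as polynomials divided by the power series\<close>

locale mixands =
  fixes c :: "nat \<Rightarrow> real" and a b :: real
  assumes c_pos: "\<And>k. 0 < c k" and c_0: "c 0 = 1" and a_nonneg: "0 \<le> a" and ab: "a < b"
    and radius: "ereal b < conv_radius c"
begin

abbreviation Z :: "real \<Rightarrow> real" where "Z \<equiv> ps_sum c"
abbreviation nrm :: "(real \<Rightarrow> real) \<Rightarrow> real" where "nrm \<equiv> L2_norm a b"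
abbreviation ip :: "(real \<Rightarrow> real) \<Rightarrow> (real \<Rightarrow> real) \<Rightarrow> real" where "ip \<equiv> L2_inner a b"
abbreviation span_below :: "nat \<Rightarrow> (real \<Rightarrow> real) set" where "span_below \<equiv> mixand_span c"
abbreviation proj :: "nat \<Rightarrow> (real \<Rightarrow> real) \<Rightarrow> real \<Rightarrow> real" where "proj \<equiv> mixand_proj c a b"
abbreviation proj_est :: "nat \<Rightarrow> nat \<Rightarrow> (nat \<Rightarrow> nat) \<Rightarrow> real \<Rightarrow> real" where
  "proj_est \<equiv> proj_estimator c a b"

lemma b_pos: "0 < b" using a_nonneg ab by simp

lemma larger_radius: "\<exists>K>b. summable (\<lambda>k. c k * K ^ k)"
proof -
  obtain K where K: "ereal b < ereal K" "ereal K < conv_radius c" using ereal_dense2[OF radius] by auto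
  then have "summable (\<lambda>k. c k * K ^ k)" using b_pos by (intro summable_in_conv_radius) auto
  then show ?thesis using K by auto
qed

lemma summable_Z: "x \<in> {0..b} \<Longrightarrow> summable (\<lambda>k. c k * x ^ k)"
proof -
  assume x: "x \<in> {0..b}"
  then have "ereal (norm x) \<le> ereal b" by simp
  then have "ereal (norm x) < conv_radius c" using radius by (rule order_le_less_trans)
  then show ?thesis by (rule summable_in_conv_radius)
qed

lemma Z_ge_1: "x \<in> {0..b} \<Longrightarrow> 1 \<le> Z x"
proof -
  assume x: "x \<in> {0..b}"
  have "(\<Sum>k\<in>{0}. c k * x ^ k) \<le> (\<Sum>k. c k * x ^ k)"
    using x c_pos by (intro sum_le_suminf summable_Z) (auto simp: less_imp_le)
  then show ?thesis by (simp add: ps_sum_def c_0)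
qed

lemma Z_le: "x \<in> {0..b} \<Longrightarrow> Z x \<le> Z b"
  unfolding ps_sum_def using c_pos b_pos
  by (intro suminf_le summable_Z mult_left_mono power_mono) (auto simp: less_imp_le)

lemma Z_continuous: "continuous_on {a..b} Z"
proof -
  obtain K where K: "K > b" "summable (\<lambda>k. c k * K ^ k)" using larger_radius by blast
  have "isCont Z x" if "x \<in> {a..b}" for x
    unfolding ps_sum_def[abs_def] using K that a_nonneg by (intro isCont_powser[OF K(2)]) auto
  then show ?thesis by (simp add: continuous_at_imp_continuous_on)
qed

lemma in_ab: "x \<in> {a..b} \<Longrightarrow> x \<in> {0..b}" using a_nonneg by auto

text \<open>Multiplication by Z turns the span of the first m mixands into the polynomials of degree
  below m. On the interval 1 \<le> Z \<le> Z b, so polynomial inequalities carry over at the cost of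
  a constant.\<close>

definition quo :: "real poly \<Rightarrow> real \<Rightarrow> real" where "quo p x = poly p x / Z x"

lemma quo_add: "quo (p + q) x = quo p x + quo q x" by (simp add: quo_def add_divide_distrib)
lemma quo_smult: "quo (smult k p) x = k * quo p x" by (simp add: quo_def)
lemma quo_diff: "quo (p - q) x = quo p x - quo q x" by (simp add: quo_def diff_divide_distrib)
lemma quo_sum: "quo (\<Sum>i\<in>A. p i) x = (\<Sum>i\<in>A. quo (p i) x)" by (simp add: quo_def poly_sum sum_divide_distrib)

lemma quo_continuous: "continuous_on {a..b} (quo p)"
  unfolding quo_def[abs_def] using Z_ge_1[OF in_ab]
  by (intro continuous_intros Z_continuous) force

lemma quo_L2: "quo p \<in> L2 a b" by (intro L2_continuous quo_continuous)

lemma mixand_eq_quo: "mixand c x k = quo (monom (c k) k) x"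
  by (simp add: mixand_def quo_def poly_monom)

lemma mixand_L2: "(\<lambda>x. mixand c x k) \<in> L2 a b"
  unfolding mixand_eq_quo by (rule quo_L2)

lemma span_eq: "span_below m = {quo p |p. \<forall>i\<ge>m. coeff p i = 0}"
proof (intro equalityI subsetI)
  fix g assume "g \<in> span_below m"
  then obtain q where g: "g = (\<lambda>\<theta>. \<Sum>k<m. q k * mixand c \<theta> k)" by (auto simp: mixand_span_def)
  define p where "p = (\<Sum>k<m. smult (q k) (monom (c k) k))"
  have "g = quo p" unfolding g p_def by (rule ext) (simp add: quo_sum quo_smult mixand_eq_quo)
  moreover have "\<forall>i\<ge>m. coeff p i = 0" by (simp add: p_def coeff_sum)
  ultimately show "g \<in> {quo p |p. \<forall>i\<ge>m. coeff p i = 0}" by blast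
next
  fix g assume "g \<in> {quo p |p. \<forall>i\<ge>m. coeff p i = 0}"
  then obtain p where p: "g = quo p" "\<And>i. i \<ge> m \<Longrightarrow> coeff p i = 0" by blast
  have p_eq: "p = (\<Sum>k<m. smult (coeff p k / c k) (monom (c k) k))"
  proof (rule poly_eqI)
    fix i show "coeff p i = coeff (\<Sum>k<m. smult (coeff p k / c k) (monom (c k) k)) i"
      using p(2)[of i] c_pos[of i] by (cases "i < m") (auto simp: coeff_sum if_distrib cong: if_cong)
  qed
  have "g = (\<lambda>\<theta>. \<Sum>k<m. (coeff p k / c k) * mixand c \<theta> k)"
  proof
    fix \<theta>
    have "quo p \<theta> = quo (\<Sum>k<m. smult (coeff p k / c k) (monom (c k) k)) \<theta>"
      using p_eq by (rule arg_cong)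
    then show "g \<theta> = (\<Sum>k<m. (coeff p k / c k) * mixand c \<theta> k)"
      by (simp add: p(1) quo_sum quo_smult mixand_eq_quo)
  qed
  then show "g \<in> span_below m"
    unfolding mixand_span_def by (intro CollectI exI[of _ "\<lambda>k. coeff p k / c k"])
qed

lemma poly_norm_le_quo_norm:
  "integral {a..b} (\<lambda>x. (poly p x)\<^sup>2) \<le> (Z b)\<^sup>2 * (nrm (quo p))\<^sup>2"
proof -
  have "integral {a..b} (\<lambda>x. (poly p x)\<^sup>2) = (nrm (poly p))\<^sup>2"
    unfolding L2_norm_square by (subst L2_inner_continuous) (auto simp: power2_eq_square intro!: continuous_intros)
  also have "\<dots> \<le> (Z b * nrm (quo p))\<^sup>2"
  proof (intro power_mono L2_norm_nonneg L2_norm_le_sup_mult quo_L2)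
    show "poly p \<in> L2 a b" by (intro L2_continuous continuous_intros)
    show "0 \<le> Z b" using Z_ge_1[of b] b_pos by simp
    fix x assume x: "x \<in> {a..b}"
    have Z: "1 \<le> Z x" "Z x \<le> Z b" using Z_ge_1[OF in_ab[OF x]] Z_le[OF in_ab[OF x]] by auto
    have "\<bar>poly p x\<bar> = Z x * \<bar>quo p x\<bar>" using Z by (simp add: quo_def)
    also have "\<dots> \<le> Z b * \<bar>quo p x\<bar>" using Z by (intro mult_right_mono) auto
    finally show "\<bar>poly p x\<bar> \<le> Z b * \<bar>quo p x\<bar>" .
  qed
  finally show ?thesis by (simp add: power_mult_distrib)
qed

text \<open>A polynomial that vanishes on an interval is zero. This is the linear independence of
  the mixands modulo null sets, hence the uniqueness behind the definite descriptions.\<close>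

lemma quo_norm_eq_0: "nrm (quo p) = 0 \<Longrightarrow> p = 0"
proof (rule ccontr)
  assume 0: "nrm (quo p) = 0" and p: "p \<noteq> 0"
  then have "integral {a..b} (\<lambda>x. (poly p x)\<^sup>2) \<le> 0" using poly_norm_le_quo_norm[of p] by simp
  moreover have "0 \<le> integral {a..b} (\<lambda>x. (poly p x)\<^sup>2)"
    by (intro integral_nonneg integrable_continuous_interval continuous_intros) auto
  ultimately have "((\<lambda>x. (poly p x)\<^sup>2) has_integral 0) (cbox a b)"
    by (simp add: has_integral_iff integrable_continuous_interval continuous_intros)
  then have i: "((\<lambda>x. (poly p x)\<^sup>2) has_integral 0) (cbox a b)" .
  have "poly p x = 0" if "x \<in> {a..b}" for x
  proof -
    have "continuous_on (cbox a b) (\<lambda>x. (poly p x)\<^sup>2)" by (intro continuous_intros)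
    from has_integral_0_cbox_imp_0[OF this _ i, of x] ab that show ?thesis by auto
  qed
  then have "{a..b} \<subseteq> {x. poly p x = 0}" by auto
  then show False using poly_roots_finite[OF p] infinite_Icc[OF ab] finite_subset by blast
qed

text \<open>Triangularity is demanded at every index, orthonormality only below n: the Gram-Schmidt
  induction then starts from the monomials and changes a single entry per step.\<close>

definition ortho :: "nat \<Rightarrow> (nat \<Rightarrow> real poly) \<Rightarrow> bool" where
  "ortho n Q \<longleftrightarrow> (\<forall>j. coeff (Q j) j \<noteq> 0 \<and> (\<forall>i>j. coeff (Q j) i = 0)) \<and>
    (\<forall>i<n. \<forall>j<n. ip (quo (Q i)) (quo (Q j)) = (if i = j then 1 else 0))"

lemma ortho_exists: "\<exists>Q. ortho n Q"
proof (induction n)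
  case 0
  show ?case by (rule exI[of _ "\<lambda>j. monom 1 j"]) (auto simp: ortho_def)
next
  case (Suc n)
  then obtain Q where Q: "ortho n Q" by blast
  define X where "X = (monom 1 n :: real poly)"
  define \<beta> where "\<beta> j = ip (quo X) (quo (Q j))" for j
  define P where "P = X - (\<Sum>j<n. smult (\<beta> j) (Q j))"
  have cP: "coeff P n = 1" "\<And>i. i > n \<Longrightarrow> coeff P i = 0"
    using Q by (auto simp: P_def X_def ortho_def coeff_sum)
  have P0: "0 < nrm (quo P)"
    using quo_norm_eq_0[of P] cP(1) L2_norm_nonneg[of a b "quo P"] by (cases "P = 0") (auto simp: less_le)
  have orth: "ip (quo P) (quo (Q i)) = 0" if "i < n" for i
  proof -
    have "quo P = (\<lambda>x. quo X x - (\<Sum>j<n. \<beta> j * quo (Q j) x))"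
      by (auto simp: P_def quo_diff quo_sum quo_smult)
    then have "ip (quo P) (quo (Q i)) = \<beta> i - (\<Sum>j<n. \<beta> j * ip (quo (Q j)) (quo (Q i)))"
      by (simp add: L2_inner_diff quo_L2 L2_sum L2_cmult L2_inner_sum \<beta>_def)
    also have "(\<Sum>j<n. \<beta> j * ip (quo (Q j)) (quo (Q i))) = (\<Sum>j<n. if j = i then \<beta> j else 0)"
      using Q that by (intro sum.cong) (auto simp: ortho_def)
    finally show ?thesis using that by simp
  qed
  define k where "k = 1 / nrm (quo P)"
  define Q' where "Q' = Q(n := smult k P)"
  have qk: "quo (smult k P) = (\<lambda>x. k * quo P x)" by (auto simp: quo_smult)
  have 1: "ip (quo (smult k P)) (quo (Q i)) = 0" if "i < n" for i
    using orth[OF that] by (simp add: qk L2_inner_cmult)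
  have 2: "ip (quo (smult k P)) (quo (smult k P)) = 1"
    using P0 unfolding L2_norm_square[symmetric] qk L2_norm_cmult by (simp add: k_def)
  have "ortho (Suc n) Q'"
    unfolding ortho_def
  proof (intro conjI allI impI)
    fix j show "coeff (Q' j) j \<noteq> 0" using Q cP P0 by (auto simp: ortho_def Q'_def k_def)
  next
    fix j i :: nat assume "j < i"
    then show "coeff (Q' j) i = 0" using Q cP by (auto simp: ortho_def Q'_def)
  next
    fix i j assume ij: "i < Suc n" "j < Suc n"
    have r1: "ip (quo (Q i)) (quo (smult k P)) = 0" if "i < n" for i
      using 1[OF that] by (subst L2_inner_commute)
    consider "i < n" "j < n" | "i < n" "j = n" | "i = n" "j < n" | "i = n" "j = n" using ij by linarith
    then show "ip (quo (Q' i)) (quo (Q' j)) = (if i = j then 1 else 0)"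
      by cases (use Q 1 r1 2 in \<open>auto simp: ortho_def Q'_def\<close>)
  qed
  then show ?case by blast
qed

definition component :: "(nat \<Rightarrow> real poly) \<Rightarrow> (real \<Rightarrow> real) \<Rightarrow> nat \<Rightarrow> real" where
  "component Q f j = ip f (quo (Q j))"

lemma expansion:
  assumes "ortho n Q" "m \<le> n" "g \<in> span_below m"
  shows "g = (\<lambda>x. \<Sum>j<m. component Q g j * quo (Q j) x)"
proof -
  obtain p where p: "g = quo p" "\<And>i. i \<ge> m \<Longrightarrow> coeff p i = 0" using assms(3) by (auto simp: span_eq)
  have "\<exists>s. p = (\<Sum>j<m. smult (s j) (Q j))"
    using assms(1) p(2) by (intro poly_triangular_expansion) (auto simp: ortho_def)
  then obtain s where s: "p = (\<Sum>j<m. smult (s j) (Q j))" by blast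
  then have g: "g = (\<lambda>x. \<Sum>j<m. s j * quo (Q j) x)" by (auto simp: p(1) quo_sum quo_smult)
  have "component Q g i = s i" if "i < m" for i
  proof -
    have "component Q g i = (\<Sum>j<m. s j * ip (quo (Q j)) (quo (Q i)))"
      by (simp add: component_def g L2_inner_sum quo_L2)
    also have "\<dots> = (\<Sum>j<m. if j = i then s j else 0)"
      using assms(1,2) that by (intro sum.cong) (auto simp: ortho_def)
    finally show ?thesis using that by simp
  qed
  then show ?thesis using g by simp
qed

lemma combination_in_span:
  assumes "ortho n Q" shows "(\<lambda>x. \<Sum>j<m. s j * quo (Q j) x) \<in> span_below m"
proof -
  have "(\<lambda>x. \<Sum>j<m. s j * quo (Q j) x) = quo (\<Sum>j<m. smult (s j) (Q j))" by (auto simp: quo_sum quo_smult)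
  moreover have "\<forall>i\<ge>m. coeff (\<Sum>j<m. smult (s j) (Q j)) i = 0"
    using assms by (auto simp: ortho_def coeff_sum)
  ultimately show ?thesis unfolding span_eq by blast
qed

lemma component_combination:
  assumes "ortho n Q" "m \<le> n" "i < n"
  shows "component Q (\<lambda>x. \<Sum>j<m. s j * quo (Q j) x) i = (if i < m then s i else 0)"
proof -
  have "component Q (\<lambda>x. \<Sum>j<m. s j * quo (Q j) x) i = (\<Sum>j<m. s j * ip (quo (Q j)) (quo (Q i)))"
    by (simp add: component_def L2_inner_sum quo_L2)
  also have "\<dots> = (\<Sum>j<m. if j = i then s j else 0)"
    using assms by (intro sum.cong) (auto simp: ortho_def)
  finally show ?thesis by simp
qed

lemma norm_combination:
  assumes "ortho n Q" "m \<le> n"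
  shows "(nrm (\<lambda>x. \<Sum>j<m. s j * quo (Q j) x))\<^sup>2 = (\<Sum>j<m. (s j)\<^sup>2)"
proof -
  define g where "g = (\<lambda>x. \<Sum>j<m. s j * quo (Q j) x)"
  have g: "g \<in> L2 a b" unfolding g_def by (intro L2_sum L2_cmult quo_L2)
  have "ip g g = (\<Sum>j<m. s j * ip (quo (Q j)) g)"
    using g by (subst g_def, subst L2_inner_sum) (auto simp: quo_L2)
  also have "\<dots> = (\<Sum>j<m. s j * component Q g j)" by (simp add: component_def L2_inner_commute)
  also have "\<dots> = (\<Sum>j<m. (s j)\<^sup>2)"
    using component_combination[OF assms] assms(2) by (intro sum.cong) (auto simp: g_def power2_eq_square)
  finally show ?thesis by (simp add: L2_norm_square g_def)
qed

lemma span_L2: "g \<in> span_below m \<Longrightarrow> g \<in> L2 a b"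
  by (auto simp: span_eq quo_L2)

lemma span_mono: "m \<le> n \<Longrightarrow> span_below m \<subseteq> span_below n"
  by (force simp: span_eq)

lemma span_diff: "g \<in> span_below m \<Longrightarrow> h \<in> span_below m \<Longrightarrow> (\<lambda>x. g x - h x) \<in> span_below m"
proof -
  assume "g \<in> span_below m" "h \<in> span_below m"
  then obtain p q where "g = quo p" "h = quo q" "\<forall>i\<ge>m. coeff p i = 0" "\<forall>i\<ge>m. coeff q i = 0" by (auto simp: span_eq)
  then have "(\<lambda>x. g x - h x) = quo (p - q) \<and> (\<forall>i\<ge>m. coeff (p - q) i = 0)" by (auto simp: quo_diff)
  then show ?thesis unfolding span_eq by blast
qed

lemma span_norm_0: "g \<in> span_below m \<Longrightarrow> nrm g = 0 \<Longrightarrow> g = (\<lambda>x. 0)"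
proof -
  assume "g \<in> span_below m" "nrm g = 0"
  then obtain p where p: "g = quo p" "p = 0" using quo_norm_eq_0 by (auto simp: span_eq)
  then show ?thesis by (auto simp: quo_def)
qed

text \<open>Two candidates differ by an element of the span that is orthogonal to the span, hence by
  0; so the description denotes the coordinate expansion in any such system that is orthonormal
  below m.\<close>

lemma proj_eq:
  assumes Q: "ortho n Q" and m: "m \<le> n" and f: "f \<in> L2 a b"
  shows "proj m f = (\<lambda>x. \<Sum>j<m. component Q f j * quo (Q j) x)"
    and "v \<in> span_below m \<Longrightarrow> ip (\<lambda>x. f x - proj m f x) v = 0"
proof -
  define g where "g = (\<lambda>x. \<Sum>j<m. component Q f j * quo (Q j) x)"
  have g: "g \<in> span_below m" unfolding g_def by (rule combination_in_span[OF Q])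
  have orth: "ip (\<lambda>x. f x - g x) v = 0" if v: "v \<in> span_below m" for v
  proof -
    have vL: "v \<in> L2 a b" by (rule span_L2[OF v])
    have v_eq: "v = (\<lambda>x. \<Sum>j<m. component Q v j * quo (Q j) x)" by (rule expansion[OF Q m v])
    have "ip v (\<lambda>x. f x - g x) = (\<Sum>j<m. component Q v j * ip (quo (Q j)) (\<lambda>x. f x - g x))"
      by (subst v_eq, rule L2_inner_sum) (auto simp: quo_L2 L2_diff f span_L2[OF g])
    also have "\<dots> = (\<Sum>j<m. component Q v j * 0)"
    proof (intro sum.cong refl arg_cong2[of _ _ _ _ "(*)"])
      fix j assume j: "j \<in> {..<m}"
      have "ip (\<lambda>x. f x - g x) (quo (Q j)) = component Q f j - component Q g j"
        by (simp add: L2_inner_diff f span_L2[OF g] quo_L2 component_def)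
      also have "component Q g j = component Q f j"
        unfolding g_def using component_combination[OF Q m, of j] j m by simp
      finally show "ip (quo (Q j)) (\<lambda>x. f x - g x) = 0" by (simp add: L2_inner_commute)
    qed
    finally show ?thesis by (simp add: L2_inner_commute)
  qed
  have "proj m f = g" unfolding mixand_proj_def
  proof (rule the_equality)
    show "g \<in> span_below m \<and> (\<forall>v\<in>span_below m. ip (\<lambda>\<theta>. f \<theta> - g \<theta>) v = 0)"
      using g orth by blast
    fix h assume h: "h \<in> span_below m \<and> (\<forall>v\<in>span_below m. ip (\<lambda>\<theta>. f \<theta> - h \<theta>) v = 0)"
    define d where "d x = h x - g x" for x
    have d: "d \<in> span_below m" unfolding d_def[abs_def] using h g by (intro span_diff) auto
    have "ip (\<lambda>x. (f x - g x) - (f x - h x)) d = 0 - 0"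
      proof -
      have hL: "h \<in> L2 a b" using h by (blast intro: span_L2)
      have "ip (\<lambda>x. (f x - g x) - (f x - h x)) d
        = ip (\<lambda>x. f x - g x) d - ip (\<lambda>x. f x - h x) d"
        by (intro L2_inner_diff L2_diff f hL span_L2[OF g] span_L2[OF d])
      then show ?thesis using orth[OF d] h d by simp
    qed
    then have "nrm d = 0" by (simp add: d_def[abs_def] L2_norm_def)
    from span_norm_0[OF d this] show "h = g" by (auto simp: d_def fun_eq_iff)
  qed
  then show "proj m f = (\<lambda>x. \<Sum>j<m. component Q f j * quo (Q j) x)"
    and "v \<in> span_below m \<Longrightarrow> ip (\<lambda>x. f x - proj m f x) v = 0"
    using orth by (auto simp: g_def)
qed

lemma proj_in_span: "f \<in> L2 a b \<Longrightarrow> proj m f \<in> span_below m"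
proof -
  assume f: "f \<in> L2 a b"
  obtain Q where Q: "ortho m Q" using ortho_exists by blast
  show ?thesis unfolding proj_eq(1)[OF Q order_refl f] by (rule combination_in_span[OF Q])
qed

lemma proj_orth: "f \<in> L2 a b \<Longrightarrow> v \<in> span_below m \<Longrightarrow> ip (\<lambda>x. f x - proj m f x) v = 0"
proof -
  assume f: "f \<in> L2 a b" and v: "v \<in> span_below m"
  obtain Q where Q: "ortho m Q" using ortho_exists by blast
  show ?thesis by (rule proj_eq(2)[OF Q order_refl f v])
qed

lemma pythagoras:
  assumes f: "f \<in> L2 a b" and v: "v \<in> span_below m"
  shows "(nrm (\<lambda>x. v x - f x))\<^sup>2 = (nrm (\<lambda>x. f x - proj m f x))\<^sup>2
    + (nrm (\<lambda>x. v x - proj m f x))\<^sup>2"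
proof -
  define g where "g = proj m f"
  have g: "g \<in> span_below m" unfolding g_def by (rule proj_in_span[OF f])
  have d: "(\<lambda>x. v x - g x) \<in> span_below m" by (intro span_diff v g)
  have "(nrm (\<lambda>x. (f x - g x) - (v x - g x)))\<^sup>2 = (nrm (\<lambda>x. f x - g x))\<^sup>2 + (nrm (\<lambda>x. v x - g x))\<^sup>2"
    using proj_orth[OF f d] by (subst L2_norm_diff_square) (auto intro!: L2_diff f span_L2[OF g] span_L2[OF v] simp: g_def[symmetric])
  moreover have "nrm (\<lambda>x. v x - f x) = nrm (\<lambda>x. f x - v x)"
    using L2_norm_cmult[of a b "-1" "\<lambda>x. f x - v x"] by simp
  ultimately show ?thesis by (simp add: g_def)
qed

lemma proj_best:
  assumes f: "f \<in> L2 a b" and v: "v \<in> span_below m"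
  shows "nrm (\<lambda>x. f x - proj m f x) \<le> nrm (\<lambda>x. f x - v x)"
proof (rule power2_le_imp_le)
  have "nrm (\<lambda>x. v x - f x) = nrm (\<lambda>x. f x - v x)"
    using L2_norm_cmult[of a b "-1" "\<lambda>x. f x - v x"] by simp
  then show "(nrm (\<lambda>x. f x - proj m f x))\<^sup>2 \<le> (nrm (\<lambda>x. f x - v x))\<^sup>2"
    using pythagoras[OF f v] by simp
qed (rule L2_norm_nonneg)

text \<open>Each basis function is a combination of mixands with coefficients coeff (Q j) k / c k,
  so its inner product with the estimator is that combination of empirical frequencies, an empirical
  mean. That the expansion built from these means has the prescribed moments follows by induction on
  k, the system being triangular with non-zero diagonal.\<close>

lemma proj_estimator_eq:
  assumes Q: "ortho m Q" and n: "0 < n"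
  shows "proj_est m n x
    = (\<lambda>\<theta>. \<Sum>j<m. ((\<Sum>i<n. coeff (Q j) (x i) / c (x i)) / real n) * quo (Q j) \<theta>)"
proof -
  define y where "y k = real (card {i. i < n \<and> x i = k}) / real n" for k
  define E where "E j k = coeff (Q j) k / c k" for j k
  have E0: "E j k = 0" if "k > j" for j k using Q that by (simp add: ortho_def E_def)
  have Ed: "E j j \<noteq> 0" for j using Q c_pos[of j] by (simp add: ortho_def E_def)
  have e_eq: "quo (Q j) = (\<lambda>\<theta>. \<Sum>k<m. E j k * mixand c \<theta> k)" if "j < m" for j
  proof -
    have "Q j = (\<Sum>k<m. smult (E j k) (monom (c k) k))"
    proof (rule poly_eqI)
      fix i show "coeff (Q j) i = coeff (\<Sum>k<m. smult (E j k) (monom (c k) k)) i"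
        using Q that c_pos[of i] by (cases "i < m") (auto simp: E_def coeff_sum ortho_def if_distrib cong: if_cong)
    qed
    then have "quo (Q j) = quo (\<Sum>k<m. smult (E j k) (monom (c k) k))" by simp
    then show ?thesis by (auto simp: quo_sum quo_smult mixand_eq_quo)
  qed
  have comp: "component Q g j = (\<Sum>k<m. E j k * ip g (\<lambda>\<theta>. mixand c \<theta> k))"
    if "g \<in> L2 a b" "j < m" for g j
  proof -
    have "component Q g j = ip (quo (Q j)) g" by (simp add: component_def L2_inner_commute)
    also have "\<dots> = (\<Sum>k<m. E j k * ip (\<lambda>\<theta>. mixand c \<theta> k) g)"
      unfolding e_eq[OF that(2)] by (rule L2_inner_sum) (auto simp: mixand_L2 that)
    finally show ?thesis by (simp add: L2_inner_commute)
  qed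
  define Y where "Y j = (\<Sum>k<m. E j k * y k)" for j
  define g where "g = (\<lambda>\<theta>. \<Sum>j<m. Y j * quo (Q j) \<theta>)"
  have g: "g \<in> span_below m" unfolding g_def by (rule combination_in_span[OF Q])
  have "ip g (\<lambda>\<theta>. mixand c \<theta> k) = y k" if "k < m" for k
    using that
  proof (induction k rule: less_induct)
    case (less k)
    define d where "d i = ip g (\<lambda>\<theta>. mixand c \<theta> i) - y i" for i
    have "component Q g k = Y k" unfolding g_def using component_combination[OF Q order_refl] less.prems by simp
    then have "0 = (\<Sum>i<m. E k i * d i)"
      using comp[OF span_L2[OF g] less.prems] by (simp add: Y_def d_def right_diff_distrib sum_subtractf)
    also have "\<dots> = (\<Sum>i<m. if i = k then E k i * d i else 0)"
      using less.IH less.prems E0 by (intro sum.cong refl) (auto simp: d_def neq_iff)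
    also have "\<dots> = E k k * d k" using less.prems by simp
    finally show ?case using Ed[of k] by (simp add: d_def)
  qed
  then have g_ok: "\<forall>k<m. ip g (\<lambda>\<theta>. mixand c \<theta> k) = y k" by blast
  have "proj_est m n x = g" unfolding proj_estimator_def y_def[symmetric]
  proof (rule the_equality)
    show "g \<in> span_below m \<and> (\<forall>k<m. ip g (\<lambda>\<theta>. mixand c \<theta> k) = y k)" using g g_ok by blast
    fix h assume h: "h \<in> span_below m \<and> (\<forall>k<m. ip h (\<lambda>\<theta>. mixand c \<theta> k) = y k)"
    then have hL: "h \<in> L2 a b" using span_L2 by blast
    have "component Q h j = Y j" if "j < m" for j using comp[OF hL that] h by (simp add: Y_def)
    then show "h = g" using expansion[OF Q order_refl, of h] h by (simp add: g_def)
  qed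
  moreover have "Y j = (\<Sum>i<n. coeff (Q j) (x i) / c (x i)) / real n" if j: "j < m" for j
  proof -
    have "(\<Sum>k<m. E j k * real (card {i. i < n \<and> x i = k})) = (\<Sum>k<m. \<Sum>i<n. if x i = k then E j k else 0)"
      by (intro sum.cong refl) (simp add: sum.If_cases Int_def mult.commute)
    also have "\<dots> = (\<Sum>i<n. \<Sum>k<m. if x i = k then E j k else 0)" by (rule sum.swap)
    also have "\<dots> = (\<Sum>i<n. E j (x i))"
      using E0 j by (intro sum.cong refl) auto
    finally have *: "(\<Sum>k<m. E j k * real (card {i. i < n \<and> x i = k})) = (\<Sum>i<n. E j (x i))" .
    have "Y j = (\<Sum>k<m. E j k * real (card {i. i < n \<and> x i = k})) / real n"
      by (simp add: Y_def y_def sum_divide_distrib)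
    then show ?thesis unfolding * by (simp add: E_def)
  qed
  ultimately show ?thesis by (simp add: g_def)
qed

lemma coefficient_bound:
  assumes Q: "ortho n Q" and j: "j < m" "m \<le> n"
    and lam: "lam = \<gamma> + sqrt (\<gamma>\<^sup>2 + 1)" "\<gamma> = (2 + a + b) / (b - a)"
  shows "(\<Sum>k<m. (coeff (Q j) k)\<^sup>2) \<le> 4 / (b - a) * (Z b)\<^sup>2 * (real m)\<^sup>2 * lam ^ (2 * m)"
proof -
  have Q0: "\<And>i. i \<ge> m \<Longrightarrow> coeff (Q j) i = 0" using Q j by (auto simp: ortho_def)
  have "(\<Sum>k<m. (coeff (Q j) k)\<^sup>2) = (\<Sum>k<m. \<bar>coeff (Q j) k\<bar> * \<bar>coeff (Q j) k\<bar>)"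
    by (simp add: power2_eq_square)
  also have "\<dots> \<le> (\<Sum>k<m. \<bar>coeff (Q j) k\<bar> * coeff_norm (Q j))"
    by (intro sum_mono mult_left_mono abs_coeff_le_coeff_norm) auto
  also have "\<dots> = (coeff_norm (Q j))\<^sup>2"
    by (simp add: coeff_norm_eq[OF Q0] power2_eq_square flip: sum_distrib_right)
  also have "\<dots> \<le> 4 / (b - a) * (real m)\<^sup>2 * lam ^ (2 * m) * integral {a..b} (\<lambda>x. (poly (Q j) x)\<^sup>2)"
    by (rule coeff_norm_le_L2[OF a_nonneg ab lam Q0])
  also have "\<dots> \<le> 4 / (b - a) * (real m)\<^sup>2 * lam ^ (2 * m) * (Z b)\<^sup>2"
  proof (intro mult_left_mono)
    have "(nrm (quo (Q j)))\<^sup>2 = 1" using Q j by (simp add: L2_norm_square ortho_def)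
    then show "integral {a..b} (\<lambda>x. (poly (Q j) x)\<^sup>2) \<le> (Z b)\<^sup>2" using poly_norm_le_quo_norm[of "Q j"] by simp
    show "0 \<le> 4 / (b - a) * (real m)\<^sup>2 * lam ^ (2 * m)" using ab by (simp add: power_mult)
  qed
  finally show ?thesis by (simp add: mult_ac)
qed

end

section \<open>Risk bounds\<close>

text \<open>A finite product of countable discrete spaces is discrete, so measurability of functions
  of the sample is automatic.\<close>

lemma sets_PiM_discrete:
  assumes "\<And>i. i \<in> I \<Longrightarrow> sets (M i) = sets (count_space (UNIV :: nat set))" "finite I"
  shows "sets (PiM I M) = Pow (PiE I (\<lambda>_. UNIV))" "space (PiM I M) = PiE I (\<lambda>_. UNIV)"
proof -
  have "sets (PiM I M) = sets (PiM I (\<lambda>_. count_space (UNIV :: nat set)))"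
    by (intro sets_PiM_cong refl assms)
  then show s: "sets (PiM I M) = Pow (PiE I (\<lambda>_. UNIV))"
    using count_space_PiM_finite[of I "\<lambda>_. UNIV :: nat set"] assms(2) by simp
  show "space (PiM I M) = PiE I (\<lambda>_. UNIV)"
    using sets_eq_imp_space_eq[of "PiM I M" "count_space (PiE I (\<lambda>_. UNIV))"] s by simp
qed

text \<open>The variance of an average of independent variables: mixed terms of the centred
  variables vanish, and centring only lowers the second moment.\<close>

lemma mean_square_error_of_mean:
  fixes \<zeta> :: "nat \<Rightarrow> real"
  assumes "prob_space \<mu>" and sets: "sets \<mu> = sets (count_space (UNIV :: nat set))"
    and bnd: "\<And>k. \<bar>\<zeta> k\<bar> \<le> B" and n: "0 < n"
  shows "(\<integral>\<^sup>+x. ennreal (((\<Sum>i<n. \<zeta> (x i)) / real n - integral\<^sup>L \<mu> \<zeta>)\<^sup>2) \<partial>PiM {..<n} (\<lambda>_. \<mu>))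
    \<le> ennreal (integral\<^sup>L \<mu> (\<lambda>k. (\<zeta> k)\<^sup>2) / real n)"
proof -
  interpret \<mu>: prob_space \<mu> by fact
  interpret P: product_prob_space "\<lambda>_::nat. \<mu>" "{..<n}" by standard
  interpret PP: prob_space "PiM {..<n} (\<lambda>_. \<mu>)" by (intro prob_space_PiM \<mu>.prob_space_axioms)
  have meas: "u \<in> borel_measurable \<mu>" for u :: "nat \<Rightarrow> real"
    unfolding measurable_cong_sets[OF sets refl] by simp
  have int: "integrable \<mu> u" if "\<And>k. \<bar>u k\<bar> \<le> C" for u :: "nat \<Rightarrow> real" and C
    using that by (intro \<mu>.integrable_const_bound[of _ C] meas) auto
  have i1: "integrable \<mu> \<zeta>" using bnd by (rule int)
  have i2: "integrable \<mu> (\<lambda>k. (\<zeta> k)\<^sup>2)"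
  proof (rule int)
    show "\<bar>(\<zeta> k)\<^sup>2\<bar> \<le> B\<^sup>2" for k using power_mono[OF bnd[of k], of 2] by simp
  qed
  define m where "m = integral\<^sup>L \<mu> \<zeta>"
  define \<eta> where "\<eta> k = \<zeta> k - m" for k
  have i3: "integrable \<mu> \<eta>" unfolding \<eta>_def[abs_def] using i1 by simp
  have \<eta>2: "(\<eta> k)\<^sup>2 = (\<zeta> k)\<^sup>2 - 2 * m * \<zeta> k + m\<^sup>2" for k by (simp add: \<eta>_def power2_eq_square algebra_simps)
  have i4: "integrable \<mu> (\<lambda>k. (\<eta> k)\<^sup>2)" unfolding \<eta>2 using i1 i2 by simp
  have \<eta>0: "integral\<^sup>L \<mu> \<eta> = 0" unfolding \<eta>_def[abs_def] using i1 by (simp add: m_def \<mu>.prob_space)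
  define v where "v = integral\<^sup>L \<mu> (\<lambda>k. (\<eta> k)\<^sup>2)"
  have v: "v \<le> integral\<^sup>L \<mu> (\<lambda>k. (\<zeta> k)\<^sup>2)"
    unfolding v_def \<eta>2 using i1 i2 by (simp add: \<mu>.prob_space power2_eq_square m_def[symmetric])
  \<comment> \<open>Writes the product of two centred coordinates as a product over all coordinates,
    the form in which product measures factorise; for i = j both factors meet in one
    coordinate.\<close>
  define F where "F i j k t = (if k = i then \<eta> t else 1) * (if k = j then \<eta> t else (1::real))" for i j k :: nat and t
  have Fi: "integrable \<mu> (F i j k)" for i j k
    unfolding F_def using i3 i4 by (cases "k = i"; cases "k = j") (auto simp: power2_eq_square)
  have Fp: "(\<Prod>k<n. F i j k (x k)) = \<eta> (x i) * \<eta> (x j)" if "i < n" "j < n" for i j x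
    unfolding F_def using that by (simp add: prod.distrib prod.delta)
  have pi: "integrable (PiM {..<n} (\<lambda>_. \<mu>)) (\<lambda>x. \<eta> (x i) * \<eta> (x j))"
    and pe: "(\<integral>x. \<eta> (x i) * \<eta> (x j) \<partial>PiM {..<n} (\<lambda>_. \<mu>)) = (if i = j then v else 0)"
    if ij: "i < n" "j < n" for i j
  proof -
    show "integrable (PiM {..<n} (\<lambda>_. \<mu>)) (\<lambda>x. \<eta> (x i) * \<eta> (x j))"
      using P.product_integrable_prod[of "{..<n}" "F i j"] Fi Fp[OF ij] by simp
    have "(\<integral>x. \<eta> (x i) * \<eta> (x j) \<partial>PiM {..<n} (\<lambda>_. \<mu>)) = (\<Prod>k<n. integral\<^sup>L \<mu> (F i j k))"
      using P.product_integral_prod[of "{..<n}" "F i j"] Fi Fp[OF ij] by simp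
    also have "\<dots> = (if i = j then v else 0)"
    proof (cases "i = j")
      case True
      have "(\<Prod>k<n. integral\<^sup>L \<mu> (F i j k)) = (\<Prod>k<n. if k = i then v else 1)"
        by (intro prod.cong refl) (auto simp: F_def[abs_def] True v_def power2_eq_square \<mu>.prob_space)
      then show ?thesis using True ij by (simp add: prod.delta)
    next
      case False
      then have "F i j i = \<eta>" by (auto simp: F_def)
      then have "\<exists>k\<in>{..<n}. integral\<^sup>L \<mu> (F i j k) = 0" using ij \<eta>0 by auto
      then show ?thesis using False by (simp add: prod_zero_iff)
    qed
    finally show "(\<integral>x. \<eta> (x i) * \<eta> (x j) \<partial>PiM {..<n} (\<lambda>_. \<mu>)) = (if i = j then v else 0)" .
  qed
  have sq: "((\<Sum>i<n. \<zeta> (x i)) / real n - m)\<^sup>2 = (1 / (real n)\<^sup>2) * (\<Sum>i<n. \<Sum>j<n. \<eta> (x i) * \<eta> (x j))" for x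
  proof -
    have "(\<Sum>i<n. \<zeta> (x i)) / real n - m = (\<Sum>i<n. \<eta> (x i)) / real n"
      using n by (simp add: \<eta>_def sum_subtractf diff_divide_distrib)
    then show ?thesis by (simp add: power_divide power2_eq_square[of "\<Sum>i<n. \<eta> (x i)"] sum_product)
  qed
  have "(\<integral>\<^sup>+x. ennreal (((\<Sum>i<n. \<zeta> (x i)) / real n - m)\<^sup>2) \<partial>PiM {..<n} (\<lambda>_. \<mu>))
    = ennreal (\<integral>x. ((\<Sum>i<n. \<zeta> (x i)) / real n - m)\<^sup>2 \<partial>PiM {..<n} (\<lambda>_. \<mu>))"
    unfolding sq by (intro nn_integral_eq_integral integrable_mult_right Bochner_Integration.integrable_sum pi)
      (simp, simp, rule AE_I2, simp only: sq[symmetric] zero_le_power2)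
  also have "(\<integral>x. ((\<Sum>i<n. \<zeta> (x i)) / real n - m)\<^sup>2 \<partial>PiM {..<n} (\<lambda>_. \<mu>))
    = (1 / (real n)\<^sup>2) * (\<Sum>i<n. \<Sum>j<n. if i = j then v else 0)"
  proof -
    have "(\<integral>x. (\<Sum>i<n. \<Sum>j<n. \<eta> (x i) * \<eta> (x j)) \<partial>PiM {..<n} (\<lambda>_. \<mu>))
      = (\<Sum>i<n. \<integral>x. (\<Sum>j<n. \<eta> (x i) * \<eta> (x j)) \<partial>PiM {..<n} (\<lambda>_. \<mu>))"
      by (rule Bochner_Integration.integral_sum, rule Bochner_Integration.integrable_sum, rule pi) auto
    also have "\<dots> = (\<Sum>i<n. \<Sum>j<n. if i = j then v else 0)"
    proof (rule sum.cong[OF refl])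
      fix i assume i: "i \<in> {..<n}"
      have "(\<integral>x. (\<Sum>j<n. \<eta> (x i) * \<eta> (x j)) \<partial>PiM {..<n} (\<lambda>_. \<mu>))
        = (\<Sum>j<n. \<integral>x. \<eta> (x i) * \<eta> (x j) \<partial>PiM {..<n} (\<lambda>_. \<mu>))"
        using i by (intro Bochner_Integration.integral_sum pi) auto
      also have "\<dots> = (\<Sum>j<n. if i = j then v else 0)" using i by (intro sum.cong refl pe) auto
      finally show "(\<integral>x. (\<Sum>j<n. \<eta> (x i) * \<eta> (x j)) \<partial>PiM {..<n} (\<lambda>_. \<mu>)) = (\<Sum>j<n. if i = j then v else 0)" .
    qed
    finally show ?thesis unfolding sq by (simp only: integral_mult_right_zero)
  qed
  also have "\<dots> = v / real n" using n by (simp add: power2_eq_square)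
  also have "ennreal (v / real n) \<le> ennreal (integral\<^sup>L \<mu> (\<lambda>k. (\<zeta> k)\<^sup>2) / real n)"
    using v by (intro ennreal_leI divide_right_mono) auto
  finally show ?thesis by (simp add: m_def)
qed

context mixands
begin

lemma mixand_nonneg: "x \<in> {a..b} \<Longrightarrow> 0 \<le> mixand c x k"
  using Z_ge_1[OF in_ab, of x] c_pos[of k] a_nonneg by (auto simp: mixand_def intro!: divide_nonneg_nonneg)

lemma mixand_le: "x \<in> {a..b} \<Longrightarrow> mixand c x k \<le> c k * b ^ k"
proof -
  assume x: "x \<in> {a..b}"
  have "mixand c x k \<le> c k * x ^ k / 1"
    unfolding mixand_def using Z_ge_1[OF in_ab[OF x]] c_pos[of k] x a_nonneg by (intro divide_left_mono) auto
  also have "\<dots> \<le> c k * b ^ k" using x c_pos[of k] a_nonneg by (auto intro!: mult_left_mono power_mono)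
  finally show ?thesis .
qed

lemma mixand_sums: "x \<in> {a..b} \<Longrightarrow> (\<lambda>k. mixand c x k) sums 1"
  using sums_divide[OF summable_sums[OF summable_Z[OF in_ab]], of x "Z x"] Z_ge_1[OF in_ab, of x]
  by (simp add: mixand_def ps_sum_def)

lemma mixture_pmf_eq_inner: "mixture_pmf c a b f k = ip f (\<lambda>x. mixand c x k)"
  by (simp add: mixture_pmf_def L2_inner_def mult.commute)

lemma density_L2: "f \<in> L2_densities a b \<Longrightarrow> f \<in> L2 a b"
  by (simp add: L2_densities_def)

lemma L2_integrable: "f \<in> L2 a b \<Longrightarrow> integrable (lebesgue_on {a..b}) f"
  using L2_mult_integrable[of f a b "\<lambda>x. 1"] L2_continuous[of a b "\<lambda>x. 1"] by simp

lemma mixture_pmf_nonneg: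
  assumes "f \<in> L2_densities a b" shows "0 \<le> mixture_pmf c a b f k"
  unfolding mixture_pmf_def
proof (rule integral_nonneg_AE)
  have "AE x in lebesgue_on {a..b}. x \<in> {a..b}" by (rule AE_I2) auto
  moreover have "AE x in lebesgue_on {a..b}. 0 \<le> f x" using assms by (simp add: L2_densities_def)
  ultimately show "AE x in lebesgue_on {a..b}. 0 \<le> mixand c x k * f x"
    by eventually_elim (auto intro!: mult_nonneg_nonneg mixand_nonneg)
qed

lemma mixture_pmf_le:
  assumes f: "f \<in> L2_densities a b" and AE: "AE x in lebesgue_on {a..b}. f x \<le> B"
  shows "mixture_pmf c a b f k \<le> B * (LINT \<theta>|lebesgue_on {a..b}. mixand c \<theta> k)"
proof -
  have "(LINT \<theta>|lebesgue_on {a..b}. mixand c \<theta> k * f \<theta>) \<le> (LINT \<theta>|lebesgue_on {a..b}. B * mixand c \<theta> k)"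
  proof (rule integral_mono_AE)
    show "integrable (lebesgue_on {a..b}) (\<lambda>x. mixand c x k * f x)"
      by (intro L2_mult_integrable mixand_L2 density_L2[OF f])
    show "integrable (lebesgue_on {a..b}) (\<lambda>x. B * mixand c x k)"
      by (intro integrable_mult_right L2_integrable mixand_L2)
    have "AE x in lebesgue_on {a..b}. x \<in> {a..b}" by (rule AE_I2) auto
    with AE show "AE x in lebesgue_on {a..b}. mixand c x k * f x \<le> B * mixand c x k"
    proof eventually_elim
      case (elim x)
      then show ?case using mult_left_mono[OF elim(1) mixand_nonneg[OF elim(2), of k]] by (simp add: mult.commute)
    qed
  qed
  then show ?thesis by (simp add: mixture_pmf_def)
qed

text \<open>Z \<ge> 1 bounds every mixand by c k b ^ k, and f has integral 1. Multiplied by the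
  square of a coefficient divided by c k, this leaves the factor b ^ k / c k whose maximum appears
  in the theorem.\<close>

lemma mixture_pmf_le_power:
  assumes f: "f \<in> L2_densities a b" shows "mixture_pmf c a b f k \<le> c k * b ^ k"
proof -
  have "(LINT \<theta>|lebesgue_on {a..b}. mixand c \<theta> k * f \<theta>) \<le> (LINT \<theta>|lebesgue_on {a..b}. (c k * b ^ k) * f \<theta>)"
  proof (rule integral_mono_AE)
    show "integrable (lebesgue_on {a..b}) (\<lambda>x. mixand c x k * f x)"
      by (intro L2_mult_integrable mixand_L2 density_L2[OF f])
    show "integrable (lebesgue_on {a..b}) (\<lambda>x. (c k * b ^ k) * f x)"
      by (intro integrable_mult_right L2_integrable density_L2[OF f])
    have "AE x in lebesgue_on {a..b}. x \<in> {a..b}" by (rule AE_I2) auto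
    moreover have "AE x in lebesgue_on {a..b}. 0 \<le> f x" using f by (simp add: L2_densities_def)
    ultimately show "AE x in lebesgue_on {a..b}. mixand c x k * f x \<le> (c k * b ^ k) * f x"
      by eventually_elim (auto intro!: mult_right_mono mixand_le)
  qed
  then show ?thesis using f by (simp add: mixture_pmf_def L2_densities_def)
qed

lemma mixture_pmf_sums:
  assumes f: "f \<in> L2_densities a b" shows "(\<lambda>k. mixture_pmf c a b f k) sums 1"
proof -
  let ?M = "lebesgue_on {a..b}"
  have fm: "f \<in> borel_measurable ?M" by (intro L2_measurable density_L2 f)
  have f0: "AE x in ?M. 0 \<le> f x" "integral\<^sup>L ?M f = 1" using f by (auto simp: L2_densities_def)
  have inab: "AE x in ?M. x \<in> {a..b}" by (rule AE_I2) auto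
  have k: "ennreal (mixture_pmf c a b f k) = (\<integral>\<^sup>+x. ennreal (mixand c x k * f x) \<partial>?M)" for k
    unfolding mixture_pmf_def
  proof (rule nn_integral_eq_integral[symmetric])
    show "integrable ?M (\<lambda>x. mixand c x k * f x)" by (intro L2_mult_integrable mixand_L2 density_L2[OF f])
    show "AE x in ?M. 0 \<le> mixand c x k * f x"
      using inab f0(1) by eventually_elim (auto intro!: mult_nonneg_nonneg mixand_nonneg)
  qed
  have "(\<Sum>k. ennreal (mixture_pmf c a b f k)) = (\<integral>\<^sup>+x. (\<Sum>k. ennreal (mixand c x k * f x)) \<partial>?M)"
    unfolding k
    by (rule nn_integral_suminf[symmetric])
      (intro measurable_compose[OF _ measurable_ennreal] borel_measurable_times L2_measurable[OF mixand_L2] fm)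
  also have "\<dots> = (\<integral>\<^sup>+x. ennreal (f x) \<partial>?M)"
  proof (rule nn_integral_cong_AE)
    show "AE x in ?M. (\<Sum>k. ennreal (mixand c x k * f x)) = ennreal (f x)"
      using inab f0(1)
    proof eventually_elim
      case (elim x)
      have s: "(\<lambda>k. mixand c x k * f x) sums (1 * f x)" by (intro sums_mult2 mixand_sums elim)
      have "(\<Sum>k. ennreal (mixand c x k * f x)) = ennreal (\<Sum>k. mixand c x k * f x)"
        using elim s by (intro suminf_ennreal2) (auto intro!: mult_nonneg_nonneg mixand_nonneg dest: sums_summable)
      then show ?case using sums_unique[OF s] by simp
    qed
  qed
  also have "\<dots> = ennreal 1"
    using f0 L2_integrable[OF density_L2[OF f]] by (subst nn_integral_eq_integral) auto
  finally have s: "(\<Sum>k. ennreal (mixture_pmf c a b f k)) = ennreal 1" .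
  have sm: "summable (mixture_pmf c a b f)"
    using s mixture_pmf_nonneg[OF f] by (intro summable_suminf_not_top) auto
  then have "ennreal (\<Sum>k. mixture_pmf c a b f k) = ennreal 1"
    using s mixture_pmf_nonneg[OF f] by (subst suminf_ennreal2[symmetric]) auto
  then have "(\<Sum>k. mixture_pmf c a b f k) = 1"
    using suminf_nonneg[OF sm mixture_pmf_nonneg[OF f]] by (subst (asm) ennreal_inj) auto
  then show ?thesis using summable_sums[OF sm] by simp
qed

lemma sets_mixture: "sets (mixture c a b f) = sets (count_space UNIV)"
  by (simp add: mixture_def)

lemma emeasure_mixture:
  "finite A \<Longrightarrow> emeasure (mixture c a b f) A = (\<Sum>k\<in>A. ennreal (mixture_pmf c a b f k))"
  unfolding mixture_def
  by (subst emeasure_density) (auto simp: nn_integral_count_space_indicator[symmetric] nn_integral_count_space_finite)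

lemma prob_space_mixture:
  assumes f: "f \<in> L2_densities a b" shows "prob_space (mixture c a b f)"
proof
  have "emeasure (mixture c a b f) (space (mixture c a b f)) = (\<Sum>k. ennreal (mixture_pmf c a b f k))"
    by (simp add: mixture_def emeasure_density nn_integral_count_space_nat)
  also have "\<dots> = ennreal (\<Sum>k. mixture_pmf c a b f k)"
    using mixture_pmf_sums[OF f] mixture_pmf_nonneg[OF f] by (intro suminf_ennreal2) (auto simp: sums_iff)
  also have "\<dots> = 1" using mixture_pmf_sums[OF f] by (simp add: sums_iff)
  finally show "emeasure (mixture c a b f) (space (mixture c a b f)) = 1" .
qed

lemma integral_mixture:
  assumes f: "f \<in> L2_densities a b" and supp: "\<And>k. k \<ge> m \<Longrightarrow> \<zeta> k = 0"
  shows "integral\<^sup>L (mixture c a b f) \<zeta> = (\<Sum>k<m. mixture_pmf c a b f k * \<zeta> k)"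
proof -
  have "integral\<^sup>L (mixture c a b f) \<zeta> = (\<integral>k. mixture_pmf c a b f k *\<^sub>R \<zeta> k \<partial>count_space UNIV)"
    unfolding mixture_def using mixture_pmf_nonneg[OF f] by (intro integral_density) auto
  also have "\<dots> = (\<Sum>k | k \<in> UNIV \<and> mixture_pmf c a b f k *\<^sub>R \<zeta> k \<noteq> 0. mixture_pmf c a b f k *\<^sub>R \<zeta> k)"
  proof (rule lebesgue_integral_count_space_finite_support, rule finite_subset)
    show "{k \<in> UNIV. mixture_pmf c a b f k *\<^sub>R \<zeta> k \<noteq> 0} \<subseteq> {..<m}" using supp by (auto simp: not_less[symmetric])
  qed simp
  also have "\<dots> = (\<Sum>k<m. mixture_pmf c a b f k * \<zeta> k)"
    using supp by (intro sum.mono_neutral_cong_left) (auto simp: not_less[symmetric])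
  finally show ?thesis .
qed

text \<open>In orthonormal coordinates the squared error is the squared bias plus m squared
  deviations of empirical means. Each contributes at most a second moment divided by n; the
  coefficient bound supplies m^2 and the number of coordinates the third factor m.\<close>

theorem MISE_proj_estimator_le:
  assumes f: "f \<in> L2_densities a b" and n: "0 < n" and m: "0 < m"
    and lam: "lam = \<gamma> + sqrt (\<gamma>\<^sup>2 + 1)" "\<gamma> = (2 + a + b) / (b - a)"
  shows "MISE c a b n (proj_est m n) f
    \<le> ennreal ((nrm (\<lambda>\<theta>. f \<theta> - proj m f \<theta>))\<^sup>2
      + 4 / (b - a) * (Z b)\<^sup>2 * real m ^ 3 * (1 / real n * lam ^ (2 * m) * Max ((\<lambda>k. b ^ k / c k) ` {..<m})))"
proof -
  let ?\<mu> = "mixture c a b f"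
  let ?P = "PiM {..<n} (\<lambda>_. ?\<mu>)"
  obtain Q where Q: "ortho m Q" using ortho_exists by blast
  have fL: "f \<in> L2 a b" by (rule density_L2[OF f])
  define bias where "bias = (nrm (\<lambda>\<theta>. f \<theta> - proj m f \<theta>))\<^sup>2"
  define \<zeta> where "\<zeta> j k = coeff (Q j) k / c k" for j k
  have \<zeta>0: "\<zeta> j k = 0" if "j < m" "k \<ge> m" for j k using Q that by (auto simp: ortho_def \<zeta>_def)
  have comp: "component Q f j = integral\<^sup>L ?\<mu> (\<zeta> j)" if j: "j < m" for j
  proof -
    have "Q j = (\<Sum>k<m. smult (\<zeta> j k) (monom (c k) k))"
    proof (rule poly_eqI)
      fix i show "coeff (Q j) i = coeff (\<Sum>k<m. smult (\<zeta> j k) (monom (c k) k)) i"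
        using Q j c_pos[of i] by (cases "i < m") (auto simp: \<zeta>_def coeff_sum ortho_def if_distrib cong: if_cong)
    qed
    then have e: "quo (Q j) = (\<lambda>\<theta>. \<Sum>k<m. \<zeta> j k * mixand c \<theta> k)"
      using arg_cong[of "Q j" "\<Sum>k<m. smult (\<zeta> j k) (monom (c k) k)" quo]
      by (auto simp: quo_sum quo_smult mixand_eq_quo)
    have "component Q f j = ip (quo (Q j)) f" by (simp add: component_def L2_inner_commute)
    also have "\<dots> = (\<Sum>k<m. \<zeta> j k * ip (\<lambda>\<theta>. mixand c \<theta> k) f)"
      unfolding e by (rule L2_inner_sum) (auto simp: mixand_L2 fL)
    also have "\<dots> = integral\<^sup>L ?\<mu> (\<zeta> j)"
      using \<zeta>0[OF j] by (subst integral_mixture[OF f, of m]) (auto simp: mixture_pmf_eq_inner L2_inner_commute mult.commute)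
    finally show ?thesis .
  qed
  define Y where "Y j x = (\<Sum>i<n. \<zeta> j (x i)) / real n" for j and x :: "nat \<Rightarrow> nat"
  have err: "(nrm (\<lambda>\<theta>. proj_est m n x \<theta> - f \<theta>))\<^sup>2
    = bias + (\<Sum>j<m. (Y j x - integral\<^sup>L ?\<mu> (\<zeta> j))\<^sup>2)" for x
  proof -
    have e: "proj_est m n x = (\<lambda>\<theta>. \<Sum>j<m. Y j x * quo (Q j) \<theta>)"
      using proj_estimator_eq[OF Q n] by (simp add: Y_def \<zeta>_def)
    have "(\<lambda>\<theta>. proj_est m n x \<theta> - proj m f \<theta>)
      = (\<lambda>\<theta>. \<Sum>j<m. (Y j x - integral\<^sup>L ?\<mu> (\<zeta> j)) * quo (Q j) \<theta>)"
      unfolding e proj_eq(1)[OF Q order_refl fL] by (auto simp: comp left_diff_distrib sum_subtractf)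
    then have "(nrm (\<lambda>\<theta>. proj_est m n x \<theta> - proj m f \<theta>))\<^sup>2
      = (\<Sum>j<m. (Y j x - integral\<^sup>L ?\<mu> (\<zeta> j))\<^sup>2)"
      using norm_combination[OF Q order_refl] by simp
    moreover have "proj_est m n x \<in> span_below m"
      unfolding e by (rule combination_in_span[OF Q])
    ultimately show ?thesis using pythagoras[OF fL] by (simp add: bias_def)
  qed
  define Mx where "Mx = Max ((\<lambda>k. b ^ k / c k) ` {..<m})"
  define K where "K = 4 / (b - a) * (Z b)\<^sup>2 * (real m)\<^sup>2 * lam ^ (2 * m)"
  have Mx: "b ^ k / c k \<le> Mx" if "k < m" for k unfolding Mx_def using that by (intro Max_ge) auto
  have Mx0: "0 \<le> Mx" using Mx[of 0] m c_0 by simp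
  have second: "integral\<^sup>L ?\<mu> (\<lambda>k. (\<zeta> j k)\<^sup>2) \<le> K * Mx" if j: "j < m" for j
  proof -
    have "integral\<^sup>L ?\<mu> (\<lambda>k. (\<zeta> j k)\<^sup>2) = (\<Sum>k<m. mixture_pmf c a b f k * (\<zeta> j k)\<^sup>2)"
      using \<zeta>0[OF j] by (intro integral_mixture[OF f]) auto
    also have "\<dots> \<le> (\<Sum>k<m. (coeff (Q j) k)\<^sup>2 * Mx)"
    proof (rule sum_mono)
      fix k assume k: "k \<in> {..<m}"
      have "mixture_pmf c a b f k * (\<zeta> j k)\<^sup>2 \<le> (c k * b ^ k) * (\<zeta> j k)\<^sup>2"
        by (intro mult_right_mono mixture_pmf_le_power f) auto
      also have "\<dots> = (coeff (Q j) k)\<^sup>2 * (b ^ k / c k)"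
        using c_pos[of k] by (simp add: \<zeta>_def power_divide power2_eq_square)
      also have "\<dots> \<le> (coeff (Q j) k)\<^sup>2 * Mx" using Mx k by (intro mult_left_mono) auto
      finally show "mixture_pmf c a b f k * (\<zeta> j k)\<^sup>2 \<le> (coeff (Q j) k)\<^sup>2 * Mx" .
    qed
    also have "\<dots> \<le> K * Mx"
    proof -
      have "(\<Sum>k<m. (coeff (Q j) k)\<^sup>2) * Mx \<le> K * Mx"
        unfolding K_def by (intro mult_right_mono coefficient_bound[OF Q j order_refl lam] Mx0)
      then show ?thesis by (simp only: sum_distrib_right[symmetric])
    qed
    finally show ?thesis .
  qed
  have setsP: "sets ?P = Pow (PiE {..<n} (\<lambda>_. UNIV))"
    by (intro sets_PiM_discrete) (auto simp: sets_mixture)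
  have meas: "u \<in> borel_measurable ?P" for u :: "(nat \<Rightarrow> nat) \<Rightarrow> ennreal"
  proof -
    have "u \<in> borel_measurable (count_space (PiE {..<n} (\<lambda>_. UNIV)))" by simp
    moreover have s: "sets ?P = sets (count_space (PiE {..<n} (\<lambda>_. UNIV)))" using setsP by simp
    ultimately show ?thesis by (simp only: measurable_cong_sets[OF s refl])
  qed
  interpret PP: prob_space ?P by (intro prob_space_PiM prob_space_mixture f)
  have "MISE c a b n (proj_est m n) f
    = (\<integral>\<^sup>+x. ennreal bias + (\<Sum>j<m. ennreal ((Y j x - integral\<^sup>L ?\<mu> (\<zeta> j))\<^sup>2)) \<partial>?P)"
    unfolding MISE_def err by (intro nn_integral_cong) (simp add: bias_def ennreal_plus sum_nonneg)
  also have "\<dots> = ennreal bias + (\<Sum>j<m. \<integral>\<^sup>+x. ennreal ((Y j x - integral\<^sup>L ?\<mu> (\<zeta> j))\<^sup>2) \<partial>?P)"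
    by (subst nn_integral_add, rule meas, rule meas, subst nn_integral_sum, rule meas)
      (simp add: PP.emeasure_space_1)
  also have "\<dots> \<le> ennreal bias + (\<Sum>j<m. ennreal (K * Mx / real n))"
  proof (intro add_left_mono sum_mono)
    fix j assume j: "j \<in> {..<m}"
    define B where "B = (\<Sum>k<m. \<bar>\<zeta> j k\<bar>)"
    have bnd: "\<bar>\<zeta> j k\<bar> \<le> B" for k
    proof (cases "k < m")
      case True
      then show ?thesis unfolding B_def by (intro member_le_sum) auto
    next
      case False
      then show ?thesis using \<zeta>0[of j k] j by (simp add: B_def sum_nonneg)
    qed
    have "(\<integral>\<^sup>+x. ennreal ((Y j x - integral\<^sup>L ?\<mu> (\<zeta> j))\<^sup>2) \<partial>?P) \<le> ennreal (integral\<^sup>L ?\<mu> (\<lambda>k. (\<zeta> j k)\<^sup>2) / real n)"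
      unfolding Y_def by (rule mean_square_error_of_mean[OF prob_space_mixture[OF f] sets_mixture bnd n])
    also have "\<dots> \<le> ennreal (K * Mx / real n)"
      using second[of j] j by (intro ennreal_leI divide_right_mono) auto
    finally show "(\<integral>\<^sup>+x. ennreal ((Y j x - integral\<^sup>L ?\<mu> (\<zeta> j))\<^sup>2) \<partial>?P) \<le> ennreal (K * Mx / real n)" .
  qed
  also have "\<dots> = ennreal (bias + real m * (K * Mx / real n))"
  proof -
    have "0 \<le> K" using ab by (simp add: K_def power_mult)
    then show ?thesis using Mx0 by (simp add: bias_def ennreal_plus ennreal_of_nat_eq_real_of_nat flip: ennreal_mult')
  qed
  also have "bias + real m * (K * Mx / real n)
    = bias + 4 / (b - a) * (Z b)\<^sup>2 * real m ^ 3 * (1 / real n * lam ^ (2 * m) * Mx)"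
    by (simp add: K_def power2_eq_square power3_eq_cube)
  finally show ?thesis by (simp add: bias_def Mx_def)
qed

definition tail :: "nat \<Rightarrow> real" where
  "tail m = (\<Sum>\<^sub>\<infinity>k\<in>{m..}. LINT \<theta>|lebesgue_on {a..b}. mixand c \<theta> k)"

lemma mixture_tail_le:
  assumes f: "f \<in> L2_densities a b" and AE: "AE x in lebesgue_on {a..b}. f x \<le> B"
  shows "1 - B * tail m \<le> (\<Sum>k<m. mixture_pmf c a b f k)"
proof -
  let ?\<pi> = "mixture_pmf c a b f"
  let ?t = "\<lambda>k. LINT \<theta>|lebesgue_on {a..b}. mixand c \<theta> k"
  \<comment> \<open>The tail is b - a times the tail of the uniform mixture, which is a probability
    distribution; this gives the summability without which \<open>infsum\<close> would be 0 by
    default.\<close>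
  have u: "(\<lambda>x. 1 / (b - a)) \<in> L2_densities a b"
    using ab by (auto simp: L2_densities_def measure_restrict_space intro!: L2_continuous)
  have tu: "?t k = (b - a) * mixture_pmf c a b (\<lambda>x. 1 / (b - a)) k" for k
    using ab by (simp add: mixture_pmf_def)
  have "(\<lambda>k. mixture_pmf c a b (\<lambda>x. 1 / (b - a)) k) summable_on UNIV"
    using mixture_pmf_sums[OF u] mixture_pmf_nonneg[OF u]
    by (intro norm_summable_imp_summable_on) (auto simp: sums_iff)
  then have st: "?t summable_on A" for A
    unfolding tu by (intro summable_on_cmult_right) (rule summable_on_subset_banach, auto)
  have "(?\<pi> has_sum 1) UNIV"
    using mixture_pmf_sums[OF f] mixture_pmf_nonneg[OF f]
    by (intro norm_summable_imp_has_sum) (auto simp: sums_iff)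
  then have s\<pi>: "?\<pi> summable_on UNIV" and i\<pi>: "infsum ?\<pi> UNIV = 1" by (auto simp: has_sum_infsum infsumI summable_on_def)
  have sA: "?\<pi> summable_on A" for A by (rule summable_on_subset_banach[OF s\<pi>]) simp
  have "{..<m} \<union> {m..} = UNIV" by auto
  then have "1 = infsum ?\<pi> ({..<m} \<union> {m..})" using i\<pi> by simp
  also have "\<dots> = infsum ?\<pi> {..<m} + infsum ?\<pi> {m..}"
    by (intro infsum_Un_disjoint sA) auto
  also have "infsum ?\<pi> {m..} \<le> infsum (\<lambda>k. B * ?t k) {m..}"
    by (intro infsum_mono sA summable_on_cmult_right st mixture_pmf_le[OF f AE])
  also have "infsum (\<lambda>k. B * ?t k) {m..} = B * tail m"
    unfolding tail_def by (intro infsum_cmult_right st)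
  finally show ?thesis by simp
qed

text \<open>Two densities with the same mixture probabilities below \<open>m\<close> cannot be told apart
  from a sample that stays below \<open>m\<close>.\<close>

theorem two_point_lower_bound:
  assumes fp: "(\<lambda>x. f0 x + g x) \<in> F" and fm: "(\<lambda>x. f0 x - g x) \<in> F"
    and Fd: "F \<subseteq> L2_densities a b" and f0: "f0 \<in> L2 a b" and g: "g \<in> L2 a b"
    and orth: "\<And>k. k < m \<Longrightarrow> ip g (\<lambda>x. mixand c x k) = 0"
    and bnd: "AE x in lebesgue_on {a..b}. f0 x + g x \<le> B" and B: "0 \<le> B" "B * tail m \<le> 1"
  shows "ennreal ((nrm g)\<^sup>2 * (1 - real n * (B * tail m))) \<le> minimax_MISE c a b n F"
  unfolding minimax_MISE_def
proof (rule INF_greatest)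
  fix est assume est: "est \<in> estimators a b n"
  define p where "p x = f0 x + g x" for x
  define q where "q x = f0 x - g x" for x
  have pF: "p \<in> F" and qF: "q \<in> F" using fp fm by (simp_all add: p_def[abs_def] q_def[abs_def])
  then have pd: "p \<in> L2_densities a b" and qd: "q \<in> L2_densities a b"
    using Fd by auto
  let ?P = "PiM {..<n} (\<lambda>_. mixture c a b p)" and ?Q = "PiM {..<n} (\<lambda>_. mixture c a b q)"
  define S where "S = PiE {..<n} (\<lambda>_. UNIV :: nat set)"
  have setsP: "sets ?P = Pow S" "space ?P = S" and setsQ: "sets ?Q = Pow S" "space ?Q = S"
    unfolding S_def by (intro sets_PiM_discrete; simp add: sets_mixture)+
  have eq: "mixture_pmf c a b p k = mixture_pmf c a b q k" if "k < m" for k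
    unfolding mixture_pmf_eq_inner p_def[abs_def] q_def[abs_def]
    using orth[OF that] by (simp add: L2_inner_add L2_inner_diff f0 g mixand_L2)
  define A where "A = PiE {..<n} (\<lambda>_. {..<m})"
  have AS: "A \<subseteq> S" by (auto simp: A_def S_def)
  have measP: "u \<in> borel_measurable ?P" and measQ: "u \<in> borel_measurable ?Q" for u :: "(nat \<Rightarrow> nat) \<Rightarrow> ennreal"
  proof -
    have u: "u \<in> borel_measurable (count_space S)" by simp
    have P: "sets ?P = sets (count_space S)" and Q: "sets ?Q = sets (count_space S)"
      using setsP setsQ by simp_all
    show "u \<in> borel_measurable ?P" using u by (simp only: measurable_cong_sets[OF P refl])
    show "u \<in> borel_measurable ?Q" using u by (simp only: measurable_cong_sets[OF Q refl])
  qed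
  interpret p: prob_space "mixture c a b p" by (rule prob_space_mixture[OF pd])
  interpret q: prob_space "mixture c a b q" by (rule prob_space_mixture[OF qd])
  interpret p: product_prob_space "\<lambda>_::nat. mixture c a b p" "{..<n}" by standard
  interpret q: product_prob_space "\<lambda>_::nat. mixture c a b q" "{..<n}" by standard
  \<comment> \<open>The laws of the two samples agree on the event that all observations stay below
    m; on a countable space it suffices to compare single points.\<close>
  have em: "density ?P (indicator A) = density ?Q (indicator A)"
  proof (rule measure_eqI_countable)
    show "sets (density ?P (indicator A)) = Pow S" "sets (density ?Q (indicator A)) = Pow S"
      by (simp_all add: setsP setsQ)
    show "countable S" unfolding S_def by (intro countable_PiE) auto
    fix x assume x: "x \<in> S"
    have sing: "{x} = PiE {..<n} (\<lambda>i. {x i})"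
      using x PiE_singleton[of x "{..<n}"] by (simp add: S_def PiE_iff)
    have "emeasure ?P {x} = emeasure ?Q {x}" if "x \<in> A"
      unfolding sing using that eq
      by (subst p.emeasure_PiM, simp, simp add: sets_mixture, subst q.emeasure_PiM)
        (auto simp: sets_mixture emeasure_mixture A_def PiE_iff intro!: prod.cong)
    moreover have "emeasure (density ?P (indicator A)) {x} = indicator A x * emeasure ?P {x}"
      using x by (subst emeasure_density) (auto simp: measP setsP nn_integral_indicator_singleton')
    moreover have "emeasure (density ?Q (indicator A)) {x} = indicator A x * emeasure ?Q {x}"
      using x by (subst emeasure_density) (auto simp: measQ setsQ nn_integral_indicator_singleton')
    ultimately show "emeasure (density ?P (indicator A)) {x} = emeasure (density ?Q (indicator A)) {x}"
      by (cases "x \<in> A") auto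
  qed
  define \<nu> where "\<nu> = density ?P (indicator A)"
  have sets\<nu>: "space \<nu> = S" "sets \<nu> = Pow S" by (simp_all add: \<nu>_def setsP)
  have meas\<nu>: "u \<in> borel_measurable \<nu>" for u :: "(nat \<Rightarrow> nat) \<Rightarrow> ennreal"
    using measP[of u] by (simp add: \<nu>_def)
  define G where "G = (nrm g)\<^sup>2"
  have estL: "est x \<in> L2 a b" if "x \<in> S" for x
  proof -
    have "x \<in> space (PiM {..<n} (\<lambda>_. count_space (UNIV :: nat set)))" using that by (simp add: space_PiM S_def)
    moreover have "space (L2_borel a b) = L2 a b" unfolding L2_borel_def by (rule space_measure_of) auto
    ultimately show ?thesis using measurable_space[OF est[unfolded estimators_def]] by simp
  qed
  \<comment> \<open>The parallelogram law; the inequality drops the squared distance to the midpoint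
    \<open>f0\<close>.\<close>
  have paral: "(nrm (\<lambda>\<theta>. est x \<theta> - p \<theta>))\<^sup>2 + (nrm (\<lambda>\<theta>. est x \<theta> - q \<theta>))\<^sup>2 \<ge> 2 * G" if "x \<in> S" for x
  proof -
    define e where "e \<theta> = est x \<theta> - f0 \<theta>" for \<theta>
    have e: "e \<in> L2 a b" unfolding e_def[abs_def] by (intro L2_diff estL that f0)
    have "(\<lambda>\<theta>. est x \<theta> - p \<theta>) = (\<lambda>\<theta>. e \<theta> - g \<theta>)" "(\<lambda>\<theta>. est x \<theta> - q \<theta>) = (\<lambda>\<theta>. e \<theta> + g \<theta>)"
      by (auto simp: e_def p_def q_def)
    then show ?thesis using L2_norm_add_square[OF e g] L2_norm_diff_square[OF e g] by (simp add: G_def)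
  qed
  have low: "(\<integral>\<^sup>+x. ennreal ((nrm (\<lambda>\<theta>. est x \<theta> - f \<theta>))\<^sup>2) \<partial>\<nu>) \<le> MISE c a b n est f" if "f = p \<or> f = q" for f
  proof -
    have "(\<integral>\<^sup>+x. u x \<partial>density M (indicator A)) \<le> (\<integral>\<^sup>+x. u x \<partial>M)"
      if "\<And>v :: (nat \<Rightarrow> nat) \<Rightarrow> ennreal. v \<in> borel_measurable M" for M :: "(nat \<Rightarrow> nat) measure" and u
      using that by (subst nn_integral_density) (auto intro!: nn_integral_mono simp: indicator_def)
    from this[OF measP] this[OF measQ] show ?thesis
      using that em by (auto simp: MISE_def \<nu>_def)
  qed
  have "ennreal (2 * G) * emeasure \<nu> S = (\<integral>\<^sup>+x. ennreal (2 * G) \<partial>\<nu>)" by (simp add: sets\<nu>)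
  also have "\<dots> \<le> (\<integral>\<^sup>+x. ennreal ((nrm (\<lambda>\<theta>. est x \<theta> - p \<theta>))\<^sup>2) + ennreal ((nrm (\<lambda>\<theta>. est x \<theta> - q \<theta>))\<^sup>2) \<partial>\<nu>)"
  proof (rule nn_integral_mono)
    fix x assume "x \<in> space \<nu>"
    then have "2 * G \<le> (nrm (\<lambda>\<theta>. est x \<theta> - p \<theta>))\<^sup>2 + (nrm (\<lambda>\<theta>. est x \<theta> - q \<theta>))\<^sup>2"
      using paral[of x] by (simp add: sets\<nu>)
    then show "ennreal (2 * G) \<le> ennreal ((nrm (\<lambda>\<theta>. est x \<theta> - p \<theta>))\<^sup>2) + ennreal ((nrm (\<lambda>\<theta>. est x \<theta> - q \<theta>))\<^sup>2)"
      by (subst ennreal_plus[symmetric], simp, simp, intro ennreal_leI)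
  qed
  also have "\<dots> = (\<integral>\<^sup>+x. ennreal ((nrm (\<lambda>\<theta>. est x \<theta> - p \<theta>))\<^sup>2) \<partial>\<nu>) + (\<integral>\<^sup>+x. ennreal ((nrm (\<lambda>\<theta>. est x \<theta> - q \<theta>))\<^sup>2) \<partial>\<nu>)"
    by (intro nn_integral_add meas\<nu>)
  also have "\<dots> \<le> max_MISE c a b n est F + max_MISE c a b n est F"
  proof (intro add_mono)
    show "(\<integral>\<^sup>+x. ennreal ((nrm (\<lambda>\<theta>. est x \<theta> - p \<theta>))\<^sup>2) \<partial>\<nu>) \<le> max_MISE c a b n est F"
      unfolding max_MISE_def by (rule SUP_upper2[OF pF low]) simp
    show "(\<integral>\<^sup>+x. ennreal ((nrm (\<lambda>\<theta>. est x \<theta> - q \<theta>))\<^sup>2) \<partial>\<nu>) \<le> max_MISE c a b n est F"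
      unfolding max_MISE_def by (rule SUP_upper2[OF qF low]) simp
  qed
  finally have main: "ennreal (2 * G) * emeasure \<nu> S \<le> 2 * max_MISE c a b n est F"
    by (simp only: mult_2[of "max_MISE c a b n est F"])
  define r where "r = (\<Sum>k<m. mixture_pmf c a b p k)"
  have r: "1 - B * tail m \<le> r" "0 \<le> r"
  proof -
    have "AE x in lebesgue_on {a..b}. p x \<le> B" using bnd by (simp only: p_def)
    then show "1 - B * tail m \<le> r" unfolding r_def by (rule mixture_tail_le[OF pd])
    show "0 \<le> r" unfolding r_def by (intro sum_nonneg mixture_pmf_nonneg[OF pd])
  qed
  have "emeasure \<nu> S = emeasure ?P A"
  proof -
    have "emeasure \<nu> S = (\<integral>\<^sup>+x. indicator A x * indicator S x \<partial>?P)"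
      unfolding \<nu>_def by (rule emeasure_density) (simp_all add: measP setsP)
    also have "\<dots> = (\<integral>\<^sup>+x. indicator A x \<partial>?P)"
      using AS by (intro nn_integral_cong) (auto simp: indicator_def)
    also have "\<dots> = emeasure ?P A" using AS by (intro nn_integral_indicator) (simp add: setsP)
    finally show ?thesis .
  qed
  also have "\<dots> = ennreal (r ^ n)"
    unfolding A_def using mixture_pmf_nonneg[OF pd]
    by (subst p.emeasure_PiM) (auto simp: sets_mixture emeasure_mixture r_def[symmetric] ennreal_power r)
  finally have \<nu>S: "emeasure \<nu> S = ennreal (r ^ n)" .
  \<comment> \<open>Bernoulli's inequality, applicable because B tail m \<le> 1, leads to a lower
    bound for the probability that no observation reaches m.\<close>
  have "1 - real n * (B * tail m) \<le> (1 - B * tail m) ^ n"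
    using Bernoulli_inequality[of "- (B * tail m)" n] B by simp
  also have "\<dots> \<le> r ^ n" using r B by (intro power_mono) auto
  finally have "1 - real n * (B * tail m) \<le> r ^ n" .
  moreover have G0: "0 \<le> G" by (simp add: G_def)
  ultimately have "ennreal (G * (1 - real n * (B * tail m))) \<le> ennreal (G * r ^ n)"
    by (intro ennreal_leI mult_left_mono)
  moreover have "2 * ennreal (G * r ^ n) \<le> 2 * max_MISE c a b n est F"
  proof -
    have "2 * ennreal (G * r ^ n) = ennreal (2 * G) * emeasure \<nu> S"
      unfolding \<nu>S using G0 r(2) by (simp only: ennreal_mult[OF G0 zero_le_power[OF r(2)]] ennreal_mult'[of 2] ennreal_numeral mult.assoc zero_le_numeral)
    then show ?thesis using main by (simp only:)
  qed
  then have "ennreal (G * r ^ n) \<le> max_MISE c a b n est F"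
    by (rule iffD1[OF ennreal_mult_le_mult_iff, rotated 2]) auto
  ultimately show "ennreal ((nrm g)\<^sup>2 * (1 - real n * (B * tail m))) \<le> max_MISE c a b n est F"
    unfolding G_def by (rule order_trans)
qed

end

section \<open>Perturbations of the uniform density\<close>

text \<open>Gaussian elimination: an equation with a non-zero coefficient at \<open>p0\<close> is
  solved for that unknown, leaving one unknown and one equation less.\<close>

lemma underdetermined_system:
  fixes A :: "nat \<Rightarrow> 'a \<Rightarrow> real"
  assumes "finite P" "r < card P"
  shows "\<exists>d. (\<exists>p\<in>P. d p \<noteq> 0) \<and> (\<forall>k<r. (\<Sum>p\<in>P. d p * A k p) = 0)"
  using assms
proof (induction r arbitrary: P A)
  case 0
  then have "P \<noteq> {}" by auto
  then show ?case by (intro exI[of _ "\<lambda>_. 1"]) auto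
next
  case (Suc r)
  show ?case
  proof (cases "\<forall>p\<in>P. A r p = 0")
    case True
    obtain d where d: "\<exists>p\<in>P. d p \<noteq> 0" "\<forall>k<r. (\<Sum>p\<in>P. d p * A k p) = 0"
      using Suc.IH[of P A] Suc.prems by auto
    moreover have "(\<Sum>p\<in>P. d p * A r p) = 0" using True by simp
    ultimately show ?thesis by (intro exI[of _ d]) (auto simp: less_Suc_eq)
  next
    case False
    then obtain p0 where p0: "p0 \<in> P" "A r p0 \<noteq> 0" by auto
    define P' where "P' = P - {p0}"
    have fin: "finite P'" "r < card P'" and P: "P = insert p0 P'" "p0 \<notin> P'"
      using Suc.prems p0 by (auto simp: P'_def card_Diff_singleton)
    define A' where "A' k p = A k p - A k p0 / A r p0 * A r p" for k p
    obtain d where d: "\<exists>p\<in>P'. d p \<noteq> 0" "\<forall>k<r. (\<Sum>p\<in>P'. d p * A' k p) = 0"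
      using Suc.IH[OF fin, of A'] by auto
    define S where "S = (\<Sum>p\<in>P'. d p * A r p)"
    define e where "e p = (if p = p0 then - S / A r p0 else d p)" for p
    have e: "(\<Sum>p\<in>P. e p * A k p) = - S / A r p0 * A k p0 + (\<Sum>p\<in>P'. d p * A k p)" for k
    proof -
      have "(\<Sum>p\<in>P'. e p * A k p) = (\<Sum>p\<in>P'. d p * A k p)" using P by (intro sum.cong) (auto simp: e_def)
      then show ?thesis using fin P by (simp add: e_def)
    qed
    have "(\<Sum>p\<in>P. e p * A k p) = 0" if "k < Suc r" for k
    proof (cases "k = r")
      case True
      then show ?thesis using e[of r] p0 by (simp add: S_def)
    next
      case False
      then have "0 = (\<Sum>p\<in>P'. d p * A' k p)" using d(2) that by auto
      also have "\<dots> = (\<Sum>p\<in>P'. d p * A k p) - A k p0 / A r p0 * S"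
        by (simp add: A'_def S_def right_diff_distrib sum_subtractf sum_distrib_left mult_ac)
      finally show ?thesis using e[of k] by simp
    qed
    moreover have "\<exists>p\<in>P. e p \<noteq> 0" using d(1) P by (auto simp: e_def)
    ultimately show ?thesis by auto
  qed
qed

text \<open>A vertex of the section of the cube \<open>[-1,1]\<^sup>M\<close> by a subspace of codimension \<open>r\<close>.\<close>

lemma flat_solution:
  fixes A :: "nat \<Rightarrow> nat \<Rightarrow> real"
  shows "\<exists>w. (\<forall>p<M. \<bar>w p\<bar> \<le> 1) \<and> (\<forall>k<r. (\<Sum>p<M. w p * A k p) = 0) \<and> M \<le> r + card {p. p < M \<and> \<bar>w p\<bar> = 1}"
proof -
  define good where "good j w \<longleftrightarrow> (\<forall>p<M. \<bar>w p\<bar> \<le> 1) \<and> (\<forall>k<r. (\<Sum>p<M. w p * A k p) = 0) \<and>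
    j \<le> card {p. p < M \<and> \<bar>w p\<bar> = 1}" for j and w :: "nat \<Rightarrow> real"
  have "\<exists>w. good j w" if "j \<le> M - r" for j
    using that
  proof (induction j)
    case 0
    show ?case by (rule exI[of _ "\<lambda>_. 0"]) (simp add: good_def)
  next
    case (Suc j)
    then obtain w where w: "good j w" by auto
    define T where "T = {p. p < M \<and> \<bar>w p\<bar> = 1}"
    show ?case
    proof (cases "Suc j \<le> card T")
      case True
      then show ?thesis using w by (intro exI[of _ w]) (simp add: good_def T_def)
    next
      case False
      \<comment> \<open>More than r coordinates are strictly inside the cube, so some non-zero
        direction supported on them satisfies all r equations.\<close>
      define P where "P = {..<M} - T"
      have "r < card P" using False Suc.prems unfolding P_def
        by (subst card_Diff_subset) (auto simp: T_def)
      then obtain d0 where d0: "\<exists>p\<in>P. d0 p \<noteq> 0" "\<forall>k<r. (\<Sum>p\<in>P. d0 p * A k p) = 0"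
        using underdetermined_system[of P r A] by (auto simp: P_def)
      define d where "d p = (if p \<in> P then d0 p else 0)" for p
      have dk: "(\<Sum>p<M. d p * A k p) = 0" if "k < r" for k
      proof -
        have "(\<Sum>p<M. d p * A k p) = (\<Sum>p\<in>P. d0 p * A k p)"
          by (intro sum.mono_neutral_cong_right) (auto simp: P_def d_def)
        then show ?thesis using d0(2) that by simp
      qed
      define D where "D = {p\<in>P. d p \<noteq> 0}"
      have D: "finite D" "D \<noteq> {}" using d0(1) by (auto simp: D_def P_def d_def)
      \<comment> \<open>The time at which coordinate p, moving along \<open>d\<close>, reaches the
        boundary of the cube; \<open>t\<close> is the first such time, so one more coordinate
        becomes 1 or -1 and none leaves the cube.\<close>
      define \<tau> where "\<tau> p = (1 - sgn (d p) * w p) / \<bar>d p\<bar>" for p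
      define t where "t = Min (\<tau> ` D)"
      have wP: "\<bar>w p\<bar> < 1" if "p \<in> P" for p using w that by (auto simp: good_def P_def T_def order_le_less)
      have \<tau>0: "0 < \<tau> p" if "p \<in> D" for p
        using that wP[of p] by (auto simp: \<tau>_def D_def sgn_if intro!: divide_pos_pos divide_pos_neg)
      have t: "0 < t" "\<And>p. p \<in> D \<Longrightarrow> t \<le> \<tau> p" using D \<tau>0 by (auto simp: t_def)
      have "t \<in> \<tau> ` D" unfolding t_def using D by (intro Min_in) auto
      then obtain p1 where p1: "p1 \<in> D" "\<tau> p1 = t" by auto
      define w' where "w' p = w p + t * d p" for p
      have sg: "\<bar>w' p\<bar> \<le> 1 \<and> (\<tau> p = t \<longrightarrow> \<bar>w' p\<bar> = 1)" if p: "p \<in> D" for p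
      proof -
        have d: "d p \<noteq> 0" and w1: "\<bar>w p\<bar> < 1" using p wP by (auto simp: D_def)
        have eq: "\<tau> p * \<bar>d p\<bar> = 1 - sgn (d p) * w p" using d by (simp add: \<tau>_def)
        have le: "t * \<bar>d p\<bar> \<le> 1 - sgn (d p) * w p" using mult_right_mono[OF t(2)[OF p], of "\<bar>d p\<bar>"] eq by simp
        have pos: "0 < t * \<bar>d p\<bar>" using t(1) d by simp
        show ?thesis
        proof (cases "0 < d p")
          case True
          then show ?thesis using le pos eq w1 by (auto simp: w'_def)
        next
          case False
          then have "d p < 0" using d by simp
          then show ?thesis using le pos eq w1 by (auto simp: w'_def)
        qed
      qed
      have same: "w' p = w p" if "p < M" "p \<notin> D" for p
        using that by (auto simp: w'_def D_def d_def)
      have "\<bar>w' p\<bar> \<le> 1" if "p < M" for p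
        using sg[of p] same[of p] that w by (cases "p \<in> D") (auto simp: good_def)
      moreover have "(\<Sum>p<M. w' p * A k p) = 0" if "k < r" for k
      proof -
        have "(\<Sum>p<M. w' p * A k p) = (\<Sum>p<M. w p * A k p) + t * (\<Sum>p<M. d p * A k p)"
          by (simp add: w'_def distrib_right sum.distrib sum_distrib_left mult.assoc)
        then show ?thesis using dk[OF that] w that by (simp add: good_def)
      qed
      moreover have "Suc j \<le> card {p. p < M \<and> \<bar>w' p\<bar> = 1}"
      proof -
        have "p1 \<notin> T" "p1 < M" using p1 by (auto simp: D_def P_def)
        then have "Suc (card T) = card (insert p1 T)" by (simp add: T_def)
        also have "\<dots> \<le> card {p. p < M \<and> \<bar>w' p\<bar> = 1}"
        proof (rule card_mono)
          have "p \<notin> D" if "p \<in> T" for p using that by (auto simp: D_def P_def)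
          then show "insert p1 T \<subseteq> {p. p < M \<and> \<bar>w' p\<bar> = 1}"
            using same sg[OF p1(1)] p1 \<open>p1 < M\<close> by (auto simp: T_def)
        qed simp
        finally show ?thesis using w by (simp add: good_def T_def)
      qed
      ultimately show ?thesis unfolding good_def by blast
    qed
  qed
  then obtain w where "good (M - r) w" by blast
  then show ?thesis by (intro exI[of _ w]) (auto simp: good_def)
qed

lemma max_power_has_derivative:
  assumes "0 < i"
  shows "((\<lambda>u::real. max 0 u ^ Suc i) has_real_derivative real (Suc i) * max 0 u ^ i) (at u)"
proof -
  consider "0 < u" | "u < 0" | "u = 0" by linarith
  then show ?thesis
  proof cases
    case 1
    have "((\<lambda>u. u ^ Suc i) has_real_derivative real (Suc i) * u ^ i) (at u)"
      using DERIV_pow[of "Suc i" u] by simp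
    then have "((\<lambda>u. max 0 u ^ Suc i) has_real_derivative real (Suc i) * u ^ i) (at u)"
      by (rule has_field_derivative_transform_within_open[of _ _ _ "{0<..}"]) (use 1 in auto)
    then show ?thesis using 1 by simp
  next
    case 2
    have "((\<lambda>u::real. max 0 u ^ Suc i) has_real_derivative 0) (at u)"
      by (rule has_field_derivative_transform_within_open[OF DERIV_const, of "{..<0}"]) (use 2 in auto)
    moreover have "max 0 u ^ i = 0" using 2 assms by simp
    ultimately show ?thesis by (simp only: mult_zero_right)
  next
    case 3
    have lim: "((\<lambda>h::real. max 0 h ^ i) \<longlongrightarrow> max 0 0 ^ i) (at 0)" by (intro tendsto_intros)
    have eq: "(max 0 (u + h) ^ Suc i - max 0 u ^ Suc i) / h = max 0 h ^ i" if "h \<noteq> 0" for h :: real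
      using 3 that assms by (cases "0 < h") auto
    have "\<forall>\<^sub>F h in at 0. max 0 h ^ i = (max 0 (u + h) ^ Suc i - max 0 u ^ Suc i) / h"
      unfolding eventually_at_filter by (intro always_eventually allI impI) (rule eq[symmetric])
    with lim have "((\<lambda>h. (max 0 (u + h) ^ Suc i - max 0 u ^ Suc i) / h) \<longlongrightarrow> max 0 0 ^ i) (at 0)"
      by (rule Lim_transform_eventually)
    moreover have "max 0 0 ^ i = real (Suc i) * max 0 u ^ i" using 3 assms by simp
    ultimately show ?thesis unfolding DERIV_def by (simp only:)
  qed
qed

text \<open>Both exponents are parameters because the derivative of such a function is a combination
  of two of the same kind, with one exponent lowered by 1; smoothness becomes a matter of keeping
  exponents positive.\<close>

definition bump :: "nat \<Rightarrow> nat \<Rightarrow> real \<Rightarrow> real" where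
  "bump i j u = max 0 u ^ i * max 0 (1 - u) ^ j"

definition bumps :: "nat \<Rightarrow> (nat \<Rightarrow> real) \<Rightarrow> nat \<Rightarrow> nat \<Rightarrow> real \<Rightarrow> real" where
  "bumps M w i j u = (\<Sum>p<M. w p * bump i j (u - real p))"

lemma bump_eq_0: "0 < i \<Longrightarrow> 0 < j \<Longrightarrow> u \<le> 0 \<or> 1 \<le> u \<Longrightarrow> bump i j u = 0"
  by (auto simp: bump_def max_def)

lemma bump_range: "0 \<le> bump i j u" "u \<in> {0..1} \<Longrightarrow> bump i j u \<le> 1"
  by (auto simp: bump_def intro!: mult_le_one power_le_one)

lemma bump_has_derivative:
  assumes "0 < i" "0 < j"
  shows "(bump (Suc i) (Suc j) has_real_derivative
    real (Suc i) * bump i (Suc j) u - real (Suc j) * bump (Suc i) j u) (at u)"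
proof -
  have "((\<lambda>u. max 0 (1 - u) ^ Suc j) has_real_derivative (real (Suc j) * max 0 (1 - u) ^ j) * (-1)) (at u)"
    by (rule DERIV_chain2[OF max_power_has_derivative[OF assms(2)]]) (auto intro!: derivative_eq_intros)
  from DERIV_mult[OF max_power_has_derivative[OF assms(1)] this] show ?thesis
    unfolding bump_def[abs_def] by (rule DERIV_cong) (simp only: algebra_simps)
qed

lemma bumps_has_derivative:
  assumes "0 < i" "0 < j"
  shows "(bumps M w (Suc i) (Suc j) has_real_derivative
    real (Suc i) * bumps M w i (Suc j) u - real (Suc j) * bumps M w (Suc i) j u) (at u)"
proof -
  have "((\<lambda>u. bump (Suc i) (Suc j) (u - real p)) has_real_derivative
    (real (Suc i) * bump i (Suc j) (u - real p) - real (Suc j) * bump (Suc i) j (u - real p)) * 1) (at u)" for p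
    by (rule DERIV_chain2[OF bump_has_derivative[OF assms]]) (auto intro!: derivative_eq_intros)
  then have "((\<lambda>u. \<Sum>p<M. w p * bump (Suc i) (Suc j) (u - real p)) has_real_derivative
    (\<Sum>p<M. w p * ((real (Suc i) * bump i (Suc j) (u - real p) - real (Suc j) * bump (Suc i) j (u - real p)) * 1))) (at u)"
    by (intro DERIV_sum DERIV_cmult)
  then show ?thesis
    unfolding bumps_def[abs_def]
    by (rule DERIV_cong) (simp only: mult_1_right right_diff_distrib sum_subtractf sum_distrib_left mult.left_commute)
qed

lemma bumps_eq:
  assumes "0 < i" "0 < j" "p < M" "real p \<le> u" "u \<le> real p + 1"
  shows "bumps M w i j u = w p * bump i j (u - real p)"
proof -
  have "bump i j (u - real q) = 0" if "q \<noteq> p" for q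
  proof (rule bump_eq_0[OF assms(1,2)])
    have "real q + 1 \<le> real p \<or> real p + 1 \<le> real q" using that by linarith
    then show "u - real q \<le> 0 \<or> 1 \<le> u - real q" using assms(4,5) by linarith
  qed
  then have "bumps M w i j u = (\<Sum>q<M. if q = p then w p * bump i j (u - real p) else 0)"
    unfolding bumps_def by (intro sum.cong) auto
  then show ?thesis using assms by simp
qed

lemma bumps_le_1:
  assumes ij: "0 < i" "0 < j" and w: "\<And>p. p < M \<Longrightarrow> \<bar>w p\<bar> \<le> 1"
  shows "\<bar>bumps M w i j u\<bar> \<le> 1"
proof (cases "0 \<le> u \<and> u < real M")
  case True
  define p where "p = nat \<lfloor>u\<rfloor>"
  have p: "p < M" "real p \<le> u" "u \<le> real p + 1" using True unfolding p_def by linarith+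
  have "\<bar>w p\<bar> * bump i j (u - real p) \<le> 1" using w[OF p(1)] bump_range[where u = "u - real p"] p by (intro mult_le_one) auto
  then show ?thesis using bumps_eq[OF ij p] bump_range(1)[where u = "u - real p"] by (simp add: abs_mult)
next
  case False
  have "bump i j (u - real p) = 0" if "p < M" for p
    using False that by (intro bump_eq_0 ij) linarith
  then show ?thesis by (simp add: bumps_def)
qed

lemma fdiff_has_derivative:
  assumes "\<And>y. (f has_real_derivative f' y) (at y)"
  shows "(fdiff s v f has_real_derivative fdiff s v f' x) (at x)"
proof -
  have "((\<lambda>x. f (x + real l * v)) has_real_derivative f' (x + real l * v) * 1) (at x)" for l
    by (rule DERIV_chain2[OF assms]) (auto intro!: derivative_eq_intros)
  then show ?thesis unfolding fdiff_def[abs_def] by (auto intro!: DERIV_sum DERIV_cmult)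
qed

text \<open>The mean value theorem trades one difference for a factor v and a derivative. The
  derivative combines bumps of lower exponents with weights i + j in total; s < i and s < j keep the
  exponents positive through s such steps. Since the bumps have disjoint supports, the bound is
  independent of M.\<close>

lemma fdiff_bumps_le:
  assumes w: "\<And>p. p < M \<Longrightarrow> \<bar>w p\<bar> \<le> 1" and v: "0 \<le> v" and "s < i" "s < j"
  shows "\<bar>fdiff s v (bumps M w i j) x\<bar> \<le> (real (i + j) * v) ^ s"
  using assms(3,4)
proof (induction s arbitrary: i j x)
  case 0
  then show ?case using bumps_le_1[of i j M w x] w by simp
next
  case (Suc s)
  obtain i' j' where ij: "i = Suc i'" "j = Suc j'" "s < i'" "s < j'"
    using Suc.prems by (cases i; cases j) auto
  define F' where "F' y = real i * bumps M w i' j y - real j * bumps M w i j' y" for y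
  have der: "(fdiff s v (bumps M w i j) has_real_derivative fdiff s v F' y) (at y)" for y
    using ij bumps_has_derivative[of i' j' M w] unfolding F'_def[abs_def] by (intro fdiff_has_derivative) simp
  have bnd: "\<bar>fdiff s v F' y\<bar> \<le> real (i + j) * (real (i + j) * v) ^ s" for y
  proof -
    have "fdiff s v F' y = real i * fdiff s v (bumps M w i' j) y - real j * fdiff s v (bumps M w i j') y"
      by (simp add: fdiff_def F'_def right_diff_distrib sum_subtractf sum_distrib_left mult_ac)
    also have "\<bar>\<dots>\<bar> \<le> real i * \<bar>fdiff s v (bumps M w i' j) y\<bar> + real j * \<bar>fdiff s v (bumps M w i j') y\<bar>"
      by (rule order_trans[OF abs_triangle_ineq4]) (simp add: abs_mult)
    also have "\<dots> \<le> real i * (real (i + j) * v) ^ s + real j * (real (i + j) * v) ^ s"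
    proof (intro add_mono mult_left_mono)
      have "\<bar>fdiff s v (bumps M w i' j) y\<bar> \<le> (real (i' + j) * v) ^ s" using ij Suc.prems by (intro Suc.IH) auto
      also have "\<dots> \<le> (real (i + j) * v) ^ s" using ij v by (intro power_mono mult_right_mono) auto
      finally show "\<bar>fdiff s v (bumps M w i' j) y\<bar> \<le> (real (i + j) * v) ^ s" .
      have "\<bar>fdiff s v (bumps M w i j') y\<bar> \<le> (real (i + j') * v) ^ s" using ij Suc.prems by (intro Suc.IH) auto
      also have "\<dots> \<le> (real (i + j) * v) ^ s" using ij v by (intro power_mono mult_right_mono) auto
      finally show "\<bar>fdiff s v (bumps M w i j') y\<bar> \<le> (real (i + j) * v) ^ s" .
    qed auto
    finally show ?thesis by (simp add: distrib_right)
  qed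
  show ?case
  proof (cases "v = 0")
    case True
    then show ?thesis by (simp add: fdiff_Suc)
  next
    case False
    then have "x < x + v" using v by simp
    from MVT2[OF this der] obtain z where "fdiff s v (bumps M w i j) (x + v) - fdiff s v (bumps M w i j) x = v * fdiff s v F' z"
      by auto
    then have "\<bar>fdiff (Suc s) v (bumps M w i j) x\<bar> = v * \<bar>fdiff s v F' z\<bar>"
      using v by (simp only: fdiff_Suc abs_minus_commute[of "fdiff s v (bumps M w i j) x"] abs_mult abs_of_nonneg)
    also have "\<dots> \<le> v * (real (i + j) * (real (i + j) * v) ^ s)" using bnd v by (intro mult_left_mono) auto
    finally show ?thesis by (simp add: mult_ac)
  qed
qed

lemma bumps_continuous: "continuous_on A (bumps M w i j)"
  unfolding bumps_def[abs_def] bump_def by (intro continuous_intros)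

text \<open>In each cell of full height the square is at least (3/16) ^ (2 q) on the middle half, as
  u (1 - u) \<ge> 3/16 for u between 1/4 and 3/4.\<close>

lemma integral_bumps_square_ge:
  assumes ab: "a < b" and M: "0 < M" and q: "0 < q"
  defines "l \<equiv> (b - a) / real M"
  shows "real (card {p. p < M \<and> \<bar>w p\<bar> = 1}) * ((3/16) ^ (2 * q) * (l / 2))
    \<le> integral {a..b} (\<lambda>x. (bumps M w q q ((x - a) / l))\<^sup>2)"
proof -
  have l: "0 < l" using ab M by (simp add: l_def)
  define T where "T = {p. p < M \<and> \<bar>w p\<bar> = 1}"
  define A where "A p = {a + (real p + 1/4) * l..a + (real p + 3/4) * l}" for p
  define \<kappa> where "\<kappa> = (3/16 :: real) ^ (2 * q)"
  have A: "x \<in> A p \<longleftrightarrow> real p + 1/4 \<le> (x - a) / l \<and> (x - a) / l \<le> real p + 3/4" for x p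
    using l by (auto simp: A_def pos_le_divide_eq pos_divide_le_eq algebra_simps)
  have sub: "A p \<subseteq> {a..b}" if "p < M" for p
  proof -
    have "(real p + 3/4) * l \<le> real M * l" using that l by (intro mult_right_mono) auto
    also have "\<dots> = b - a" using M by (simp add: l_def)
    finally have "a + (real p + 3/4) * l \<le> b" by simp
    moreover have "0 \<le> (real p + 1/4) * l" using l by simp
    ultimately show ?thesis by (auto simp: A_def)
  qed
  have "((\<lambda>x. if x \<in> A p then \<kappa> else 0) has_integral \<kappa> * (l / 2)) {a..b}" if "p < M" for p
  proof (subst has_integral_restrict[OF sub[OF that]])
    have "a + (real p + 1/4) * l \<le> a + (real p + 3/4) * l" using l by simp
    then show "((\<lambda>x. \<kappa>) has_integral \<kappa> * (l / 2)) (A p)"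
      using has_integral_const_real[of \<kappa> "a + (real p + 1/4) * l" "a + (real p + 3/4) * l"]
      by (simp add: A_def algebra_simps)
  qed
  then have "((\<lambda>x. \<Sum>p\<in>T. if x \<in> A p then \<kappa> else 0) has_integral (\<Sum>p\<in>T. \<kappa> * (l / 2))) {a..b}"
    by (intro has_integral_sum) (auto simp: T_def)
  moreover have "((\<lambda>x. (bumps M w q q ((x - a) / l))\<^sup>2) has_integral
      integral {a..b} (\<lambda>x. (bumps M w q q ((x - a) / l))\<^sup>2)) {a..b}"
    by (intro integrable_integral integrable_continuous_real continuous_intros
        continuous_on_compose2[OF bumps_continuous[of UNIV]]) (use l in auto)
  moreover have "(\<Sum>p\<in>T. if x \<in> A p then \<kappa> else 0) \<le> (bumps M w q q ((x - a) / l))\<^sup>2" for x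
  proof (cases "\<exists>p\<in>T. x \<in> A p")
    case False
    then have "(\<Sum>p\<in>T. if x \<in> A p then \<kappa> else 0) = 0" by (intro sum.neutral) auto
    then show ?thesis by simp
  next
    case True
    then obtain p where p: "p \<in> T" "x \<in> A p" by auto
    define u where "u = (x - a) / l - real p"
    have u: "1/4 \<le> u" "u \<le> 3/4" using p(2) unfolding A u_def by linarith+
    have "x \<notin> A q" if "q \<noteq> p" for q
    proof
      assume "x \<in> A q"
      moreover have "real q + 1 \<le> real p \<or> real p + 1 \<le> real q" using that by linarith
      ultimately show False using p(2) unfolding A by linarith
    qed
    then have "(\<Sum>p\<in>T. if x \<in> A p then \<kappa> else 0) = (\<Sum>q\<in>T. if q = p then \<kappa> else 0)"
      using p by (intro sum.cong) auto
    also have "\<dots> = \<kappa>" using p by (simp add: T_def)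
    also have "\<kappa> \<le> ((u * (1 - u)) ^ q)\<^sup>2"
    proof -
      have "0 \<le> (u - 1/4) * (3/4 - u)" using u by simp
      then have "3/16 \<le> u * (1 - u)" by (simp add: field_simps)
      then have "(3/16) ^ (2 * q) \<le> (u * (1 - u)) ^ (2 * q)" by (intro power_mono) auto
      then show ?thesis by (simp only: \<kappa>_def power_mult[symmetric] mult.commute)
    qed
    also have "((u * (1 - u)) ^ q)\<^sup>2 = (bumps M w q q ((x - a) / l))\<^sup>2"
    proof -
      have "bumps M w q q ((x - a) / l) = w p * bump q q u"
        unfolding u_def
      proof (rule bumps_eq[OF q q])
        show "p < M" using p by (simp add: T_def)
        show "real p \<le> (x - a) / l" "(x - a) / l \<le> real p + 1" using u unfolding u_def by linarith+
      qed
      moreover have "bump q q u = (u * (1 - u)) ^ q" using u by (simp add: bump_def power_mult_distrib)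
      moreover have "(w p)\<^sup>2 = 1" using p(1) power2_abs[of "w p"] by (simp add: T_def)
      ultimately show ?thesis by (simp add: power_mult_distrib)
    qed
    finally show ?thesis .
  qed
  ultimately have "(\<Sum>p\<in>T. \<kappa> * (l / 2)) \<le> integral {a..b} (\<lambda>x. (bumps M w q q ((x - a) / l))\<^sup>2)"
    by (rule has_integral_le)
  then show ?thesis by (simp add: T_def \<kappa>_def)
qed

text \<open>If the square is not integrable its integral is 0 by convention; so weighted differences
  can be bounded pointwise without establishing their measurability.\<close>

lemma L2_norm_le_sup:
  assumes ab: "a < b" and K: "0 \<le> K" "\<And>x. x \<in> {a..b} \<Longrightarrow> \<bar>f x\<bar> \<le> K"
  shows "L2_norm a b f \<le> sqrt (b - a) * K"
proof -
  have "L2_inner a b f f \<le> (b - a) * K\<^sup>2"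
  proof (cases "integrable (lebesgue_on {a..b}) (\<lambda>x. f x * f x)")
    case True
    have "L2_inner a b f f \<le> (LINT x|lebesgue_on {a..b}. K\<^sup>2)"
      unfolding L2_inner_def
    proof (rule integral_mono[OF True])
      show "integrable (lebesgue_on {a..b}) (\<lambda>x. K\<^sup>2)"
        using continuous_imp_integrable_real[of a b "\<lambda>x. K\<^sup>2"] by simp
      show "f x * f x \<le> K\<^sup>2" if "x \<in> space (lebesgue_on {a..b})" for x
        using power_mono[OF K(2)[of x], of 2] that by (simp add: power2_eq_square)
    qed
    then show ?thesis using ab by (simp add: measure_restrict_space)
  next
    case False
    then show ?thesis using ab by (simp add: L2_inner_def not_integrable_integral_eq)
  qed
  then have "sqrt (L2_inner a b f f) \<le> sqrt ((b - a) * K\<^sup>2)" by (rule real_sqrt_le_mono)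
  then show ?thesis using K by (simp add: L2_norm_def real_sqrt_mult)
qed

lemma fdiff_le_sup:
  assumes "\<And>y. \<bar>f y\<bar> \<le> K" shows "\<bar>fdiff s v f x\<bar> \<le> 2 ^ s * K"
proof (induction s arbitrary: x)
  case 0
  then show ?case using assms by simp
next
  case (Suc s)
  have "\<bar>fdiff (Suc s) v f x\<bar> \<le> \<bar>fdiff s v f x\<bar> + \<bar>fdiff s v f (x + v)\<bar>"
    unfolding fdiff_Suc by (rule abs_triangle_ineq4)
  also have "\<dots> \<le> 2 ^ s * K + 2 ^ s * K" by (intro add_mono Suc)
  finally show ?case by (simp add: mult_ac)
qed

text \<open>Two regimes: for u \<le> 1 the bound from smoothness is used, together with \<alpha>
  \<le> s; for u > 1 the trivial bound 2 ^ s. Together they bound the modulus at all steps.\<close>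

lemma min_power_le_powr:
  assumes "0 < u" "0 < s" "\<alpha> \<le> real s" "0 \<le> \<alpha>" "y \<le> 2 ^ s" "y \<le> (real (s + 1) * u) ^ s"
  shows "y \<le> real (s + 1) ^ s * u powr \<alpha>"
proof (cases "u \<le> 1")
  case True
  have "u ^ s = u powr real s" using assms by (simp add: powr_realpow)
  also have "\<dots> \<le> u powr \<alpha>" using True assms by (intro powr_mono') auto
  finally have "real (s + 1) ^ s * u ^ s \<le> real (s + 1) ^ s * u powr \<alpha>" by (intro mult_left_mono) auto
  then show ?thesis using assms(6) by (simp only: power_mult_distrib)
next
  case False
  have "y \<le> 2 ^ s * 1" using assms by simp
  also have "\<dots> \<le> real (s + 1) ^ s * u powr \<alpha>"
    using False assms by (intro mult_mono power_mono) (auto intro: ge_one_powr_ge_zero)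
  finally show ?thesis .
qed

text \<open>With M = 2 (r + 1) cells and r linear conditions, at least r + 2 cells have full height,
  so the norm does not degenerate. A height of order M powr (- \<alpha>) at scale 1 / M is what the
  modulus allows, and differences annihilate the constant 1 / (b - a). The constant \<kappa> depends
  neither on r nor on the conditions.\<close>

theorem smooth_perturbation:
  assumes ab: "a < b" and \<alpha>: "1 \<le> \<alpha>" and C: "1 / sqrt (b - a) < C"
  shows "\<exists>\<kappa>>0. \<forall>r \<psi>. (\<forall>k<r. \<psi> k \<in> L2 a b) \<longrightarrow>
    (\<exists>g. g \<in> L2 a b \<and> (\<forall>k<r. L2_inner a b g (\<psi> k) = 0) \<and> (\<forall>x. \<bar>g x\<bar> \<le> 1 / (b - a)) \<and>
      (\<lambda>x. 1 / (b - a) + g x) \<in> smooth_class a b \<alpha> C \<and> (\<lambda>x. 1 / (b - a) - g x) \<in> smooth_class a b \<alpha> C \<and>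
      \<kappa> * real (r + 1) powr (- 2 * \<alpha>) \<le> (L2_norm a b g)\<^sup>2)"
proof -
  define s where "s = nat \<lfloor>\<alpha>\<rfloor> + 1"
  have s: "0 < s" "\<alpha> \<le> real s" "s = Suc (nat \<lfloor>\<alpha>\<rfloor>)" using \<alpha> by (simp_all add: s_def) linarith
  \<comment> \<open>The exponents of the bumps must exceed the order s of the differences.\<close>
  define q where "q = s + 1"
  define S where "S = sqrt (b - a)"
  have S: "0 < S" "S * S = b - a" using ab by (simp_all add: S_def)
  have C0: "0 < C" using C S by (intro order.strict_trans[OF _ C]) (simp add: S_def)
  \<comment> \<open>The three bounds on the height secure, in this order, the modulus, the
    non-negativity of the densities, and the norm bound C, for which 1 / sqrt (b - a) < C leaves
    room.\<close>
  define d where "d = min (C / (S * real (s + 1) ^ s)) (min (1 / (b - a)) ((C - 1 / S) / S))"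
  have d: "0 < d" "S * d * real (s + 1) ^ s \<le> C" "d \<le> 1 / (b - a)" "S * d \<le> C - 1 / S"
  proof -
    have "0 < C - 1 / S" using C by (simp add: S_def)
    then show "0 < d" using S C0 ab by (simp add: d_def)
    have "d \<le> C / (S * real (s + 1) ^ s)" "d \<le> (C - 1 / S) / S" "d \<le> 1 / (b - a)" by (simp_all add: d_def)
    then show "S * d * real (s + 1) ^ s \<le> C" "S * d \<le> C - 1 / S" "d \<le> 1 / (b - a)"
      using S by (simp_all add: pos_le_divide_eq mult_ac)
  qed
  define \<kappa> where "\<kappa> = d\<^sup>2 * (3/16) ^ (2 * q) * ((b - a) / 4) * 2 powr (- 2 * \<alpha>)"
  have "0 < \<kappa>" using d(1) ab by (simp add: \<kappa>_def)
  moreover have "\<exists>g. g \<in> L2 a b \<and> (\<forall>k<r. L2_inner a b g (\<psi> k) = 0) \<and> (\<forall>x. \<bar>g x\<bar> \<le> 1 / (b - a)) \<and>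
      (\<lambda>x. 1 / (b - a) + g x) \<in> smooth_class a b \<alpha> C \<and> (\<lambda>x. 1 / (b - a) - g x) \<in> smooth_class a b \<alpha> C \<and>
      \<kappa> * real (r + 1) powr (- 2 * \<alpha>) \<le> (L2_norm a b g)\<^sup>2"
    if \<psi>: "\<forall>k<r. \<psi> k \<in> L2 a b" for r \<psi>
  proof -
    define M where "M = 2 * (r + 1)"
    define l where "l = (b - a) / real M"
    have M: "0 < M" and M1: "1 \<le> real M" by (simp_all add: M_def)
    have l: "0 < l" using ab M by (simp add: l_def)
    define e where "e p x = bump q q ((x - a) / l - real p)" for p x
    have eL: "e p \<in> L2 a b" for p
      unfolding e_def[abs_def] bump_def by (intro L2_continuous continuous_intros) (use l in auto)
    obtain w where w: "\<And>p. p < M \<Longrightarrow> \<bar>w p\<bar> \<le> 1" "\<And>k. k < r \<Longrightarrow> (\<Sum>p<M. w p * L2_inner a b (e p) (\<psi> k)) = 0"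
        "M \<le> r + card {p. p < M \<and> \<bar>w p\<bar> = 1}"
      using flat_solution[of M r "\<lambda>k p. L2_inner a b (e p) (\<psi> k)"] by auto
    define \<delta> where "\<delta> = d * real M powr (- \<alpha>)"
    have \<delta>: "0 < \<delta>" "\<delta> \<le> d"
    proof -
      have "real M powr (- \<alpha>) \<le> real M powr 0" using M1 \<alpha> by (intro powr_mono) auto
      then have "real M powr (- \<alpha>) \<le> 1" using M by simp
      then show "\<delta> \<le> d" using d(1) by (simp add: \<delta>_def mult_left_le)
      show "0 < \<delta>" using d(1) M by (simp add: \<delta>_def)
    qed
    define G where "G = bumps M w q q"
    define g where "g x = \<delta> * G ((x - a) / l)" for x
    have G1: "\<bar>G u\<bar> \<le> 1" for u unfolding G_def by (rule bumps_le_1) (auto simp: q_def w)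
    have gd: "\<bar>g x\<bar> \<le> \<delta>" for x using mult_left_mono[OF G1, of \<delta>] \<delta> by (simp add: g_def abs_mult)
    have ge: "g = (\<lambda>x. \<delta> * (\<Sum>p<M. w p * e p x))" by (simp add: g_def G_def bumps_def e_def fun_eq_iff)
    have gc: "continuous_on {a..b} g"
      unfolding g_def[abs_def] G_def
      by (intro continuous_intros continuous_on_compose2[OF bumps_continuous[of UNIV]]) (use l in auto)
    then have gL: "g \<in> L2 a b" by (rule L2_continuous)
    have orth: "L2_inner a b g (\<psi> k) = 0" if "k < r" for k
      unfolding ge L2_inner_cmult using w(2)[OF that] \<psi> that by (subst L2_inner_sum) (auto simp: eL)
    have smooth: "(\<lambda>x. 1 / (b - a) + \<sigma> * g x) \<in> smooth_class a b \<alpha> C" if \<sigma>: "\<bar>\<sigma>\<bar> = 1" for \<sigma>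
    proof -
      let ?f = "\<lambda>x. 1 / (b - a) + \<sigma> * g x"
      have fL: "?f \<in> L2 a b" by (intro L2_continuous continuous_intros gc)
      have "L2_norm a b ?f \<le> S * (1 / (b - a) + d)"
        unfolding S_def
      proof (rule L2_norm_le_sup[OF ab])
        show "0 \<le> 1 / (b - a) + d" using ab d by simp
        show "\<bar>?f x\<bar> \<le> 1 / (b - a) + d" for x
          using abs_triangle_ineq[of "1 / (b - a)" "\<sigma> * g x"] gd[of x] \<delta> ab \<sigma> by (simp add: abs_mult)
      qed
      also have "\<dots> = 1 / S + S * d"
      proof -
        have "S * (1 / (S * S)) = 1 / S" using S(1) by simp
        then show ?thesis using S(2) by (simp add: distrib_left)
      qed
      also have "\<dots> \<le> C" using d(4) by simp
      finally have nC: "L2_norm a b ?f \<le> C" .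
      have sd: "\<bar>sym_diff a b s (h * step_weight a b x) ?f x\<bar> \<le> d * real (s + 1) ^ s * h powr \<alpha>"
        if h: "0 < h" and x: "x \<in> {a..b}" for h x
      proof -
        define v where "v = h * step_weight a b x"
        have sw: "0 \<le> step_weight a b x" using x by (simp add: step_weight_def)
        have "step_weight a b x \<le> (b - a) / 2"
        proof -
          have "(x - a) * (b - x) = ((b - a) / 2)\<^sup>2 - (x - (a + b) / 2)\<^sup>2" by (simp add: power2_eq_square field_simps)
          then show ?thesis unfolding step_weight_def using ab by (intro real_le_lsqrt) auto
        qed
        then have v: "0 \<le> v" "v \<le> h * ((b - a) / 2)" using h sw by (simp_all add: v_def)
        have vl: "0 \<le> v / l" "real (q + q) * (v / l) \<le> real (s + 1) * (h * real M)"
        proof -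
          show "0 \<le> v / l" using v l by simp
          have "v / l \<le> h * ((b - a) / 2) / l" using v l by (intro divide_right_mono) auto
          also have "\<dots> = h * real M / 2"
        proof -
          have "b - a = l * real M" using M by (simp add: l_def)
          then show ?thesis using l by simp
        qed
          finally have "real (q + q) * (v / l) \<le> real (q + q) * (h * real M / 2)" by (rule mult_left_mono) simp
          moreover have "real (q + q) * (h * real M / 2) = real (s + 1) * (h * real M)" by (simp add: q_def algebra_simps)
          ultimately show "real (q + q) * (v / l) \<le> real (s + 1) * (h * real M)" by (simp only:)
        qed
        have "\<bar>fdiff s (v / l) G y\<bar> \<le> real (s + 1) ^ s * (h * real M) powr \<alpha>" for y
        proof (rule min_power_le_powr)
          have "\<bar>fdiff s (v / l) G y\<bar> \<le> (real (q + q) * (v / l)) ^ s"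
            unfolding G_def by (rule fdiff_bumps_le) (auto simp: q_def w vl)
          also have "\<dots> \<le> (real (s + 1) * (h * real M)) ^ s"
            using vl(1) by (intro power_mono[OF vl(2)] mult_nonneg_nonneg) auto
          finally show "\<bar>fdiff s (v / l) G y\<bar> \<le> (real (s + 1) * (h * real M)) ^ s" .
          show "\<bar>fdiff s (v / l) G y\<bar> \<le> 2 ^ s" using fdiff_le_sup[of G 1, OF G1, of s] by simp
        qed (use s \<alpha> h M in auto)
        moreover have "fdiff s v ?f y = \<sigma> * \<delta> * fdiff s (v / l) G ((y - a) / l)" for y
        proof -
          have c: "(\<Sum>i\<le>s. real (s choose i) * (- 1) ^ i) = 0"
            using choose_alternating_sum[of s, where ?'a = real] s by (simp add: mult.commute)
          have t: "(y + real i * v - a) / l = (y - a) / l + real i * (v / l)" for i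
            by (simp add: add_divide_distrib diff_divide_distrib)
          have "fdiff s v ?f y = (\<Sum>i\<le>s. real (s choose i) * (- 1) ^ i) * (1 / (b - a))
            + \<sigma> * \<delta> * fdiff s (v / l) G ((y - a) / l)"
          proof -
            have fy: "1 / (b - a) + \<sigma> * g (y + real i * v) = 1 / (b - a) + \<sigma> * \<delta> * G ((y - a) / l + real i * (v / l))" for i
              by (simp only: g_def t mult.assoc)
            show ?thesis
              unfolding fdiff_def fy
              by (simp only: distrib_left sum.distrib sum_distrib_left sum_distrib_right mult_ac)
          qed
          then show ?thesis using c by simp
        qed
        ultimately have "\<bar>fdiff s v ?f y\<bar> \<le> \<delta> * (real (s + 1) ^ s * (h * real M) powr \<alpha>)" for y
          using \<sigma> \<delta> by (simp add: abs_mult)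
        also have "\<delta> * (real (s + 1) ^ s * (h * real M) powr \<alpha>) = d * real (s + 1) ^ s * h powr \<alpha>"
          using h M by (simp add: \<delta>_def powr_mult powr_minus field_simps)
        finally have "\<bar>fdiff s v ?f y\<bar> \<le> d * real (s + 1) ^ s * h powr \<alpha>" for y .
        then show ?thesis using d(1) by (simp add: sym_diff_eq_fdiff v_def[symmetric])
      qed
      have "weighted_modulus a b s ?f t \<le> ennreal (C * t powr \<alpha>)" if "0 < t" for t
        unfolding weighted_modulus_def
      proof (rule SUP_least, rule ennreal_leI)
        fix h assume h: "h \<in> {0<..t}"
        have "L2_norm a b (\<lambda>x. sym_diff a b s (h * step_weight a b x) ?f x) \<le> S * (d * real (s + 1) ^ s * h powr \<alpha>)"
          unfolding S_def using sd h d(1) by (intro L2_norm_le_sup[OF ab]) auto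
        also have "\<dots> = S * d * real (s + 1) ^ s * h powr \<alpha>" by simp
        also have "\<dots> \<le> C * t powr \<alpha>"
          using d(2) h \<alpha> C0 by (intro mult_mono powr_mono2) auto
        finally show "L2_norm a b (\<lambda>x. sym_diff a b s (h * step_weight a b x) ?f x) \<le> C * t powr \<alpha>" .
      qed
      then show ?thesis using fL nC unfolding smooth_class_def s_def by blast
    qed
    have "\<kappa> * real (r + 1) powr (- 2 * \<alpha>) \<le> (L2_norm a b g)\<^sup>2"
    proof -
      have cd: "real M / 2 \<le> real (card {p. p < M \<and> \<bar>w p\<bar> = 1})" using w(3) by (simp add: M_def)
      have "(3/16) ^ (2 * q) * ((b - a) / 4) = real M / 2 * ((3/16) ^ (2 * q) * (l / 2))"
        using M by (simp add: l_def)
      also have "\<dots> \<le> real (card {p. p < M \<and> \<bar>w p\<bar> = 1}) * ((3/16) ^ (2 * q) * (l / 2))"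
        using cd l by (intro mult_right_mono) auto
      also have "\<dots> \<le> integral {a..b} (\<lambda>x. (G ((x - a) / l))\<^sup>2)"
        unfolding G_def l_def by (rule integral_bumps_square_ge[OF ab M]) (simp add: q_def)
      finally have "\<delta>\<^sup>2 * ((3/16) ^ (2 * q) * ((b - a) / 4)) \<le> \<delta>\<^sup>2 * integral {a..b} (\<lambda>x. (G ((x - a) / l))\<^sup>2)"
        by (rule mult_left_mono) simp
      also have "\<dots> = (L2_norm a b g)\<^sup>2"
        unfolding L2_norm_square L2_inner_continuous[OF gc gc] g_def
        by (simp add: power2_eq_square mult_ac flip: integral_mult_right)
      also have "\<delta>\<^sup>2 * ((3/16) ^ (2 * q) * ((b - a) / 4)) = \<kappa> * real (r + 1) powr (- 2 * \<alpha>)"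
      proof -
        have "(real M powr (- \<alpha>))\<^sup>2 = real M powr (- 2 * \<alpha>)"
          by (simp add: power2_eq_square flip: powr_add)
        also have "\<dots> = 2 powr (- 2 * \<alpha>) * real (r + 1) powr (- 2 * \<alpha>)"
          unfolding M_def of_nat_mult by (subst powr_mult) auto
        finally show ?thesis by (simp add: \<delta>_def \<kappa>_def power_mult_distrib)
      qed
      finally show ?thesis .
    qed
    moreover have "\<forall>x. \<bar>g x\<bar> \<le> 1 / (b - a)" using gd \<delta> d(3) by (meson order_trans)
    ultimately show ?thesis using gL orth smooth[of 1] smooth[of "-1"] by (intro exI[of _ g]) auto
  qed
  ultimately show ?thesis by blast
qed

section \<open>Minimax rates\<close>

lemma powr_times_geometric:
  fixes \<rho> \<beta> :: real
  assumes "0 < \<rho>" "\<rho> < 1"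
  shows "(\<lambda>m. real m powr \<beta> * \<rho> ^ m) \<longlonglongrightarrow> 0"
proof -
  define t where "t = - ln \<rho>"
  have t: "0 < t" using assms by (simp add: t_def)
  define k where "k = nat \<lceil>\<beta>\<rceil>"
  have "filterlim (\<lambda>m. t * real m) at_top sequentially"
    using t by (intro filterlim_tendsto_pos_mult_at_top[OF tendsto_const] filterlim_real_sequentially)
  then have "(\<lambda>m. (t * real m) ^ k / exp (t * real m)) \<longlonglongrightarrow> 0"
    by (rule filterlim_compose[OF tendsto_power_div_exp_0])
  then have "(\<lambda>m. (t * real m) ^ k / exp (t * real m) / t ^ k) \<longlonglongrightarrow> 0 / t ^ k" by (intro tendsto_intros) (use t in auto)
  then have lim: "(\<lambda>m. (t * real m) ^ k / exp (t * real m) / t ^ k) \<longlonglongrightarrow> 0" by simp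
  show ?thesis
  proof (rule tendsto_sandwich[OF _ _ tendsto_const lim])
    show "\<forall>\<^sub>F m in sequentially. 0 \<le> real m powr \<beta> * \<rho> ^ m" using assms by simp
    show "\<forall>\<^sub>F m in sequentially. real m powr \<beta> * \<rho> ^ m \<le> (t * real m) ^ k / exp (t * real m) / t ^ k"
      using eventually_ge_at_top[of 1]
    proof eventually_elim
      case (elim m)
      have "real m powr \<beta> \<le> real m powr real k"
        using elim real_nat_ceiling_ge[of \<beta>] by (intro powr_mono) (auto simp: k_def)
      then have 1: "real m powr \<beta> \<le> real m ^ k" using elim by (simp add: powr_realpow)
      have "exp (t * real m) = inverse (\<rho> ^ m)"
        using assms by (simp add: t_def exp_minus mult.commute[of "ln \<rho>"] exp_of_nat_mult)
      then have "(t * real m) ^ k / exp (t * real m) / t ^ k = real m ^ k * \<rho> ^ m"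
        using t by (simp add: power_mult_distrib field_simps)
      then show ?case using 1 assms by (simp add: mult_right_mono)
    qed
  qed
qed

context mixands
begin

abbreviation decay_densities :: "real \<Rightarrow> real \<Rightarrow> nat \<Rightarrow> (real \<Rightarrow> real) set" where
  "decay_densities \<alpha> C r \<equiv> approx_class c a b (poly_decay \<alpha>) C r \<inter> L2_densities a b"

abbreviation smooth_densities :: "real \<Rightarrow> real \<Rightarrow> (real \<Rightarrow> real) set" where
  "smooth_densities \<alpha> C \<equiv> smooth_class a b \<alpha> C \<inter> L2_densities a b"

text \<open>The ratio (lam / lam1) ^ (2 m n) decays geometrically in m n and beats every power of m
  n, so the variance is negligible against any polynomial rate.\<close>

lemma variance_bound_negligible:
  fixes m :: "nat \<Rightarrow> nat"
  assumes lam: "0 < lam" "lam < lam1" and m: "filterlim m at_top sequentially"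
    and lim: "(\<lambda>n. 1 / real n * lam1 ^ (2 * m n) * M n) \<longlonglongrightarrow> 0"
  shows "(\<lambda>n. K * real (m n) ^ 3 * (1 / real n * lam ^ (2 * m n) * M n) * real (m n) powr \<beta>) \<longlonglongrightarrow> 0"
proof -
  define \<rho> where "\<rho> = (lam / lam1)\<^sup>2"
  have \<rho>: "0 < \<rho>" "\<rho> < 1" using lam by (simp_all add: \<rho>_def power_less_one_iff)
  have "(\<lambda>n. real (m n) powr (3 + \<beta>) * \<rho> ^ m n) \<longlonglongrightarrow> 0"
    by (rule filterlim_compose[OF powr_times_geometric[OF \<rho>] m])
  then have "(\<lambda>n. K * ((1 / real n * lam1 ^ (2 * m n) * M n) * (real (m n) powr (3 + \<beta>) * \<rho> ^ m n))) \<longlonglongrightarrow> K * (0 * 0)"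
    by (intro tendsto_mult tendsto_const lim)
  moreover have "K * ((1 / real n * lam1 ^ (2 * m n) * M n) * (real (m n) powr (3 + \<beta>) * \<rho> ^ m n))
    = K * real (m n) ^ 3 * (1 / real n * lam ^ (2 * m n) * M n) * real (m n) powr \<beta>" for n
  proof -
    have p: "real (m n) powr (3 + \<beta>) = real (m n) ^ 3 * real (m n) powr \<beta>"
      by (cases "m n = 0") (simp_all add: powr_add powr_numeral)
    have l: "lam1 ^ (2 * m n) * \<rho> ^ m n = lam ^ (2 * m n)"
      using lam by (simp add: \<rho>_def power_divide flip: power_mult)
    show ?thesis unfolding p l[symmetric] by (simp only: mult_ac)
  qed
  ultimately show ?thesis by (simp only: mult_zero_left mult_zero_right)
qed

lemma approx_class_MISE_le:
  assumes f: "f \<in> decay_densities \<alpha> C r"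
    and n: "0 < n" "0 < m" "r \<le> m" and C: "0 < C" and \<alpha>: "0 < \<alpha>"
    and lam: "lam = \<gamma> + sqrt (\<gamma>\<^sup>2 + 1)" "\<gamma> = (2 + a + b) / (b - a)"
  shows "MISE c a b n (proj_est m n) f
    \<le> ennreal (C\<^sup>2 * real m powr (- 2 * \<alpha>)
      + 4 / (b - a) * (Z b)\<^sup>2 * real m ^ 3 * (1 / real n * lam ^ (2 * m) * Max ((\<lambda>k. b ^ k / c k) ` {..<m})))"
proof -
  have fd: "f \<in> L2_densities a b" using f by simp
  have "nrm (\<lambda>\<theta>. f \<theta> - proj m f \<theta>) \<le> C * (1 + real m) powr (- \<alpha>)"
    using f n(3) by (simp add: approx_class_def poly_decay_def)
  also have "\<dots> \<le> C * real m powr (- \<alpha>)" using n C \<alpha> by (intro mult_left_mono powr_mono2') auto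
  finally have "(nrm (\<lambda>\<theta>. f \<theta> - proj m f \<theta>))\<^sup>2 \<le> (C * real m powr (- \<alpha>))\<^sup>2"
    by (intro power_mono L2_norm_nonneg)
  also have "\<dots> = C\<^sup>2 * real m powr (- 2 * \<alpha>)" by (simp add: power2_eq_square mult_ac flip: powr_add)
  finally show ?thesis
    by (intro order_trans[OF MISE_proj_estimator_le[OF fd n(1,2) lam]] ennreal_leI add_right_mono)
qed

theorem max_MISE_approx_class:
  fixes m :: "nat \<Rightarrow> nat"
  assumes \<alpha>: "0 < \<alpha>" and C: "0 < C" and m: "filterlim m at_top sequentially"
    and lam: "lam = \<gamma> + sqrt (\<gamma>\<^sup>2 + 1)" "\<gamma> = (2 + a + b) / (b - a)" "lam < lam1"
    and lim: "(\<lambda>n. 1 / real n * lam1 ^ (2 * m n) * Max ((\<lambda>k. b ^ k / c k) ` {..<m n})) \<longlonglongrightarrow> 0"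
  shows "\<exists>\<epsilon> :: nat \<Rightarrow> real. \<epsilon> \<longlonglongrightarrow> 0 \<and>
    (\<forall>\<^sub>F n in sequentially. max_MISE c a b n (proj_est (m n) n)
        (decay_densities \<alpha> C r)
      \<le> ennreal (C\<^sup>2 * real (m n) powr (- 2 * \<alpha>) * (1 + \<epsilon> n)))"
proof -
  have lam0: "0 < lam" using a_nonneg ab by (auto simp: lam intro!: add_pos_nonneg)
  define V where "V n = 4 / (b - a) * (Z b)\<^sup>2 * real (m n) ^ 3
    * (1 / real n * lam ^ (2 * m n) * Max ((\<lambda>k. b ^ k / c k) ` {..<m n}))" for n
  have "(\<lambda>n. V n * real (m n) powr (2 * \<alpha>)) \<longlonglongrightarrow> 0"
    unfolding V_def by (rule variance_bound_negligible[OF lam0 lam(3) m lim])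
  then have "(\<lambda>n. V n * real (m n) powr (2 * \<alpha>) / C\<^sup>2) \<longlonglongrightarrow> 0 / C\<^sup>2" using C by (intro tendsto_divide tendsto_const) auto
  then have \<epsilon>: "(\<lambda>n. V n * real (m n) powr (2 * \<alpha>) / C\<^sup>2) \<longlonglongrightarrow> 0" by simp
  have "\<forall>\<^sub>F n in sequentially. max (max r 1) 1 \<le> m n" using m unfolding filterlim_at_top by blast
  then have "\<forall>\<^sub>F n in sequentially. max_MISE c a b n (proj_est (m n) n)
        (decay_densities \<alpha> C r)
      \<le> ennreal (C\<^sup>2 * real (m n) powr (- 2 * \<alpha>) * (1 + V n * real (m n) powr (2 * \<alpha>) / C\<^sup>2))"
    using eventually_gt_at_top[of 0]
  proof eventually_elim
    case (elim n)
    then have mn: "0 < m n" "r \<le> m n" by auto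
    have "real (m n) powr (- 2 * \<alpha>) * real (m n) powr (2 * \<alpha>) = 1"
      using mn by (simp flip: powr_add)
    then have "C\<^sup>2 * real (m n) powr (- 2 * \<alpha>) * (1 + V n * real (m n) powr (2 * \<alpha>) / C\<^sup>2) = C\<^sup>2 * real (m n) powr (- 2 * \<alpha>) + V n"
      using C by (simp add: distrib_left mult.left_commute)
    then show ?case
      unfolding max_MISE_def V_def
      using approx_class_MISE_le[OF _ elim(2) mn C \<alpha> lam(1,2)] by (intro SUP_least) (simp only:)
  qed
  with \<epsilon> show ?thesis by (intro exI[of _ "\<lambda>n. V n * real (m n) powr (2 * \<alpha>) / C\<^sup>2"] conjI)
qed

lemma tail_nonneg: "0 \<le> tail m"
  unfolding tail_def
  by (intro infsum_nonneg integral_nonneg_AE AE_I2) (auto intro: mixand_nonneg)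

text \<open>The growth is only linear in m; against a perturbation of norm C m powr (- \<alpha>)
  this is what \<alpha> > 1 compensates.\<close>

lemma span_sup_le:
  assumes g: "g \<in> span_below m" and x: "x \<in> {a..b}"
  shows "\<bar>g x\<bar> \<le> sqrt (8 / (b - a)) * Z b * real m * nrm g"
proof -
  obtain p where p: "g = quo p" "\<And>i. i \<ge> m \<Longrightarrow> coeff p i = 0" using g by (auto simp: span_eq)
  have Zx: "1 \<le> Z x" "1 \<le> Z b" using Z_ge_1[OF in_ab[OF x]] Z_ge_1[of b] b_pos by auto
  have "(poly p x)\<^sup>2 \<le> 8 / (b - a) * (real m)\<^sup>2 * integral {a..b} (\<lambda>x. (poly p x)\<^sup>2)"
    by (rule poly_sup_le_L2[OF ab p(2) x])
  also have "\<dots> \<le> 8 / (b - a) * (real m)\<^sup>2 * ((Z b)\<^sup>2 * (nrm (quo p))\<^sup>2)"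
    using ab by (intro mult_left_mono poly_norm_le_quo_norm) auto
  also have "\<dots> = (sqrt (8 / (b - a)) * Z b * real m * nrm g)\<^sup>2"
    using ab by (simp add: power_mult_distrib p(1))
  finally have "\<bar>poly p x\<bar> \<le> sqrt (8 / (b - a)) * Z b * real m * nrm g"
    using ab Zx by (intro abs_le_square_iff[THEN iffD2, THEN order_trans[OF _ eq_refl[OF abs_of_nonneg]]])
      (auto intro!: mult_nonneg_nonneg L2_norm_nonneg)
  moreover have "\<bar>g x\<bar> \<le> \<bar>poly p x\<bar>" using Zx by (simp add: p quo_def abs_divide divide_le_eq mult_right_le_one_le mult_le_cancel_left1)
  ultimately show ?thesis by simp
qed

text \<open>Basis vectors M and M + 1 are orthogonal to the first M mixands; a rotation in their
  plane makes the integral vanish, with coefficients proportional to I (M + 1) and - I M. Only two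
  dimensions beyond M are spent, so the sharp constant survives.\<close>

lemma orthogonal_unit_direction:
  "\<exists>g. g \<in> span_below (M + 2) \<and> nrm g = 1 \<and> ip g (\<lambda>_. 1) = 0 \<and>
    (\<forall>k<M. ip g (\<lambda>x. mixand c x k) = 0)"
proof -
  obtain Q where Q: "ortho (M + 2) Q" using ortho_exists by blast
  define I where "I j = ip (quo (Q j)) (\<lambda>_. 1)" for j
  have "\<exists>p q. p\<^sup>2 + q\<^sup>2 = 1 \<and> p * I M + q * I (M + 1) = 0"
  proof (cases "I M = 0 \<and> I (M + 1) = 0")
    case True
    then show ?thesis by (intro exI[of _ 1] exI[of _ 0]) simp
  next
    case False
    define R where "R = sqrt ((I M)\<^sup>2 + (I (M + 1))\<^sup>2)"
    have "0 < (I M)\<^sup>2 + (I (M + 1))\<^sup>2" using False by (simp add: sum_power2_gt_zero_iff)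
    then have R: "R \<noteq> 0" "R\<^sup>2 = (I M)\<^sup>2 + (I (M + 1))\<^sup>2"
    proof -
      show "R\<^sup>2 = (I M)\<^sup>2 + (I (M + 1))\<^sup>2" unfolding R_def by (rule real_sqrt_pow2) (rule sum_power2_ge_zero)
      then show "R \<noteq> 0" using \<open>0 < (I M)\<^sup>2 + (I (M + 1))\<^sup>2\<close> by auto
    qed
    have "(I (M + 1) / R)\<^sup>2 + (- I M / R)\<^sup>2 = 1"
    proof -
      have "(I (M + 1) / R)\<^sup>2 + (- I M / R)\<^sup>2 = ((I M)\<^sup>2 + (I (M + 1))\<^sup>2) / R\<^sup>2"
        by (simp add: power_divide add_divide_distrib)
      also have "\<dots> = 1" unfolding R(2)[symmetric] using R(1) by simp
      finally show ?thesis .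
    qed
    then show ?thesis by (intro exI[of _ "I (M + 1) / R"] exI[of _ "- I M / R"]) simp
  qed
  then obtain p q where pq: "p\<^sup>2 + q\<^sup>2 = 1" "p * I M + q * I (M + 1) = 0" by blast
  define s where "s j = (if j = M then p else if j = M + 1 then q else 0)" for j
  define g where "g = (\<lambda>x. \<Sum>j<M + 2. s j * quo (Q j) x)"
  have sums: "(\<Sum>j<M + 2. F j) = F M + F (M + 1)" if "\<And>j. j < M \<Longrightarrow> F j = 0" for F :: "nat \<Rightarrow> real"
    using that by (simp add: numeral_2_eq_2)
  have gs: "g \<in> span_below (M + 2)" unfolding g_def by (rule combination_in_span[OF Q])
  have gL: "g \<in> L2 a b" by (rule span_L2[OF gs])
  have "(nrm g)\<^sup>2 = 1"
    unfolding g_def norm_combination[OF Q order_refl] by (subst sums) (auto simp: s_def pq)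
  then have n: "nrm g = 1" using L2_norm_nonneg[of a b g] by (simp add: power2_eq_1_iff)
  have i: "ip g (\<lambda>_. 1) = 0"
    unfolding g_def by (subst L2_inner_sum, rule quo_L2, intro L2_continuous continuous_intros, subst sums)
      (use pq(2) in \<open>auto simp: s_def I_def[symmetric]\<close>)
  have o: "ip g (\<lambda>x. mixand c x k) = 0" if k: "k < M" for k
  proof -
    have "(\<lambda>x. mixand c x k) \<in> span_below M"
      unfolding mixand_span_def using k by (intro CollectI exI[of _ "\<lambda>j. if j = k then 1 else 0"]) (simp add: if_distrib[of "\<lambda>u. u * _"] cong: if_cong)
    from expansion[OF Q _ this] have e: "(\<lambda>x. mixand c x k) = (\<lambda>x. \<Sum>j<M. component Q (\<lambda>x. mixand c x k) j * quo (Q j) x)"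
      by simp
    have "ip g (\<lambda>x. mixand c x k) = ip (\<lambda>x. mixand c x k) g" by (rule L2_inner_commute)
    also have "\<dots> = (\<Sum>j<M. component Q (\<lambda>x. mixand c x k) j * ip (quo (Q j)) g)"
      by (subst e, subst L2_inner_sum) (auto simp: quo_L2 gL)
    also have "\<dots> = 0"
    proof (intro sum.neutral ballI)
      fix j assume j: "j \<in> {..<M}"
      have "ip (quo (Q j)) g = component Q g j" unfolding component_def by (rule L2_inner_commute)
      also have "\<dots> = 0" unfolding g_def using j by (subst component_combination[OF Q order_refl]) (auto simp: s_def)
      finally show "component Q (\<lambda>x. mixand c x k) j * ip (quo (Q j)) g = 0" by simp
    qed
    finally show ?thesis .
  qed
  show ?thesis using gs n i o by blast
qed

text \<open>The centre \<open>f0\<close> is a multiple of 1 / Z, hence in the span of the first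
  mixand, and is reproduced exactly at every level m \<ge> r \<ge> 1. The perturbation lies in the
  span of M + 2 mixands, so only levels m \<le> M + 1 matter, where C (1 + m) powr (- \<alpha>) is
  at least C (M + 2) powr (- \<alpha>), the norm given to the perturbation.\<close>

theorem minimax_MISE_approx_class:
  fixes m' :: "nat \<Rightarrow> nat"
  assumes \<alpha>: "1 < \<alpha>" and C: "0 < C" and r: "0 < r" and m': "filterlim m' at_top sequentially"
    and lim: "(\<lambda>n. real n * tail (m' n)) \<longlonglongrightarrow> 0"
  shows "\<exists>\<epsilon> :: nat \<Rightarrow> real. \<epsilon> \<longlonglongrightarrow> 0 \<and>
    (\<forall>\<^sub>F n in sequentially. minimax_MISE c a b n (decay_densities \<alpha> C r)
      \<ge> ennreal (C\<^sup>2 * real (m' n) powr (- 2 * \<alpha>) * (1 + \<epsilon> n)))"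
proof -
  define I where "I = ip (quo 1) (\<lambda>_. 1)"
  define f0 where "f0 x = 1 / I * quo 1 x" for x
  have Zab: "1 \<le> Z x" "Z x \<le> Z b" if "x \<in> {a..b}" for x using Z_ge_1 Z_le in_ab[OF that] by auto
  have Zb: "1 \<le> Z b" using Zab[of b] ab by simp
  have I: "0 < I"
  proof -
    have "0 < (b - a) / Z b" using ab Zb by simp
    also have "(b - a) / Z b = ip (\<lambda>_. 1 / Z b) (\<lambda>_. 1)"
      using ab by (simp add: L2_inner_def measure_restrict_space)
    also have "\<dots> \<le> I"
      unfolding I_def L2_inner_def
    proof (rule integral_mono)
      show "integrable (lebesgue_on {a..b}) (\<lambda>x. quo 1 x * 1)" using L2_integrable[OF quo_L2[of 1]] by simp
      show "integrable (lebesgue_on {a..b}) (\<lambda>x. 1 / Z b * 1)"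
        using L2_integrable[OF L2_continuous[of a b "\<lambda>x. 1 / Z b"]] by simp
      show "1 / Z b * 1 \<le> quo 1 x * 1" if "x \<in> space (lebesgue_on {a..b})" for x
        using Zab[of x] that by (simp add: quo_def frac_le)
    qed
    finally show ?thesis .
  qed
  \<comment> \<open>A lower bound for \<open>f0\<close> on the interval; a perturbation of supremum
    at most \<mu> leaves it non-negative.\<close>
  define \<mu> where "\<mu> = 1 / (I * Z b)"
  have \<mu>: "0 < \<mu>" using I Zb by (simp add: \<mu>_def)
  have f0: "\<mu> \<le> f0 x" "f0 x \<le> 1 / I" if "x \<in> {a..b}" for x
  proof -
    have q: "1 / Z b \<le> quo 1 x" "quo 1 x \<le> 1" using Zab[OF that] by (simp_all add: quo_def frac_le)
    show "\<mu> \<le> f0 x" using mult_left_mono[OF q(1), of "1 / I"] I by (simp add: \<mu>_def f0_def)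
    show "f0 x \<le> 1 / I" using mult_left_mono[OF q(2), of "1 / I"] I by (simp add: f0_def)
  qed
  have f0e: "f0 = quo (smult (1 / I) 1)" by (rule ext) (simp only: f0_def quo_smult)
  have f0s: "f0 \<in> span_below 1" unfolding span_eq f0e
    by (intro CollectI exI[of _ "smult (1 / I) 1"]) (simp add: coeff_eq_0)
  have f0L: "f0 \<in> L2 a b" unfolding f0e by (rule quo_L2)
  have L1: "(\<lambda>_. 1) \<in> L2 a b" by (intro L2_continuous continuous_intros)
  have f0i: "ip f0 (\<lambda>_. 1) = 1" using I unfolding f0_def L2_inner_cmult I_def[symmetric] by simp
  define B where "B = 1 / I + \<mu>"
  have B: "0 < B" using I \<mu> by (simp add: B_def add_pos_pos)
  define K where "K = sqrt (8 / (b - a)) * Z b"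
  have lower: "ennreal ((C * real (2 + M) powr (- \<alpha>))\<^sup>2 * (1 - real n * (B * tail M)))
      \<le> minimax_MISE c a b n (decay_densities \<alpha> C r)"
    if small: "K * C * real (2 + M) powr (1 - \<alpha>) \<le> \<mu>" "B * tail M \<le> 1" for M n
  proof -
    obtain g1 where g1: "g1 \<in> span_below (M + 2)" "nrm g1 = 1" "ip g1 (\<lambda>_. 1) = 0"
        "\<And>k. k < M \<Longrightarrow> ip g1 (\<lambda>x. mixand c x k) = 0"
      using orthogonal_unit_direction[of M] by blast
    define t where "t = C * real (2 + M) powr (- \<alpha>)"
    have t: "0 < t" using C by (simp add: t_def)
    define g where "g x = t * g1 x" for x
    have g1L: "g1 \<in> L2 a b" by (rule span_L2[OF g1(1)])
    have gL: "g \<in> L2 a b" unfolding g_def[abs_def] by (intro L2_cmult g1L)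
    have gn: "nrm g = t" unfolding g_def L2_norm_cmult using g1(2) t by simp
    have gi: "ip g (\<lambda>_. 1) = 0" unfolding g_def L2_inner_cmult g1(3) by simp
    have go: "ip g (\<lambda>x. mixand c x k) = 0" if "k < M" for k
      unfolding g_def L2_inner_cmult g1(4)[OF that] by simp
    have gsup: "\<bar>g x\<bar> \<le> \<mu>" if "x \<in> {a..b}" for x
    proof -
      have "\<bar>g x\<bar> \<le> t * (K * real (M + 2))"
        using span_sup_le[OF g1(1) that] t by (simp add: g_def abs_mult K_def g1(2) mult_left_mono)
      also have "\<dots> = K * C * (real (2 + M) powr (- \<alpha>) * real (2 + M) powr 1)"
        by (simp add: t_def mult_ac add.commute)
      also have "real (2 + M) powr (- \<alpha>) * real (2 + M) powr 1 = real (2 + M) powr (1 - \<alpha>)"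
        by (simp only: powr_add[symmetric]) simp
      also have "K * C * real (2 + M) powr (1 - \<alpha>) \<le> \<mu>" by (rule small)
      finally show ?thesis .
    qed
    have mem: "(\<lambda>x. f0 x + \<sigma> * g x) \<in> decay_densities \<alpha> C r"
      if \<sigma>: "\<bar>\<sigma>\<bar> = 1" for \<sigma>
    proof
      let ?f = "\<lambda>x. f0 x + \<sigma> * g x"
      have fL: "?f \<in> L2 a b" by (intro L2_add L2_cmult f0L gL)
      have "AE x in lebesgue_on {a..b}. 0 \<le> ?f x"
      proof (rule AE_I2)
        fix x assume "x \<in> space (lebesgue_on {a..b})"
        then have x: "x \<in> {a..b}" by simp
        have "\<bar>\<sigma> * g x\<bar> \<le> f0 x" using gsup[OF x] f0(1)[OF x] \<sigma> by (simp add: abs_mult)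
        then show "0 \<le> ?f x" by linarith
      qed
      moreover have "(LINT x|lebesgue_on {a..b}. ?f x) = 1"
      proof -
        have "ip ?f (\<lambda>_. 1) = 1"
          using L2_inner_add[OF f0L L2_cmult[OF gL, of \<sigma>] L1] f0i gi L2_inner_cmult[of a b \<sigma> g "\<lambda>_. 1"] by simp
        then show ?thesis by (simp add: L2_inner_def)
      qed
      ultimately show "?f \<in> L2_densities a b" using fL by (simp add: L2_densities_def)
      have "nrm (\<lambda>x. ?f x - proj m ?f x) \<le> C * poly_decay \<alpha> m" if m: "r \<le> m" for m
      proof (cases "M + 2 \<le> m")
        case True
        have "?f \<in> span_below (M + 2)"
        proof -
          obtain p where p: "g1 = quo p" "\<forall>i\<ge>M + 2. coeff p i = 0" using g1(1) by (auto simp: span_eq)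
          have "?f = quo (smult (1 / I) 1 + smult (\<sigma> * t) p)"
            by (rule ext) (simp only: f0e g_def p(1) quo_add quo_smult mult.assoc)
          moreover have "\<forall>i\<ge>M + 2. coeff (smult (1 / I) 1 + smult (\<sigma> * t) p) i = 0"
            using p(2) by (simp add: coeff_eq_0)
          ultimately show ?thesis unfolding span_eq by blast
        qed
        then have "?f \<in> span_below m" using span_mono[OF True] by auto
        from proj_best[OF fL this] have "nrm (\<lambda>x. ?f x - proj m ?f x) \<le> 0"
          by (simp add: L2_norm_def L2_inner_def)
        also have "0 \<le> C * poly_decay \<alpha> m" using C by (simp add: poly_decay_def)
        finally show ?thesis .
      next
        case False
        have "f0 \<in> span_below m" using f0s span_mono[of 1 m] r m by auto
        from proj_best[OF fL this] have "nrm (\<lambda>x. ?f x - proj m ?f x) \<le> nrm (\<lambda>x. \<sigma> * g x)"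
          by simp
        also have "\<dots> = t" unfolding L2_norm_cmult gn using \<sigma> by simp
        also have "t \<le> C * poly_decay \<alpha> m"
          unfolding t_def poly_decay_def using False C \<alpha> by (intro mult_left_mono powr_mono2') auto
        finally show ?thesis .
      qed
      then show "?f \<in> approx_class c a b (poly_decay \<alpha>) C r" using fL by (simp add: approx_class_def)
    qed
    have "ennreal ((nrm g)\<^sup>2 * (1 - real n * (B * tail M)))
      \<le> minimax_MISE c a b n (decay_densities \<alpha> C r)"
    proof (rule two_point_lower_bound)
      show "(\<lambda>x. f0 x + g x) \<in> decay_densities \<alpha> C r" using mem[of 1] by simp
      show "(\<lambda>x. f0 x - g x) \<in> decay_densities \<alpha> C r" using mem[of "-1"] by simp
      show "AE x in lebesgue_on {a..b}. f0 x + g x \<le> B"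
      proof (rule AE_I2)
        fix x assume "x \<in> space (lebesgue_on {a..b})"
        then have x: "x \<in> {a..b}" by simp
        then show "f0 x + g x \<le> B" using gsup[OF x] f0(2)[OF x] unfolding B_def by linarith
      qed
    qed (use f0L gL go B small in auto)
    then show ?thesis by (simp only: gn t_def)
  qed
  have mr: "filterlim (\<lambda>n. real (m' n)) at_top sequentially"
    by (rule filterlim_compose[OF filterlim_real_sequentially m'])
  \<comment> \<open>The first factor compares m' + 2 with m', the second is the probability bound of
    the two-point argument.\<close>
  define \<epsilon> where "\<epsilon> n = (1 + 2 / real (m' n)) powr (- 2 * \<alpha>) * (1 - B * (real n * tail (m' n))) - 1" for n
  have "(\<lambda>n. 2 / real (m' n)) \<longlonglongrightarrow> 0" by (rule tendsto_divide_0[OF tendsto_const filterlim_at_top_imp_at_infinity[OF mr]])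
  then have "\<epsilon> \<longlonglongrightarrow> (1 + 0) powr (- 2 * \<alpha>) * (1 - B * 0) - 1"
    unfolding \<epsilon>_def by (intro tendsto_intros lim) auto
  then have \<epsilon>: "\<epsilon> \<longlonglongrightarrow> 0" by simp
  have "((\<lambda>y. K * C * y powr (1 - \<alpha>)) \<longlongrightarrow> K * C * 0) at_top"
    using \<alpha> by (intro tendsto_intros tendsto_neg_powr filterlim_ident) auto
  moreover have "filterlim (\<lambda>n. real (2 + m' n)) at_top sequentially"
    by (rule filterlim_compose[OF filterlim_real_sequentially], rule filterlim_at_top_mono[OF m']) simp
  ultimately have "(\<lambda>n. K * C * real (2 + m' n) powr (1 - \<alpha>)) \<longlonglongrightarrow> K * C * 0" by (rule filterlim_compose)
  then have e1: "\<forall>\<^sub>F n in sequentially. K * C * real (2 + m' n) powr (1 - \<alpha>) < \<mu>"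
    using \<mu> by (intro order_tendstoD(2)[of _ "K * C * 0"]) auto
  have e2: "\<forall>\<^sub>F n in sequentially. real n * tail (m' n) < 1 / B"
    using B by (intro order_tendstoD(2)[OF lim]) auto
  have e3: "\<forall>\<^sub>F n in sequentially. 1 \<le> m' n" using m' unfolding filterlim_at_top by blast
  have "\<forall>\<^sub>F n in sequentially. minimax_MISE c a b n (decay_densities \<alpha> C r)
      \<ge> ennreal (C\<^sup>2 * real (m' n) powr (- 2 * \<alpha>) * (1 + \<epsilon> n))"
    using e1 e2 e3 eventually_gt_at_top[of 0]
  proof eventually_elim
    case (elim n)
    have "1 * tail (m' n) \<le> real n * tail (m' n)" using elim(4) by (intro mult_right_mono tail_nonneg) auto
    then have "tail (m' n) \<le> 1 / B" using elim(2) by simp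
    then have bt: "B * tail (m' n) \<le> 1" using B by (simp add: field_simps)
    have "real (2 + m' n) = real (m' n) * (1 + 2 / real (m' n))" using elim(3) by (simp add: distrib_left)
    then have p: "real (2 + m' n) powr (- 2 * \<alpha>) = real (m' n) powr (- 2 * \<alpha>) * (1 + 2 / real (m' n)) powr (- 2 * \<alpha>)"
      using elim(3) by (simp only: powr_mult)
    have "(C * real (2 + m' n) powr (- \<alpha>))\<^sup>2 = C\<^sup>2 * real (2 + m' n) powr (- 2 * \<alpha>)"
      by (simp add: power2_eq_square mult_ac flip: powr_add)
    then have "C\<^sup>2 * real (m' n) powr (- 2 * \<alpha>) * (1 + \<epsilon> n)
      = (C * real (2 + m' n) powr (- \<alpha>))\<^sup>2 * (1 - real n * (B * tail (m' n)))"
      by (simp only: p \<epsilon>_def) (simp add: mult_ac)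
    then show ?case using lower[OF less_imp_le[OF elim(1)] bt, of n] by (simp only:)
  qed
  with \<epsilon> show ?thesis by blast
qed

text \<open>Summability at some K > b makes the remainder on the interval geometric with ratio b /
  K.\<close>

lemma partial_sum_approximation:
  "\<exists>S \<rho>. 0 \<le> S \<and> 0 < \<rho> \<and> \<rho> < 1 \<and> (\<forall>N. \<forall>x\<in>{a..b}. \<bar>Z x - (\<Sum>k<N. c k * x ^ k)\<bar> \<le> S * \<rho> ^ N)"
proof -
  obtain K where K: "K > b" "summable (\<lambda>k. c k * K ^ k)" using larger_radius by blast
  define S where "S = (\<Sum>k. c k * K ^ k)"
  define \<rho> where "\<rho> = b / K"
  have \<rho>: "0 < \<rho>" "\<rho> < 1" using K(1) b_pos by (simp_all add: \<rho>_def)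
  have nonneg: "0 \<le> c k * K ^ k" for k using K(1) b_pos c_pos[of k] by simp
  have S: "0 \<le> S" unfolding S_def using K nonneg by (intro suminf_nonneg) auto
  have "\<bar>Z x - (\<Sum>k<N. c k * x ^ k)\<bar> \<le> S * \<rho> ^ N" if x: "x \<in> {a..b}" for N x
  proof -
    have x0: "x \<in> {0..b}" by (rule in_ab[OF x])
    have sm: "summable (\<lambda>k. c (k + N) * x ^ (k + N))" using summable_Z[OF x0] by (subst summable_iff_shift)
    have "Z x - (\<Sum>k<N. c k * x ^ k) = (\<Sum>k. c (k + N) * x ^ (k + N))"
      unfolding ps_sum_def using suminf_split_initial_segment[OF summable_Z[OF x0], of N] by simp
    moreover have "0 \<le> (\<Sum>k. c (k + N) * x ^ (k + N))"
      using x0 c_pos by (intro suminf_nonneg sm) (auto intro!: mult_nonneg_nonneg simp: less_imp_le)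
    moreover have "(\<Sum>k. c (k + N) * x ^ (k + N)) \<le> (\<Sum>k. \<rho> ^ N * (c (k + N) * K ^ (k + N)))"
    proof (rule suminf_le[OF _ sm])
      show "summable (\<lambda>k. \<rho> ^ N * (c (k + N) * K ^ (k + N)))"
        using K(2) by (intro summable_mult) (subst summable_iff_shift)
      fix k
      have "x ^ (k + N) \<le> b ^ (k + N)" using x0 by (intro power_mono) auto
      also have "b ^ (k + N) = \<rho> ^ (k + N) * K ^ (k + N)" using K(1) b_pos by (simp add: \<rho>_def power_divide)
      also have "\<dots> \<le> \<rho> ^ N * K ^ (k + N)"
        using \<rho> K(1) b_pos by (intro mult_right_mono power_decreasing) auto
      finally show "c (k + N) * x ^ (k + N) \<le> \<rho> ^ N * (c (k + N) * K ^ (k + N))"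
        using c_pos[of "k + N"] by (simp add: mult.left_commute mult_left_mono)
    qed
    moreover have "(\<Sum>k. \<rho> ^ N * (c (k + N) * K ^ (k + N))) \<le> \<rho> ^ N * S"
    proof -
      have "(\<Sum>k. c (k + N) * K ^ (k + N)) \<le> S"
        unfolding S_def suminf_split_initial_segment[OF K(2), of N] using nonneg by (simp add: sum_nonneg)
      moreover have "(\<Sum>k. \<rho> ^ N * (c (k + N) * K ^ (k + N))) = \<rho> ^ N * (\<Sum>k. c (k + N) * K ^ (k + N))"
        using K(2) by (intro suminf_mult) (subst summable_iff_shift)
      ultimately show ?thesis using \<rho> by (simp add: mult_left_mono)
    qed
    ultimately show ?thesis by (simp add: mult.commute)
  qed
  with S \<rho> show ?thesis by blast
qed

text \<open>Elements of the span are polynomials divided by Z, so a polynomial q is replaced by q z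
  / Z with z a partial sum of Z. The relative error is geometrically small, and two factors of
  degree below n give degree below 2 n; hence n = N div 2, and N \<le> 3 n explains the factor 3
  powr (2 \<alpha>).\<close>

theorem smooth_class_projection_error:
  assumes \<alpha>: "1 \<le> \<alpha>" and C: "0 < C"
  shows "\<exists>K N0. 0 \<le> K \<and> (\<forall>f\<in>smooth_class a b \<alpha> C. \<forall>N\<ge>N0.
    (nrm (\<lambda>x. f x - proj N f x))\<^sup>2 \<le> K * real N powr (- 2 * \<alpha>))"
proof -
  obtain K1 N1 where K1: "0 \<le> K1" "\<And>f N. f \<in> smooth_class a b \<alpha> C \<Longrightarrow> N1 \<le> N \<Longrightarrow> \<exists>q. (\<forall>i\<ge>N. coeff q i = 0) \<and>
      (nrm (\<lambda>x. f x - poly q x))\<^sup>2 \<le> K1 * real N powr (- 2 * \<alpha>)"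
    using smooth_class_polynomial_approximation[OF ab \<alpha> C] by metis
  obtain S \<rho> where S: "0 \<le> S" "0 < \<rho>" "\<rho> < 1"
      "\<And>N x. x \<in> {a..b} \<Longrightarrow> \<bar>Z x - (\<Sum>k<N. c k * x ^ k)\<bar> \<le> S * \<rho> ^ N"
    using partial_sum_approximation by blast
  have "\<forall>\<^sub>F N in sequentially. real N powr \<alpha> * \<rho> ^ N < 1"
    using powr_times_geometric[OF S(2,3)] by (rule order_tendstoD) simp
  then obtain N2 where N2: "\<And>N. N2 \<le> N \<Longrightarrow> real N powr \<alpha> * \<rho> ^ N < 1" by (auto simp: eventually_sequentially)
  define A where "A = sqrt K1 + S * (C + sqrt K1)"
  have A: "0 \<le> A" using K1(1) S C by (simp add: A_def)
  define K where "K = A\<^sup>2 * 3 powr (2 * \<alpha>)"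
  have "(nrm (\<lambda>x. f x - proj N f x))\<^sup>2 \<le> K * real N powr (- 2 * \<alpha>)"
    if f: "f \<in> smooth_class a b \<alpha> C" and N: "2 * N1 + 2 * N2 + 2 \<le> N" for f N
  proof -
    define n where "n = N div 2"
    have n: "N1 \<le> n" "N2 \<le> n" "1 \<le> n" "2 * n \<le> N" "real N / 3 \<le> real n"
    proof -
      show "N1 \<le> n" "N2 \<le> n" "1 \<le> n" "2 * n \<le> N" using N unfolding n_def by linarith+
      have "N \<le> 3 * n" using N unfolding n_def by linarith
      then have "real N \<le> real (3 * n)" by (simp only: of_nat_le_iff)
      then show "real N / 3 \<le> real n" by simp
    qed
    have fL: "f \<in> L2 a b" and fC: "nrm f \<le> C" using f by (auto simp: smooth_class_def)
    obtain q where q: "\<And>i. n \<le> i \<Longrightarrow> coeff q i = 0" "(nrm (\<lambda>x. f x - poly q x))\<^sup>2 \<le> K1 * real n powr (- 2 * \<alpha>)"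
      using K1(2)[OF f n(1)] by blast
    define \<eta> where "\<eta> = real n powr (- \<alpha>)"
    have \<eta>: "0 < \<eta>" "\<eta> \<le> 1" "\<rho> ^ n \<le> \<eta>"
    proof -
      show "0 < \<eta>" using n by (simp add: \<eta>_def)
      have "\<eta> \<le> real n powr 0" unfolding \<eta>_def using n \<alpha> by (intro powr_mono) auto
      then show "\<eta> \<le> 1" using n by simp
      have "real n powr \<alpha> * \<rho> ^ n \<le> 1" using N2[OF n(2)] by simp
      then show "\<rho> ^ n \<le> \<eta>" using n by (simp add: \<eta>_def powr_minus field_simps)
    qed
    define z where "z = (\<Sum>k<n. monom (c k) k)"
    have pz: "poly z x = (\<Sum>k<n. c k * x ^ k)" for x by (simp add: z_def poly_sum poly_monom)
    have qL: "poly q \<in> L2 a b" by (intro L2_continuous continuous_intros)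
    have d1: "nrm (\<lambda>x. f x - poly q x) \<le> sqrt K1 * \<eta>"
    proof (rule power2_le_imp_le)
      have "K1 * real n powr (- 2 * \<alpha>) = (sqrt K1 * \<eta>)\<^sup>2"
        using K1(1) by (simp add: \<eta>_def power_mult_distrib power2_eq_square[of "_ powr _"] flip: powr_add)
      then show "(nrm (\<lambda>x. f x - poly q x))\<^sup>2 \<le> (sqrt K1 * \<eta>)\<^sup>2" using q(2) by simp
    qed (use K1(1) \<eta> in simp)
    have qn: "nrm (poly q) \<le> C + sqrt K1"
    proof -
      have "nrm (\<lambda>x. f x + (-1) * (f x - poly q x)) \<le> nrm f + nrm (\<lambda>x. (-1) * (f x - poly q x))"
        by (intro L2_norm_triangle L2_cmult L2_diff fL qL)
      also have "\<dots> = nrm f + nrm (\<lambda>x. f x - poly q x)" unfolding L2_norm_cmult by simp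
      also have "\<dots> \<le> C + sqrt K1"
        using fC d1 mult_left_mono[OF \<eta>(2), of "sqrt K1"] K1(1) by simp
      finally show ?thesis by simp
    qed
    define e where "e x = poly q x - quo (q * z) x" for x
    have eL: "e \<in> L2 a b" unfolding e_def[abs_def] by (intro L2_diff qL quo_L2)
    have "nrm e \<le> (S * \<rho> ^ n) * nrm (poly q)"
    proof (rule L2_norm_le_sup_mult[OF eL qL])
      show "0 \<le> S * \<rho> ^ n" using S by simp
      fix x assume x: "x \<in> {a..b}"
      have Zx: "1 \<le> Z x" using Z_ge_1[OF in_ab[OF x]] .
      have "e x = poly q x * ((Z x - poly z x) / Z x)" using Zx by (simp add: e_def quo_def field_simps)
      then have "\<bar>e x\<bar> = \<bar>poly q x\<bar> * (\<bar>Z x - poly z x\<bar> / Z x)" using Zx by (simp add: abs_mult)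
      also have "\<dots> \<le> \<bar>poly q x\<bar> * (S * \<rho> ^ n / 1)"
        using S(4)[OF x, of n] S(1,2) Zx unfolding pz by (intro mult_left_mono frac_le) auto
      finally show "\<bar>e x\<bar> \<le> S * \<rho> ^ n * \<bar>poly q x\<bar>" by (simp add: mult.commute)
    qed
    also have "\<dots> \<le> (S * \<eta>) * (C + sqrt K1)"
      using S \<eta> qn by (intro mult_mono mult_left_mono L2_norm_nonneg) auto
    finally have d2: "nrm e \<le> (S * \<eta>) * (C + sqrt K1)" .
    have "quo (q * z) \<in> span_below N"
    proof -
      have "coeff (q * z) i = 0" if i: "N \<le> i" for i
        unfolding coeff_mult
      proof (intro sum.neutral ballI)
        fix j assume j: "j \<in> {..i}"
        show "coeff q j * coeff z (i - j) = 0"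
        proof (cases "n \<le> j")
          case True
          then show ?thesis using q(1) by simp
        next
          case False
          then have "n \<le> i - j" using i n(4) by linarith
          then show ?thesis by (simp add: z_def coeff_sum)
        qed
      qed
      then show ?thesis unfolding span_eq by blast
    qed
    from proj_best[OF fL this]
    have "nrm (\<lambda>x. f x - proj N f x) \<le> nrm (\<lambda>x. (f x - poly q x) + e x)"
      by (simp add: e_def)
    also have "\<dots> \<le> nrm (\<lambda>x. f x - poly q x) + nrm e"
      by (intro L2_norm_triangle L2_diff fL qL eL)
    also have "\<dots> \<le> A * \<eta>" using d1 d2 by (simp add: A_def algebra_simps)
    finally have "(nrm (\<lambda>x. f x - proj N f x))\<^sup>2 \<le> (A * \<eta>)\<^sup>2"
      by (intro power_mono L2_norm_nonneg)
    also have "\<dots> = A\<^sup>2 * real n powr (- 2 * \<alpha>)"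
      by (simp add: \<eta>_def power_mult_distrib power2_eq_square[of "_ powr _"] flip: powr_add)
    also have "\<dots> \<le> A\<^sup>2 * (real N / 3) powr (- 2 * \<alpha>)"
      using n N \<alpha> by (intro mult_left_mono powr_mono2') auto
    also have "\<dots> = K * real N powr (- 2 * \<alpha>)"
      by (simp add: K_def powr_divide powr_minus field_simps)
    finally show ?thesis .
  qed
  moreover have "0 \<le> K" by (simp add: K_def)
  ultimately show ?thesis by blast
qed

lemma proj_estimator_measurable:
  assumes n: "0 < n" shows "proj_est m n \<in> estimators a b n"
proof -
  let ?P = "PiM {..<n} (\<lambda>_. count_space (UNIV :: nat set))"
  have P: "sets ?P = Pow (PiE {..<n} (\<lambda>_. UNIV))" "space ?P = PiE {..<n} (\<lambda>_. UNIV)"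
    by (intro sets_PiM_discrete; simp)+
  obtain Q where Q: "ortho m Q" using ortho_exists by blast
  have "proj_est m n x \<in> L2 a b" for x
    unfolding proj_estimator_eq[OF Q n] by (intro L2_sum L2_cmult quo_L2)
  moreover have "space (L2_borel a b) = L2 a b" unfolding L2_borel_def by (rule space_measure_of) auto
  ultimately show ?thesis unfolding estimators_def measurable_def using P by auto
qed

lemma max_MISE_smooth_class:
  fixes m :: "nat \<Rightarrow> nat"
  assumes \<alpha>: "1 \<le> \<alpha>" and C: "0 < C" and m: "filterlim m at_top sequentially"
    and lam: "lam = \<gamma> + sqrt (\<gamma>\<^sup>2 + 1)" "\<gamma> = (2 + a + b) / (b - a)" "lam < lam1"
    and lim: "(\<lambda>n. 1 / real n * lam1 ^ (2 * m n) * Max ((\<lambda>k. b ^ k / c k) ` {..<m n})) \<longlonglongrightarrow> 0"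
  shows "\<exists>K. \<forall>\<^sub>F n in sequentially. max_MISE c a b n (proj_est (m n) n)
      (smooth_densities \<alpha> C) \<le> ennreal (K * real (m n) powr (- 2 * \<alpha>))"
proof -
  have lam0: "0 < lam" using a_nonneg ab by (auto simp: lam intro!: add_pos_nonneg)
  define V where "V n = 4 / (b - a) * (Z b)\<^sup>2 * real (m n) ^ 3
    * (1 / real n * lam ^ (2 * m n) * Max ((\<lambda>k. b ^ k / c k) ` {..<m n}))" for n
  have "(\<lambda>n. V n * real (m n) powr (2 * \<alpha>)) \<longlonglongrightarrow> 0"
    unfolding V_def by (rule variance_bound_negligible[OF lam0 lam(3) m lim])
  then have v: "\<forall>\<^sub>F n in sequentially. V n * real (m n) powr (2 * \<alpha>) < 1" by (rule order_tendstoD) simp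
  obtain K N0 where K: "0 \<le> K" "\<And>f N. f \<in> smooth_class a b \<alpha> C \<Longrightarrow> N0 \<le> N \<Longrightarrow>
      (nrm (\<lambda>x. f x - proj N f x))\<^sup>2 \<le> K * real N powr (- 2 * \<alpha>)"
    using smooth_class_projection_error[OF \<alpha> C] by metis
  have "\<forall>\<^sub>F n in sequentially. N0 + 1 \<le> m n" using m unfolding filterlim_at_top by blast
  with v have "\<forall>\<^sub>F n in sequentially. max_MISE c a b n (proj_est (m n) n)
      (smooth_densities \<alpha> C) \<le> ennreal ((K + 1) * real (m n) powr (- 2 * \<alpha>))"
    using eventually_gt_at_top[of 0]
  proof eventually_elim
    case (elim n)
    then have mn: "0 < m n" "N0 \<le> m n" by auto
    have "V n * (real (m n) powr (2 * \<alpha>) * real (m n) powr (- 2 * \<alpha>)) \<le> 1 * real (m n) powr (- 2 * \<alpha>)"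
      unfolding mult.assoc[symmetric] using elim(1) by (intro mult_right_mono) auto
    then have Vn: "V n \<le> real (m n) powr (- 2 * \<alpha>)" using mn by (simp flip: powr_add)
    show ?case
      unfolding max_MISE_def
    proof (rule SUP_least)
      fix f assume f: "f \<in> smooth_densities \<alpha> C"
      then have "f \<in> L2_densities a b" by simp
      from MISE_proj_estimator_le[OF this elim(3) mn(1) lam(1,2)]
      have "MISE c a b n (proj_est (m n) n) f
        \<le> ennreal ((nrm (\<lambda>\<theta>. f \<theta> - proj (m n) f \<theta>))\<^sup>2 + V n)" unfolding V_def .
      also have "\<dots> \<le> ennreal ((K + 1) * real (m n) powr (- 2 * \<alpha>))"
        using K(2)[OF IntD1[OF f] mn(2)] Vn by (intro ennreal_leI) (simp add: distrib_right)
      finally show "MISE c a b n (proj_est (m n) n) f \<le> ennreal ((K + 1) * real (m n) powr (- 2 * \<alpha>))" .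
    qed
  qed
  then show ?thesis by blast
qed

lemma minimax_MISE_smooth_class:
  fixes m m' :: "nat \<Rightarrow> nat"
  assumes \<alpha>: "1 \<le> \<alpha>" and C: "1 / sqrt (b - a) < C" and m': "filterlim m' at_top sequentially"
    and lim: "(\<lambda>n. real n * tail (m' n)) \<longlonglongrightarrow> 0"
    and ratio: "0 < liminf (\<lambda>n. ereal (real (m n) / real (m' n)))"
  shows "\<exists>\<kappa>>0. \<forall>\<^sub>F n in sequentially. ennreal (\<kappa> * real (m n) powr (- 2 * \<alpha>))
    \<le> minimax_MISE c a b n (smooth_densities \<alpha> C)"
proof -
  obtain \<kappa> where \<kappa>: "0 < \<kappa>" and pert: "\<And>r \<psi>. (\<forall>k<r. \<psi> k \<in> L2 a b) \<Longrightarrow>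
      \<exists>g. g \<in> L2 a b \<and> (\<forall>k<r. ip g (\<psi> k) = 0) \<and> (\<forall>x. \<bar>g x\<bar> \<le> 1 / (b - a)) \<and>
      (\<lambda>x. 1 / (b - a) + g x) \<in> smooth_class a b \<alpha> C \<and> (\<lambda>x. 1 / (b - a) - g x) \<in> smooth_class a b \<alpha> C \<and>
      \<kappa> * real (r + 1) powr (- 2 * \<alpha>) \<le> (nrm g)\<^sup>2"
    using smooth_perturbation[OF ab \<alpha> C] by metis
  define B where "B = 2 / (b - a)"
  have B: "0 < B" using ab by (simp add: B_def)
  obtain \<eta>' where \<eta>': "0 < \<eta>'" "\<eta>' < liminf (\<lambda>n. ereal (real (m n) / real (m' n)))"
    using dense[OF ratio] by blast
  then obtain \<eta> where \<eta>: "\<eta>' = ereal \<eta>" by (cases \<eta>') auto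
  have \<eta>0: "0 < \<eta>" using \<eta>' \<eta> by simp
  have e0: "\<forall>\<^sub>F n in sequentially. ereal \<eta> < ereal (real (m n) / real (m' n))"
    by (rule less_LiminfD) (use \<eta>' \<eta> in simp)
  have e1: "\<forall>\<^sub>F n in sequentially. real n * tail (m' n) < 1 / (2 * B)"
    using B by (intro order_tendstoD(2)[OF lim]) auto
  have e2: "\<forall>\<^sub>F n in sequentially. 1 \<le> m' n" using m' unfolding filterlim_at_top by blast
  \<comment> \<open>M + 2 \<le> 3 M and M \<le> m n / \<eta> produce the power of 3 / \<eta>; the
    factor 1/2 is a lower bound for the probability that no observation reaches M.\<close>
  define \<kappa>' where "\<kappa>' = \<kappa> * (3 / \<eta>) powr (- 2 * \<alpha>) / 2"
  have "0 < \<kappa>'" using \<kappa> \<eta>0 by (simp add: \<kappa>'_def)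
  moreover have "\<forall>\<^sub>F n in sequentially. ennreal (\<kappa>' * real (m n) powr (- 2 * \<alpha>))
    \<le> minimax_MISE c a b n (smooth_densities \<alpha> C)"
    using e0 e1 e2 eventually_gt_at_top[of 0]
  proof eventually_elim
    case (elim n)
    define M where "M = m' n"
    \<comment> \<open>Index M carries the constant function, so that the perturbation also has
      integral 0; there are M + 1 conditions in all.\<close>
    define \<psi> where "\<psi> k = (if k < M then (\<lambda>x. mixand c x k) else (\<lambda>_. 1))" for k
    have L1: "(\<lambda>_. 1) \<in> L2 a b" by (intro L2_continuous continuous_intros)
    have "\<forall>k<M + 1. \<psi> k \<in> L2 a b" using mixand_L2 L1 by (auto simp: \<psi>_def)
    from pert[OF this] obtain g where g: "g \<in> L2 a b" "\<And>k. k < M + 1 \<Longrightarrow> ip g (\<psi> k) = 0"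
        "\<And>x. \<bar>g x\<bar> \<le> 1 / (b - a)"
        "(\<lambda>x. 1 / (b - a) + g x) \<in> smooth_class a b \<alpha> C" "(\<lambda>x. 1 / (b - a) - g x) \<in> smooth_class a b \<alpha> C"
        "\<kappa> * real (M + 1 + 1) powr (- 2 * \<alpha>) \<le> (nrm g)\<^sup>2"
      by blast
    have g1: "integrable (lebesgue_on {a..b}) g" "(LINT x|lebesgue_on {a..b}. g x) = 0"
      using L2_integrable[OF g(1)] g(2)[of M] by (simp_all add: \<psi>_def L2_inner_def)
    have dens: "(\<lambda>x. 1 / (b - a) + g x) \<in> L2_densities a b" "(\<lambda>x. 1 / (b - a) - g x) \<in> L2_densities a b"
    proof -
      have i: "integrable (lebesgue_on {a..b}) (\<lambda>x. 1 / (b - a))"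
        using L2_integrable[OF L2_continuous[of a b "\<lambda>x. 1 / (b - a)"]] by simp
      have s: "0 \<le> 1 / (b - a) + g x" "0 \<le> 1 / (b - a) - g x" for x using g(3)[of x] by linarith+
      have one: "(LINT x|lebesgue_on {a..b}. 1 / (b - a)) = 1" using ab by (simp add: measure_restrict_space)
      show "(\<lambda>x. 1 / (b - a) + g x) \<in> L2_densities a b"
        using g(4) s one g1 i Bochner_Integration.integral_add[OF i g1(1)]
        by (simp add: L2_densities_def smooth_class_def)
      show "(\<lambda>x. 1 / (b - a) - g x) \<in> L2_densities a b"
        using g(5) s one g1 i Bochner_Integration.integral_diff[OF i g1(1)]
        by (simp add: L2_densities_def smooth_class_def)
    qed
    have "1 * tail M \<le> real n * tail M" using elim(4) by (intro mult_right_mono tail_nonneg) auto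
    then have tm: "tail M \<le> 1 / (2 * B)" "real n * tail M \<le> 1 / (2 * B)" using elim(2) by (simp_all add: M_def)
    have Bt: "B * tail M \<le> 1" "real n * (B * tail M) \<le> 1 / 2"
      using mult_left_mono[OF tm(1), of B] mult_left_mono[OF tm(2), of B] B by (simp_all add: mult.left_commute)
    have "ennreal (\<kappa>' * real (m n) powr (- 2 * \<alpha>)) \<le> ennreal ((nrm g)\<^sup>2 * (1 - real n * (B * tail M)))"
    proof (rule ennreal_leI)
      have "\<eta> * real M < real (m n)" using elim(1,3) by (simp add: M_def pos_less_divide_eq)
      then have "real M \<le> real (m n) / \<eta>" using \<eta>0 by (simp add: pos_le_divide_eq mult.commute)
      moreover have "real (M + 1 + 1) \<le> 3 * real M" using elim(3) by (simp add: M_def)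
      ultimately have "real (M + 1 + 1) \<le> 3 / \<eta> * real (m n)" by simp
      then have "(3 / \<eta> * real (m n)) powr (- 2 * \<alpha>) \<le> real (M + 1 + 1) powr (- 2 * \<alpha>)"
        using \<alpha> by (intro powr_mono2') auto
      moreover have "(3 / \<eta> * real (m n)) powr (- 2 * \<alpha>) = (3 / \<eta>) powr (- 2 * \<alpha>) * real (m n) powr (- 2 * \<alpha>)"
        by (rule powr_mult)
      ultimately have "\<kappa> * ((3 / \<eta>) powr (- 2 * \<alpha>) * real (m n) powr (- 2 * \<alpha>)) \<le> (nrm g)\<^sup>2"
        using \<kappa> by (intro order_trans[OF mult_left_mono g(6)]) (simp_all only: less_imp_le)
      then have "\<kappa>' * real (m n) powr (- 2 * \<alpha>) \<le> (nrm g)\<^sup>2 * (1 / 2)" by (simp add: \<kappa>'_def)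
      also have "\<dots> \<le> (nrm g)\<^sup>2 * (1 - real n * (B * tail M))"
        using Bt by (intro mult_left_mono) auto
      finally show "\<kappa>' * real (m n) powr (- 2 * \<alpha>) \<le> (nrm g)\<^sup>2 * (1 - real n * (B * tail M))" .
    qed
    also have "\<dots> \<le> minimax_MISE c a b n (smooth_densities \<alpha> C)"
    proof (rule two_point_lower_bound)
      show "AE x in lebesgue_on {a..b}. 1 / (b - a) + g x \<le> B"
      proof (rule AE_I2)
        fix x
        have "B = 1 / (b - a) + 1 / (b - a)" by (simp add: B_def)
        then show "1 / (b - a) + g x \<le> B" using g(3)[of x] by linarith
      qed
      show "ip g (\<lambda>x. mixand c x k) = 0" if "k < M" for k
        using g(2)[of k] that by (simp add: \<psi>_def)
      show "(\<lambda>x. 1 / (b - a)) \<in> L2 a b" by (intro L2_continuous continuous_intros)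
    qed (use g(1,4,5) dens B Bt in auto)
    finally show ?case .
  qed
  ultimately show ?thesis by blast
qed

end

text \<open>Positivity is required eventually only: m n may be 0 for small n, where the rate is 0
  and its inverse infinite.\<close>

lemma rate_bounds:
  fixes v :: "nat \<Rightarrow> real" and X :: "nat \<Rightarrow> ennreal"
  assumes v: "\<forall>\<^sub>F n in sequentially. 0 < v n"
  shows "\<forall>\<^sub>F n in sequentially. X n \<le> ennreal (K * v n) \<Longrightarrow> limsup (\<lambda>n. inverse (ennreal (v n)) * X n) < \<infinity>"
    and "\<forall>\<^sub>F n in sequentially. ennreal (\<kappa> * v n) \<le> X n \<Longrightarrow> 0 < \<kappa> \<Longrightarrow> 0 < liminf (\<lambda>n. inverse (ennreal (v n)) * X n)"
proof -
  have inv: "inverse (ennreal y) * ennreal (k * y) = ennreal k" if "0 < y" for y k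
  proof -
    have "inverse (ennreal y) * ennreal (k * y) = ennreal (inverse y * (k * y))"
      using that by (simp add: inverse_ennreal flip: ennreal_mult')
    also have "inverse y * (k * y) = k" using that by simp
    finally show ?thesis .
  qed
  show "limsup (\<lambda>n. inverse (ennreal (v n)) * X n) < \<infinity>" if "\<forall>\<^sub>F n in sequentially. X n \<le> ennreal (K * v n)"
  proof (rule order_le_less_trans)
    show "limsup (\<lambda>n. inverse (ennreal (v n)) * X n) \<le> ennreal K"
    proof (rule Limsup_bounded)
      show "\<forall>\<^sub>F n in sequentially. inverse (ennreal (v n)) * X n \<le> ennreal K"
        using that v
      proof eventually_elim
        case (elim n)
        then show ?case using mult_left_mono[OF elim(1), of "inverse (ennreal (v n))"] inv[of "v n" K] by simp
      qed
    qed
  qed simp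
  show "0 < liminf (\<lambda>n. inverse (ennreal (v n)) * X n)" if "\<forall>\<^sub>F n in sequentially. ennreal (\<kappa> * v n) \<le> X n" "0 < \<kappa>"
  proof (rule order_less_le_trans)
    show "ennreal \<kappa> \<le> liminf (\<lambda>n. inverse (ennreal (v n)) * X n)"
    proof (rule Liminf_bounded)
      show "\<forall>\<^sub>F n in sequentially. ennreal \<kappa> \<le> inverse (ennreal (v n)) * X n"
        using that(1) v
      proof eventually_elim
        case (elim n)
        then show ?case using mult_left_mono[OF elim(1), of "inverse (ennreal (v n))"] inv[of "v n" \<kappa>] by simp
      qed
    qed
  qed (use that(2) in simp)
qed

context mixands
begin

theorem smooth_class_MISE_rate:
  fixes m m' :: "nat \<Rightarrow> nat"
  assumes \<alpha>: "1 \<le> \<alpha>" and C: "1 / sqrt (b - a) < C" and m: "filterlim m at_top sequentially"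
    and m': "filterlim m' at_top sequentially"
    and lam: "lam = \<gamma> + sqrt (\<gamma>\<^sup>2 + 1)" "\<gamma> = (2 + a + b) / (b - a)" "lam < lam1"
    and lim: "(\<lambda>n. 1 / real n * lam1 ^ (2 * m n) * Max ((\<lambda>k. b ^ k / c k) ` {..<m n})) \<longlonglongrightarrow> 0"
    and lim': "(\<lambda>n. real n * tail (m' n)) \<longlonglongrightarrow> 0"
    and ratio: "0 < liminf (\<lambda>n. ereal (real (m n) / real (m' n)))"
  shows "minimax_MISE_rate c a b (smooth_densities \<alpha> C) (\<lambda>n. real (m n) powr (- 2 * \<alpha>)) \<and>
    achieves_MISE_rate c a b (smooth_densities \<alpha> C)
      (\<lambda>n. real (m n) powr (- 2 * \<alpha>)) (\<lambda>n. proj_est (m n) n)"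
proof -
  have "0 < 1 / sqrt (b - a)" using ab by simp
  then have C0: "0 < C" using C by linarith
  have "\<forall>\<^sub>F n in sequentially. 1 \<le> m n" using m unfolding filterlim_at_top by blast
  then have v: "\<forall>\<^sub>F n in sequentially. 0 < real (m n) powr (- 2 * \<alpha>)" by eventually_elim simp
  obtain K where up: "\<forall>\<^sub>F n in sequentially. max_MISE c a b n (proj_est (m n) n)
      (smooth_densities \<alpha> C) \<le> ennreal (K * real (m n) powr (- 2 * \<alpha>))"
    using max_MISE_smooth_class[OF \<alpha> C0 m lam lim] by blast
  \<comment> \<open>The projection estimator is itself one of the measurable estimators over which
    the infimum is taken.\<close>
  have up': "\<forall>\<^sub>F n in sequentially. minimax_MISE c a b n (smooth_densities \<alpha> C)
      \<le> ennreal (K * real (m n) powr (- 2 * \<alpha>))"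
    using up eventually_gt_at_top[of 0]
  proof eventually_elim
    case (elim n)
    then show ?case unfolding minimax_MISE_def by (intro INF_lower2[OF proj_estimator_measurable])
  qed
  obtain \<kappa> where low: "0 < \<kappa>" "\<forall>\<^sub>F n in sequentially. ennreal (\<kappa> * real (m n) powr (- 2 * \<alpha>))
      \<le> minimax_MISE c a b n (smooth_densities \<alpha> C)"
    using minimax_MISE_smooth_class[OF \<alpha> C m' lim' ratio] by blast
  show ?thesis
    unfolding minimax_MISE_rate_def achieves_MISE_rate_def
    by (intro conjI rate_bounds(1)[OF v up] rate_bounds(1)[OF v up'] rate_bounds(2)[OF v low(2,1)])
qed

end

theorem theorem3:
  fixes c :: "nat \<Rightarrow> real" and a b \<gamma> lam :: real
  assumes "\<And>k. 0 < c k" and "c 0 = 1"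
    and "0 < conv_radius c"
    and "0 \<le> a" and "a < b" and "ereal b < conv_radius c"
    and "\<gamma> = (2 + a + b) / (b - a)"
    and "lam = \<gamma> + sqrt (\<gamma>\<^sup>2 + 1)"
  shows
    "(\<forall>(\<alpha>::real) (C::real) (r::nat) (m :: nat \<Rightarrow> nat).
        0 < \<alpha> \<and> 0 < C \<and> mono m \<and> filterlim m at_top sequentially \<and>
        (\<exists>lam1>lam. (\<lambda>n. 1 / real n * lam1 ^ (2 * m n) * Max ((\<lambda>k. b ^ k / c k) ` {..<m n}))
                      \<longlonglongrightarrow> 0)
        \<longrightarrow> (\<exists>\<epsilon> :: nat \<Rightarrow> real. \<epsilon> \<longlonglongrightarrow> 0 \<and>
              (\<forall>\<^sub>F n in sequentially.
                 max_MISE c a b n (proj_estimator c a b (m n) n)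
                   (approx_class c a b (poly_decay \<alpha>) C r \<inter> L2_densities a b)
                 \<le> ennreal (C\<^sup>2 * real (m n) powr (- 2 * \<alpha>) * (1 + \<epsilon> n)))))
     \<and>
     (\<forall>(\<alpha>::real) (C::real) (r::nat) (m' :: nat \<Rightarrow> nat).
        1 < \<alpha> \<and> 0 < C \<and> 0 < r \<and> mono m' \<and> filterlim m' at_top sequentially \<and>
        (\<lambda>n. real n * (\<Sum>\<^sub>\<infinity>k\<in>{m' n..}. LINT \<theta>|lebesgue_on {a..b}. mixand c \<theta> k)) \<longlonglongrightarrow> 0
        \<longrightarrow> (\<exists>\<epsilon> :: nat \<Rightarrow> real. \<epsilon> \<longlonglongrightarrow> 0 \<and>
              (\<forall>\<^sub>F n in sequentially.
                 minimax_MISE c a b n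
                   (approx_class c a b (poly_decay \<alpha>) C r \<inter> L2_densities a b)
                 \<ge> ennreal (C\<^sup>2 * real (m' n) powr (- 2 * \<alpha>) * (1 + \<epsilon> n)))))
     \<and>
     (\<forall>(\<alpha>::real) (C::real) (m :: nat \<Rightarrow> nat) (m' :: nat \<Rightarrow> nat).
        1 \<le> \<alpha> \<and> 1 / sqrt (b - a) < C \<and>
        mono m \<and> filterlim m at_top sequentially \<and>
        mono m' \<and> filterlim m' at_top sequentially \<and>
        (\<exists>lam1>lam. (\<lambda>n. 1 / real n * lam1 ^ (2 * m n) * Max ((\<lambda>k. b ^ k / c k) ` {..<m n}))
                      \<longlonglongrightarrow> 0) \<and>
        (\<lambda>n. real n * (\<Sum>\<^sub>\<infinity>k\<in>{m' n..}. LINT \<theta>|lebesgue_on {a..b}. mixand c \<theta> k)) \<longlonglongrightarrow> 0 \<and>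
        0 < liminf (\<lambda>n. ereal (real (m n) / real (m' n)))
        \<longrightarrow> minimax_MISE_rate c a b (smooth_class a b \<alpha> C \<inter> L2_densities a b)
              (\<lambda>n. real (m n) powr (- 2 * \<alpha>)) \<and>
            achieves_MISE_rate c a b (smooth_class a b \<alpha> C \<inter> L2_densities a b)
              (\<lambda>n. real (m n) powr (- 2 * \<alpha>)) (\<lambda>n. proj_estimator c a b (m n) n))"
proof -
  interpret mixands c a b using assms by unfold_locales auto
  note lam = assms(8,7)
  show ?thesis
    by (intro conjI[OF _ conjI] allI impI; elim conjE exE)
      (rule max_MISE_approx_class[OF _ _ _ lam] minimax_MISE_approx_class[unfolded tail_def]
        smooth_class_MISE_rate[unfolded tail_def, OF _ _ _ _ lam]; assumption)+
qed

end
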